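(* Let a mean field game (MFG) as described in the context satisfy Assumptions 1, 2 and 3, and suppose it is $\kappa$-herding for some $\kappa\ge 0$ with constant $\rho\in(0,\infty)$. Run Algorithm 1 with step sizes $$\lambda_k=\frac{\lambda_0}{\sqrt{k+1}},\quad \alpha_k=\frac{\alpha_0}{\sqrt{k+1}},\quad \beta_k=\frac{\beta_0}{\sqrt{k+1}},\quad \xi_k=\frac{\xi_0}{\sqrt{k+1}},$$ where $c_J$ and the constants $\lambda_0,\alpha_0,\beta_0,\xi_0>0$ satisfy the step-size conditions listed in the context. Then there exists a constant $C>0$ independent of $k$ such that for all $k$ with $k\ge\tau_k$, $$\min_{0\le t<k}\mathbb{E}\big[\varepsilon_t^{\pi}+\varepsilon_t^{\mu}+\varepsilon_t^{V}+\varepsilon_t^{J}\big]\le C\left(\frac{\log^3(k+1)}{\sqrt{k+1}}+\kappa\right).$$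
   Context: Mean field game. $\mathcal{S}$ and $\mathcal{A}$ are finite sets; $\Delta_{\mathcal{S}}$, $\Delta_{\mathcal{A}}$ are the probability simplices over them. A mean field is $\mu\in\Delta_{\mathcal{S}}$. The MFG consists of a transition kernel $\mathcal{P}^{\mu}(s'\mid s,a)$ (a probability distribution over $s'\in\mathcal{S}$ for every $s\in\mathcal{S},a\in\mathcal{A},\mu\in\Delta_{\mathcal{S}}$) and a reward $r(s,a,\mu)\in[0,1]$. A policy is a map $\pi:\mathcal{S}\to\Delta_{\mathcal{A}}$, identified with a vector in $\mathbb{R}^{|\mathcal{S}||\mathcal{A}|}$; all norms $\|\cdot\|$ are Euclidean. For a policy $\pi$ and mean field $\mu$ let $P^{\pi,\mu}_{s',s}=\sum_{a}\mathcal{P}^{\mu}(s'\mid s,a)\pi(a\mid s)$ and let $\nu^{\pi,\mu}\in\Delta_{\mathcal{S}}$ be its stationary distribution. Define $J(\pi,\mu)=\mathbb{E}_{s\sim\nu^{\pi,\mu},a\sim\pi(\cdot\mid s)}[r(s,a,\mu)]$ and the differential value function $V^{\pi,\mu}\in\mathbb{R}^{|\mathcal{S}|}$, $V^{\pi,\mu}(s)=\mathbb{E}[\sum_{t=0}^\infty (r(s_t,a_t,\mu)-J(\pi,\mu))\mid s_0=s]$ where $a_t\sim\pi(\cdot\mid s_t)$, $s_{t+1}\sim\mathcal{P}^{\mu}(\cdot\mid s_t,a_t)$. For each policy $\pi$, $\mu^\star(\pi)\in\Delta_{\mathcal{S}}$ denotes the (assumed unique) mean field with $\mu^\star(\pi)=\nu^{\pi,\mu^\star(\pi)}$,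 and $\ell(\pi)=J(\pi,\mu^\star(\pi))$. Softmax policies: for $\theta\in\mathbb{R}^{|\mathcal{S}||\mathcal{A}|}$, $\pi_\theta(a\mid s)=\exp(\theta(s,a))/\sum_{a'}\exp(\theta(s,a'))$. $e_s\in\mathbb{R}^{|\mathcal{S}|}$ is the indicator vector of $s$. The total variation distance is $d_{TV}(\phi_1,\phi_2)=\frac12\sup_{\psi:\mathcal{X}\to[-1,1]}|\int\psi\,d\phi_1-\int\psi\,d\phi_2|$. Herding: given $\kappa\ge0$, the MFG is $\kappa$-herding if there is $0<\rho<\infty$ with $\ell(\pi)-\ell(\pi')\le\rho\big(J(\pi,\mu^\star(\pi))-J(\pi',\mu^\star(\pi))\big)+\kappa\|\pi-\pi'\|$ for all policies $\pi,\pi'$. Assumption 1 (uniform geometric ergodicity): for every $\pi,\mu$ the Markov chain with transition $P^{\pi,\mu}$ is irreducible and aperiodic, and there are $C_0\ge1$, $C_1\in(0,1)$ with $\sup_s d_{TV}(\mathbb{P}(s_k=\cdot\mid s_0=s),\nu^{\pi,\mu})\le C_0C_1^k$ for all $k\ge0$. Assumption 2: there is $\delta\in(0,1)$ with $\|\nu^{\pi,\mu_1}-\nu^{\pi,\mu_2}\|\le\delta\|\mu_1-\mu_2\|$ for all $\pi,\mu_1,\mu_2$. Assumption 3: there is $L>0$ such that for all distributions $d_1,d_2$ on $\mathcal{S}$, policies $\pi_1,\pi_2$, mean fields $\mu_1,\mu_2$, and all $s,a$, with $s\sim d_1$, $s'\sim P^{\pi_1,\mu_1}(\cdot\mid s)$,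 $\hat s\sim d_2$, $\hat s'\sim P^{\pi_2,\mu_2}(\cdot\mid\hat s)$: $|r(s,a,\mu_1)-r(s,a,\mu_2)|\le L\|\mu_1-\mu_2\|$; $d_{TV}(\mathbb{P}(s'=\cdot),\mathbb{P}(\hat s'=\cdot))\le d_{TV}(d_1,d_2)+L(\|\pi_1-\pi_2\|+\|\mu_1-\mu_2\|)$; $d_{TV}(\nu^{\pi_1,\mu_1},\nu^{\pi_2,\mu_2})\le L(\|\pi_1-\pi_2\|+\|\mu_1-\mu_2\|)$; $\|\mu^\star(\pi_1)-\mu^\star(\pi_2)\|\le L\|\pi_1-\pi_2\|$. Moreover there is $B_V>0$ with $\|V^{\pi,\mu}\|\le B_V$ for all $\pi,\mu$. Algorithm 1. Fix $c_J>0$ and step sizes $\alpha_k,\beta_k,\xi_k,\lambda_k>0$. Initialize $\theta_0\in\mathbb{R}^{|\mathcal{S}||\mathcal{A}|}$, $\hat V_0\in\mathbb{R}^{|\mathcal{S}|}$, $\hat J_0\in\mathbb{R}$, $\hat\mu_0\in\Delta_{\mathcal{S}}$, $f_0=0$, $g_0^V=0$, $g_0^J=0$, $h_0=0$, and an initial state $s_0$. For $k=0,1,2,\dots$: draw $a_k\sim\pi_{\theta_k}(\cdot\mid s_k)$, observe $r_k=r(s_k,a_k,\hat\mu_k)$ and $s_{k+1}\sim\mathcal{P}^{\hat\mu_k}(\cdot\mid s_k,a_k)$; set $\theta_{k+1}=\theta_k+\alpha_kf_k$; $\hat\mu_{k+1}=\Pi_{\Delta_{\mathcal{S}}}(\hat\mu_k+\xi_kh_k)$;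 $\hat V_{k+1}=\Pi_{B_V}(\hat V_k+\beta_kg^V_k)$; $\hat J_{k+1}=\Pi_{[0,1]}(\hat J_k+\beta_kg^J_k)$; $f_{k+1}=(1-\lambda_k)f_k+\lambda_k(r_k+\hat V_k(s_{k+1})-\hat V_k(s_k))\nabla_\theta\log\pi_{\theta_k}(a_k\mid s_k)$; $g^V_{k+1}=(1-\lambda_k)g^V_k+\lambda_k(r_k-\hat J_k+\hat V_k(s_{k+1})-\hat V_k(s_k))e_{s_k}$; $g^J_{k+1}=(1-\lambda_k)g^J_k+\lambda_kc_J(r_k-\hat J_k)$; $h_{k+1}=(1-\lambda_k)h_k+\lambda_k(e_{s_k}-\hat\mu_k)$. Here $\Pi_{\Delta_{\mathcal{S}}}$ is Euclidean projection onto the simplex, $\Pi_{B_V}$ Euclidean projection onto the $\ell_2$-ball of radius $B_V$, $\Pi_{[0,1]}$ projection onto $[0,1]$. Expectations are over the randomness of the algorithm. Metrics. Let $\mathcal{E}$ be the span of the all-ones vector $\mathbf{1}\in\mathbb{R}^{|\mathcal{S}|}$ and $\Pi_{\mathcal{E}_\perp}=I-\mathbf{1}\mathbf{1}^\top/|\mathcal{S}|$. Define $\varepsilon^\pi_k=\|\nabla_\theta J(\pi_{\theta_k},\mu)|_{\mu=\mu^\star(\pi_{\theta_k})}\|^2$ (gradient in $\theta$ with $\mu$ held fixed, then set to $\mu^\star(\pi_{\theta_k})$), $\varepsilon^\mu_k=\|\hat\mu_k-\mu^\star(\pi_{\theta_k})\|^2$, $\varepsilon^V_k=\|\Pi_{\mathcal{E}_\perp}(\hat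 V_k-V^{\pi_{\theta_k},\hat\mu_k})\|^2$, $\varepsilon^J_k=(\hat J_k-J(\pi_{\theta_k},\hat\mu_k))^2$. Mixing time. For $c>0$, $\tau^{\pi,\mu}(c)=\min\{k\in\mathbb{N}:\sup_s d_{TV}(\mathbb{P}(\hat s_k=\cdot\mid\hat s_0=s),\nu^{\pi,\mu})\le c\}$ for the chain $\hat s_k\sim P^{\pi,\mu}(\cdot\mid\hat s_{k-1})$; $\tau_k=\sup_{\pi,\mu}\tau^{\pi,\mu}(\alpha_k)$. Constants. $L_V\ge1$ is a constant such that for all $\theta_1,\theta_2,\mu_1,\mu_2$ the quantities $\|\Pi_{\mathcal{E}_\perp}(V^{\pi_{\theta_1},\mu_1}-V^{\pi_{\theta_2},\mu_2})\|$, $|J(\pi_{\theta_1},\mu_1)-J(\pi_{\theta_2},\mu_2)|$, $\|\nabla_\theta J(\pi_{\theta_1},\mu_1)-\nabla_\theta J(\pi_{\theta_2},\mu_2)\|$, $\|\nabla_\mu J(\pi_{\theta_1},\mu_1)-\nabla_\mu J(\pi_{\theta_2},\mu_2)\|$ are each at most $L_V(\|\theta_1-\theta_2\|+\|\mu_1-\mu_2\|)$. $L_{TV}$ is a constant such that $d_{TV}(\nu^{\pi_1,\mu_1}\otimes\pi_1\otimes\mathcal{P}^{\mu_1},\nu^{\pi_2,\mu_2}\otimes\pi_2\otimes\mathcal{P}^{\mu_2})\le L_{TV}(\|\pi_1-\pi_2\|+\|\mu_1-\mu_2\|)$ for all $\pi_i,\mu_i$, where $\nu\otimes\pi\otimes\mathcal{P}^\mu$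 is the joint law of $(s,a,s')$ with $s\sim\nu,a\sim\pi(\cdot\mid s),s'\sim\mathcal{P}^\mu(\cdot\mid s,a)$. $\gamma\in(0,1)$ is a constant such that $V^\top\mathbb{E}_{s\sim\nu^{\pi_\theta,\mu},a\sim\pi_\theta(\cdot\mid s),s'\sim\mathcal{P}^\mu(\cdot\mid s,a)}[e_s(e_{s'}-e_s)^\top]V\le-\gamma\|V\|^2$ for all $\theta,\mu$ and all $V$ with $V^\top\mathbf{1}=0$. Set $B_F=B_V+1$, $B_G=2(B_V+c_J+2)$, $B_H=2$, $L_F=10B_V+L+2B_FL_{TV}+5$, $L_G=2B_GL_{TV}+(L+1)(c_J+1)+2$, $L_H=L+1$. Step-size conditions: $c_J\ge1/\gamma$; $\alpha_0\le\xi_0\le\beta_0\le\lambda_0\le1/4$; $\alpha_0\le\min\{\lambda_0/(192(L_F^2+L_G^2+L_H^2+L_V^2+L^2/(1-\delta)+\rho)),\,C_\beta\beta_0,\,C_\xi\xi_0\}$; $\xi_0\le\min\{\lambda_0/(64(L_H^2L_F^2+L_G^2+L_V^2/\gamma+1/(1-\delta))),\,(1-\delta)\gamma\beta_0/(6912(L_F^4L_V^2+L_F^2L_G^2L_H^2L_V^2+L_F^2L_H^4L_V^2+L_V^2))\}$; $\beta_0\le\min\{\lambda_0/(72|\mathcal{S}|L_G^2+36L_F^2+8/\gamma),\,\gamma/(4L_G^2),\,(1-\delta)/(2L_H^2)\}$; where $C_\xi=\min\{\frac{1-\delta}{32\rho L_F^2},\frac{1-\delta}{4\rho},\frac{L_H}{2L_FL_V},\frac{1-\delta}{16LL_FL_V}\}$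 and $C_\beta=\min\{\frac{\gamma}{4},\frac{\rho\gamma}{512(L_F^2+L_G^2+L_H^2+L_V^2+L^2/(1-\delta))},\sqrt{\frac{\gamma}{3456|\mathcal{S}|(L_F^4L_G^4+L_F^2L_H^2+\rho L_F^2+L_V^2/\gamma+L^2L_F^2(1-\delta))}},\frac{\gamma}{2\rho}\}$. *)

theory Defs
  imports "HOL-Probability.Probability"
begin

text \<open>Finite state type 's, finite action type 'a. Mean fields and value vectors are
  elements of real^'s, mfg_policies and softmax parameters are elements of real^'a^'s
  (whose norm is the Euclidean norm on R^(|S||A|)). The transition kernel is
  K mu s a :: 's pmf, the reward is r s a mu.\<close>

definition prob_simplex :: "(real^'n) set" where
  "prob_simplex = {p. (\<forall>i. 0 \<le> p $ i) \<and> (\<Sum>i\<in>UNIV. p $ i) = 1}"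

definition mfg_policies :: "(real^'a^'s) set" where
  "mfg_policies = {\<pi>. \<forall>s. \<pi> $ s \<in> prob_simplex}"

text \<open>Total variation distance of two (signed) measures on a finite set, given by their
  point masses, literally as the supremum formula.\<close>
definition dTV :: "('x::finite \<Rightarrow> real) \<Rightarrow> ('x \<Rightarrow> real) \<Rightarrow> real" where
  "dTV p q = 1/2 * (SUP \<psi>\<in>{\<psi>::'x \<Rightarrow> real. \<forall>x. \<bar>\<psi> x\<bar> \<le> 1}.
       \<bar>(\<Sum>x\<in>UNIV. \<psi> x * p x) - (\<Sum>x\<in>UNIV. \<psi> x * q x)\<bar>)"

definition Pmat :: "(real^'s \<Rightarrow> 's::finite \<Rightarrow> 'a::finite \<Rightarrow> 's pmf) \<Rightarrow> real^'a^'s \<Rightarrow> real^'s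
     \<Rightarrow> 's \<Rightarrow> 's \<Rightarrow> real" where
  "Pmat K \<pi> \<mu> s s' = (\<Sum>a\<in>UNIV. pmf (K \<mu> s a) s' * \<pi> $ s $ a)"

primrec kstep :: "(real^'s \<Rightarrow> 's::finite \<Rightarrow> 'a::finite \<Rightarrow> 's pmf) \<Rightarrow> real^'a^'s \<Rightarrow> real^'s
     \<Rightarrow> nat \<Rightarrow> 's \<Rightarrow> real^'s" where
  "kstep K \<pi> \<mu> 0 s = (\<chi> s'. if s' = s then 1 else 0)"
| "kstep K \<pi> \<mu> (Suc k) s = (\<chi> s'. \<Sum>s''\<in>UNIV. kstep K \<pi> \<mu> k s $ s'' * Pmat K \<pi> \<mu> s'' s')"

definition stationary :: "(real^'s \<Rightarrow> 's::finite \<Rightarrow> 'a::finite \<Rightarrow> 's pmf) \<Rightarrow> real^'a^'s \<Rightarrow> real^'s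
     \<Rightarrow> real^'s \<Rightarrow> bool" where
  "stationary K \<pi> \<mu> \<nu> \<longleftrightarrow> \<nu> \<in> prob_simplex \<and> (\<forall>s'. \<nu> $ s' = (\<Sum>s\<in>UNIV. \<nu> $ s * Pmat K \<pi> \<mu> s s'))"

definition stat_dist :: "(real^'s \<Rightarrow> 's::finite \<Rightarrow> 'a::finite \<Rightarrow> 's pmf) \<Rightarrow> real^'a^'s \<Rightarrow> real^'s \<Rightarrow> real^'s" where
  "stat_dist K \<pi> \<mu> = (THE \<nu>. stationary K \<pi> \<mu> \<nu>)"

definition irreducible_aperiodic :: "(real^'s \<Rightarrow> 's::finite \<Rightarrow> 'a::finite \<Rightarrow> 's pmf) \<Rightarrow> real^'a^'s
     \<Rightarrow> real^'s \<Rightarrow> bool" where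
  "irreducible_aperiodic K \<pi> \<mu> \<longleftrightarrow>
     (\<forall>s s'. \<exists>k. kstep K \<pi> \<mu> k s $ s' > 0) \<and>
     (\<forall>s. Gcd {k. 0 < k \<and> kstep K \<pi> \<mu> k s $ s > 0} = 1)"

definition Jf :: "(real^'s \<Rightarrow> 's::finite \<Rightarrow> 'a::finite \<Rightarrow> 's pmf) \<Rightarrow> ('s \<Rightarrow> 'a \<Rightarrow> real^'s \<Rightarrow> real)
     \<Rightarrow> real^'a^'s \<Rightarrow> real^'s \<Rightarrow> real" where
  "Jf K r \<pi> \<mu> = (\<Sum>s\<in>UNIV. \<Sum>a\<in>UNIV. stat_dist K \<pi> \<mu> $ s * \<pi> $ s $ a * r s a \<mu>)"

text \<open>Differential value function V^{pi,mu}(s) = sum_t E[r(s_t,a_t,mu) - J | s_0 = s].\<close>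
definition Vf :: "(real^'s \<Rightarrow> 's::finite \<Rightarrow> 'a::finite \<Rightarrow> 's pmf) \<Rightarrow> ('s \<Rightarrow> 'a \<Rightarrow> real^'s \<Rightarrow> real)
     \<Rightarrow> real^'a^'s \<Rightarrow> real^'s \<Rightarrow> real^'s" where
  "Vf K r \<pi> \<mu> = (\<chi> s. \<Sum>t. \<Sum>s'\<in>UNIV. kstep K \<pi> \<mu> t s $ s' *
       ((\<Sum>a\<in>UNIV. \<pi> $ s' $ a * r s' a \<mu>) - Jf K r \<pi> \<mu>))"

definition mustar :: "(real^'s \<Rightarrow> 's::finite \<Rightarrow> 'a::finite \<Rightarrow> 's pmf) \<Rightarrow> real^'a^'s \<Rightarrow> real^'s" where
  "mustar K \<pi> = (THE \<mu>. \<mu> \<in> prob_simplex \<and> \<mu> = stat_dist K \<pi> \<mu>)"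

definition mfg_ell :: "(real^'s \<Rightarrow> 's::finite \<Rightarrow> 'a::finite \<Rightarrow> 's pmf) \<Rightarrow> ('s \<Rightarrow> 'a \<Rightarrow> real^'s \<Rightarrow> real)
     \<Rightarrow> real^'a^'s \<Rightarrow> real" where
  "mfg_ell K r \<pi> = Jf K r \<pi> (mustar K \<pi>)"

definition softmax :: "real^'a::finite^'s \<Rightarrow> real^'a^'s" where
  "softmax \<theta> = (\<chi> s a. exp (\<theta> $ s $ a) / (\<Sum>a'\<in>UNIV. exp (\<theta> $ s $ a')))"

definition gradf :: "('v::real_inner \<Rightarrow> real) \<Rightarrow> 'v \<Rightarrow> 'v" where
  "gradf f x = (THE g. GDERIV f x :> g)"

definition projperp :: "real^'s::finite \<Rightarrow> real^'s" where
  "projperp V = (\<chi> s. V $ s - (\<Sum>s'\<in>UNIV. V $ s') / real CARD('s))"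

definition mix_time :: "(real^'s \<Rightarrow> 's::finite \<Rightarrow> 'a::finite \<Rightarrow> 's pmf) \<Rightarrow> real^'a^'s \<Rightarrow> real^'s
     \<Rightarrow> real \<Rightarrow> nat" where
  "mix_time K \<pi> \<mu> c = (LEAST k. \<forall>s. dTV (\<lambda>x. kstep K \<pi> \<mu> k s $ x) (\<lambda>x. stat_dist K \<pi> \<mu> $ x) \<le> c)"

definition mfg_joint :: "(real^'s \<Rightarrow> 's::finite \<Rightarrow> 'a::finite \<Rightarrow> 's pmf) \<Rightarrow> real^'a^'s \<Rightarrow> real^'s
     \<Rightarrow> 's \<times> 'a \<times> 's \<Rightarrow> real" where
  "mfg_joint K \<pi> \<mu> = (\<lambda>(s, a, s'). stat_dist K \<pi> \<mu> $ s * \<pi> $ s $ a * pmf (K \<mu> s a) s')"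

record ('s, 'a) alg_state =
  th :: "real^'a^'s"
  Vh :: "real^'s"
  Jh :: real
  muh :: "real^'s"
  fv :: "real^'a^'s"
  gV :: "real^'s"
  gJ :: real
  hv :: "real^'s"
  st :: 's

definition act_pmf :: "real^'a::finite^'s \<Rightarrow> 's \<Rightarrow> 'a pmf" where
  "act_pmf \<pi> s = embed_pmf (\<lambda>a. \<pi> $ s $ a)"

definition alg_step :: "(real^'s \<Rightarrow> 's::finite \<Rightarrow> 'a::finite \<Rightarrow> 's pmf) \<Rightarrow> ('s \<Rightarrow> 'a \<Rightarrow> real^'s \<Rightarrow> real)
     \<Rightarrow> real \<Rightarrow> real \<Rightarrow> (nat \<Rightarrow> real) \<Rightarrow> (nat \<Rightarrow> real) \<Rightarrow> (nat \<Rightarrow> real) \<Rightarrow> (nat \<Rightarrow> real)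
     \<Rightarrow> nat \<Rightarrow> ('s, 'a) alg_state \<Rightarrow> ('s, 'a) alg_state pmf" where
  "alg_step K r cJ BV \<alpha> \<beta> \<xi> lm k x =
     act_pmf (softmax (th x)) (st x) \<bind> (\<lambda>a.
     K (muh x) (st x) a \<bind> (\<lambda>s'.
     (let rk = r (st x) a (muh x) in
     return_pmf
       \<lparr> th = th x + \<alpha> k *\<^sub>R fv x,
         Vh = closest_point (cball 0 BV) (Vh x + \<beta> k *\<^sub>R gV x),
         Jh = closest_point {0..1} (Jh x + \<beta> k * gJ x),
         muh = closest_point prob_simplex (muh x + \<xi> k *\<^sub>R hv x),
         fv = (1 - lm k) *\<^sub>R fv x + (lm k * (rk + Vh x $ s' - Vh x $ st x)) *\<^sub>R
                 gradf (\<lambda>\<theta>. ln (softmax \<theta> $ st x $ a)) (th x),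
         gV = (1 - lm k) *\<^sub>R gV x + (lm k * (rk - Jh x + Vh x $ s' - Vh x $ st x)) *\<^sub>R axis (st x) 1,
         gJ = (1 - lm k) * gJ x + lm k * cJ * (rk - Jh x),
         hv = (1 - lm k) *\<^sub>R hv x + lm k *\<^sub>R (axis (st x) 1 - muh x),
         st = s' \<rparr>)))"

primrec alg_dist :: "(real^'s \<Rightarrow> 's::finite \<Rightarrow> 'a::finite \<Rightarrow> 's pmf) \<Rightarrow> ('s \<Rightarrow> 'a \<Rightarrow> real^'s \<Rightarrow> real)
     \<Rightarrow> real \<Rightarrow> real \<Rightarrow> (nat \<Rightarrow> real) \<Rightarrow> (nat \<Rightarrow> real) \<Rightarrow> (nat \<Rightarrow> real) \<Rightarrow> (nat \<Rightarrow> real)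
     \<Rightarrow> ('s, 'a) alg_state \<Rightarrow> nat \<Rightarrow> ('s, 'a) alg_state pmf" where
  "alg_dist K r cJ BV \<alpha> \<beta> \<xi> lm x0 0 = return_pmf x0"
| "alg_dist K r cJ BV \<alpha> \<beta> \<xi> lm x0 (Suc k) =
     alg_dist K r cJ BV \<alpha> \<beta> \<xi> lm x0 k \<bind> alg_step K r cJ BV \<alpha> \<beta> \<xi> lm k"

definition eps_pi :: "(real^'s \<Rightarrow> 's::finite \<Rightarrow> 'a::finite \<Rightarrow> 's pmf) \<Rightarrow> ('s \<Rightarrow> 'a \<Rightarrow> real^'s \<Rightarrow> real)
     \<Rightarrow> ('s, 'a) alg_state \<Rightarrow> real" where
  "eps_pi K r x = (norm (gradf (\<lambda>\<theta>. Jf K r (softmax \<theta>) (mustar K (softmax (th x)))) (th x)))\<^sup>2"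

definition eps_mu :: "(real^'s \<Rightarrow> 's::finite \<Rightarrow> 'a::finite \<Rightarrow> 's pmf) \<Rightarrow> ('s, 'a) alg_state \<Rightarrow> real" where
  "eps_mu K x = (norm (muh x - mustar K (softmax (th x))))\<^sup>2"

definition eps_V :: "(real^'s \<Rightarrow> 's::finite \<Rightarrow> 'a::finite \<Rightarrow> 's pmf) \<Rightarrow> ('s \<Rightarrow> 'a \<Rightarrow> real^'s \<Rightarrow> real)
     \<Rightarrow> ('s, 'a) alg_state \<Rightarrow> real" where
  "eps_V K r x = (norm (projperp (Vh x - Vf K r (softmax (th x)) (muh x))))\<^sup>2"

definition eps_J :: "(real^'s \<Rightarrow> 's::finite \<Rightarrow> 'a::finite \<Rightarrow> 's pmf) \<Rightarrow> ('s \<Rightarrow> 'a \<Rightarrow> real^'s \<Rightarrow> real)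
     \<Rightarrow> ('s, 'a) alg_state \<Rightarrow> real" where
  "eps_J K r x = (Jh x - Jf K r (softmax (th x)) (muh x))\<^sup>2"

end

(*
For kappa > 0 the constant may depend on kappa, and the bound already holds with the error at time 0.
For kappa = 0 a Lyapunov function decreases, up to terms whose sums grow logarithmically, by a multiple of
eps_k / sqrt (k+1); summing gives the rate.

The filters f, gV, gJ, h track averages over the stationary law while being driven by the current state
of the chain.  With u the solution of the Poisson equation of the frozen chain, the corrected square
|z - mean|^2 + 2 lm_k (z - mean, u s) decreases by 2 lm_k |z - mean|^2 up to O(lm_k^2) and up to the motion
of the mean, so no mixing-time window is needed.  The herding inequality with kappa = 0, used in both
directions between consecutive policies, says that ell moves by rho times the inner product of the step
with the partial gradient of J.

Projecting the value estimate onto the ball multiplies it by some 1 - eta, which is not a contraction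
for the seminorm |projperp (V - Vf)|: the excess is eta chat^2, with chat the normalized sum of the
unprojected iterate.  The normalized sum of V, corrected by gV, gJ and J so that all other first order
terms cancel, changes by -eta chat exactly up to second order, so half of its square pays for the excess.
The remaining first order terms form a quadratic form in the errors, which is negative definite under the
step-size conditions.

L_TV < 0 is possible only if there is one state and one action; then only J and its filter move and they
form a damped oscillator.
*)
theory Submission
  imports Defs
begin

section \<open>Total variation and the simplex\<close>

text \<open>Values matter only modulo constants, and projection onto a ball does not respect this
  quotient: when it acts it also rescales the constant component. Its factor \<open>1 - eta\<close>
  has eta = O(tk), so the excess eta chat^2 is of the same order as the drift and cannot be left to
  the error terms. The square of \<open>Yl\<close> that compensates it contains \<open>ell\<close>,
  whose increment thereby gets the factor \<open>aa * Yl\<close> of unknown sign. This is why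
  \<open>ell\<close> needs a two-sided expansion and not only an ascent inequality, and why the
  weight \<open>Wc\<close> of \<open>- ell\<close> must dominate \<open>aa * (BV + 2)\<close>. All
  increments are measured in units of \<open>be\<close>: the actor and mean-field ratios
  \<open>nA\<close>, \<open>nZ\<close> are small and the filter ratio \<open>nR\<close> is large, as
  quantified by the step-size conditions. The remainders are multiples of tk^2 and tk ee, with
  partial sums O(log k). Dividing by the sum of the tk, of order sqrt k, gives log k / sqrt k, which
  the cube in the theorem covers because ln (k + 1) >= ln 2.\<close>

lemma dTV_eq:
  fixes p q :: "'x::finite \<Rightarrow> real"
  shows "dTV p q = (\<Sum>x\<in>UNIV. \<bar>p x - q x\<bar>) / 2"
proof -
  let ?S = "{\<psi>::'x \<Rightarrow> real. \<forall>x. \<bar>\<psi> x\<bar> \<le> 1}"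
  let ?F = "\<lambda>\<psi>. \<bar>(\<Sum>x\<in>UNIV. \<psi> x * p x) - (\<Sum>x\<in>UNIV. \<psi> x * q x)\<bar>"
  have F: "?F \<psi> = \<bar>\<Sum>x\<in>UNIV. \<psi> x * (p x - q x)\<bar>" for \<psi>
    by (simp add: sum_subtractf right_diff_distrib)
  have "(SUP \<psi>\<in>?S. ?F \<psi>) = (\<Sum>x\<in>UNIV. \<bar>p x - q x\<bar>)"
  proof (rule cSup_eq_maximum)
    let ?\<psi> = "\<lambda>x. sgn (p x - q x)"
    have "?F ?\<psi> = (\<Sum>x\<in>UNIV. \<bar>p x - q x\<bar>)"
      unfolding F by (simp add: sgn_mult_self_eq mult.commute abs_sgn[symmetric] sum_nonneg)
    moreover have "?\<psi> \<in> ?S" by (auto simp: sgn_real_def)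
    ultimately show "(\<Sum>x\<in>UNIV. \<bar>p x - q x\<bar>) \<in> ?F ` ?S"
      by (intro image_eqI[of _ _ ?\<psi>]) (auto simp only:)
  next
    fix y assume "y \<in> ?F ` ?S"
    then obtain \<psi> where \<psi>: "\<forall>x. \<bar>\<psi> x\<bar> \<le> 1" and y: "y = \<bar>\<Sum>x\<in>UNIV. \<psi> x * (p x - q x)\<bar>"
      using F by auto
    have "y \<le> (\<Sum>x\<in>UNIV. \<bar>\<psi> x * (p x - q x)\<bar>)" unfolding y by (rule sum_abs)
    also have "\<dots> \<le> (\<Sum>x\<in>UNIV. \<bar>p x - q x\<bar>)"
      by (rule sum_mono) (use \<psi> in \<open>auto simp: abs_mult intro: mult_left_le_one_le\<close>)
    finally show "y \<le> (\<Sum>x\<in>UNIV. \<bar>p x - q x\<bar>)" .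
  qed
  then show ?thesis unfolding dTV_def by simp
qed

lemma dTV_nonneg: "0 \<le> dTV (p::'x::finite \<Rightarrow> real) q"
  by (simp add: dTV_eq sum_nonneg)

lemma dTV_pointwise: "\<bar>p x - q x\<bar> \<le> 2 * dTV (p::'x::finite \<Rightarrow> real) q"
  unfolding dTV_eq using member_le_sum[of x UNIV "\<lambda>x. \<bar>p x - q x\<bar>"] by simp

lemma dTV_integral:
  fixes F :: "'x::finite \<Rightarrow> 'v::real_normed_vector"
  assumes "\<And>x. norm (F x) \<le> M"
  shows "norm (\<Sum>x\<in>UNIV. (p x - q x) *\<^sub>R F x) \<le> 2 * M * dTV p q"
proof -
  have "norm (\<Sum>x\<in>UNIV. (p x - q x) *\<^sub>R F x) \<le> (\<Sum>x\<in>UNIV. \<bar>p x - q x\<bar> * M)"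
    by (rule order_trans[OF norm_sum sum_mono]) (simp add: assms mult_left_mono)
  then show ?thesis unfolding sum_distrib_right[symmetric] by (simp add: dTV_eq mult.commute)
qed

lemma norm_le_dTV: "norm (p - q) \<le> 2 * dTV (\<lambda>i. p $ i) (\<lambda>i. q $ (i::'n::finite))"
  using norm_le_l1_cart[of "p - q"] by (simp add: dTV_eq)

lemma simplex_nonneg: "p \<in> prob_simplex \<Longrightarrow> 0 \<le> p $ i"
  and simplex_sum: "p \<in> prob_simplex \<Longrightarrow> (\<Sum>i\<in>UNIV. p $ i) = 1"
  by (auto simp: prob_simplex_def)

lemma simplex_le_one: "p \<in> prob_simplex \<Longrightarrow> p $ (i::'n::finite) \<le> 1"
  using member_le_sum[of i UNIV "\<lambda>i. p $ i"] by (simp add: prob_simplex_def)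

lemma simplex_norm: "p \<in> prob_simplex \<Longrightarrow> norm (p::real^'n::finite) \<le> 1"
  using norm_le_l1_cart[of p] by (simp add: prob_simplex_def)

lemma policy_nonneg: "\<pi> \<in> mfg_policies \<Longrightarrow> 0 \<le> \<pi> $ s $ a"
  and policy_sum: "\<pi> \<in> mfg_policies \<Longrightarrow> (\<Sum>a\<in>UNIV. \<pi> $ s $ a) = 1"
  and policy_le_one: "\<pi> \<in> mfg_policies \<Longrightarrow> \<pi> $ s $ (a::'a::finite) \<le> 1"
  by (auto simp: mfg_policies_def simplex_sum simplex_nonneg simplex_le_one)

lemma simplex_convex_bound:
  fixes F :: "'n::finite \<Rightarrow> 'v::real_normed_vector"
  assumes "\<And>i. 0 \<le> p i" "sum p UNIV = 1" "\<And>i. norm (F i) \<le> M"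
  shows "norm (\<Sum>i\<in>UNIV. p i *\<^sub>R F i) \<le> M"
proof -
  have "norm (\<Sum>i\<in>UNIV. p i *\<^sub>R F i) \<le> (\<Sum>i\<in>UNIV. p i * M)"
    by (rule order_trans[OF norm_sum sum_mono]) (simp add: assms mult_left_mono)
  then show ?thesis by (simp add: assms sum_distrib_right[symmetric])
qed

lemma closed_simplex: "closed (prob_simplex :: (real^'n::finite) set)"
  unfolding prob_simplex_def
  by (intro closed_Collect_conj closed_Collect_all closed_Collect_le closed_Collect_eq continuous_intros)

lemma convex_simplex: "convex (prob_simplex :: (real^'n::finite) set)"
  unfolding convex_def prob_simplex_def
  by (auto simp: sum.distrib sum_distrib_left[symmetric])

lemma axis_in_simplex: "axis i 1 \<in> (prob_simplex :: (real^'n::finite) set)"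
  by (auto simp: prob_simplex_def axis_def)

lemma simplex_nonempty: "(prob_simplex :: (real^'n::finite) set) \<noteq> {}"
  using axis_in_simplex by auto

lemma pmf_sum_UNIV: "(\<Sum>x\<in>UNIV. pmf p (x::'x::finite)) = 1"
  by (rule sum_pmf_eq_1) auto

section \<open>Ergodic kernels and the deviation matrix\<close>

lemma Pmat_nonneg: "\<pi> \<in> mfg_policies \<Longrightarrow> 0 \<le> Pmat K \<pi> \<mu> s s'"
  unfolding Pmat_def by (intro sum_nonneg mult_nonneg_nonneg) (auto simp: policy_nonneg)

lemma Pmat_sum:
  assumes "\<pi> \<in> mfg_policies" shows "(\<Sum>s'\<in>UNIV. Pmat K \<pi> \<mu> s s') = 1"
proof -
  have "(\<Sum>s'\<in>UNIV. Pmat K \<pi> \<mu> s s') = (\<Sum>a\<in>UNIV. \<Sum>s'\<in>UNIV. pmf (K \<mu> s a) s' * \<pi> $ s $ a)"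
    unfolding Pmat_def by (rule sum.swap)
  then show ?thesis using assms by (simp add: sum_distrib_right[symmetric] pmf_sum_UNIV policy_sum)
qed

lemma kstep_simplex: "\<pi> \<in> mfg_policies \<Longrightarrow> kstep K \<pi> \<mu> k s \<in> prob_simplex"
proof (induction k)
  case 0 then show ?case by (auto simp: prob_simplex_def)
next
  case (Suc k)
  have "(\<Sum>s'\<in>UNIV. \<Sum>s''\<in>UNIV. kstep K \<pi> \<mu> k s $ s'' * Pmat K \<pi> \<mu> s'' s') =
     (\<Sum>s''\<in>UNIV. kstep K \<pi> \<mu> k s $ s'' * (\<Sum>s'\<in>UNIV. Pmat K \<pi> \<mu> s'' s'))"
    by (subst sum.swap) (simp add: sum_distrib_left)
  then show ?case using Suc
    by (auto simp: prob_simplex_def Pmat_sum intro!: sum_nonneg mult_nonneg_nonneg Pmat_nonneg)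
qed

text \<open>\<open>kstep\<close> appends a transition at the end; the Poisson and Bellman equations
  need the first transition split off instead.\<close>

lemma kstep_Suc_left:
  "kstep K \<pi> \<mu> (Suc k) s $ s' = (\<Sum>s''\<in>UNIV. Pmat K \<pi> \<mu> s s'' * kstep K \<pi> \<mu> k s'' $ s')"
proof (induction k arbitrary: s')
  case 0
  show ?case by (simp add: if_distrib if_distribR cong: if_cong)
next
  case (Suc k)
  have "kstep K \<pi> \<mu> (Suc (Suc k)) s $ s' =
      (\<Sum>j\<in>UNIV. kstep K \<pi> \<mu> (Suc k) s $ j * Pmat K \<pi> \<mu> j s')" by simp
  also have "\<dots> = (\<Sum>j\<in>UNIV. \<Sum>i\<in>UNIV. Pmat K \<pi> \<mu> s i * kstep K \<pi> \<mu> k i $ j * Pmat K \<pi> \<mu> j s')"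
    by (simp only: Suc.IH sum_distrib_right)
  also have "\<dots> = (\<Sum>i\<in>UNIV. \<Sum>j\<in>UNIV. Pmat K \<pi> \<mu> s i * kstep K \<pi> \<mu> k i $ j * Pmat K \<pi> \<mu> j s')"
    by (rule sum.swap)
  also have "\<dots> = (\<Sum>i\<in>UNIV. Pmat K \<pi> \<mu> s i * kstep K \<pi> \<mu> (Suc k) i $ s')"
    by (simp add: sum_distrib_left mult.assoc)
  finally show ?case .
qed

lemma sum_delta_mult:
  "(\<Sum>j\<in>UNIV. (if i = j then 1 else 0) * f j) = (f (i::'n::finite) :: real)"
  "(\<Sum>j\<in>UNIV. f j * (if j = i then 1 else 0)) = (f (i::'n::finite) :: real)"
  by (simp_all add: if_distrib if_distribR cong: if_cong)

text \<open>That \<open>C0\<close> and \<open>C1\<close> are uniform over policies and mean fields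
  is what bounds the deviation matrix independently of the parameters, and so makes Poisson
  solutions Lipschitz.\<close>

locale ergodic_kernel =
  fixes K :: "real^'s \<Rightarrow> 's::finite \<Rightarrow> 'a::finite \<Rightarrow> 's pmf" and C0 C1 :: real
  assumes C0: "C0 \<ge> 1" and C1: "0 < C1" "C1 < 1"
    and ergodic: "\<And>\<pi> \<mu> s k. \<pi> \<in> mfg_policies \<Longrightarrow> \<mu> \<in> prob_simplex \<Longrightarrow>
      dTV (\<lambda>x. kstep K \<pi> \<mu> k s $ x) (\<lambda>x. stat_dist K \<pi> \<mu> $ x) \<le> C0 * C1 ^ k"
begin

context
  fixes \<pi> :: "real^'a^'s" and \<mu> :: "real^'s"
  assumes pm: "\<pi> \<in> mfg_policies" "\<mu> \<in> prob_simplex"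
begin

lemma kstep_stat_diff: "\<bar>kstep K \<pi> \<mu> k s $ x - stat_dist K \<pi> \<mu> $ x\<bar> \<le> 2 * C0 * C1 ^ k"
  using dTV_pointwise[of "\<lambda>x. kstep K \<pi> \<mu> k s $ x" x "\<lambda>x. stat_dist K \<pi> \<mu> $ x"] ergodic[OF pm, of k s] by simp

lemma kstep_tendsto: "(\<lambda>k. kstep K \<pi> \<mu> k s $ x) \<longlonglongrightarrow> stat_dist K \<pi> \<mu> $ x"
proof -
  have "(\<lambda>k. 2 * C0 * C1 ^ k) \<longlonglongrightarrow> 2 * C0 * 0"
    by (intro tendsto_intros LIMSEQ_realpow_zero) (use C1 in auto)
  then have "(\<lambda>k. kstep K \<pi> \<mu> k s $ x - stat_dist K \<pi> \<mu> $ x) \<longlonglongrightarrow> 0"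
    by - (rule Lim_null_comparison[where g = "\<lambda>k. 2 * C0 * C1 ^ k"], simp_all add: kstep_stat_diff)
  then show ?thesis using Lim_null by blast
qed

text \<open>\<open>stat_dist\<close> is a definite description, so its properties do not come with
  the definition. They are recovered from convergence: as a limit of \<open>kstep\<close> it is a
  probability vector and, in \<open>stat_eq\<close>, invariant.\<close>

lemma stat_simplex: "stat_dist K \<pi> \<mu> \<in> prob_simplex"
proof -
  fix s :: 's
  have "(\<lambda>k. \<Sum>x\<in>UNIV. kstep K \<pi> \<mu> k s $ x) \<longlonglongrightarrow> (\<Sum>x\<in>UNIV. stat_dist K \<pi> \<mu> $ x)"
    by (intro tendsto_sum kstep_tendsto)
  then have "(\<Sum>x\<in>UNIV. stat_dist K \<pi> \<mu> $ x) = 1"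
    by (simp add: simplex_sum[OF kstep_simplex[OF pm(1)]] LIMSEQ_const_iff)
  moreover have "0 \<le> stat_dist K \<pi> \<mu> $ x" for x
    by (rule LIMSEQ_le_const[OF kstep_tendsto[of s]]) (auto intro!: simplex_nonneg kstep_simplex[OF pm(1)])
  ultimately show ?thesis by (auto simp: prob_simplex_def)
qed

lemma stat_eq: "stat_dist K \<pi> \<mu> $ s' = (\<Sum>s\<in>UNIV. stat_dist K \<pi> \<mu> $ s * Pmat K \<pi> \<mu> s s')"
proof -
  fix s0 :: 's
  have "(\<lambda>k. kstep K \<pi> \<mu> (Suc k) s0 $ s') \<longlonglongrightarrow> (\<Sum>s\<in>UNIV. stat_dist K \<pi> \<mu> $ s * Pmat K \<pi> \<mu> s s')"
    unfolding kstep.simps vec_lambda_beta by (intro tendsto_sum tendsto_mult kstep_tendsto tendsto_const)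
  moreover have "(\<lambda>k. kstep K \<pi> \<mu> (Suc k) s0 $ s') \<longlonglongrightarrow> stat_dist K \<pi> \<mu> $ s'"
    by (rule LIMSEQ_Suc[OF kstep_tendsto])
  ultimately show ?thesis by (rule LIMSEQ_unique[symmetric])
qed

lemma stat_kstep: "(\<Sum>s\<in>UNIV. stat_dist K \<pi> \<mu> $ s * kstep K \<pi> \<mu> k s $ s') = stat_dist K \<pi> \<mu> $ s'"
proof (induction k)
  case 0
  show ?case by (simp add: if_distrib cong: if_cong)
next
  case (Suc k)
  have "(\<Sum>s\<in>UNIV. stat_dist K \<pi> \<mu> $ s * kstep K \<pi> \<mu> (Suc k) s $ s') =
    (\<Sum>i\<in>UNIV. (\<Sum>s\<in>UNIV. stat_dist K \<pi> \<mu> $ s * Pmat K \<pi> \<mu> s i) * kstep K \<pi> \<mu> k i $ s')"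
    unfolding kstep_Suc_left sum_distrib_left sum_distrib_right by (subst sum.swap) (simp add: mult.assoc)
  then show ?case using Suc by (simp add: stat_eq[symmetric])
qed

end

text \<open>The deviation matrix D, the group inverse of I - P. With Pi the matrix whose rows all
  equal the stationary law, the lemmas below say D = I - Pi + P D = I - Pi + D P, D 1 = 0 and Pi D =
  0.\<close>

definition dev :: "real^'a^'s \<Rightarrow> real^'s \<Rightarrow> 's \<Rightarrow> 's \<Rightarrow> real" where
  "dev \<pi> \<mu> s s' = (\<Sum>t. kstep K \<pi> \<mu> t s $ s' - stat_dist K \<pi> \<mu> $ s')"

context
  fixes \<pi> :: "real^'a^'s" and \<mu> :: "real^'s"
  assumes pm: "\<pi> \<in> mfg_policies" "\<mu> \<in> prob_simplex"
begin

lemma geometric_summable: "summable (\<lambda>t. 2 * C0 * C1 ^ t)"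
  using C1 by (intro summable_mult summable_geometric) auto

lemma dev_summable: "summable (\<lambda>t. kstep K \<pi> \<mu> t s $ s' - stat_dist K \<pi> \<mu> $ s')"
  by (rule summable_comparison_test'[OF geometric_summable, of 0]) (simp add: kstep_stat_diff[OF pm])

lemma dev_bound: "\<bar>dev \<pi> \<mu> s s'\<bar> \<le> 2 * C0 / (1 - C1)"
proof -
  have "norm (dev \<pi> \<mu> s s') \<le> (\<Sum>t. 2 * C0 * C1 ^ t)"
    unfolding dev_def by (rule norm_suminf_le[OF _ geometric_summable]) (simp add: kstep_stat_diff[OF pm])
  also have "\<dots> = 2 * C0 / (1 - C1)"
    using C1 by (subst suminf_mult) (auto simp: summable_geometric suminf_geometric)
  finally show ?thesis by simp
qed

lemma dev_split: "dev \<pi> \<mu> s s' = (if s = s' then 1 else 0) - stat_dist K \<pi> \<mu> $ s' +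
    (\<Sum>t. kstep K \<pi> \<mu> (Suc t) s $ s' - stat_dist K \<pi> \<mu> $ s')"
  unfolding dev_def using suminf_split_head[OF dev_summable[of s s']]
  by (cases "s = s'") auto

lemma dev_left: "dev \<pi> \<mu> s s' = (if s = s' then 1 else 0) - stat_dist K \<pi> \<mu> $ s' +
    (\<Sum>i\<in>UNIV. Pmat K \<pi> \<mu> s i * dev \<pi> \<mu> i s')"
proof -
  have "kstep K \<pi> \<mu> (Suc t) s $ s' - stat_dist K \<pi> \<mu> $ s' =
     (\<Sum>i\<in>UNIV. Pmat K \<pi> \<mu> s i * (kstep K \<pi> \<mu> t i $ s' - stat_dist K \<pi> \<mu> $ s'))" for t
    by (simp only: kstep_Suc_left right_diff_distrib sum_subtractf sum_distrib_right[symmetric] Pmat_sum[OF pm(1)] mult_1)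
  then have "(\<Sum>t. kstep K \<pi> \<mu> (Suc t) s $ s' - stat_dist K \<pi> \<mu> $ s') =
     (\<Sum>t. \<Sum>i\<in>UNIV. Pmat K \<pi> \<mu> s i * (kstep K \<pi> \<mu> t i $ s' - stat_dist K \<pi> \<mu> $ s'))"
    by (simp only:)
  also have "\<dots> = (\<Sum>i\<in>UNIV. Pmat K \<pi> \<mu> s i * dev \<pi> \<mu> i s')"
    unfolding dev_def by (subst suminf_sum) (auto intro!: summable_mult dev_summable simp: suminf_mult[OF dev_summable])
  finally show ?thesis using dev_split by simp
qed

lemma dev_right: "dev \<pi> \<mu> s s' = (if s = s' then 1 else 0) - stat_dist K \<pi> \<mu> $ s' +
    (\<Sum>i\<in>UNIV. dev \<pi> \<mu> s i * Pmat K \<pi> \<mu> i s')"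
proof -
  have "kstep K \<pi> \<mu> (Suc t) s $ s' - stat_dist K \<pi> \<mu> $ s' =
     (\<Sum>i\<in>UNIV. (kstep K \<pi> \<mu> t s $ i - stat_dist K \<pi> \<mu> $ i) * Pmat K \<pi> \<mu> i s')" for t
    by (simp add: left_diff_distrib sum_subtractf stat_eq[OF pm, symmetric])
  then have "(\<Sum>t. kstep K \<pi> \<mu> (Suc t) s $ s' - stat_dist K \<pi> \<mu> $ s') =
     (\<Sum>t. \<Sum>i\<in>UNIV. (kstep K \<pi> \<mu> t s $ i - stat_dist K \<pi> \<mu> $ i) * Pmat K \<pi> \<mu> i s')"
    by (simp only:)
  also have "\<dots> = (\<Sum>i\<in>UNIV. dev \<pi> \<mu> s i * Pmat K \<pi> \<mu> i s')"
    unfolding dev_def by (subst suminf_sum) (auto intro!: summable_mult2 dev_summable simp: suminf_mult2[OF dev_summable])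
  finally show ?thesis using dev_split by simp
qed

lemma dev_row_sum: "(\<Sum>i\<in>UNIV. dev \<pi> \<mu> s i) = 0"
proof -
  have "(\<Sum>i\<in>UNIV. dev \<pi> \<mu> s i) = (\<Sum>t. \<Sum>i\<in>UNIV. kstep K \<pi> \<mu> t s $ i - stat_dist K \<pi> \<mu> $ i)"
    unfolding dev_def by (subst suminf_sum) (auto intro!: dev_summable)
  also have "\<dots> = 0"
    by (simp add: sum_subtractf simplex_sum[OF kstep_simplex[OF pm(1)]] simplex_sum[OF stat_simplex[OF pm]])
  finally show ?thesis .
qed

lemma stat_dev: "(\<Sum>i\<in>UNIV. stat_dist K \<pi> \<mu> $ i * dev \<pi> \<mu> i s') = 0"
proof -
  have "(\<Sum>i\<in>UNIV. stat_dist K \<pi> \<mu> $ i * dev \<pi> \<mu> i s') =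
     (\<Sum>t. \<Sum>i\<in>UNIV. stat_dist K \<pi> \<mu> $ i * (kstep K \<pi> \<mu> t i $ s' - stat_dist K \<pi> \<mu> $ s'))"
    unfolding dev_def by (subst suminf_sum) (auto intro!: summable_mult dev_summable simp: suminf_mult[OF dev_summable])
  also have "\<dots> = 0"
    by (simp add: right_diff_distrib sum_subtractf stat_kstep[OF pm] sum_distrib_right[symmetric] simplex_sum[OF stat_simplex[OF pm]])
  finally show ?thesis .
qed

text \<open>Rows of \<open>kstep\<close> sum to one, so subtracting \<open>Jf\<close> from the
  reward amounts to subtracting the stationary law from \<open>kstep\<close>.\<close>

lemma Vf_eq_dev:
  "Vf K r \<pi> \<mu> $ s = (\<Sum>s'\<in>UNIV. dev \<pi> \<mu> s s' * (\<Sum>a\<in>UNIV. \<pi> $ s' $ a * r s' a \<mu>))"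
proof -
  define g where "g s' = (\<Sum>a\<in>UNIV. \<pi> $ s' $ a * r s' a \<mu>)" for s'
  have J: "Jf K r \<pi> \<mu> = (\<Sum>s'\<in>UNIV. stat_dist K \<pi> \<mu> $ s' * g s')"
    unfolding Jf_def g_def by (simp add: sum_distrib_left mult.assoc)
  have "(\<Sum>s'\<in>UNIV. kstep K \<pi> \<mu> t s $ s' * (g s' - Jf K r \<pi> \<mu>)) =
    (\<Sum>s'\<in>UNIV. (kstep K \<pi> \<mu> t s $ s' - stat_dist K \<pi> \<mu> $ s') * g s')" for t
    by (simp add: right_diff_distrib left_diff_distrib sum_subtractf sum_distrib_right[symmetric]
        simplex_sum[OF kstep_simplex[OF pm(1)]] J[symmetric])
  then have "Vf K r \<pi> \<mu> $ s = (\<Sum>t. \<Sum>s'\<in>UNIV. (kstep K \<pi> \<mu> t s $ s' - stat_dist K \<pi> \<mu> $ s') * g s')"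
    unfolding Vf_def g_def by simp
  also have "\<dots> = (\<Sum>s'\<in>UNIV. dev \<pi> \<mu> s s' * g s')"
    unfolding dev_def by (subst suminf_sum) (auto intro!: summable_mult2 dev_summable simp: suminf_mult2[OF dev_summable])
  finally show ?thesis unfolding g_def .
qed

lemma Vf_bellman:
  "Vf K r \<pi> \<mu> $ s = (\<Sum>a\<in>UNIV. \<pi> $ s $ a * r s a \<mu>) - Jf K r \<pi> \<mu> +
     (\<Sum>i\<in>UNIV. Pmat K \<pi> \<mu> s i * Vf K r \<pi> \<mu> $ i)"
proof -
  define g where "g s' = (\<Sum>a\<in>UNIV. \<pi> $ s' $ a * r s' a \<mu>)" for s'
  have J: "Jf K r \<pi> \<mu> = (\<Sum>s'\<in>UNIV. stat_dist K \<pi> \<mu> $ s' * g s')"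
    unfolding Jf_def g_def by (simp add: sum_distrib_left mult.assoc)
  have V: "Vf K r \<pi> \<mu> $ s = (\<Sum>s'\<in>UNIV. dev \<pi> \<mu> s s' * g s')" for s
    unfolding g_def by (rule Vf_eq_dev)
  have "Vf K r \<pi> \<mu> $ s = (\<Sum>s'\<in>UNIV. ((if s = s' then 1 else 0) - stat_dist K \<pi> \<mu> $ s' +
    (\<Sum>i\<in>UNIV. Pmat K \<pi> \<mu> s i * dev \<pi> \<mu> i s')) * g s')"
    unfolding V by (subst dev_left) (rule refl)
  also have "\<dots> = g s - Jf K r \<pi> \<mu> + (\<Sum>s'\<in>UNIV. \<Sum>i\<in>UNIV. Pmat K \<pi> \<mu> s i * dev \<pi> \<mu> i s' * g s')"
    by (simp add: distrib_right left_diff_distrib sum.distrib sum_subtractf J sum_distrib_right sum_delta_mult)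
  also have "(\<Sum>s'\<in>UNIV. \<Sum>i\<in>UNIV. Pmat K \<pi> \<mu> s i * dev \<pi> \<mu> i s' * g s') =
     (\<Sum>i\<in>UNIV. Pmat K \<pi> \<mu> s i * Vf K r \<pi> \<mu> $ i)"
    unfolding V by (subst sum.swap) (simp add: sum_distrib_left mult.assoc)
  finally show ?thesis unfolding g_def .
qed

end

text \<open>A resolvent identity. In D1 (P1 - P2) D2 substitute D1 P1 = D1 - I + Pi1 and P2 D2 = D2
  - I + Pi2: the terms D1 D2 cancel, D1 Pi2 = 0 by the row sums, and Pi2 D2 = 0 allows Pi1 D2 to be
  written as (Pi1 - Pi2) D2. Both differences on the right are Lipschitz by assumption, hence so is
  D.\<close>

lemma dev_perturb:
  assumes 1: "\<pi>1 \<in> mfg_policies" "\<mu>1 \<in> prob_simplex" and 2: "\<pi>2 \<in> mfg_policies" "\<mu>2 \<in> prob_simplex"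
  shows "dev \<pi>1 \<mu>1 s s' - dev \<pi>2 \<mu>2 s s' =
    (\<Sum>j\<in>UNIV. \<Sum>i\<in>UNIV. dev \<pi>1 \<mu>1 s i * (Pmat K \<pi>1 \<mu>1 i j - Pmat K \<pi>2 \<mu>2 i j) * dev \<pi>2 \<mu>2 j s')
    - (\<Sum>j\<in>UNIV. (stat_dist K \<pi>1 \<mu>1 $ j - stat_dist K \<pi>2 \<mu>2 $ j) * dev \<pi>2 \<mu>2 j s')"
proof -
  let ?Z1 = "dev \<pi>1 \<mu>1" and ?Z2 = "dev \<pi>2 \<mu>2" and ?P1 = "Pmat K \<pi>1 \<mu>1" and ?P2 = "Pmat K \<pi>2 \<mu>2"
  let ?n1 = "\<lambda>j. stat_dist K \<pi>1 \<mu>1 $ j" and ?n2 = "\<lambda>j. stat_dist K \<pi>2 \<mu>2 $ j"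
  have a: "(\<Sum>i\<in>UNIV. ?Z1 s i * ?P1 i j) = ?Z1 s j - (if s = j then 1 else 0) + ?n1 j" for j
    using dev_right[OF 1, of s j] by simp
  have b: "(\<Sum>j\<in>UNIV. ?P2 i j * ?Z2 j s') = ?Z2 i s' - (if i = s' then 1 else 0) + ?n2 s'" for i
    using dev_left[OF 2, of i s'] by simp
  have "(\<Sum>j\<in>UNIV. \<Sum>i\<in>UNIV. ?Z1 s i * (?P1 i j - ?P2 i j) * ?Z2 j s') =
     (\<Sum>j\<in>UNIV. \<Sum>i\<in>UNIV. ?Z1 s i * ?P1 i j * ?Z2 j s') - (\<Sum>j\<in>UNIV. \<Sum>i\<in>UNIV. ?Z1 s i * ?P2 i j * ?Z2 j s')"
    by (simp add: right_diff_distrib left_diff_distrib sum_subtractf)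
  also have "(\<Sum>j\<in>UNIV. \<Sum>i\<in>UNIV. ?Z1 s i * ?P1 i j * ?Z2 j s') = (\<Sum>j\<in>UNIV. (\<Sum>i\<in>UNIV. ?Z1 s i * ?P1 i j) * ?Z2 j s')"
    by (simp add: sum_distrib_right)
  also have "\<dots> = (\<Sum>j\<in>UNIV. ?Z1 s j * ?Z2 j s') - ?Z2 s s' + (\<Sum>j\<in>UNIV. ?n1 j * ?Z2 j s')"
    unfolding a by (simp add: distrib_right left_diff_distrib sum.distrib sum_subtractf sum_delta_mult)
  also have "(\<Sum>j\<in>UNIV. \<Sum>i\<in>UNIV. ?Z1 s i * ?P2 i j * ?Z2 j s') = (\<Sum>i\<in>UNIV. ?Z1 s i * (\<Sum>j\<in>UNIV. ?P2 i j * ?Z2 j s'))"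
    by (subst sum.swap) (simp add: sum_distrib_left mult.assoc)
  also have "\<dots> = (\<Sum>j\<in>UNIV. ?Z1 s j * ?Z2 j s') - ?Z1 s s' + (\<Sum>i\<in>UNIV. ?Z1 s i) * ?n2 s'"
    unfolding b by (simp add: distrib_left right_diff_distrib sum.distrib sum_subtractf sum_delta_mult sum_distrib_right)
  finally show ?thesis
    by (simp add: dev_row_sum[OF 1] left_diff_distrib sum_subtractf stat_dev[OF 2])
qed

end

section \<open>Softmax policies\<close>

lemma softmax_denominator_pos: "0 < (\<Sum>a\<in>UNIV. exp (\<theta> $ s $ (a::'a::finite)) :: real)"
  by (rule sum_pos) auto

lemma softmax_policy: "softmax \<theta> \<in> mfg_policies"
proof -
  have "(\<Sum>a\<in>UNIV. exp (\<theta> $ s $ a) / (\<Sum>a'\<in>UNIV. exp (\<theta> $ s $ a'))) = 1" for s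
    unfolding sum_divide_distrib[symmetric] using softmax_denominator_pos[of \<theta> s] by simp
  then show ?thesis
    by (auto simp: mfg_policies_def prob_simplex_def softmax_def intro!: divide_nonneg_nonneg sum_nonneg)
qed

lemma softmax_pos: "0 < softmax \<theta> $ s $ a"
  by (simp add: softmax_def softmax_denominator_pos)

text \<open>Along a segment of direction \<open>d\<close> the velocity of the softmax is p (d - D),
  with D the p-mean of d. As p <= 1, its squared norm is at most the p-variance of d, hence at most
  |d|^2; this gives the constant 1.\<close>

lemma softmax_state_lipschitz:
  fixes v w :: "real^'a::finite"
  defines "S \<equiv> \<lambda>v::real^'a. (\<chi> a. exp (v $ a) / (\<Sum>a'\<in>UNIV. exp (v $ a')) :: real^'a)"
  shows "norm (S w - S v) \<le> norm (w - v)"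
proof -
  define d where "d = w - v"
  define y where "y = S w - S v"
  define p where "p t = S (v + t *\<^sub>R d)" for t
  define D where "D t = (\<Sum>a\<in>UNIV. p t $ a * d $ a)" for t
  have Z: "0 < (\<Sum>a\<in>UNIV. exp (u $ a))" for u :: "real^'a"
    by (rule sum_pos) auto
  have p0: "0 \<le> p t $ a" for t a
    using Z[of "v + t *\<^sub>R d"] by (auto simp: p_def S_def intro!: divide_nonneg_nonneg)
  have p1: "(\<Sum>a\<in>UNIV. p t $ a) = 1" for t
    using Z[of "v + t *\<^sub>R d"] by (simp add: p_def S_def sum_divide_distrib[symmetric])
  have p2: "p t $ a \<le> 1" for t a
    using member_le_sum[of a UNIV "\<lambda>a. p t $ a"] p0 p1 by simp
  have der: "((\<lambda>t. p t $ a) has_real_derivative p t $ a * (d $ a - D t)) (at t)" for t a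
  proof -
    let ?E = "\<lambda>a. exp (v $ a + t * d $ a)"
    have nz: "(\<Sum>a\<in>UNIV. ?E a) \<noteq> 0"
      using Z[of "v + t *\<^sub>R d"] by simp
    have "((\<lambda>t. exp (v $ a + t * d $ a) / (\<Sum>a'\<in>UNIV. exp (v $ a' + t * d $ a'))) has_real_derivative
        (?E a * d $ a * (\<Sum>a'\<in>UNIV. ?E a') - ?E a * (\<Sum>a'\<in>UNIV. ?E a' * d $ a')) /
        ((\<Sum>a'\<in>UNIV. ?E a') * (\<Sum>a'\<in>UNIV. ?E a'))) (at t)"
      by (rule derivative_eq_intros refl nz | simp)+
    moreover have "(?E a * d $ a * (\<Sum>a'\<in>UNIV. ?E a') - ?E a * (\<Sum>a'\<in>UNIV. ?E a' * d $ a')) /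
        ((\<Sum>a'\<in>UNIV. ?E a') * (\<Sum>a'\<in>UNIV. ?E a')) = p t $ a * (d $ a - D t)"
      using nz by (simp add: p_def D_def S_def sum_divide_distrib[symmetric] divide_simps)
        (simp add: algebra_simps)
    ultimately show ?thesis by (simp add: p_def S_def)
  qed
  \<comment> \<open>The mean value theorem needs a scalar function: it is applied to the pairing of
    the path with its own total increment \<open>y\<close>, and Cauchy-Schwarz then cancels one
    factor \<open>norm y\<close>.\<close>
  have "\<exists>z>0. z < 1 \<and> (\<Sum>a\<in>UNIV. y $ a * p 1 $ a) - (\<Sum>a\<in>UNIV. y $ a * p 0 $ a) =
      (1 - 0) * (\<Sum>a\<in>UNIV. y $ a * (p z $ a * (d $ a - D z)))"
    by (rule MVT2) (auto intro!: DERIV_sum DERIV_cmult der)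
  then obtain z where z: "(\<Sum>a\<in>UNIV. y $ a * p 1 $ a) - (\<Sum>a\<in>UNIV. y $ a * p 0 $ a) =
      (\<Sum>a\<in>UNIV. y $ a * (p z $ a * (d $ a - D z)))" by auto
  define q where "q = (\<chi> a. p z $ a * (d $ a - D z))"
  have "(norm q)\<^sup>2 = (\<Sum>a\<in>UNIV. (p z $ a)\<^sup>2 * (d $ a - D z)\<^sup>2)"
    by (simp add: q_def norm_vec_def L2_set_def sum_nonneg power_mult_distrib)
  also have "\<dots> \<le> (\<Sum>a\<in>UNIV. p z $ a * (d $ a - D z)\<^sup>2)"
  proof (rule sum_mono)
    fix a
    have "(p z $ a)\<^sup>2 \<le> p z $ a"
      using p0[of z a] p2[of z a] by (simp add: power2_eq_square mult_left_le)
    then show "(p z $ a)\<^sup>2 * (d $ a - D z)\<^sup>2 \<le> p z $ a * (d $ a - D z)\<^sup>2"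
      by (rule mult_right_mono) simp
  qed
  also have "\<dots> = (\<Sum>a\<in>UNIV. p z $ a * (d $ a)\<^sup>2) - (D z)\<^sup>2"
  proof -
    have "(\<Sum>a\<in>UNIV. p z $ a * (d $ a - D z)\<^sup>2) =
       (\<Sum>a\<in>UNIV. p z $ a * (d $ a)\<^sup>2 - 2 * D z * (p z $ a * d $ a) + (D z)\<^sup>2 * p z $ a)"
      by (rule sum.cong) (auto simp: power2_eq_square algebra_simps)
    also have "\<dots> = (\<Sum>a\<in>UNIV. p z $ a * (d $ a)\<^sup>2) - 2 * D z * D z + (D z)\<^sup>2 * 1"
      by (simp only: sum.distrib sum_subtractf sum_distrib_left[symmetric] p1 D_def[symmetric])
    finally show ?thesis by (simp add: power2_eq_square)
  qed
  also have "\<dots> \<le> (\<Sum>a\<in>UNIV. (d $ a)\<^sup>2)"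
  proof -
    have "(\<Sum>a\<in>UNIV. p z $ a * (d $ a)\<^sup>2) \<le> (\<Sum>a\<in>UNIV. (d $ a)\<^sup>2)"
      by (rule sum_mono) (use p2 p0 in \<open>simp add: mult_left_le_one_le\<close>)
    then show ?thesis by (smt (verit) zero_le_power2)
  qed
  also have "\<dots> = (norm d)\<^sup>2" by (simp add: norm_vec_def L2_set_def sum_nonneg)
  finally have nq: "norm q \<le> norm d" by (simp add: power2_le_iff_abs_le)
  have "(norm y)\<^sup>2 = y \<bullet> (p 1 - p 0)"
    by (simp add: y_def p_def d_def power2_norm_eq_inner)
  also have "\<dots> = y \<bullet> q"
    using z by (simp add: inner_vec_def q_def right_diff_distrib sum_subtractf)
  also have "\<dots> \<le> norm y * norm d"
    using norm_cauchy_schwarz[of y q] nq by (meson mult_left_mono norm_ge_zero order_trans)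
  finally show ?thesis
    unfolding y_def d_def power2_eq_square by (cases "norm (S w - S v) = 0") auto
qed

lemma softmax_lipschitz: "norm (softmax \<theta> - softmax \<theta>') \<le> norm (\<theta> - \<theta>')"
proof -
  have "norm ((softmax \<theta> - softmax \<theta>') $ s) \<le> norm ((\<theta> - \<theta>') $ s)" for s
    using softmax_state_lipschitz[of "\<theta> $ s" "\<theta>' $ s"] by (simp add: softmax_def)
  then show ?thesis unfolding norm_vec_def[of "softmax \<theta> - softmax \<theta>'"] norm_vec_def[of "\<theta> - \<theta>'"]
    by (intro L2_set_mono) auto
qed

text \<open>The gradient of the log-probability in closed form, from which its bounds are immediate;
  \<open>gderiv_log_softmax\<close> identifies it with the \<open>gradf\<close> in the
  algorithm.\<close>

definition score :: "real^'a::finite^'s::finite \<Rightarrow> 's \<Rightarrow> 'a \<Rightarrow> real^'a^'s" where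
  "score \<theta> s a = axis s (axis a 1 - softmax \<theta> $ s)"

lemma norm_axis_state: "norm (axis s x :: ('v::real_inner)^'s::finite) = norm x"
proof -
  have "(\<Sum>i\<in>UNIV. (norm (if i = s then x else 0))\<^sup>2) = (\<Sum>i\<in>UNIV. if i = s then (norm x)\<^sup>2 else 0)"
    by (rule sum.cong) auto
  then show ?thesis by (simp add: norm_vec_def L2_set_def axis_def)
qed

lemma norm_score: "norm (score \<theta> s a) \<le> sqrt 2"
proof -
  define p where "p = softmax \<theta> $ s"
  have p: "p \<in> prob_simplex" using softmax_policy[of \<theta>] by (auto simp: p_def mfg_policies_def)
  have "(norm (axis a 1 - p))\<^sup>2 = 1 + (norm p)\<^sup>2 - 2 * p $ a"
    by (simp add: power2_norm_eq_inner inner_diff_left inner_diff_right inner_axis inner_axis' inner_commute)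
  also have "\<dots> \<le> 2"
    using simplex_norm[OF p] simplex_nonneg[OF p, of a] power_mono[of "norm p" 1 2] by simp
  finally show ?thesis unfolding score_def norm_axis_state p_def[symmetric] by (simp add: real_le_rsqrt)
qed

lemma score_lipschitz: "norm (score \<theta> s a - score \<theta>' s a) \<le> norm (\<theta> - \<theta>')"
proof -
  have "score \<theta> s a - score \<theta>' s a = axis s ((softmax \<theta>' - softmax \<theta>) $ s)"
    by (simp add: score_def axis_def vec_eq_iff)
  then have "norm (score \<theta> s a - score \<theta>' s a) \<le> norm (softmax \<theta>' - softmax \<theta>)"
    using Finite_Cartesian_Product.norm_nth_le[of "softmax \<theta>' - softmax \<theta>" s] by (simp only: norm_axis_state)
  then show ?thesis using softmax_lipschitz[of \<theta>' \<theta>] by (simp add: norm_minus_commute)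
qed

lemma gradf_eq: "GDERIV f x :> g \<Longrightarrow> gradf f x = g"
  unfolding gradf_def
proof (rule the_equality)
  fix h assume "GDERIV f x :> g" "GDERIV f x :> h"
  then have "(\<lambda>k. inner k g) = (\<lambda>k. inner k h)"
    unfolding gderiv_def by (rule has_derivative_unique)
  then have "inner k (g - h) = 0" for k by (simp add: inner_diff_right fun_eq_iff)
  then show "h = g" by (metis inner_eq_zero_iff right_minus_eq)
qed

lemma gderiv_log_softmax: "GDERIV (\<lambda>\<theta>. ln (softmax \<theta> $ s $ a)) \<theta> :> score \<theta> s a"
proof -
  have eq: "(\<lambda>\<theta>. ln (softmax \<theta> $ s $ a)) = (\<lambda>\<theta>. \<theta> $ s $ a - ln (\<Sum>a'\<in>UNIV. exp (\<theta> $ s $ a')))"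
    by (rule ext) (simp add: softmax_def ln_div less_imp_neq[OF softmax_denominator_pos, symmetric])
  let ?Z = "\<Sum>a'\<in>UNIV. exp (\<theta> $ s $ a')"
  have nz: "?Z \<noteq> 0" "0 < ?Z" using softmax_denominator_pos[of \<theta> s] by auto
  have "((\<lambda>\<theta>. \<theta> $ s $ a - ln (\<Sum>a'\<in>UNIV. exp (\<theta> $ s $ a'))) has_derivative
     (\<lambda>h. h $ s $ a - (\<Sum>a'\<in>UNIV. h $ s $ a' * exp (\<theta> $ s $ a')) * inverse ?Z)) (at \<theta>)"
    by (rule derivative_eq_intros refl nz
        bounded_linear.has_derivative[OF bounded_linear_compose[OF bounded_linear_vec_nth bounded_linear_vec_nth], of _ _ _ s]
        | simp add: mult.commute)+
  moreover have "h $ s $ a - (\<Sum>a'\<in>UNIV. h $ s $ a' * exp (\<theta> $ s $ a')) * inverse ?Z = inner h (score \<theta> s a)" for h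
    by (simp add: score_def inner_axis inner_diff_right inner_vec_def[of "h $ s"] softmax_def
        sum_distrib_right divide_inverse mult.assoc)
  ultimately show "GDERIV (\<lambda>\<theta>. ln (softmax \<theta> $ s $ a)) \<theta> :> score \<theta> s a"
    unfolding gderiv_def eq by simp
qed

lemmas gradf_log_softmax = gradf_eq[OF gderiv_log_softmax]

text \<open>Bounded and Lipschitz: the class of parameter dependences for which the filter drift is second order.\<close>

definition blip :: "'p::real_normed_vector set \<Rightarrow> ('p \<Rightarrow> 'v::real_normed_vector) \<Rightarrow> bool" where
  "blip S f \<longleftrightarrow> (\<exists>C. (\<forall>p\<in>S. norm (f p) \<le> C) \<and> (\<forall>p\<in>S. \<forall>q\<in>S. norm (f p - f q) \<le> C * norm (p - q)))"

lemma blipI: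
  assumes "\<And>p. p \<in> S \<Longrightarrow> norm (f p) \<le> C" "\<And>p q. p \<in> S \<Longrightarrow> q \<in> S \<Longrightarrow> norm (f p - f q) \<le> D * norm (p - q)"
  shows "blip S f"
  unfolding blip_def
proof (intro exI[of _ "max C D"] conjI ballI)
  fix p q assume "p \<in> S" "q \<in> S"
  then show "norm (f p - f q) \<le> max C D * norm (p - q)"
    using assms(2) by (meson max.cobounded2 mult_right_mono norm_ge_zero order_trans)
qed (use assms(1) in fastforce)

lemma blipE:
  assumes "blip S f"
  obtains C where "C \<ge> 0" "\<And>p. p \<in> S \<Longrightarrow> norm (f p) \<le> C"
    "\<And>p q. p \<in> S \<Longrightarrow> q \<in> S \<Longrightarrow> norm (f p - f q) \<le> C * norm (p - q)"
proof -
  from assms obtain C where C: "\<forall>p\<in>S. norm (f p) \<le> C" "\<forall>p\<in>S. \<forall>q\<in>S. norm (f p - f q) \<le> C * norm (p - q)"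
    unfolding blip_def by auto
  show ?thesis
  proof (rule that[of "max C 0"])
    fix p q assume "p \<in> S" "q \<in> S"
    then show "norm (f p - f q) \<le> max C 0 * norm (p - q)"
      using C(2) by (meson max.cobounded1 mult_right_mono norm_ge_zero order_trans)
  qed (use C(1) in \<open>auto simp: le_max_iff_disj\<close>)
qed

lemma blip_const: "blip S (\<lambda>p. c)"
  by (rule blipI[of _ _ "norm c" 0]) auto

lemma blip_add:
  assumes "blip S f" "blip S g" shows "blip S (\<lambda>p. f p + g p)"
proof -
  obtain C where C: "\<And>p. p \<in> S \<Longrightarrow> norm (f p) \<le> C" "\<And>p q. p \<in> S \<Longrightarrow> q \<in> S \<Longrightarrow> norm (f p - f q) \<le> C * norm (p - q)"
    using blipE[OF assms(1)] by metis
  obtain D where D: "\<And>p. p \<in> S \<Longrightarrow> norm (g p) \<le> D" "\<And>p q. p \<in> S \<Longrightarrow> q \<in> S \<Longrightarrow> norm (g p - g q) \<le> D * norm (p - q)"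
    using blipE[OF assms(2)] by metis
  show ?thesis
  proof (rule blipI[of _ _ "C + D" "C + D"])
    fix p q assume pq: "p \<in> S" "q \<in> S"
    show "norm (f p + g p) \<le> C + D" using norm_triangle_mono C(1) D(1) pq by blast
    have "norm (f p + g p - (f q + g q)) \<le> norm (f p - f q) + norm (g p - g q)"
      by (simp add: add_diff_add norm_triangle_ineq)
    then show "norm (f p + g p - (f q + g q)) \<le> (C + D) * norm (p - q)"
      using C(2)[OF pq] D(2)[OF pq] by (simp add: distrib_right)
  qed
qed

lemma blip_bounded_linear:
  assumes "bounded_linear h" "blip S f" shows "blip S (\<lambda>p. h (f p))"
proof -
  obtain C where C: "\<And>p. p \<in> S \<Longrightarrow> norm (f p) \<le> C" "\<And>p q. p \<in> S \<Longrightarrow> q \<in> S \<Longrightarrow> norm (f p - f q) \<le> C * norm (p - q)"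
    using blipE[OF assms(2)] by metis
  obtain B where B: "B > 0" "\<And>x. norm (h x) \<le> norm x * B"
    using bounded_linear.pos_bounded[OF assms(1)] by auto
  show ?thesis
  proof (rule blipI[of _ _ "C * B" "C * B"])
    fix p q assume pq: "p \<in> S" "q \<in> S"
    show "norm (h (f p)) \<le> C * B"
      using B(2)[of "f p"] mult_right_mono[OF C(1)[OF pq(1)], of B] B(1) by linarith
    have "norm (h (f p) - h (f q)) \<le> norm (f p - f q) * B"
      using B(2)[of "f p - f q"] assms(1) by (simp add: bounded_linear.linear linear_diff)
    also have "\<dots> \<le> C * norm (p - q) * B"
      using C(2)[OF pq] B(1) by simp
    finally show "norm (h (f p) - h (f q)) \<le> C * B * norm (p - q)" by (simp add: mult_ac)
  qed
qed

lemma blip_scaleR: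
  fixes f :: "'p::real_normed_vector \<Rightarrow> real"
  assumes "blip S f" "blip S g" shows "blip S (\<lambda>p. f p *\<^sub>R g p)"
proof -
  obtain C where C: "C \<ge> 0" "\<And>p. p \<in> S \<Longrightarrow> norm (f p) \<le> C" "\<And>p q. p \<in> S \<Longrightarrow> q \<in> S \<Longrightarrow> norm (f p - f q) \<le> C * norm (p - q)"
    using blipE[OF assms(1)] by metis
  obtain D where D: "D \<ge> 0" "\<And>p. p \<in> S \<Longrightarrow> norm (g p) \<le> D" "\<And>p q. p \<in> S \<Longrightarrow> q \<in> S \<Longrightarrow> norm (g p - g q) \<le> D * norm (p - q)"
    using blipE[OF assms(2)] by metis
  show ?thesis
  proof (rule blipI[of _ _ "C * D" "2 * (C * D)"])
    fix p q assume pq: "p \<in> S" "q \<in> S"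
    show "norm (f p *\<^sub>R g p) \<le> C * D"
      using C(2)[OF pq(1)] D(2)[OF pq(1)] C(1) by (simp add: mult_mono)
    have "f p *\<^sub>R g p - f q *\<^sub>R g q = (f p - f q) *\<^sub>R g p + f q *\<^sub>R (g p - g q)"
      by (simp add: algebra_simps)
    then have "norm (f p *\<^sub>R g p - f q *\<^sub>R g q) \<le> \<bar>f p - f q\<bar> * norm (g p) + \<bar>f q\<bar> * norm (g p - g q)"
      by (metis norm_scaleR norm_triangle_ineq)
    also have "\<dots> \<le> (C * norm (p - q)) * D + C * (D * norm (p - q))"
      using C(2,3) D(2,3) pq C(1) D(1) by (intro add_mono mult_mono) auto
    finally show "norm (f p *\<^sub>R g p - f q *\<^sub>R g q) \<le> 2 * (C * D) * norm (p - q)" by (simp add: mult_ac)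
  qed
qed

lemma blip_mult: "blip S f \<Longrightarrow> blip S g \<Longrightarrow> blip S (\<lambda>p. f p * g p :: real)"
  using blip_scaleR[of S f g] by simp

lemma blip_uminus: "blip S f \<Longrightarrow> blip S (\<lambda>p. - f p)"
  by (rule blip_bounded_linear[of uminus]) (simp add: bounded_linear_minus bounded_linear_ident)

lemma blip_diff: "blip S f \<Longrightarrow> blip S g \<Longrightarrow> blip S (\<lambda>p. f p - g p)"
  using blip_add[of S f "\<lambda>p. - g p"] blip_uminus[of S g] by simp

lemma blip_sum: "(\<And>i. i \<in> I \<Longrightarrow> blip S (f i)) \<Longrightarrow> blip S (\<lambda>p. \<Sum>i\<in>I. f i p)"
  by (induction I rule: infinite_finite_induct) (auto intro: blip_const blip_add)

lemma blip_nth: "blip S f \<Longrightarrow> blip S (\<lambda>p. f p $ i)"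
  by (rule blip_bounded_linear[OF bounded_linear_vec_nth])

lemmas blip_intros = blip_const blip_add blip_diff blip_mult blip_scaleR blip_sum

section \<open>Averages over transitions and the Poisson equation\<close>

text \<open>Pairing with \<open>axis i 1 - axis j 1\<close> gives \<open>sqrt 2\<close> instead of
  2; together with \<open>norm_score\<close> the bias of the actor then gets the constant 2.\<close>

lemma component_diff_bound: "\<bar>V $ i - V $ j\<bar> \<le> sqrt 2 * norm (V::real^'n::finite)"
proof -
  have "(norm (axis i 1 - axis j 1 :: real^'n))\<^sup>2 \<le> 2"
    by (simp add: power2_norm_eq_inner inner_diff_left inner_diff_right inner_axis_axis)
  then have a: "norm (axis i 1 - axis j 1 :: real^'n) \<le> sqrt 2" by (simp add: real_le_rsqrt)
  have "\<bar>V \<bullet> (axis i 1 - axis j 1)\<bar> \<le> norm V * norm (axis i 1 - axis j 1 :: real^'n)"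
    by (rule Cauchy_Schwarz_ineq2)
  also have "\<dots> \<le> norm V * sqrt 2" using a by (rule mult_left_mono) simp
  finally show ?thesis by (simp add: inner_diff_right inner_axis mult.commute)
qed

lemma softmax_has_derivative:
  "((\<lambda>\<theta>. softmax \<theta> $ s $ a) has_derivative (\<lambda>h. softmax \<theta> $ s $ a * inner h (score \<theta> s a))) (at \<theta>)"
proof -
  have "((\<lambda>\<theta>. exp (ln (softmax \<theta> $ s $ a))) has_derivative
     (\<lambda>h. exp (ln (softmax \<theta> $ s $ a)) * inner h (score \<theta> s a))) (at \<theta>)"
    using has_derivative_exp[OF gderiv_log_softmax[of s a \<theta>, unfolded gderiv_def]]
    by (simp add: mult.commute)
  then show ?thesis by (simp add: exp_ln[OF softmax_pos])
qed

lemma has_derivative_quadratic_remainder: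
  assumes "\<And>y. norm (f y - f x) \<le> C * (norm (y - x))\<^sup>2"
  shows "(f has_derivative (\<lambda>_. 0)) (at x)"
  unfolding has_derivative_at_alt
proof (intro conjI allI impI)
  fix e :: real assume e: "0 < e"
  define d where "d = e / (\<bar>C\<bar> + 1)"
  have d: "0 < d" unfolding d_def using e by simp
  have "norm (f y - f x) \<le> e * norm (y - x)" if "norm (y - x) < d" for y
  proof -
    have "C * norm (y - x) \<le> (\<bar>C\<bar> + 1) * d" using that by (intro mult_mono) auto
    also have "\<dots> = e" unfolding d_def by simp
    finally show ?thesis
      using assms[of y] by (smt (verit) mult_right_mono norm_ge_zero power2_eq_square mult.assoc)
  qed
  with d show "\<exists>d>0. \<forall>y. norm (y - x) < d \<longrightarrow> norm (f y - f x - 0) \<le> e * norm (y - x)" by auto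
qed simp

text \<open>The situation of the theorem for herding constant zero and \<open>0 <= LTV\<close>. The
  transition bound is stated for equal initial laws; point masses turn it into a bound on single
  entries of the kernel.\<close>

locale mfg = ergodic_kernel K C0 C1
  for K :: "real^'s::finite \<Rightarrow> 's \<Rightarrow> 'a::finite \<Rightarrow> 's pmf" and C0 C1 :: real +
  fixes r :: "'s \<Rightarrow> 'a \<Rightarrow> real^'s \<Rightarrow> real"
    and \<delta> L BV LV LTV \<gamma> \<rho> cJ :: real
  assumes rew: "\<And>s a \<mu>. \<mu> \<in> prob_simplex \<Longrightarrow> 0 \<le> r s a \<mu>" "\<And>s a \<mu>. \<mu> \<in> prob_simplex \<Longrightarrow> r s a \<mu> \<le> 1"
    and delta: "0 < \<delta>" "\<delta> < 1"
    and stat_contraction: "\<And>\<pi> \<mu>1 \<mu>2. \<pi> \<in> mfg_policies \<Longrightarrow> \<mu>1 \<in> prob_simplex \<Longrightarrow> \<mu>2 \<in> prob_simplex \<Longrightarrow>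
      norm (stat_dist K \<pi> \<mu>1 - stat_dist K \<pi> \<mu>2) \<le> \<delta> * norm (\<mu>1 - \<mu>2)"
    and L: "L > 0"
    and r_lip: "\<And>s a \<mu>1 \<mu>2. \<mu>1 \<in> prob_simplex \<Longrightarrow> \<mu>2 \<in> prob_simplex \<Longrightarrow>
      \<bar>r s a \<mu>1 - r s a \<mu>2\<bar> \<le> L * norm (\<mu>1 - \<mu>2)"
    and trans_lip: "\<And>d \<pi>1 \<pi>2 \<mu>1 \<mu>2. d \<in> prob_simplex \<Longrightarrow> \<pi>1 \<in> mfg_policies \<Longrightarrow> \<pi>2 \<in> mfg_policies \<Longrightarrow>
      \<mu>1 \<in> prob_simplex \<Longrightarrow> \<mu>2 \<in> prob_simplex \<Longrightarrow>
      dTV (\<lambda>s'. \<Sum>s\<in>UNIV. d $ s * Pmat K \<pi>1 \<mu>1 s s') (\<lambda>s'. \<Sum>s\<in>UNIV. d $ s * Pmat K \<pi>2 \<mu>2 s s')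
        \<le> L * (norm (\<pi>1 - \<pi>2) + norm (\<mu>1 - \<mu>2))"
    and stat_lip: "\<And>\<pi>1 \<pi>2 \<mu>1 \<mu>2. \<pi>1 \<in> mfg_policies \<Longrightarrow> \<pi>2 \<in> mfg_policies \<Longrightarrow>
      \<mu>1 \<in> prob_simplex \<Longrightarrow> \<mu>2 \<in> prob_simplex \<Longrightarrow>
      dTV (\<lambda>x. stat_dist K \<pi>1 \<mu>1 $ x) (\<lambda>x. stat_dist K \<pi>2 \<mu>2 $ x) \<le> L * (norm (\<pi>1 - \<pi>2) + norm (\<mu>1 - \<mu>2))"
    and mustar_lip: "\<And>\<pi>1 \<pi>2. \<pi>1 \<in> mfg_policies \<Longrightarrow> \<pi>2 \<in> mfg_policies \<Longrightarrow>
      norm (mustar K \<pi>1 - mustar K \<pi>2) \<le> L * norm (\<pi>1 - \<pi>2)"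
    and BV: "BV > 0"
    and Vf_bound: "\<And>\<pi> \<mu>. \<pi> \<in> mfg_policies \<Longrightarrow> \<mu> \<in> prob_simplex \<Longrightarrow> norm (Vf K r \<pi> \<mu>) \<le> BV"
    and mustar_unique: "\<And>\<pi>. \<pi> \<in> mfg_policies \<Longrightarrow> \<exists>!\<mu>. \<mu> \<in> prob_simplex \<and> \<mu> = stat_dist K \<pi> \<mu>"
    and rho: "0 < \<rho>"
    and herding: "\<And>\<pi> \<pi>'. \<pi> \<in> mfg_policies \<Longrightarrow> \<pi>' \<in> mfg_policies \<Longrightarrow>
      mfg_ell K r \<pi> - mfg_ell K r \<pi>' \<le> \<rho> * (Jf K r \<pi> (mustar K \<pi>) - Jf K r \<pi>' (mustar K \<pi>))"
    and LV: "LV \<ge> 1"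
    and Vf_lip: "\<And>\<theta>1 \<theta>2 \<mu>1 \<mu>2. \<mu>1 \<in> prob_simplex \<Longrightarrow> \<mu>2 \<in> prob_simplex \<Longrightarrow>
      norm (projperp (Vf K r (softmax \<theta>1) \<mu>1 - Vf K r (softmax \<theta>2) \<mu>2)) \<le> LV * (norm (\<theta>1 - \<theta>2) + norm (\<mu>1 - \<mu>2))"
    and Jf_lip: "\<And>\<theta>1 \<theta>2 \<mu>1 \<mu>2. \<mu>1 \<in> prob_simplex \<Longrightarrow> \<mu>2 \<in> prob_simplex \<Longrightarrow>
      \<bar>Jf K r (softmax \<theta>1) \<mu>1 - Jf K r (softmax \<theta>2) \<mu>2\<bar> \<le> LV * (norm (\<theta>1 - \<theta>2) + norm (\<mu>1 - \<mu>2))"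
    and Jgrad_lip: "\<And>\<theta>1 \<theta>2 \<mu>1 \<mu>2. \<mu>1 \<in> prob_simplex \<Longrightarrow> \<mu>2 \<in> prob_simplex \<Longrightarrow>
      norm (gradf (\<lambda>\<theta>. Jf K r (softmax \<theta>) \<mu>1) \<theta>1 - gradf (\<lambda>\<theta>. Jf K r (softmax \<theta>) \<mu>2) \<theta>2)
        \<le> LV * (norm (\<theta>1 - \<theta>2) + norm (\<mu>1 - \<mu>2))"
    and LTV: "0 \<le> LTV"
    and joint_lip: "\<And>\<pi>1 \<pi>2 \<mu>1 \<mu>2. \<pi>1 \<in> mfg_policies \<Longrightarrow> \<pi>2 \<in> mfg_policies \<Longrightarrow>
      \<mu>1 \<in> prob_simplex \<Longrightarrow> \<mu>2 \<in> prob_simplex \<Longrightarrow>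
      dTV (mfg_joint K \<pi>1 \<mu>1) (mfg_joint K \<pi>2 \<mu>2) \<le> LTV * (norm (\<pi>1 - \<pi>2) + norm (\<mu>1 - \<mu>2))"
    and gam: "0 < \<gamma>" "\<gamma> < 1"
    and coercive: "\<And>\<theta> \<mu> (V::real^'s). \<mu> \<in> prob_simplex \<Longrightarrow> (\<Sum>s\<in>UNIV. V $ s) = 0 \<Longrightarrow>
        (\<Sum>s\<in>UNIV. \<Sum>a\<in>UNIV. \<Sum>s'\<in>UNIV. stat_dist K (softmax \<theta>) \<mu> $ s * softmax \<theta> $ s $ a
            * pmf (K \<mu> s a) s' * (V $ s * (V $ s' - V $ s))) \<le> - \<gamma> * (norm V)\<^sup>2"
    and cJ: "0 < cJ" "1 \<le> cJ * \<gamma>"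
begin

lemma mustar_simplex: "\<pi> \<in> mfg_policies \<Longrightarrow> mustar K \<pi> \<in> prob_simplex"
  and mustar_fix: "\<pi> \<in> mfg_policies \<Longrightarrow> stat_dist K \<pi> (mustar K \<pi>) = mustar K \<pi>"
  using theI'[OF mustar_unique, of \<pi>] unfolding mustar_def by auto

text \<open>\<open>avg\<close> is an expectation in stationarity, \<open>loc_avg\<close> the
  conditional expectation given the current state. The sample of a filter has conditional mean
  \<open>loc_avg\<close>, while the analysis compares the filter with \<open>avg\<close>; the
  Poisson equation bridges the two.\<close>

definition avg :: "real^'a^'s \<Rightarrow> real^'s \<Rightarrow> ('s \<Rightarrow> 'a \<Rightarrow> 's \<Rightarrow> 'v::real_normed_vector) \<Rightarrow> 'v" where
  "avg \<pi> \<mu> X = (\<Sum>s\<in>UNIV. \<Sum>a\<in>UNIV. \<Sum>s'\<in>UNIV. (stat_dist K \<pi> \<mu> $ s * \<pi> $ s $ a * pmf (K \<mu> s a) s') *\<^sub>R X s a s')"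

definition loc_avg :: "real^'a^'s \<Rightarrow> real^'s \<Rightarrow> ('s \<Rightarrow> 'a \<Rightarrow> 's \<Rightarrow> 'v::real_normed_vector) \<Rightarrow> 's \<Rightarrow> 'v" where
  "loc_avg \<pi> \<mu> X s = (\<Sum>a\<in>UNIV. \<Sum>s'\<in>UNIV. (\<pi> $ s $ a * pmf (K \<mu> s a) s') *\<^sub>R X s a s')"

lemma avg_eq_loc: "avg \<pi> \<mu> X = (\<Sum>s\<in>UNIV. stat_dist K \<pi> \<mu> $ s *\<^sub>R loc_avg \<pi> \<mu> X s)"
  unfolding avg_def loc_avg_def by (simp add: scaleR_sum_right mult.assoc)

lemma avg_eq_joint: "avg \<pi> \<mu> X = (\<Sum>z\<in>UNIV. mfg_joint K \<pi> \<mu> z *\<^sub>R (case z of (s, a, s') \<Rightarrow> X s a s'))"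
  unfolding avg_def mfg_joint_def UNIV_Times_UNIV[symmetric] sum.cartesian_product
  by (simp add: case_prod_beta')

lemma loc_avg_next: "\<pi> \<in> mfg_policies \<Longrightarrow> loc_avg \<pi> \<mu> (\<lambda>s a s'. g s') s = (\<Sum>i\<in>UNIV. Pmat K \<pi> \<mu> s i *\<^sub>R g i)"
  unfolding loc_avg_def Pmat_def by (subst sum.swap) (simp add: scaleR_sum_left mult.commute)

lemma loc_avg_curr: "\<pi> \<in> mfg_policies \<Longrightarrow> loc_avg \<pi> \<mu> (\<lambda>s a s'. g s) s = g s"
  unfolding loc_avg_def
  by (simp add: scaleR_sum_left[symmetric] sum_distrib_left[symmetric] pmf_sum_UNIV policy_sum)

lemma loc_avg_action: "loc_avg \<pi> \<mu> (\<lambda>s a s'. g s a) s = (\<Sum>a\<in>UNIV. \<pi> $ s $ a *\<^sub>R g s a)"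
  unfolding loc_avg_def
  by (simp add: scaleR_sum_left[symmetric] sum_distrib_left[symmetric] pmf_sum_UNIV)

lemma loc_avg_add: "loc_avg \<pi> \<mu> (\<lambda>s a s'. X s a s' + Y s a s') s = loc_avg \<pi> \<mu> X s + loc_avg \<pi> \<mu> Y s"
  unfolding loc_avg_def by (simp add: scaleR_add_right sum.distrib)

lemma loc_avg_diff: "loc_avg \<pi> \<mu> (\<lambda>s a s'. X s a s' - Y s a s') s = loc_avg \<pi> \<mu> X s - loc_avg \<pi> \<mu> Y s"
  unfolding loc_avg_def by (simp add: scaleR_diff_right sum_subtractf)

lemma loc_avg_linear:
  assumes "linear h" shows "loc_avg \<pi> \<mu> (\<lambda>s a s'. h (X s a s')) s = h (loc_avg \<pi> \<mu> X s)"
  unfolding loc_avg_def using assms by (simp add: linear_sum linear_cmul)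

lemma loc_avg_local: "loc_avg \<pi> \<mu> (\<lambda>s a s'. X s a s') s = loc_avg \<pi> \<mu> (\<lambda>_ a s'. X s a s') s"
  unfolding loc_avg_def by simp

lemma loc_avg_mono:
  assumes "\<pi> \<in> mfg_policies" "\<And>a s'. X s a s' \<le> (Y s a s' :: real)"
  shows "loc_avg \<pi> \<mu> X s \<le> loc_avg \<pi> \<mu> Y s"
  unfolding loc_avg_def using assms by (intro sum_mono) (simp add: policy_nonneg mult_left_mono)

lemma loc_avg_norm:
  assumes "\<pi> \<in> mfg_policies" "\<And>a s'. norm (X s a s') \<le> M"
  shows "norm (loc_avg \<pi> \<mu> X s) \<le> M"
proof -
  have "norm (loc_avg \<pi> \<mu> X s) \<le> loc_avg \<pi> \<mu> (\<lambda>s a s'. M) s"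
    unfolding loc_avg_def using assms
    by (intro order_trans[OF norm_sum sum_mono] order_trans[OF norm_sum sum_mono]) (simp add: policy_nonneg mult_left_mono abs_mult)
  then show ?thesis by (simp add: loc_avg_curr[OF assms(1), where g = "\<lambda>_. M"])
qed

lemma avg_norm:
  assumes "\<pi> \<in> mfg_policies" "\<mu> \<in> prob_simplex" "\<And>s a s'. norm (X s a s') \<le> M"
  shows "norm (avg \<pi> \<mu> X) \<le> M"
  unfolding avg_eq_loc
  by (rule simplex_convex_bound) (use assms stat_simplex[OF assms(1,2)] in
      \<open>auto intro!: loc_avg_norm simp: simplex_sum simplex_nonneg\<close>)

lemma avg_add: "avg \<pi> \<mu> (\<lambda>s a s'. X s a s' + Y s a s') = avg \<pi> \<mu> X + avg \<pi> \<mu> Y"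
  unfolding avg_eq_loc loc_avg_add by (simp add: scaleR_add_right sum.distrib)

lemma avg_diff: "avg \<pi> \<mu> (\<lambda>s a s'. X s a s' - Y s a s') = avg \<pi> \<mu> X - avg \<pi> \<mu> Y"
  unfolding avg_eq_loc loc_avg_diff by (simp add: scaleR_diff_right sum_subtractf)

lemma avg_linear: "linear h \<Longrightarrow> avg \<pi> \<mu> (\<lambda>s a s'. h (X s a s')) = h (avg \<pi> \<mu> X)"
  unfolding avg_eq_loc by (simp add: loc_avg_linear linear_sum linear_cmul)

lemma avg_perturb:
  assumes 1: "\<pi>1 \<in> mfg_policies" "\<mu>1 \<in> prob_simplex" and 2: "\<pi>2 \<in> mfg_policies" "\<mu>2 \<in> prob_simplex"
    and X: "\<And>s a s'. norm (X s a s') \<le> M" "\<And>s a s'. norm (X s a s' - Y s a s') \<le> D"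
  shows "norm (avg \<pi>1 \<mu>1 X - avg \<pi>2 \<mu>2 Y) \<le> 2 * M * (LTV * (norm (\<pi>1 - \<pi>2) + norm (\<mu>1 - \<mu>2))) + D"
proof -
  have "norm (X undefined undefined undefined) \<le> M" by (rule X)
  then have M: "0 \<le> M" using norm_ge_zero order_trans by blast
  have "avg \<pi>1 \<mu>1 X - avg \<pi>2 \<mu>2 X = (\<Sum>z\<in>UNIV. (mfg_joint K \<pi>1 \<mu>1 z - mfg_joint K \<pi>2 \<mu>2 z) *\<^sub>R (case z of (s, a, s') \<Rightarrow> X s a s'))"
    unfolding avg_eq_joint by (simp add: scaleR_diff_left sum_subtractf)
  also have "norm \<dots> \<le> 2 * M * dTV (mfg_joint K \<pi>1 \<mu>1) (mfg_joint K \<pi>2 \<mu>2)"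
    by (rule dTV_integral) (auto simp: X split: prod.split)
  also have "\<dots> \<le> 2 * M * (LTV * (norm (\<pi>1 - \<pi>2) + norm (\<mu>1 - \<mu>2)))"
    using joint_lip[OF 1(1) 2(1) 1(2) 2(2)] M by (intro mult_left_mono) auto
  finally have a: "norm (avg \<pi>1 \<mu>1 X - avg \<pi>2 \<mu>2 X) \<le> 2 * M * (LTV * (norm (\<pi>1 - \<pi>2) + norm (\<mu>1 - \<mu>2)))" .
  have b: "norm (avg \<pi>2 \<mu>2 X - avg \<pi>2 \<mu>2 Y) \<le> D"
    unfolding avg_diff[symmetric] by (rule avg_norm[OF 2 X(2)])
  have "avg \<pi>1 \<mu>1 X - avg \<pi>2 \<mu>2 Y = (avg \<pi>1 \<mu>1 X - avg \<pi>2 \<mu>2 X) + (avg \<pi>2 \<mu>2 X - avg \<pi>2 \<mu>2 Y)" by simp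
  then show ?thesis using a b norm_triangle_ineq[of "avg \<pi>1 \<mu>1 X - avg \<pi>2 \<mu>2 X" "avg \<pi>2 \<mu>2 X - avg \<pi>2 \<mu>2 Y"] by simp
qed

definition poisson :: "real^'a^'s \<Rightarrow> real^'s \<Rightarrow> ('s \<Rightarrow> 'a \<Rightarrow> 's \<Rightarrow> 'v::real_normed_vector) \<Rightarrow> 's \<Rightarrow> 'v" where
  "poisson \<pi> \<mu> X s = (\<Sum>s'\<in>UNIV. dev \<pi> \<mu> s s' *\<^sub>R loc_avg \<pi> \<mu> X s')"

text \<open>With u the Poisson solution this reads E[u s' | s] + (h s - mean) = u s for h =
  \<open>loc_avg\<close>: the bias of sampling from a single state is a difference of u along the
  chain, and such differences telescope.\<close>

lemma poisson_eq:
  assumes pm: "\<pi> \<in> mfg_policies" "\<mu> \<in> prob_simplex"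
  shows "loc_avg \<pi> \<mu> (\<lambda>s a s'. poisson \<pi> \<mu> X s') s = poisson \<pi> \<mu> X s - loc_avg \<pi> \<mu> X s + avg \<pi> \<mu> X"
proof -
  let ?h = "loc_avg \<pi> \<mu> X"
  have "poisson \<pi> \<mu> X s = (\<Sum>s'\<in>UNIV. ((if s = s' then 1 else 0) - stat_dist K \<pi> \<mu> $ s' +
    (\<Sum>i\<in>UNIV. Pmat K \<pi> \<mu> s i * dev \<pi> \<mu> i s')) *\<^sub>R ?h s')"
    unfolding poisson_def by (subst dev_left[OF pm]) (rule refl)
  also have "\<dots> = (\<Sum>s'\<in>UNIV. (if s = s' then 1 else 0) *\<^sub>R ?h s') - avg \<pi> \<mu> X
      + (\<Sum>s'\<in>UNIV. \<Sum>i\<in>UNIV. (Pmat K \<pi> \<mu> s i * dev \<pi> \<mu> i s') *\<^sub>R ?h s')"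
    by (simp only: avg_eq_loc scaleR_add_left scaleR_diff_left sum.distrib sum_subtractf scaleR_sum_left)
  also have "(\<Sum>s'\<in>UNIV. (if s = s' then 1 else 0) *\<^sub>R ?h s') = ?h s"
    by (simp add: if_distrib if_distribR cong: if_cong)
  also have "(\<Sum>s'\<in>UNIV. \<Sum>i\<in>UNIV. (Pmat K \<pi> \<mu> s i * dev \<pi> \<mu> i s') *\<^sub>R ?h s') =
     (\<Sum>i\<in>UNIV. Pmat K \<pi> \<mu> s i *\<^sub>R poisson \<pi> \<mu> X i)"
    unfolding poisson_def by (subst sum.swap) (simp add: scaleR_sum_right)
  finally show ?thesis unfolding loc_avg_next[OF pm(1)] by simp
qed

lemma avg_rew: "avg \<pi> \<mu> (\<lambda>s a s'. r s a \<mu>) = Jf K r \<pi> \<mu>"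
  unfolding avg_eq_loc loc_avg_action Jf_def by (simp add: sum_distrib_left mult.assoc)

lemma avg_curr:
  assumes "\<pi> \<in> mfg_policies" shows "avg \<pi> \<mu> (\<lambda>s a s'. g s) = (\<Sum>s\<in>UNIV. stat_dist K \<pi> \<mu> $ s *\<^sub>R g s)"
  unfolding avg_eq_loc loc_avg_curr[OF assms] ..

lemma avg_const:
  assumes "\<pi> \<in> mfg_policies" "\<mu> \<in> prob_simplex" shows "avg \<pi> \<mu> (\<lambda>s a s'. c) = c"
  unfolding avg_curr[OF assms(1), where g = "\<lambda>_. c"]
  by (simp add: scaleR_sum_left[symmetric] simplex_sum stat_simplex assms)

lemma avg_next:
  assumes "\<pi> \<in> mfg_policies" "\<mu> \<in> prob_simplex"
  shows "avg \<pi> \<mu> (\<lambda>s a s'. g s') = avg \<pi> \<mu> (\<lambda>s a s'. g s)"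
proof -
  have "avg \<pi> \<mu> (\<lambda>s a s'. g s') = (\<Sum>i\<in>UNIV. (\<Sum>s\<in>UNIV. stat_dist K \<pi> \<mu> $ s * Pmat K \<pi> \<mu> s i) *\<^sub>R g i)"
    unfolding avg_eq_loc loc_avg_next[OF assms(1)] scaleR_sum_right scaleR_sum_left
    by (subst sum.swap) simp
  then show ?thesis by (simp add: stat_eq[OF assms, symmetric] avg_curr[OF assms(1)])
qed

lemma avg_axis_curr:
  assumes "\<pi> \<in> mfg_policies" shows "avg \<pi> \<mu> (\<lambda>s a s'. axis s 1) = stat_dist K \<pi> \<mu>"
  unfolding avg_curr[OF assms, where g = "\<lambda>s. axis s 1"]
  by (simp add: vec_eq_iff axis_def if_distrib sum_delta_mult cong: if_cong)

lemma loc_avg_bellman: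
  assumes "\<pi> \<in> mfg_policies" "\<mu> \<in> prob_simplex"
  shows "loc_avg \<pi> \<mu> (\<lambda>s a s'. r s a \<mu> + Vf K r \<pi> \<mu> $ s' - Vf K r \<pi> \<mu> $ s) s = Jf K r \<pi> \<mu>"
  unfolding loc_avg_diff loc_avg_add
  unfolding loc_avg_curr[OF assms(1), where g = "\<lambda>s. Vf K r \<pi> \<mu> $ s"]
    loc_avg_next[OF assms(1), where g = "\<lambda>s. Vf K r \<pi> \<mu> $ s"]
  unfolding loc_avg_action using Vf_bellman[OF assms, of r s] by simp

text \<open>Write V as \<open>Vf\<close> plus a constant plus the projected error. The constant
  cancels in \<open>V $ s' - V $ s\<close>, and the Bellman equation makes the part with
  \<open>Vf\<close> average to \<open>Jf - j\<close> state by state. What remains is linear in the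
  two errors.\<close>

lemma avg_bellman_residual:
  assumes pm: "\<pi> \<in> mfg_policies" "\<mu> \<in> prob_simplex"
  shows "avg \<pi> \<mu> (\<lambda>s a s'. (r s a \<mu> - j + V $ s' - V $ s) *\<^sub>R (axis s 1 :: real^'s)) =
    (Jf K r \<pi> \<mu> - j) *\<^sub>R stat_dist K \<pi> \<mu> +
    avg \<pi> \<mu> (\<lambda>s a s'. (projperp (V - Vf K r \<pi> \<mu>) $ s' - projperp (V - Vf K r \<pi> \<mu>) $ s) *\<^sub>R axis s 1)"
proof -
  define d where "d = projperp (V - Vf K r \<pi> \<mu>)"
  have d: "d $ s' - d $ s = (V $ s' - V $ s) - (Vf K r \<pi> \<mu> $ s' - Vf K r \<pi> \<mu> $ s)" for s s'
    by (simp add: d_def projperp_def)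
  have lin: "linear (\<lambda>x::real. x *\<^sub>R v)" for v :: "real^'s"
    by (rule linearI) (auto simp: scaleR_add_left)
  have "loc_avg \<pi> \<mu> (\<lambda>s a s'. (r s a \<mu> - j + V $ s' - V $ s) *\<^sub>R axis s 1) s =
    (Jf K r \<pi> \<mu> - j) *\<^sub>R (axis s 1 :: real^'s) + loc_avg \<pi> \<mu> (\<lambda>s a s'. (d $ s' - d $ s) *\<^sub>R axis s 1) s" for s
  proof -
    have "loc_avg \<pi> \<mu> (\<lambda>s a s'. (r s a \<mu> - j + V $ s' - V $ s) *\<^sub>R (axis s 1 :: real^'s)) s =
      loc_avg \<pi> \<mu> (\<lambda>s a s'. (r s a \<mu> + Vf K r \<pi> \<mu> $ s' - Vf K r \<pi> \<mu> $ s) *\<^sub>R axis s 1 - j *\<^sub>R axis s 1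
         + (d $ s' - d $ s) *\<^sub>R axis s 1) s"
      unfolding d by (simp add: algebra_simps)
    also have "\<dots> = loc_avg \<pi> \<mu> (\<lambda>s a s'. (r s a \<mu> + Vf K r \<pi> \<mu> $ s' - Vf K r \<pi> \<mu> $ s) *\<^sub>R axis s 1) s
      - j *\<^sub>R axis s 1 + loc_avg \<pi> \<mu> (\<lambda>s a s'. (d $ s' - d $ s) *\<^sub>R axis s 1) s"
      by (simp add: loc_avg_add loc_avg_diff loc_avg_curr[OF pm(1), where g = "\<lambda>s. j *\<^sub>R axis s 1"])
    also have "loc_avg \<pi> \<mu> (\<lambda>s a s'. (r s a \<mu> + Vf K r \<pi> \<mu> $ s' - Vf K r \<pi> \<mu> $ s) *\<^sub>R (axis s 1 :: real^'s)) s =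
       loc_avg \<pi> \<mu> (\<lambda>s a s'. r s a \<mu> + Vf K r \<pi> \<mu> $ s' - Vf K r \<pi> \<mu> $ s) s *\<^sub>R axis s 1"
      unfolding loc_avg_def by (simp add: scaleR_sum_left)
    finally show ?thesis unfolding loc_avg_bellman[OF pm] by (simp add: algebra_simps)
  qed
  then have "avg \<pi> \<mu> (\<lambda>s a s'. (r s a \<mu> - j + V $ s' - V $ s) *\<^sub>R axis s 1) =
    (\<Sum>s\<in>UNIV. stat_dist K \<pi> \<mu> $ s *\<^sub>R ((Jf K r \<pi> \<mu> - j) *\<^sub>R (axis s 1 :: real^'s)
      + loc_avg \<pi> \<mu> (\<lambda>s a s'. (d $ s' - d $ s) *\<^sub>R axis s 1) s))"
    unfolding avg_eq_loc by (simp only:)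
  also have "\<dots> = (\<Sum>s\<in>UNIV. (Jf K r \<pi> \<mu> - j) *\<^sub>R (stat_dist K \<pi> \<mu> $ s *\<^sub>R (axis s 1 :: real^'s)))
      + avg \<pi> \<mu> (\<lambda>s a s'. (d $ s' - d $ s) *\<^sub>R axis s 1)"
    unfolding avg_eq_loc by (simp add: scaleR_add_right sum.distrib mult.commute)
  also have "(\<Sum>s\<in>UNIV. (Jf K r \<pi> \<mu> - j) *\<^sub>R (stat_dist K \<pi> \<mu> $ s *\<^sub>R (axis s 1 :: real^'s))) =
     (Jf K r \<pi> \<mu> - j) *\<^sub>R stat_dist K \<pi> \<mu>"
    unfolding scaleR_sum_right[symmetric]
    using avg_axis_curr[OF pm(1), of \<mu>, unfolded avg_curr[OF pm(1), where g = "\<lambda>s. axis s 1"]] by simp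
  finally show ?thesis unfolding d_def .
qed

lemma critic_mean_norm:
  assumes pm: "\<pi> \<in> mfg_policies" "\<mu> \<in> prob_simplex"
  shows "norm (avg \<pi> \<mu> (\<lambda>s a s'. (r s a \<mu> - j + V $ s' - V $ s) *\<^sub>R (axis s 1 :: real^'s)))
    \<le> sqrt 2 * norm (projperp (V - Vf K r \<pi> \<mu>)) + \<bar>Jf K r \<pi> \<mu> - j\<bar>"
proof -
  let ?d = "projperp (V - Vf K r \<pi> \<mu>)"
  have a: "norm (avg \<pi> \<mu> (\<lambda>s a s'. (?d $ s' - ?d $ s) *\<^sub>R (axis s 1 :: real^'s))) \<le> sqrt 2 * norm ?d"
    by (rule avg_norm[OF pm]) (simp add: norm_axis_state component_diff_bound)
  have b: "norm ((Jf K r \<pi> \<mu> - j) *\<^sub>R stat_dist K \<pi> \<mu>) \<le> \<bar>Jf K r \<pi> \<mu> - j\<bar>"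
    using simplex_norm[OF stat_simplex[OF pm]] by (simp add: mult_left_le)
  show ?thesis unfolding avg_bellman_residual[OF pm]
    using norm_triangle_mono[OF b a] by simp
qed

text \<open>Summed over states, the mean critic direction forgets V altogether: by stationarity
  \<open>V $ s'\<close> and \<open>V $ s\<close> have equal averages. It equals the mean of
  \<open>XJ\<close> divided by \<open>cJ\<close>, which is the relation behind the correction of the
  value sum by \<open>gJ\<close> and \<open>Jh\<close>.\<close>

lemma critic_mean_sum:
  assumes pm: "\<pi> \<in> mfg_policies" "\<mu> \<in> prob_simplex"
  shows "(\<Sum>i\<in>UNIV. avg \<pi> \<mu> (\<lambda>s a s'. (r s a \<mu> - j + V $ s' - V $ s) *\<^sub>R (axis s 1 :: real^'s)) $ i) = Jf K r \<pi> \<mu> - j"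
proof -
  have lin: "linear (\<lambda>v::real^'s. \<Sum>i\<in>UNIV. v $ i)"
    by (rule linearI) (auto simp: sum.distrib sum_distrib_left)
  have "(\<Sum>i\<in>UNIV. avg \<pi> \<mu> (\<lambda>s a s'. (r s a \<mu> - j + V $ s' - V $ s) *\<^sub>R (axis s 1 :: real^'s)) $ i) =
     avg \<pi> \<mu> (\<lambda>s a s'. r s a \<mu> - j + V $ s' - V $ s)"
    unfolding avg_linear[OF lin, symmetric] by (simp add: axis_def if_distrib cong: if_cong)
  also have "\<dots> = Jf K r \<pi> \<mu> - j"
    by (simp only: avg_diff avg_add avg_rew avg_next[OF pm, where g = "\<lambda>s. V $ s"] avg_const[OF pm])
  finally show ?thesis .
qed

lemma sum_projperp: "(\<Sum>i\<in>UNIV. projperp V $ i) = (0::real)"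
  by (simp add: projperp_def sum_subtractf)

text \<open>Coercivity holds on vectors of sum zero, hence the pairing with the projected error. The
  error of the reward estimate enters through the stationary law, whose norm is at most one.\<close>

lemma critic_mean_descent:
  fixes \<theta> \<mu> V j
  assumes mu: "\<mu> \<in> prob_simplex"
  defines "\<pi> \<equiv> softmax \<theta>"
  defines "d \<equiv> projperp (V - Vf K r \<pi> \<mu>)"
  shows "d \<bullet> avg \<pi> \<mu> (\<lambda>s a s'. (r s a \<mu> - j + V $ s' - V $ s) *\<^sub>R (axis s 1 :: real^'s))
    \<le> - \<gamma> * (norm d)\<^sup>2 + norm d * \<bar>Jf K r \<pi> \<mu> - j\<bar>"
proof -
  have pm: "\<pi> \<in> mfg_policies" "\<mu> \<in> prob_simplex" using mu by (auto simp: \<pi>_def softmax_policy)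
  have lin: "linear (\<lambda>v. d \<bullet> v)"
    by (rule linearI) (auto simp: inner_add_right)
  have "d \<bullet> avg \<pi> \<mu> (\<lambda>s a s'. (d $ s' - d $ s) *\<^sub>R (axis s 1 :: real^'s)) =
    avg \<pi> \<mu> (\<lambda>s a s'. d $ s * (d $ s' - d $ s))"
    unfolding avg_linear[OF lin, symmetric] by (simp add: inner_axis mult.commute)
  also have "\<dots> \<le> - \<gamma> * (norm d)\<^sup>2"
    using coercive[OF mu, of d \<theta>] sum_projperp[of "V - Vf K r \<pi> \<mu>"] unfolding avg_def \<pi>_def[symmetric] d_def[symmetric] by simp
  finally have a: "d \<bullet> avg \<pi> \<mu> (\<lambda>s a s'. (d $ s' - d $ s) *\<^sub>R (axis s 1 :: real^'s)) \<le> - \<gamma> * (norm d)\<^sup>2" .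
  have "d \<bullet> ((Jf K r \<pi> \<mu> - j) *\<^sub>R stat_dist K \<pi> \<mu>) \<le> norm d * norm ((Jf K r \<pi> \<mu> - j) *\<^sub>R stat_dist K \<pi> \<mu>)"
    by (rule norm_cauchy_schwarz)
  also have "\<dots> \<le> norm d * \<bar>Jf K r \<pi> \<mu> - j\<bar>"
    using simplex_norm[OF stat_simplex[OF pm]] by (intro mult_left_mono) (simp_all add: mult_left_le)
  finally show ?thesis
    using a unfolding avg_bellman_residual[OF pm] d_def[symmetric] by (simp add: inner_add_right)
qed

end

abbreviation pth :: "'x \<times> 'v \<times> real \<times> 'm \<Rightarrow> 'x" where "pth p \<equiv> fst p"
abbreviation pV :: "'x \<times> 'v \<times> real \<times> 'm \<Rightarrow> 'v" where "pV p \<equiv> fst (snd p)"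
abbreviation pJ :: "'x \<times> 'v \<times> real \<times> 'm \<Rightarrow> real" where "pJ p \<equiv> fst (snd (snd p))"
abbreviation pmu :: "'x \<times> 'v \<times> real \<times> 'm \<Rightarrow> 'm" where "pmu p \<equiv> snd (snd (snd p))"

lemma param_norms:
  fixes p q :: "'x::real_normed_vector \<times> 'v::real_normed_vector \<times> real \<times> 'm::real_normed_vector"
  shows "norm (pth p - pth q) \<le> norm (p - q)" "norm (pV p - pV q) \<le> norm (p - q)"
    "\<bar>pJ p - pJ q\<bar> \<le> norm (p - q)" "norm (pmu p - pmu q) \<le> norm (p - q)"
proof -
  obtain a b c d where pq: "p - q = (a, b, c, d)" by (metis prod_cases4)
  have eq: "pth p - pth q = a" "pV p - pV q = b" "pJ p - pJ q = c" "pmu p - pmu q = d"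
    using pq by (metis fst_conv snd_conv fst_diff snd_diff)+
  have "norm c \<le> norm (c, d)" "norm d \<le> norm (c, d)" "norm b \<le> norm (b, c, d)"
    "norm (c, d) \<le> norm (b, c, d)" "norm (b, c, d) \<le> norm (a, b, c, d)" "norm a \<le> norm (a, b, c, d)"
    using norm_fst_le norm_snd_le by (metis)+
  then show "norm (pth p - pth q) \<le> norm (p - q)" "norm (pV p - pV q) \<le> norm (p - q)"
    "\<bar>pJ p - pJ q\<bar> \<le> norm (p - q)" "norm (pmu p - pmu q) \<le> norm (p - q)"
    unfolding eq pq by auto
qed

lemma sqrt2_bounds: "0 \<le> sqrt (2::real)" "sqrt (2::real) \<le> 3/2"
  by simp (rule real_le_lsqrt, simp_all add: power2_eq_square)

section \<open>Policy gradient, and Lipschitz dependence of the mean directions on the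
  parameters\<close>

context mfg
begin

lemma loc_avg_advantage:
  "loc_avg \<pi> \<mu> (\<lambda>s a s'. (r s a \<mu> + V $ s' - V $ s) *\<^sub>R g s a) s =
    (\<Sum>a\<in>UNIV. (\<pi> $ s $ a * (r s a \<mu> + (\<Sum>s'\<in>UNIV. pmf (K \<mu> s a) s' * V $ s') - V $ s)) *\<^sub>R g s a)"
proof -
  have "(\<Sum>s'\<in>UNIV. \<pi> $ s $ a * pmf (K \<mu> s a) s' * (r s a \<mu> + V $ s' - V $ s)) =
    \<pi> $ s $ a * (\<Sum>s'\<in>UNIV. pmf (K \<mu> s a) s' * (r s a \<mu> - V $ s) + pmf (K \<mu> s a) s' * V $ s')" for a
    unfolding sum_distrib_left by (rule sum.cong) (auto simp: algebra_simps)
  then show ?thesis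
    unfolding loc_avg_def scaleR_scaleR scaleR_sum_left[symmetric]
    by (simp only: sum.distrib sum_distrib_right[symmetric] pmf_sum_UNIV) (simp add: algebra_simps)
qed

text \<open>The average-reward performance difference formula. Averaging the Bellman residual of the
  old policy under the stationary law of the new one removes \<open>Vf\<close> by stationarity, and
  the baseline vanishes because the advantage-like \<open>A\<close> averages to \<open>Jf\<close>
  under the old policy in every state.\<close>

lemma performance_difference:
  assumes pm: "\<pi> \<in> mfg_policies" "\<pi>' \<in> mfg_policies" "\<mu> \<in> prob_simplex"
  defines "A \<equiv> \<lambda>s a. r s a \<mu> + (\<Sum>s'\<in>UNIV. pmf (K \<mu> s a) s' * Vf K r \<pi> \<mu> $ s') - Vf K r \<pi> \<mu> $ s"
  shows "Jf K r \<pi>' \<mu> - Jf K r \<pi> \<mu> =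
    (\<Sum>s\<in>UNIV. stat_dist K \<pi>' \<mu> $ s * (\<Sum>a\<in>UNIV. (\<pi>' $ s $ a - \<pi> $ s $ a) * A s a))"
proof -
  let ?V = "Vf K r \<pi> \<mu>"
  have "loc_avg \<pi>'' \<mu> (\<lambda>s a s'. r s a \<mu> + ?V $ s' - ?V $ s) s = (\<Sum>a\<in>UNIV. \<pi>'' $ s $ a * A s a)" for \<pi>'' s
    using loc_avg_advantage[of \<pi>'' \<mu> ?V "\<lambda>_ _. 1 :: real" s] unfolding A_def by simp
  note eq = this
  have "Jf K r \<pi>' \<mu> = avg \<pi>' \<mu> (\<lambda>s a s'. r s a \<mu> + ?V $ s' - ?V $ s)"
    by (simp add: avg_diff avg_add avg_rew avg_next[OF pm(2,3), where g = "\<lambda>s. ?V $ s"])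
  also have "\<dots> = (\<Sum>s\<in>UNIV. stat_dist K \<pi>' \<mu> $ s * (\<Sum>a\<in>UNIV. \<pi>' $ s $ a * A s a))"
    unfolding avg_eq_loc eq by simp
  finally have 1: "Jf K r \<pi>' \<mu> = (\<Sum>s\<in>UNIV. stat_dist K \<pi>' \<mu> $ s * (\<Sum>a\<in>UNIV. \<pi>' $ s $ a * A s a))" .
  have "(\<Sum>a\<in>UNIV. \<pi> $ s $ a * A s a) = Jf K r \<pi> \<mu>" for s
    using loc_avg_bellman[OF pm(1,3)] eq by simp
  then have "(\<Sum>s\<in>UNIV. stat_dist K \<pi>' \<mu> $ s * (\<Sum>a\<in>UNIV. \<pi> $ s $ a * A s a)) = Jf K r \<pi> \<mu>"
    by (simp add: sum_distrib_right[symmetric] simplex_sum[OF stat_simplex[OF pm(2,3)]])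
  with 1 show ?thesis by (simp add: left_diff_distrib right_diff_distrib sum_subtractf)
qed

lemma Vf_component_bound:
  "\<pi> \<in> mfg_policies \<Longrightarrow> \<mu> \<in> prob_simplex \<Longrightarrow> \<bar>Vf K r \<pi> \<mu> $ s\<bar> \<le> BV"
  using Vf_bound component_le_norm_cart order_trans by blast

text \<open>Replacing the new stationary law by the old one in \<open>performance_difference\<close>
  costs a product of two factors that are both O(|theta' - theta|), by \<open>stat_lip\<close> and
  \<open>softmax_lipschitz\<close>. That product has derivative zero, so the stationary law itself
  is never differentiated.\<close>

lemma policy_gradient:
  assumes mu: "\<mu> \<in> prob_simplex"
  shows "GDERIV (\<lambda>\<theta>. Jf K r (softmax \<theta>) \<mu>) \<theta> :>
    avg (softmax \<theta>) \<mu> (\<lambda>s a s'. (r s a \<mu> + Vf K r (softmax \<theta>) \<mu> $ s' - Vf K r (softmax \<theta>) \<mu> $ s) *\<^sub>R score \<theta> s a)"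
    (is "GDERIV ?J \<theta> :> ?G")
proof -
  let ?\<pi> = "softmax \<theta>"
  let ?V = "Vf K r ?\<pi> \<mu>"
  define A where "A s a = r s a \<mu> + (\<Sum>s'\<in>UNIV. pmf (K \<mu> s a) s' * ?V $ s') - ?V $ s" for s a
  let ?\<nu> = "\<lambda>\<theta> s. stat_dist K (softmax \<theta>) \<mu> $ s"
  define D where "D \<theta>' s = (\<Sum>a\<in>UNIV. (softmax \<theta>' $ s $ a - ?\<pi> $ s $ a) * A s a)" for \<theta>' s
  define M where "M = real CARD('a) * (1 + 2 * BV)"
  have J: "?J \<theta>' = ?J \<theta> + (\<Sum>s\<in>UNIV. ?\<nu> \<theta> s * D \<theta>' s) + (\<Sum>s\<in>UNIV. (?\<nu> \<theta>' s - ?\<nu> \<theta> s) * D \<theta>' s)" for \<theta>'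
    using performance_difference[OF softmax_policy softmax_policy mu, of \<theta>' \<theta>]
    by (simp add: A_def D_def left_diff_distrib sum_subtractf)
  have A: "\<bar>A s a\<bar> \<le> 1 + 2 * BV" for s a
  proof -
    have "norm (\<Sum>s'\<in>UNIV. pmf (K \<mu> s a) s' *\<^sub>R ?V $ s') \<le> BV"
      by (rule simplex_convex_bound) (auto simp: pmf_sum_UNIV Vf_component_bound[OF softmax_policy mu])
    then show ?thesis
      unfolding A_def using rew[OF mu, of s a] Vf_component_bound[OF softmax_policy mu, of \<theta> s] by simp
  qed
  have D: "\<bar>D \<theta>' s\<bar> \<le> M * norm (\<theta>' - \<theta>)" for \<theta>' s
  proof -
    have "\<bar>D \<theta>' s\<bar> \<le> (\<Sum>a\<in>(UNIV::'a set). norm (\<theta>' - \<theta>) * (1 + 2 * BV))"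
      unfolding D_def
    proof (rule order_trans[OF sum_abs sum_mono])
      fix a
      have "\<bar>softmax \<theta>' $ s $ a - ?\<pi> $ s $ a\<bar> \<le> norm ((softmax \<theta>' - ?\<pi>) $ s)"
        using component_le_norm_cart[of "(softmax \<theta>' - ?\<pi>) $ s" a] by simp
      also have "\<dots> \<le> norm (softmax \<theta>' - ?\<pi>)" by (rule Finite_Cartesian_Product.norm_nth_le)
      also have "\<dots> \<le> norm (\<theta>' - \<theta>)" by (rule softmax_lipschitz)
      finally show "\<bar>(softmax \<theta>' $ s $ a - ?\<pi> $ s $ a) * A s a\<bar> \<le> norm (\<theta>' - \<theta>) * (1 + 2 * BV)"
        unfolding abs_mult using A by (intro mult_mono) auto
    qed
    then show ?thesis by (simp add: M_def mult_ac)
  qed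
  have "((\<lambda>\<theta>'. \<Sum>s\<in>UNIV. (?\<nu> \<theta>' s - ?\<nu> \<theta> s) * D \<theta>' s) has_derivative (\<lambda>_. 0)) (at \<theta>)"
  proof (rule has_derivative_quadratic_remainder)
    fix \<theta>'
    have M0: "0 \<le> M" unfolding M_def using BV by simp
    have "norm (\<Sum>s\<in>UNIV. (?\<nu> \<theta>' s - ?\<nu> \<theta> s) *\<^sub>R D \<theta>' s) \<le> 2 * (M * norm (\<theta>' - \<theta>)) * dTV (?\<nu> \<theta>') (?\<nu> \<theta>)"
      by (rule dTV_integral) (simp add: D)
    also have "\<dots> \<le> 2 * (M * norm (\<theta>' - \<theta>)) * (L * norm (\<theta>' - \<theta>))"
    proof (rule mult_left_mono)
      have "dTV (?\<nu> \<theta>') (?\<nu> \<theta>) \<le> L * norm (softmax \<theta>' - softmax \<theta>)"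
        using stat_lip[OF softmax_policy[of \<theta>'] softmax_policy[of \<theta>] mu mu] by simp
      also have "\<dots> \<le> L * norm (\<theta>' - \<theta>)" using L softmax_lipschitz by simp
      finally show "dTV (?\<nu> \<theta>') (?\<nu> \<theta>) \<le> L * norm (\<theta>' - \<theta>)" .
    qed (use M0 in simp)
    finally show "norm ((\<Sum>s\<in>UNIV. (?\<nu> \<theta>' s - ?\<nu> \<theta> s) * D \<theta>' s) - (\<Sum>s\<in>UNIV. (?\<nu> \<theta> s - ?\<nu> \<theta> s) * D \<theta> s))
       \<le> 2 * M * L * (norm (\<theta>' - \<theta>))\<^sup>2"
      by (simp add: power2_eq_square mult_ac)
  qed
  moreover have "((\<lambda>\<theta>'. \<Sum>s\<in>UNIV. ?\<nu> \<theta> s * D \<theta>' s) has_derivative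
     (\<lambda>h. \<Sum>s\<in>UNIV. ?\<nu> \<theta> s * (\<Sum>a\<in>UNIV. (softmax \<theta> $ s $ a * inner h (score \<theta> s a)) * A s a))) (at \<theta>)"
    unfolding D_def
    by (auto intro!: derivative_eq_intros softmax_has_derivative)
  moreover have "(\<Sum>s\<in>UNIV. ?\<nu> \<theta> s * (\<Sum>a\<in>UNIV. (softmax \<theta> $ s $ a * inner h (score \<theta> s a)) * A s a)) = inner h ?G" for h
    unfolding avg_eq_loc loc_avg_advantage A_def[symmetric] inner_sum_right inner_scaleR_right
    by (simp add: mult_ac)
  ultimately have "((\<lambda>\<theta>'. ?J \<theta> + (\<Sum>s\<in>UNIV. ?\<nu> \<theta> s * D \<theta>' s) + (\<Sum>s\<in>UNIV. (?\<nu> \<theta>' s - ?\<nu> \<theta> s) * D \<theta>' s))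
     has_derivative (\<lambda>h. 0 + inner h ?G + 0)) (at \<theta>)"
    by (intro has_derivative_add has_derivative_const) simp_all
  moreover have "?J = (\<lambda>\<theta>'. ?J \<theta> + (\<Sum>s\<in>UNIV. ?\<nu> \<theta> s * D \<theta>' s) + (\<Sum>s\<in>UNIV. (?\<nu> \<theta>' s - ?\<nu> \<theta> s) * D \<theta>' s))"
    by (rule ext) (rule J)
  ultimately show ?thesis unfolding gderiv_def by simp
qed

text \<open>By \<open>policy_gradient\<close> the gradient is the same average with
  \<open>Vf\<close> in place of V, so only the difference of the two value vectors modulo constants
  is left.\<close>

lemma actor_bias:
  assumes mu: "\<mu> \<in> prob_simplex"
  shows "norm (avg (softmax \<theta>) \<mu> (\<lambda>s a s'. (r s a \<mu> + V $ s' - V $ s) *\<^sub>R score \<theta> s a)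
     - gradf (\<lambda>\<theta>. Jf K r (softmax \<theta>) \<mu>) \<theta>) \<le> 2 * norm (projperp (V - Vf K r (softmax \<theta>) \<mu>))"
proof -
  let ?d = "projperp (V - Vf K r (softmax \<theta>) \<mu>)"
  have "avg (softmax \<theta>) \<mu> (\<lambda>s a s'. (r s a \<mu> + V $ s' - V $ s) *\<^sub>R score \<theta> s a)
     - gradf (\<lambda>\<theta>. Jf K r (softmax \<theta>) \<mu>) \<theta> = avg (softmax \<theta>) \<mu> (\<lambda>s a s'. (?d $ s' - ?d $ s) *\<^sub>R score \<theta> s a)"
    unfolding gradf_eq[OF policy_gradient[OF mu]] avg_diff[symmetric]
    by (rule arg_cong[where f = "avg (softmax \<theta>) \<mu>"]) (auto simp: fun_eq_iff projperp_def algebra_simps)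
  also have "norm \<dots> \<le> sqrt 2 * norm ?d * sqrt 2"
    by (rule avg_norm[OF softmax_policy mu], simp, intro mult_mono)
      (auto simp: component_diff_bound norm_score)
  also have "\<dots> = 2 * norm ?d"
    by (simp only: mult.commute[of "sqrt 2 * norm ?d"] mult.assoc[symmetric] real_sqrt_mult_self abs_numeral)
  finally show ?thesis .
qed

definition params :: "((real^'a^'s) \<times> (real^'s) \<times> real \<times> (real^'s)) set" where
  "params = {p. norm (pV p) \<le> BV \<and> 0 \<le> pJ p \<and> pJ p \<le> 1 \<and> pmu p \<in> prob_simplex}"

lemma paramsD:
  assumes "p \<in> params"
  shows "norm (pV p) \<le> BV" "0 \<le> pJ p" "pJ p \<le> 1" "pmu p \<in> prob_simplex"
  using assms by (auto simp: params_def)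

lemma axis_policy: "(\<chi> s. axis a 1) \<in> mfg_policies"
  by (simp add: mfg_policies_def axis_in_simplex)

lemma sum_axis_mult: "(\<Sum>i\<in>UNIV. axis j (1::real) $ i * f i) = f (j::'n::finite)"
  by (simp add: axis_def if_distrib if_distribR cong: if_cong)

lemma Pmat_lip:
  assumes "\<pi>1 \<in> mfg_policies" "\<pi>2 \<in> mfg_policies" "\<mu>1 \<in> prob_simplex" "\<mu>2 \<in> prob_simplex"
  shows "\<bar>Pmat K \<pi>1 \<mu>1 s s' - Pmat K \<pi>2 \<mu>2 s s'\<bar> \<le> 2 * L * (norm (\<pi>1 - \<pi>2) + norm (\<mu>1 - \<mu>2))"
  using trans_lip[OF axis_in_simplex[of s] assms]
    dTV_pointwise[of "\<lambda>s'. Pmat K \<pi>1 \<mu>1 s s'" s' "\<lambda>s'. Pmat K \<pi>2 \<mu>2 s s'"]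
  unfolding sum_axis_mult by simp

lemma K_lip:
  assumes "\<mu>1 \<in> prob_simplex" "\<mu>2 \<in> prob_simplex"
  shows "\<bar>pmf (K \<mu>1 s a) s' - pmf (K \<mu>2 s a) s'\<bar> \<le> 2 * L * norm (\<mu>1 - \<mu>2)"
proof -
  \<comment> \<open>The deterministic policy that always plays \<open>a\<close> turns
    \<open>Pmat\<close> into the kernel itself.\<close>
  have "Pmat K (\<chi> s. axis a 1) \<mu> s s' = pmf (K \<mu> s a) s'" for \<mu>
    unfolding Pmat_def using sum_axis_mult[of a "\<lambda>a. pmf (K \<mu> s a) s'"] by (simp add: mult.commute)
  then show ?thesis using Pmat_lip[OF axis_policy[of a] axis_policy[of a] assms, of s s'] by simp
qed

lemma blip_policy_field:
  assumes bound: "\<And>p. p \<in> params \<Longrightarrow> norm (f (softmax (pth p)) (pmu p)) \<le> B" and C: "0 \<le> C"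
    and lip: "\<And>\<pi>1 \<pi>2 \<mu>1 \<mu>2. \<pi>1 \<in> mfg_policies \<Longrightarrow> \<pi>2 \<in> mfg_policies \<Longrightarrow> \<mu>1 \<in> prob_simplex \<Longrightarrow> \<mu>2 \<in> prob_simplex
      \<Longrightarrow> norm (f \<pi>1 \<mu>1 - f \<pi>2 \<mu>2) \<le> C * (norm (\<pi>1 - \<pi>2) + norm (\<mu>1 - \<mu>2))"
  shows "blip params (\<lambda>p. f (softmax (pth p)) (pmu p))"
proof (rule blipI[OF bound])
  fix p q assume pq: "p \<in> params" "q \<in> params"
  have "norm (softmax (pth p) - softmax (pth q)) + norm (pmu p - pmu q) \<le> 2 * norm (p - q)"
    using softmax_lipschitz[of "pth p" "pth q"] param_norms[of p q] by linarith
  then show "norm (f (softmax (pth p)) (pmu p) - f (softmax (pth q)) (pmu q)) \<le> C * 2 * norm (p - q)"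
    using lip[OF softmax_policy softmax_policy paramsD(4)[OF pq(1)] paramsD(4)[OF pq(2)], of "pth p" "pth q"]
      mult_left_mono[OF _ C] by fastforce
qed

lemma blip_softmax: "blip params (\<lambda>p. softmax (pth p) $ s $ a)"
proof (rule blip_policy_field[where f = "\<lambda>\<pi> \<mu>. \<pi> $ s $ a" and B = 1 and C = 1])
  fix \<pi>1 \<pi>2 :: "real^'a^'s" and \<mu>1 \<mu>2 :: "real^'s"
  have "\<bar>\<pi>1 $ s $ a - \<pi>2 $ s $ a\<bar> \<le> norm ((\<pi>1 - \<pi>2) $ s)"
    using component_le_norm_cart[of "(\<pi>1 - \<pi>2) $ s" a] by simp
  also have "\<dots> \<le> norm (\<pi>1 - \<pi>2)" by (rule Finite_Cartesian_Product.norm_nth_le)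
  also have "\<dots> \<le> norm (\<pi>1 - \<pi>2) + norm (\<mu>1 - \<mu>2)" by simp
  finally show "norm (\<pi>1 $ s $ a - \<pi>2 $ s $ a) \<le> 1 * (norm (\<pi>1 - \<pi>2) + norm (\<mu>1 - \<mu>2))" by simp
qed (auto simp: policy_nonneg policy_le_one softmax_policy)

lemma blip_kernel: "blip params (\<lambda>p. pmf (K (pmu p) s a) s')"
proof (rule blip_policy_field[where f = "\<lambda>\<pi> \<mu>. pmf (K \<mu> s a) s'" and B = 1 and C = "2 * L"])
  fix \<pi>1 \<pi>2 :: "real^'a^'s" and \<mu>1 \<mu>2 :: "real^'s"
  assume mu: "\<mu>1 \<in> prob_simplex" "\<mu>2 \<in> prob_simplex"
  have "2 * L * norm (\<mu>1 - \<mu>2) \<le> 2 * L * (norm (\<pi>1 - \<pi>2) + norm (\<mu>1 - \<mu>2))"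
    using L by (intro mult_left_mono) auto
  then show "norm (pmf (K \<mu>1 s a) s' - pmf (K \<mu>2 s a) s') \<le> 2 * L * (norm (\<pi>1 - \<pi>2) + norm (\<mu>1 - \<mu>2))"
    using K_lip[OF mu, of s a s'] by simp
qed (use L in \<open>auto simp: pmf_le_1\<close>)

lemma blip_reward: "blip params (\<lambda>p. r s a (pmu p))"
proof (rule blip_policy_field[where f = "\<lambda>\<pi> \<mu>. r s a \<mu>" and B = 1 and C = L])
  fix \<pi>1 \<pi>2 :: "real^'a^'s" and \<mu>1 \<mu>2 :: "real^'s"
  assume mu: "\<mu>1 \<in> prob_simplex" "\<mu>2 \<in> prob_simplex"
  have "L * norm (\<mu>1 - \<mu>2) \<le> L * (norm (\<pi>1 - \<pi>2) + norm (\<mu>1 - \<mu>2))"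
    using L by (intro mult_left_mono) auto
  then show "norm (r s a \<mu>1 - r s a \<mu>2) \<le> L * (norm (\<pi>1 - \<pi>2) + norm (\<mu>1 - \<mu>2))"
    using r_lip[OF mu, of s a] by simp
qed (use L rew in \<open>auto simp: paramsD\<close>)

lemma blip_stat: "blip params (\<lambda>p. stat_dist K (softmax (pth p)) (pmu p) $ s)"
proof (rule blip_policy_field[where f = "\<lambda>\<pi> \<mu>. stat_dist K \<pi> \<mu> $ s" and B = 1 and C = "2 * L"])
  fix \<pi>1 \<pi>2 :: "real^'a^'s" and \<mu>1 \<mu>2 :: "real^'s"
  assume "\<pi>1 \<in> mfg_policies" "\<pi>2 \<in> mfg_policies" and mu: "\<mu>1 \<in> prob_simplex" "\<mu>2 \<in> prob_simplex"
  then show "norm (stat_dist K \<pi>1 \<mu>1 $ s - stat_dist K \<pi>2 \<mu>2 $ s) \<le> 2 * L * (norm (\<pi>1 - \<pi>2) + norm (\<mu>1 - \<mu>2))"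
    using stat_lip[of \<pi>1 \<pi>2 \<mu>1 \<mu>2] dTV_pointwise[of "\<lambda>x. stat_dist K \<pi>1 \<mu>1 $ x" s "\<lambda>x. stat_dist K \<pi>2 \<mu>2 $ x"] by simp
qed (use L in \<open>auto simp: paramsD softmax_policy simplex_nonneg stat_simplex simplex_le_one\<close>)

lemma blip_dev: "blip params (\<lambda>p. dev (softmax (pth p)) (pmu p) s s')"
proof -
  define Z where "Z = 2 * C0 / (1 - C1)"
  define n where "n = real CARD('s)"
  define C where "C = n * (n * (Z * (2 * L) * Z)) + n * (2 * L * Z)"
  have Z: "0 \<le> Z" unfolding Z_def using C0 C1 by simp
  have Zb: "\<bar>dev \<pi> \<mu> i j\<bar> \<le> Z" if "\<pi> \<in> mfg_policies" "\<mu> \<in> prob_simplex" for \<pi> \<mu> i j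
    unfolding Z_def by (rule dev_bound[OF that])
  show ?thesis
  proof (rule blip_policy_field[where f = "\<lambda>\<pi> \<mu>. dev \<pi> \<mu> s s'" and B = Z and C = C])
    fix \<pi>1 \<pi>2 :: "real^'a^'s" and \<mu>1 \<mu>2 :: "real^'s"
    assume pm: "\<pi>1 \<in> mfg_policies" "\<pi>2 \<in> mfg_policies" "\<mu>1 \<in> prob_simplex" "\<mu>2 \<in> prob_simplex"
    define e where "e = norm (\<pi>1 - \<pi>2) + norm (\<mu>1 - \<mu>2)"
    have e: "0 \<le> e" unfolding e_def by simp
    have "\<bar>\<Sum>j\<in>UNIV. \<Sum>i\<in>UNIV. dev \<pi>1 \<mu>1 s i * (Pmat K \<pi>1 \<mu>1 i j - Pmat K \<pi>2 \<mu>2 i j) * dev \<pi>2 \<mu>2 j s'\<bar>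
      \<le> (\<Sum>j\<in>(UNIV::'s set). \<Sum>i\<in>(UNIV::'s set). Z * (2 * L * e) * Z)"
    proof (intro order_trans[OF sum_abs sum_mono] order_trans[OF sum_abs sum_mono])
      fix i j
      show "\<bar>dev \<pi>1 \<mu>1 s i * (Pmat K \<pi>1 \<mu>1 i j - Pmat K \<pi>2 \<mu>2 i j) * dev \<pi>2 \<mu>2 j s'\<bar> \<le> Z * (2 * L * e) * Z"
        unfolding abs_mult using Z e L Pmat_lip[OF pm, of i j, folded e_def]
        by (intro mult_mono Zb pm) auto
    qed
    moreover have "\<bar>\<Sum>j\<in>UNIV. (stat_dist K \<pi>1 \<mu>1 $ j - stat_dist K \<pi>2 \<mu>2 $ j) * dev \<pi>2 \<mu>2 j s'\<bar>
       \<le> (\<Sum>j\<in>(UNIV::'s set). (2 * L * e) * Z)"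
    proof (rule order_trans[OF sum_abs sum_mono])
      fix j
      have "\<bar>stat_dist K \<pi>1 \<mu>1 $ j - stat_dist K \<pi>2 \<mu>2 $ j\<bar> \<le> 2 * L * e"
        using stat_lip[OF pm] dTV_pointwise[of "\<lambda>x. stat_dist K \<pi>1 \<mu>1 $ x" j "\<lambda>x. stat_dist K \<pi>2 \<mu>2 $ x"]
        unfolding e_def by simp
      then show "\<bar>(stat_dist K \<pi>1 \<mu>1 $ j - stat_dist K \<pi>2 \<mu>2 $ j) * dev \<pi>2 \<mu>2 j s'\<bar> \<le> (2 * L * e) * Z"
        unfolding abs_mult using Zb[OF pm(2,4)] e L by (intro mult_mono) auto
    qed
    ultimately have "\<bar>dev \<pi>1 \<mu>1 s s' - dev \<pi>2 \<mu>2 s s'\<bar> \<le> n * (n * (Z * (2 * L * e) * Z)) + n * ((2 * L * e) * Z)"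
      unfolding dev_perturb[OF pm(1,3,2,4)] n_def by simp
    also have "\<dots> = C * e" unfolding C_def by (simp add: algebra_simps)
    finally show "norm (dev \<pi>1 \<mu>1 s s' - dev \<pi>2 \<mu>2 s s') \<le> C * (norm (\<pi>1 - \<pi>2) + norm (\<mu>1 - \<mu>2))"
      unfolding e_def by simp
  qed (use Zb Z L in \<open>auto simp: C_def n_def paramsD softmax_policy\<close>)
qed

lemma blip_pV: "blip params (\<lambda>p. pV p $ s)"
proof (rule blip_nth, rule blipI[where C = BV])
  fix p q :: "(real^'a^'s) \<times> (real^'s) \<times> real \<times> (real^'s)"
  show "norm (pV p - pV q) \<le> 1 * norm (p - q)" using param_norms(2)[of p q] by simp
qed (auto simp: paramsD)

lemma blip_pJ: "blip params (\<lambda>p. pJ p)"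
proof (rule blipI[where C = 1])
  fix p q :: "(real^'a^'s) \<times> (real^'s) \<times> real \<times> (real^'s)"
  show "norm (pJ p - pJ q) \<le> 1 * norm (p - q)" using param_norms(3)[of p q] by simp
qed (use paramsD in fastforce)

lemma blip_pmu: "blip params (\<lambda>p. pmu p)"
proof (rule blipI[where C = 1])
  fix p q :: "(real^'a^'s) \<times> (real^'s) \<times> real \<times> (real^'s)"
  show "norm (pmu p - pmu q) \<le> 1 * norm (p - q)" using param_norms(4)[of p q] by simp
qed (use paramsD simplex_norm in fastforce)

lemma blip_score: "blip params (\<lambda>p. score (pth p) s a)"
proof (rule blipI)
  fix p q :: "(real^'a^'s) \<times> (real^'s) \<times> real \<times> (real^'s)"
  show "norm (score (pth p) s a - score (pth q) s a) \<le> 1 * norm (p - q)"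
    using score_lipschitz[of "pth p" s a "pth q"] param_norms(1)[of p q] by simp
qed (rule norm_score)

lemma blip_avg:
  assumes "\<And>s a s'. blip params (\<lambda>p. X p s a s')"
  shows "blip params (\<lambda>p. avg (softmax (pth p)) (pmu p) (X p))"
  unfolding avg_def by (intro blip_intros blip_softmax blip_kernel blip_stat assms)

lemma blip_poisson:
  assumes "\<And>s a s'. blip params (\<lambda>p. X p s a s')"
  shows "blip params (\<lambda>p. poisson (softmax (pth p)) (pmu p) (X p) s)"
  unfolding poisson_def loc_avg_def by (intro blip_intros blip_softmax blip_kernel blip_dev assms)

text \<open>\<open>XF\<close>, \<open>XV\<close>, \<open>XJ\<close>, \<open>XH\<close> are the
  samples fed into the filters \<open>fv\<close>, \<open>gV\<close>, \<open>gJ\<close>,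
  \<open>hv\<close>, as functions of the current parameters and one transition.\<close>

definition XF :: "(real^'a^'s) \<times> (real^'s) \<times> real \<times> (real^'s) \<Rightarrow> 's \<Rightarrow> 'a \<Rightarrow> 's \<Rightarrow> real^'a^'s" where
  "XF p s a s' = (r s a (pmu p) + pV p $ s' - pV p $ s) *\<^sub>R score (pth p) s a"
definition XV :: "(real^'a^'s) \<times> (real^'s) \<times> real \<times> (real^'s) \<Rightarrow> 's \<Rightarrow> 'a \<Rightarrow> 's \<Rightarrow> real^'s" where
  "XV p s a s' = (r s a (pmu p) - pJ p + pV p $ s' - pV p $ s) *\<^sub>R axis s 1"
definition XJ :: "(real^'a^'s) \<times> (real^'s) \<times> real \<times> (real^'s) \<Rightarrow> 's \<Rightarrow> 'a \<Rightarrow> 's \<Rightarrow> real" where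
  "XJ p s a s' = cJ * (r s a (pmu p) - pJ p)"
definition XH :: "(real^'a^'s) \<times> (real^'s) \<times> real \<times> (real^'s) \<Rightarrow> 's \<Rightarrow> 'a \<Rightarrow> 's \<Rightarrow> real^'s" where
  "XH p s a s' = axis s 1 - pmu p"

lemma blip_XF: "blip params (\<lambda>p. XF p s a s')"
  unfolding XF_def by (intro blip_intros blip_reward blip_pV blip_score)
lemma blip_XV: "blip params (\<lambda>p. XV p s a s')"
  unfolding XV_def by (intro blip_intros blip_reward blip_pV blip_pJ)
lemma blip_XJ: "blip params (\<lambda>p. XJ p s a s')"
  unfolding XJ_def by (intro blip_intros blip_reward blip_pJ)
lemma blip_XH: "blip params (\<lambda>p. XH p s a s')"
  unfolding XH_def by (intro blip_intros blip_pmu)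

abbreviation mean where "mean X p \<equiv> avg (softmax (pth p)) (pmu p) (X p)"

definition LF :: real where "LF = 10 * BV + L + 2 * (BV + 1) * LTV + 5"
definition LG :: real where "LG = 2 * (2 * (BV + cJ + 2)) * LTV + (L + 1) * (cJ + 1) + 2"

lemma td_bound:
  assumes "p \<in> params"
  shows "\<bar>r s a (pmu p) + pV p $ s' - pV p $ s\<bar> \<le> 1 + sqrt 2 * BV"
    "\<bar>r s a (pmu p) - pJ p + pV p $ s' - pV p $ s\<bar> \<le> 1 + sqrt 2 * BV"
proof -
  have "\<bar>pV p $ s' - pV p $ s\<bar> \<le> sqrt 2 * BV"
    using component_diff_bound[of "pV p" s' s] mult_left_mono[OF paramsD(1)[OF assms] sqrt2_bounds(1)] by linarith
  then show "\<bar>r s a (pmu p) + pV p $ s' - pV p $ s\<bar> \<le> 1 + sqrt 2 * BV"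
    "\<bar>r s a (pmu p) - pJ p + pV p $ s' - pV p $ s\<bar> \<le> 1 + sqrt 2 * BV"
    using rew[OF paramsD(4)[OF assms], of s a] paramsD(2,3)[OF assms] by linarith+
qed

lemma XF_bound: "p \<in> params \<Longrightarrow> norm (XF p s a s') \<le> (1 + sqrt 2 * BV) * sqrt 2"
  unfolding XF_def norm_scaleR using BV by (intro mult_mono td_bound norm_score) auto

lemma XV_bound: "p \<in> params \<Longrightarrow> norm (XV p s a s') \<le> 1 + sqrt 2 * BV"
  unfolding XV_def norm_scaleR norm_axis_state using td_bound(2) by simp

lemma XH_bound: "p \<in> params \<Longrightarrow> norm (XH p s a s') \<le> 2"
  unfolding XH_def
  using norm_triangle_ineq4[of "axis s 1" "pmu p"] simplex_norm[OF axis_in_simplex] simplex_norm[OF paramsD(4), of p]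
  by fastforce

lemma td_diff:
  assumes "p \<in> params" "q \<in> params"
  shows "\<bar>(r s a (pmu p) + pV p $ s' - pV p $ s) - (r s a (pmu q) + pV q $ s' - pV q $ s)\<bar>
    \<le> L * norm (pmu p - pmu q) + sqrt 2 * norm (pV p - pV q)"
  using r_lip[OF paramsD(4)[OF assms(1)] paramsD(4)[OF assms(2)], of s a] component_diff_bound[of "pV p - pV q" s' s]
  by simp

text \<open>Changing the law costs \<open>4 * (BV + 1) * LTV\<close>, twice the matching summand of
  \<open>LF\<close>, and the factor \<open>sqrt 2\<close> of the score enlarges the \<open>L\<close>
  term; hence a multiple of \<open>LF\<close>. The motion of V is kept apart with its own constant
  because it is much faster than that of theta and mu.\<close>

lemma mean_XF_lip:
  assumes pq: "p \<in> params" "q \<in> params"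
  shows "norm (mean XF p - mean XF q) \<le> 3 * LF * (norm (pth p - pth q) + norm (pmu p - pmu q)) + 2 * norm (pV p - pV q)"
proof -
  define T where "T = norm (pth p - pth q) + norm (pmu p - pmu q)"
  define M where "M = (1 + sqrt 2 * BV) * sqrt 2"
  define D where "D = (L * norm (pmu p - pmu q) + sqrt 2 * norm (pV p - pV q)) * sqrt 2 + (1 + sqrt 2 * BV) * norm (pth p - pth q)"
  have T: "0 \<le> T" "norm (softmax (pth p) - softmax (pth q)) + norm (pmu p - pmu q) \<le> T" "norm (pmu p - pmu q) \<le> T" "norm (pth p - pth q) \<le> T"
    unfolding T_def using softmax_lipschitz[of "pth p" "pth q"] by auto
  have "norm (XF p s a s' - XF q s a s') \<le> D" for s a s'
  proof -
    let ?u = "\<lambda>p. r s a (pmu p) + pV p $ s' - pV p $ s"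
    have "XF p s a s' - XF q s a s' = (?u p - ?u q) *\<^sub>R score (pth p) s a + ?u q *\<^sub>R (score (pth p) s a - score (pth q) s a)"
      unfolding XF_def by (simp add: algebra_simps)
    then have "norm (XF p s a s' - XF q s a s') \<le> \<bar>?u p - ?u q\<bar> * norm (score (pth p) s a) + \<bar>?u q\<bar> * norm (score (pth p) s a - score (pth q) s a)"
      by (metis norm_scaleR norm_triangle_ineq)
    also have "\<dots> \<le> D" unfolding D_def using BV L
      by (intro add_mono mult_mono td_diff pq norm_score td_bound score_lipschitz) auto
    finally show ?thesis .
  qed
  then have "norm (mean XF p - mean XF q) \<le> 2 * M * (LTV * (norm (softmax (pth p) - softmax (pth q)) + norm (pmu p - pmu q))) + D"
    unfolding M_def by (intro avg_perturb softmax_policy paramsD(4) pq XF_bound)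
  also have "\<dots> \<le> 2 * M * (LTV * T) + D"
    unfolding M_def using T LTV BV by (intro add_right_mono mult_left_mono) auto
  also have "\<dots> \<le> 4 * (BV + 1) * (LTV * T) + ((1 + 3/2 * BV) * T + 3/2 * L * T + 2 * norm (pV p - pV q))"
  proof (rule add_mono)
    have "2 * M = 2 * sqrt 2 + 4 * BV" unfolding M_def by (simp add: algebra_simps)
    then show "2 * M * (LTV * T) \<le> 4 * (BV + 1) * (LTV * T)"
      using sqrt2_bounds T(1) LTV by (intro mult_right_mono) auto
    have "L * norm (pmu p - pmu q) * sqrt 2 \<le> L * T * (3/2)" using L T sqrt2_bounds by (intro mult_mono) auto
    moreover have "(1 + sqrt 2 * BV) * norm (pth p - pth q) \<le> (1 + 3/2 * BV) * T"
      using T sqrt2_bounds BV by (intro mult_mono add_mono) auto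
    moreover have "sqrt 2 * norm (pV p - pV q) * sqrt 2 = 2 * norm (pV p - pV q)"
      by (simp only: mult.commute[of "sqrt 2 * norm (pV p - pV q)"] mult.assoc[symmetric] real_sqrt_mult_self abs_numeral)
    ultimately show "D \<le> (1 + 3/2 * BV) * T + 3/2 * L * T + 2 * norm (pV p - pV q)"
      unfolding D_def distrib_right[of _ _ "sqrt 2"] by linarith
  qed
  also have "\<dots> = (4 * (BV + 1) * LTV + (1 + 3/2 * BV) + 3/2 * L) * T + 2 * norm (pV p - pV q)"
    by (simp add: algebra_simps)
  also have "\<dots> \<le> 3 * LF * T + 2 * norm (pV p - pV q)"
  proof (intro add_right_mono mult_right_mono T)
    have "0 \<le> (BV + 1) * LTV" using BV LTV by simp
    then show "4 * (BV + 1) * LTV + (1 + 3/2 * BV) + 3/2 * L \<le> 3 * LF"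
      unfolding LF_def using BV L by (simp add: algebra_simps)
  qed
  finally show ?thesis unfolding T_def .
qed

lemma mean_XV_lip:
  assumes pq: "p \<in> params" "q \<in> params"
  shows "norm (mean XV p - mean XV q) \<le> LG * (norm (pth p - pth q) + norm (pmu p - pmu q))
    + \<bar>pJ p - pJ q\<bar> + sqrt 2 * norm (pV p - pV q)"
proof -
  define T where "T = norm (pth p - pth q) + norm (pmu p - pmu q)"
  define M where "M = 1 + sqrt 2 * BV"
  define D where "D = L * norm (pmu p - pmu q) + sqrt 2 * norm (pV p - pV q) + \<bar>pJ p - pJ q\<bar>"
  have T: "0 \<le> T" "norm (softmax (pth p) - softmax (pth q)) + norm (pmu p - pmu q) \<le> T" "norm (pmu p - pmu q) \<le> T"
    unfolding T_def using softmax_lipschitz[of "pth p" "pth q"] by auto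
  have "norm (XV p s a s' - XV q s a s') \<le> D" for s a s'
    using td_diff[OF pq, of s a s']
    unfolding XV_def D_def by (simp add: scaleR_diff_left[symmetric] norm_axis_state)
  then have "norm (mean XV p - mean XV q) \<le> 2 * M * (LTV * (norm (softmax (pth p) - softmax (pth q)) + norm (pmu p - pmu q))) + D"
    unfolding M_def by (intro avg_perturb softmax_policy paramsD(4) pq XV_bound)
  also have "\<dots> \<le> 2 * M * (LTV * T) + D"
    unfolding M_def using T LTV BV by (intro add_right_mono mult_left_mono) auto
  also have "\<dots> \<le> (2 + 3 * BV) * (LTV * T) + (L * T + \<bar>pJ p - pJ q\<bar> + sqrt 2 * norm (pV p - pV q))"
  proof (rule add_mono)
    have "sqrt 2 * BV \<le> 3/2 * BV" using sqrt2_bounds BV by (intro mult_right_mono) auto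
    then have "2 * M \<le> 2 + 3 * BV" unfolding M_def by simp
    then show "2 * M * (LTV * T) \<le> (2 + 3 * BV) * (LTV * T)"
      using T(1) LTV by (intro mult_right_mono) auto
    show "D \<le> L * T + \<bar>pJ p - pJ q\<bar> + sqrt 2 * norm (pV p - pV q)" unfolding D_def using L T by simp
  qed
  also have "\<dots> = ((2 + 3 * BV) * LTV + L) * T + \<bar>pJ p - pJ q\<bar> + sqrt 2 * norm (pV p - pV q)"
    by (simp add: algebra_simps)
  also have "\<dots> \<le> LG * T + \<bar>pJ p - pJ q\<bar> + sqrt 2 * norm (pV p - pV q)"
  proof (intro add_right_mono mult_right_mono T)
    have "(2 + 3 * BV) * LTV \<le> 2 * (2 * (BV + cJ + 2)) * LTV" using BV LTV cJ by (intro mult_right_mono) auto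
    moreover have "L \<le> (L + 1) * (cJ + 1)" using L cJ mult_pos_pos[OF L cJ(1)] by (simp add: algebra_simps)
    ultimately show "(2 + 3 * BV) * LTV + L \<le> LG" unfolding LG_def by simp
  qed
  finally show ?thesis unfolding T_def .
qed

lemma mean_XJ: "p \<in> params \<Longrightarrow> mean XJ p = cJ * (Jf K r (softmax (pth p)) (pmu p) - pJ p)"
proof -
  assume p: "p \<in> params"
  have lin: "linear (\<lambda>x::real. cJ * x)" by (rule linearI) (auto simp: algebra_simps)
  show ?thesis unfolding XJ_def avg_linear[OF lin] avg_diff avg_rew
    by (simp add: avg_const[OF softmax_policy paramsD(4)[OF p]])
qed

lemma mean_XJ_lip:
  assumes pq: "p \<in> params" "q \<in> params"
  shows "\<bar>mean XJ p - mean XJ q\<bar> \<le> cJ * (LV * (norm (pth p - pth q) + norm (pmu p - pmu q)) + \<bar>pJ p - pJ q\<bar>)"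
proof -
  have "\<bar>(Jf K r (softmax (pth p)) (pmu p) - pJ p) - (Jf K r (softmax (pth q)) (pmu q) - pJ q)\<bar>
    \<le> LV * (norm (pth p - pth q) + norm (pmu p - pmu q)) + \<bar>pJ p - pJ q\<bar>"
    using Jf_lip[OF paramsD(4)[OF pq(1)] paramsD(4)[OF pq(2)], of "pth p" "pth q"] by linarith
  then show ?thesis unfolding mean_XJ[OF pq(1)] mean_XJ[OF pq(2)] right_diff_distrib[symmetric] abs_mult using cJ by simp
qed

lemma mean_XH: "p \<in> params \<Longrightarrow> mean XH p = stat_dist K (softmax (pth p)) (pmu p) - pmu p"
  unfolding XH_def avg_diff by (simp add: avg_axis_curr avg_const paramsD softmax_policy)

text \<open>Theta and mu are changed one after the other, so that the mu part is governed by the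
  contraction factor \<open>\<delta>\<close> < 1 and not by \<open>L\<close>.\<close>

lemma mean_XH_lip:
  assumes pq: "p \<in> params" "q \<in> params"
  shows "norm (mean XH p - mean XH q) \<le> 2 * L * norm (pth p - pth q) + 2 * norm (pmu p - pmu q)"
proof -
  let ?n = "\<lambda>p q. stat_dist K (softmax (pth p)) (pmu q)"
  have "norm (?n p p - ?n q p) \<le> 2 * (L * norm (softmax (pth p) - softmax (pth q)))"
    using norm_le_dTV[of "?n p p" "?n q p"] stat_lip[OF softmax_policy[of "pth p"] softmax_policy[of "pth q"] paramsD(4)[OF pq(1)] paramsD(4)[OF pq(1)]]
    by simp
  also have "\<dots> \<le> 2 * L * norm (pth p - pth q)"
    using softmax_lipschitz[of "pth p" "pth q"] L by simp
  finally have a: "norm (?n p p - ?n q p) \<le> 2 * L * norm (pth p - pth q)" .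
  have "norm (?n q p - ?n q q) \<le> \<delta> * norm (pmu p - pmu q)"
    by (rule stat_contraction[OF softmax_policy paramsD(4)[OF pq(1)] paramsD(4)[OF pq(2)]])
  also have "\<dots> \<le> 1 * norm (pmu p - pmu q)" using delta by (intro mult_right_mono) auto
  finally have b: "norm (?n q p - ?n q q) \<le> norm (pmu p - pmu q)" by simp
  have "norm (mean XH p - mean XH q) = norm ((?n p p - ?n q p) + (?n q p - ?n q q) - (pmu p - pmu q))"
    unfolding mean_XH[OF pq(1)] mean_XH[OF pq(2)] by (simp add: algebra_simps)
  also have "\<dots> \<le> norm (?n p p - ?n q p) + norm (?n q p - ?n q q) + norm (pmu p - pmu q)"
    by (meson norm_triangle_ineq norm_triangle_ineq4 add_right_mono order_trans)
  finally show ?thesis using a b by simp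
qed

end

section \<open>One step of the algorithm\<close>

definition tk :: "nat \<Rightarrow> real" where "tk k = 1 / sqrt (real k + 1)"

lemma tk_pos: "0 < tk k" and tk_le_one: "tk k \<le> 1"
  by (auto simp: tk_def)

lemma tk_sq: "(tk k)\<^sup>2 = 1 / (real k + 1)"
  by (simp add: tk_def power_divide)

text \<open>The weights of the correction terms change with k; this bound makes the change second
  order.\<close>

lemma tk_diff: "\<bar>tk (Suc k) - tk k\<bar> \<le> (tk k)\<^sup>2"
proof -
  define a where "a = sqrt (real k + 1)"
  define b where "b = sqrt (real k + 2)"
  have a: "1 \<le> a" "a \<le> b" unfolding a_def b_def by auto
  have "b\<^sup>2 \<le> (a + 1)\<^sup>2" using a unfolding a_def b_def by (simp add: power2_sum)
  then have b: "b \<le> a + 1" using a by (simp add: power2_le_iff_abs_le)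
  have "tk k - tk (Suc k) = (b - a) / (a * b)"
    unfolding tk_def using a by (simp add: a_def b_def divide_simps add.commute)
  also have "\<dots> \<le> 1 / (a * a)" using a b by (intro frac_le mult_left_mono) auto
  finally have "tk k - tk (Suc k) \<le> (tk k)\<^sup>2" unfolding tk_def a_def by (simp add: power2_eq_square)
  moreover have "tk (Suc k) \<le> tk k" unfolding tk_def by (intro divide_left_mono) auto
  ultimately show ?thesis by simp
qed

text \<open>Roles: \<open>z\<close> is the filter, \<open>zb\<close> and \<open>zb'\<close> its
  target before and after the step, \<open>X\<close> the sample, \<open>u\<close> and
  \<open>u'\<close> the Poisson solution at the next state with old and new parameters,
  \<open>l\<close> and \<open>l'\<close> consecutive gains. Replacing \<open>l'\<close>,
  \<open>y\<close>, \<open>u'\<close> in the correction by \<open>l\<close>, \<open>z - zb\<close>,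
  \<open>u\<close> costs 2, 3 and 2 times M^2 t^2, doubled to 14; the 9 from
  \<open>(norm w)^2\<close> makes 23. The surviving product with \<open>X - zb + u\<close> is what
  the Poisson equation averages.\<close>

lemma filter_step:
  fixes z zb zb' X u u' :: "'v::real_inner"
  assumes M: "1 \<le> M" "norm z \<le> M" "norm zb \<le> M" "norm zb' \<le> M" "norm X \<le> M" "norm u' \<le> M"
    and t: "0 \<le> t" "t \<le> 1" "norm (zb' - zb) \<le> M * t" "norm (u' - u) \<le> M * t"
    and l: "0 \<le> l" "l \<le> t" "\<bar>l' - l\<bar> \<le> t\<^sup>2"
  defines "y \<equiv> (1 - l) *\<^sub>R z + l *\<^sub>R X - zb'"
  shows "(norm y)\<^sup>2 + 2 * l' * (y \<bullet> u') \<le>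
    (norm (z - zb))\<^sup>2 - 2 * l * (norm (z - zb))\<^sup>2 + 2 * norm (z - zb) * norm (zb' - zb)
    + 2 * l * ((z - zb) \<bullet> (X - zb + u)) + 23 * M^3 * t\<^sup>2"
proof -
  define \<Delta> where "\<Delta> = z - zb"
  define w where "w = l *\<^sub>R (X - z) - (zb' - zb)"
  have yw: "y = \<Delta> + w" unfolding y_def \<Delta>_def w_def by (simp add: algebra_simps)
  have n\<Delta>: "norm \<Delta> \<le> 2 * M" unfolding \<Delta>_def using M norm_triangle_ineq4[of z zb] by simp
  have "norm (X - z) \<le> 2 * M" using M norm_triangle_ineq4[of X z] by simp
  then have "norm (l *\<^sub>R (X - z)) \<le> t * (2 * M)" using l by (simp add: mult_mono)
  then have nw: "norm w \<le> 3 * M * t" unfolding w_def using t(3) norm_triangle_ineq4[of "l *\<^sub>R (X - z)" "zb' - zb"]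
    by (simp add: mult_ac)
  have "norm ((1 - l) *\<^sub>R z + l *\<^sub>R X) \<le> (1 - l) * M + l * M"
    using M l t by (intro norm_triangle_mono) (auto intro!: mult_left_mono)
  then have ny: "norm y \<le> 2 * M" unfolding y_def using M norm_triangle_ineq4[of "(1 - l) *\<^sub>R z + l *\<^sub>R X" zb']
    by (simp add: algebra_simps)
  have "(norm y)\<^sup>2 = (norm \<Delta>)\<^sup>2 + 2 * (\<Delta> \<bullet> w) + (norm w)\<^sup>2"
    unfolding yw by (simp add: power2_norm_eq_inner inner_add_left inner_add_right inner_commute)
  moreover have "\<Delta> \<bullet> w = l * (\<Delta> \<bullet> (X - zb)) - l * (norm \<Delta>)\<^sup>2 - \<Delta> \<bullet> (zb' - zb)"
    unfolding w_def \<Delta>_def power2_norm_eq_inner by (simp add: inner_diff_left inner_diff_right inner_commute algebra_simps)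
  moreover have "- (\<Delta> \<bullet> (zb' - zb)) \<le> norm \<Delta> * norm (zb' - zb)"
    using Cauchy_Schwarz_ineq2[of \<Delta> "zb' - zb"] by linarith
  moreover have "(norm w)\<^sup>2 \<le> 9 * M^3 * t\<^sup>2"
  proof -
    have "(norm w)\<^sup>2 \<le> (3 * M * t)\<^sup>2" using nw by (intro power_mono) auto
    also have "\<dots> = 9 * M\<^sup>2 * t\<^sup>2" by (simp add: power_mult_distrib)
    also have "\<dots> \<le> 9 * M^3 * t\<^sup>2" using M(1) power_increasing[of 2 3 M] by (intro mult_right_mono) auto
    finally show ?thesis .
  qed
  moreover have "2 * l' * (y \<bullet> u') \<le> 2 * l * (\<Delta> \<bullet> u) + 14 * M^3 * t\<^sup>2"
  proof -
    have M23: "M * M \<le> M^3" using M(1) power_increasing[of 2 3 M] by (simp add: power2_eq_square)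
    have yu: "\<bar>y \<bullet> u'\<bar> \<le> 2 * M * M"
      using Cauchy_Schwarz_ineq2[of y u'] mult_mono[OF ny M(6)] M(1) by simp
    have wu: "\<bar>w \<bullet> u'\<bar> \<le> 3 * M * t * M"
      using Cauchy_Schwarz_ineq2[of w u'] mult_mono[OF nw M(6)] M(1) t by simp
    have du: "\<bar>\<Delta> \<bullet> (u' - u)\<bar> \<le> 2 * M * (M * t)"
      using Cauchy_Schwarz_ineq2[of \<Delta> "u' - u"] mult_mono[OF n\<Delta> t(4)] M(1) t by simp
    have "\<bar>(l' - l) * (y \<bullet> u')\<bar> \<le> t\<^sup>2 * (2 * M * M)" unfolding abs_mult
      using l(3) yu by (intro mult_mono) auto
    moreover have "\<bar>l * (w \<bullet> u')\<bar> \<le> t * (3 * M * t * M)" unfolding abs_mult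
      using l wu t by (intro mult_mono) auto
    moreover have "\<bar>l * (\<Delta> \<bullet> (u' - u))\<bar> \<le> t * (2 * M * (M * t))" unfolding abs_mult
      using l du t by (intro mult_mono) auto
    moreover have "l' * (y \<bullet> u') = l * (\<Delta> \<bullet> u) + (l' - l) * (y \<bullet> u') + l * (w \<bullet> u') + l * (\<Delta> \<bullet> (u' - u))"
      unfolding yw by (simp add: inner_add_left inner_diff_right algebra_simps)
    moreover have "t\<^sup>2 * (2 * M * M) = 2 * (M * M * t\<^sup>2)" "t * (3 * M * t * M) = 3 * (M * M * t\<^sup>2)"
      "t * (2 * M * (M * t)) = 2 * (M * M * t\<^sup>2)"
      by (simp_all add: power2_eq_square)
    ultimately have "2 * l' * (y \<bullet> u') \<le> 2 * l * (\<Delta> \<bullet> u) + 14 * (M * M * t\<^sup>2)"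
      unfolding abs_le_iff by argo
    then have "2 * l' * (y \<bullet> u') \<le> 2 * l * (\<Delta> \<bullet> u) + 14 * (M * M) * t\<^sup>2" by (simp add: mult.assoc)
    also have "\<dots> \<le> 2 * l * (\<Delta> \<bullet> u) + 14 * M^3 * t\<^sup>2"
      using M23 by (intro add_left_mono mult_right_mono) auto
    finally show ?thesis .
  qed
  ultimately show ?thesis unfolding \<Delta>_def[symmetric] by (simp add: inner_add_right algebra_simps)
qed

lemma act_pmf_softmax: "pmf (act_pmf (softmax \<theta>) s) a = softmax \<theta> $ s $ a"
  unfolding act_pmf_def
proof (rule pmf_embed_pmf)
  have "(\<integral>\<^sup>+ x. ennreal (softmax \<theta> $ s $ x) \<partial>count_space UNIV) = ennreal (\<Sum>x\<in>UNIV. softmax \<theta> $ s $ x)"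
    by (subst nn_integral_count_space_finite) (auto simp: sum_ennreal policy_nonneg[OF softmax_policy])
  then show "(\<integral>\<^sup>+ x. ennreal (softmax \<theta> $ s $ x) \<partial>count_space UNIV) = 1"
    by (simp add: policy_sum[OF softmax_policy])
qed (simp add: policy_nonneg[OF softmax_policy])

text \<open>\<open>u\<close> is the distance of the reward estimate to one end of the interval and
  \<open>g\<close> its speed towards that end. A ray g = m u is invariant for the continuous system
  if \<beta> m^2 - l m + l c <= 0; the slope \<open>2 * c\<close> satisfies this when
  \<open>4 * \<beta> * c <= l\<close>, and is the double root in the critical case. The other part
  of the bound, \<open>\<epsilon>\<close>, decays at half the rate of the filter.\<close>

lemma overdamped_invariant:
  fixes g u u' c \<beta> l \<epsilon> :: real
  assumes "0 \<le> u" "0 \<le> \<epsilon>" "0 < c" "0 \<le> \<beta>" "4 * \<beta> * c \<le> l" "l \<le> 1"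
    and g: "g \<le> 2 * c * u + \<epsilon>" and y: "y \<le> c * u"
    and u': "g \<le> 0 \<Longrightarrow> u \<le> u'" "0 \<le> g \<Longrightarrow> u - \<beta> * g \<le> u'"
  shows "(1 - l) * g + l * y \<le> 2 * c * u' + (1 - l / 2) * \<epsilon>"
proof -
  have "0 \<le> 4 * \<beta> * c" using assms by simp
  then have l: "0 \<le> l" using assms(5) by linarith
  have ly: "l * y \<le> l * (c * u)" using l y by (rule mult_left_mono[rotated])
  show ?thesis
  proof (cases "g \<le> 0")
    case True
    have "(1 - l) * g \<le> 0" using True assms(6) by (simp add: mult_nonneg_nonpos)
    moreover have "l * (c * u) \<le> 1 * (c * u)" using assms by (intro mult_right_mono) auto
    moreover have "c * u \<le> c * u'" using u'(1)[OF True] assms by simp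
    moreover have "0 \<le> c * u" using assms by simp
    moreover have "0 \<le> (1 - l / 2) * \<epsilon>" using assms by simp
    ultimately show ?thesis using ly by linarith
  next
    case False
    have "\<beta> * g \<le> \<beta> * (2 * c * u + \<epsilon>)" using g assms by (intro mult_left_mono) auto
    then have "u - \<beta> * (2 * c * u + \<epsilon>) \<le> u'" using u'(2) False by linarith
    then have "2 * c * (u - \<beta> * (2 * c * u + \<epsilon>)) \<le> 2 * c * u'" using assms by simp
    moreover have "(1 - l) * g \<le> (1 - l) * (2 * c * u + \<epsilon>)" using g assms by (intro mult_left_mono) auto
    moreover have "4 * \<beta> * c * (c * u) \<le> l * (c * u)" "4 * \<beta> * c * \<epsilon> \<le> l * \<epsilon>"
      using mult_right_mono[OF assms(5), of "c * u"] mult_right_mono[OF assms(5), of \<epsilon>] assms(1-3) by auto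
    ultimately show ?thesis using ly by (simp add: algebra_simps)
  qed
qed

lemma closest_point_interval:
  assumes "(a::real) \<le> b" shows "closest_point {a..b} x = max a (min b x)"
  by (rule closest_point_unique[symmetric]) (use assms in \<open>auto simp: dist_real_def\<close>)

lemma closest_point_nonexpansive:
  fixes S :: "'v::euclidean_space set"
  assumes "closed S" "convex S" "y \<in> S"
  shows "norm (closest_point S x - y) \<le> norm (x - y)"
  using closest_point_lipschitz[OF assms(2,1), of x y] closest_point_self[OF assms(3)] assms(3)
  by (auto simp: dist_norm)

text \<open>Projection onto the ball of radius B is multiplication by 1 - shrink B y.\<close>

definition shrink :: "real \<Rightarrow> 'v::real_normed_vector \<Rightarrow> real" where
  "shrink B y = (if norm y \<le> B then 0 else 1 - B / norm y)"

lemma closest_point_ball: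
  fixes y :: "'v::euclidean_space"
  assumes B: "0 < B"
  shows "closest_point (cball 0 B) y = (1 - shrink B y) *\<^sub>R y \<and> 0 \<le> shrink B y \<and> shrink B y \<le> 1 \<and>
    shrink B y * norm y = max 0 (norm y - B) \<and> (shrink B y = 0 \<or> B \<le> norm y)"
proof (cases "norm y \<le> B")
  case True
  then show "closest_point (cball 0 B) y = (1 - shrink B y) *\<^sub>R y \<and> 0 \<le> shrink B y \<and> shrink B y \<le> 1 \<and>
    shrink B y * norm y = max 0 (norm y - B) \<and> (shrink B y = 0 \<or> B \<le> norm y)"
    using closest_point_self[of y "cball 0 B"] by (simp add: shrink_def)
next
  case False
  define \<eta> where "\<eta> = 1 - B / norm y"
  have sh: "shrink B y = \<eta>" using False by (simp add: shrink_def \<eta>_def)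
  have y: "0 < norm y" "B < norm y" using False B by auto
  have nz: "norm ((1 - \<eta>) *\<^sub>R y) = B" unfolding \<eta>_def using y B by simp
  have "(1 - \<eta>) *\<^sub>R y = closest_point (cball 0 B) y"
  proof (rule closest_point_unique)
    show "\<forall>z\<in>cball 0 B. dist y ((1 - \<eta>) *\<^sub>R y) \<le> dist y z"
    proof
      fix z :: 'v assume "z \<in> cball 0 B"
      then have "norm y - B \<le> norm (y - z)" using norm_triangle_ineq2[of y z] by simp
      moreover have "norm (y - (1 - \<eta>) *\<^sub>R y) = norm y - B"
      proof -
        have "y - (1 - \<eta>) *\<^sub>R y = \<eta> *\<^sub>R y" by (simp add: algebra_simps)
        moreover have "0 \<le> \<eta>" "\<eta> * norm y = norm y - B" unfolding \<eta>_def using y B by (auto simp: field_simps)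
        ultimately show ?thesis by (simp only: norm_scaleR abs_of_nonneg)
      qed
      ultimately show "dist y ((1 - \<eta>) *\<^sub>R y) \<le> dist y z" by (simp add: dist_norm)
    qed
  qed (use nz in auto)
  moreover have "\<eta> * norm y = norm y - B" "0 \<le> \<eta>" "\<eta> \<le> 1" unfolding \<eta>_def using y B by (auto simp: field_simps)
  ultimately show "closest_point (cball 0 B) y = (1 - shrink B y) *\<^sub>R y \<and> 0 \<le> shrink B y \<and> shrink B y \<le> 1 \<and>
    shrink B y * norm y = max 0 (norm y - B) \<and> (shrink B y = 0 \<or> B \<le> norm y)"
    unfolding sh using y by auto
qed

text \<open>\<open>S1\<close> and \<open>S2\<close> come from two of the terms in the minimum C_xi,
  \<open>S3\<close> from two summands of the denominator in the second bound on xi, and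
  \<open>S4\<close> from the first bound on beta with |S| >= 1. The size \<open>E1\<close> is chosen
  later from the initial data.\<close>

locale mfg_alg = mfg K C0 C1 r \<delta> L BV LV LTV \<gamma> \<rho> cJ
  for K :: "real^'s::finite \<Rightarrow> 's \<Rightarrow> 'a::finite \<Rightarrow> 's pmf" and C0 C1 r \<delta> L BV LV LTV \<gamma> \<rho> cJ +
  fixes al be xi lam E1 :: real
  assumes pos: "0 < al" "al \<le> xi" "xi \<le> be" "be \<le> lam" "lam \<le> 1/4"
    and S1: "16 * L * LF * LV * al \<le> (1 - \<delta>) * xi"
    and S2: "32 * \<rho> * LF\<^sup>2 * al \<le> (1 - \<delta>) * xi"
    and S3: "6912 * (LF^4 * LV\<^sup>2) * xi \<le> (1 - \<delta>) * \<gamma> * be"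
      "6912 * (LF\<^sup>2 * LG\<^sup>2 * (L + 1)\<^sup>2 * LV\<^sup>2) * xi \<le> (1 - \<delta>) * \<gamma> * be"
    and S4: "(72 * LG\<^sup>2 + 36 * LF\<^sup>2 + 8 / \<gamma>) * be \<le> lam"
    and E1: "0 \<le> E1"
begin

lemma pos': "0 < xi" "0 < be" "0 < lam" using pos by auto

lemma LF_ge: "5 \<le> LF" "10 * BV + 5 \<le> LF"
  unfolding LF_def using BV L LTV mult_nonneg_nonneg[of "BV + 1" LTV] by auto

lemma LG_ge: "cJ + 3 \<le> LG"
proof -
  have "0 \<le> 2 * (2 * (BV + cJ + 2)) * LTV" using BV cJ LTV by simp
  moreover have "cJ + 1 \<le> (L + 1) * (cJ + 1)" using L cJ by simp
  ultimately show ?thesis unfolding LG_def by linarith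
qed

lemma overdamped: "72 * (cJ + 3)\<^sup>2 * be \<le> lam" "4 * be * cJ \<le> lam"
proof -
  have "(cJ + 3)\<^sup>2 \<le> LG\<^sup>2" using LG_ge cJ by (intro power_mono) auto
  moreover have "0 \<le> 8 / \<gamma>" "0 \<le> LF\<^sup>2" using gam by auto
  ultimately have "72 * (cJ + 3)\<^sup>2 \<le> 72 * LG\<^sup>2 + 36 * LF\<^sup>2 + 8 / \<gamma>" by linarith
  then have "72 * (cJ + 3)\<^sup>2 * be \<le> (72 * LG\<^sup>2 + 36 * LF\<^sup>2 + 8 / \<gamma>) * be"
    using pos' by (intro mult_right_mono) auto
  then show *: "72 * (cJ + 3)\<^sup>2 * be \<le> lam" using S4 by linarith
  have "4 * cJ * be \<le> 72 * (cJ + 3)\<^sup>2 * be"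
    using pos' cJ by (intro mult_right_mono) (auto simp: power2_eq_square algebra_simps)
  then show "4 * be * cJ \<le> lam" using * by (simp add: mult_ac)
qed

definition par :: "('s, 'a) alg_state \<Rightarrow> (real^'a^'s) \<times> (real^'s) \<times> real \<times> (real^'s)" where
  "par x = (th x, Vh x, Jh x, muh x)"

lemma par_simps: "pth (par x) = th x" "pV (par x) = Vh x" "pJ (par x) = Jh x" "pmu (par x) = muh x"
  by (simp_all add: par_def)

text \<open>Given the sampled action and state a step is deterministic. Moreover the parameters move
  with the old filter values, so \<open>par\<close> of the result does not depend on the sample;
  only the filters and the chain state do.\<close>

definition nxt :: "nat \<Rightarrow> ('s, 'a) alg_state \<Rightarrow> 'a \<Rightarrow> 's \<Rightarrow> ('s, 'a) alg_state" where
  "nxt k x a s' =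
       \<lparr> th = th x + (al * tk k) *\<^sub>R fv x,
         Vh = closest_point (cball 0 BV) (Vh x + (be * tk k) *\<^sub>R gV x),
         Jh = closest_point {0..1} (Jh x + (be * tk k) * gJ x),
         muh = closest_point prob_simplex (muh x + (xi * tk k) *\<^sub>R hv x),
         fv = (1 - lam * tk k) *\<^sub>R fv x + (lam * tk k) *\<^sub>R XF (par x) (st x) a s',
         gV = (1 - lam * tk k) *\<^sub>R gV x + (lam * tk k) *\<^sub>R XV (par x) (st x) a s',
         gJ = (1 - lam * tk k) *\<^sub>R gJ x + (lam * tk k) *\<^sub>R XJ (par x) (st x) a s',
         hv = (1 - lam * tk k) *\<^sub>R hv x + (lam * tk k) *\<^sub>R XH (par x) (st x) a s',
         st = s' \<rparr>"

definition Estep :: "nat \<Rightarrow> ('s, 'a) alg_state \<Rightarrow> (('s, 'a) alg_state \<Rightarrow> real) \<Rightarrow> real" where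
  "Estep k x g = loc_avg (softmax (th x)) (muh x) (\<lambda>_ a s'. g (nxt k x a s')) (st x)"

abbreviation "astep \<equiv> alg_step K r cJ BV (\<lambda>k. al / sqrt (real k + 1)) (\<lambda>k. be / sqrt (real k + 1))
  (\<lambda>k. xi / sqrt (real k + 1)) (\<lambda>k. lam / sqrt (real k + 1))"

abbreviation "adist \<equiv> alg_dist K r cJ BV (\<lambda>k. al / sqrt (real k + 1)) (\<lambda>k. be / sqrt (real k + 1))
  (\<lambda>k. xi / sqrt (real k + 1)) (\<lambda>k. lam / sqrt (real k + 1))"

lemma div_sqrt_tk: "c / sqrt (real k + 1) = c * tk k"
  by (simp add: tk_def)

lemma astep_eq: "astep k x = act_pmf (softmax (th x)) (st x) \<bind> (\<lambda>a. K (muh x) (st x) a \<bind> (\<lambda>s'. return_pmf (nxt k x a s')))"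
  unfolding alg_step_def nxt_def div_sqrt_tk gradf_log_softmax Let_def XF_def XV_def XJ_def XH_def par_simps
  by (simp add: mult.assoc)

lemma finite_astep: "finite (set_pmf (astep k x))"
  unfolding astep_eq by (auto simp: set_bind_pmf)

lemma set_astep: "set_pmf (astep k x) \<subseteq> {nxt k x a s' | a s'. True}"
  unfolding astep_eq by (auto simp: set_bind_pmf)

lemma finite_adist: "finite (set_pmf (adist x0 k))"
  by (induction k) (auto simp: set_bind_pmf finite_astep)

lemma expectation_astep: "measure_pmf.expectation (astep k x) g = Estep k x g"
proof -
  have "measure_pmf.expectation (K (muh x) (st x) a \<bind> (\<lambda>s'. return_pmf (nxt k x a s'))) g =
    (\<Sum>s'\<in>UNIV. pmf (K (muh x) (st x) a) s' * g (nxt k x a s'))" for a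
    by (subst pmf_expectation_bind[of UNIV]) auto
  then have "measure_pmf.expectation (astep k x) g =
    (\<Sum>a\<in>UNIV. softmax (th x) $ st x $ a * (\<Sum>s'\<in>UNIV. pmf (K (muh x) (st x) a) s' * g (nxt k x a s')))"
    unfolding astep_eq by (subst pmf_expectation_bind[of UNIV]) (auto simp: set_bind_pmf act_pmf_softmax)
  then show ?thesis unfolding Estep_def loc_avg_def by (simp add: sum_distrib_left mult.assoc)
qed

lemma expectation_adist_Suc:
  "measure_pmf.expectation (adist x0 (Suc k)) g = measure_pmf.expectation (adist x0 k) (\<lambda>x. Estep k x g)"
proof -
  have "measure_pmf.expectation (adist x0 (Suc k)) g =
     (\<Sum>x\<in>set_pmf (adist x0 k). pmf (adist x0 k) x * measure_pmf.expectation (astep k x) g)"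
    unfolding alg_dist.simps by (subst pmf_expectation_bind[OF finite_adist]) (auto simp: finite_astep)
  also have "\<dots> = measure_pmf.expectation (adist x0 k) (\<lambda>x. Estep k x g)"
    unfolding expectation_astep by (subst integral_measure_pmf[OF finite_adist]) (auto simp: set_pmf_iff)
  finally show ?thesis .
qed

text \<open>The induction starts at 1 because \<open>V0\<close> and \<open>J0\<close> are arbitrary:
  only the first projection brings the parameters into \<open>params\<close>.\<close>

lemma adist_invariant:
  assumes "\<And>x. x \<in> set_pmf (adist x0 1) \<Longrightarrow> P 1 x"
    and "\<And>k x a s'. 1 \<le> k \<Longrightarrow> P k x \<Longrightarrow> P (Suc k) (nxt k x a s')"
  shows "1 \<le> k \<Longrightarrow> x \<in> set_pmf (adist x0 k) \<Longrightarrow> P k x"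
proof (induction k arbitrary: x rule: dec_induct)
  case base then show ?case using assms(1) by simp
next
  case (step k)
  then obtain y where y: "y \<in> set_pmf (adist x0 k)" "x \<in> set_pmf (astep k y)"
    by (auto simp: set_bind_pmf)
  with set_astep[of k y] obtain a s' where "x = nxt k y a s'" by auto
  then show ?case using assms(2)[OF step(1)] step.IH[OF y(1)] by simp
qed

text \<open>The initial V0 and J0 are arbitrary, so the first increments may violate the steady-state bounds on
  the filters; E1 bounds the excess, and ee k is what is left of it at step k. Only sums of tk k * ee k enter.\<close>

primrec ee :: "nat \<Rightarrow> real" where
  "ee 0 = E1"
| "ee (Suc k) = (1 - lam * tk k / 2) * ee k"

lemma lam_tk: "0 < lam * tk k" "lam * tk k \<le> 1/4" "lam * tk k \<le> tk k"
proof -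
  show "0 < lam * tk k" using pos' tk_pos by simp
  show "lam * tk k \<le> 1/4" using mult_mono[of lam "1/4" "tk k" 1] pos tk_le_one tk_pos[of k] by simp
  show "lam * tk k \<le> tk k" using mult_right_mono[of lam 1 "tk k"] pos tk_pos[of k] by simp
qed

lemma ee_nonneg: "0 \<le> ee k"
proof (induction k)
  case (Suc k) then show ?case using lam_tk[of k] by simp
qed (simp add: E1)

lemma ee_le: "ee k \<le> E1"
proof (induction k)
  case (Suc k)
  have "(1 - lam * tk k / 2) * ee k \<le> 1 * ee k" using lam_tk[of k] ee_nonneg by (intro mult_right_mono) auto
  then show ?case using Suc by simp
qed simp

lemma ee_sum: "lam / 2 * (\<Sum>i<k. tk i * ee i) = E1 - ee k"
  by (induction k) (auto simp: algebra_simps)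

text \<open>The one-sided bounds on gJ express that the pair (Jh, gJ) is overdamped: near an end of the unit
  interval gJ points inwards up to ee k, hence the projection of Jh acts only at second order.\<close>

definition Inv :: "nat \<Rightarrow> ('s, 'a) alg_state \<Rightarrow> bool" where
  "Inv k x \<longleftrightarrow> par x \<in> params \<and> norm (fv x) \<le> (1 + sqrt 2 * BV) * sqrt 2 + E1
    \<and> norm (gV x) \<le> 1 + sqrt 2 * BV + ee k
    \<and> gJ x \<le> 2 * cJ * (1 - Jh x) + ee k \<and> - gJ x \<le> 2 * cJ * Jh x + ee k \<and> norm (hv x) \<le> 2"

lemma convex_step_bound:
  fixes z X :: "'v::real_normed_vector"
  assumes "norm z \<le> m + e" "norm X \<le> m" "0 \<le> l" "l \<le> 1"
  shows "norm ((1 - l) *\<^sub>R z + l *\<^sub>R X) \<le> m + (1 - l) * e"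
proof -
  have "norm ((1 - l) *\<^sub>R z + l *\<^sub>R X) \<le> (1 - l) * (m + e) + l * m"
    using assms by (intro norm_triangle_mono) (auto intro!: mult_left_mono)
  then show ?thesis by (simp add: algebra_simps)
qed

lemma par_nxt_params: "par (nxt k x a s') \<in> params"
proof -
  have "closest_point (cball 0 BV) v \<in> cball 0 BV" for v :: "real^'s"
    by (rule closest_point_in_set) (use BV in auto)
  moreover have "closest_point {0..1} v \<in> {0..1::real}" for v
    by (rule closest_point_in_set) auto
  moreover have "closest_point prob_simplex v \<in> (prob_simplex :: (real^'s) set)" for v
    by (rule closest_point_in_set) (auto simp: closed_simplex simplex_nonempty)
  ultimately show ?thesis by (auto simp: params_def par_def nxt_def)
qed

lemma Inv_nxt:
  assumes "Inv k x" shows "Inv (Suc k) (nxt k x a s')"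
proof -
  have p: "par x \<in> params" using assms by (simp add: Inv_def)
  note l = lam_tk[of k]
  have ee: "(1 - lam * tk k) * ee k \<le> ee (Suc k)" "0 \<le> ee k" using ee_nonneg[of k] l by (auto intro!: mult_right_mono)
  have f: "norm (fv (nxt k x a s')) \<le> (1 + sqrt 2 * BV) * sqrt 2 + E1"
  proof -
    have "norm (fv (nxt k x a s')) \<le> (1 + sqrt 2 * BV) * sqrt 2 + (1 - lam * tk k) * E1"
      using assms l unfolding nxt_def alg_state.simps by (intro convex_step_bound XF_bound p) (auto simp: Inv_def)
    moreover have "(1 - lam * tk k) * E1 \<le> 1 * E1" using E1 l by (intro mult_right_mono) auto
    ultimately show ?thesis by simp
  qed
  have g: "norm (gV (nxt k x a s')) \<le> 1 + sqrt 2 * BV + ee (Suc k)"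
  proof -
    have "norm (gV (nxt k x a s')) \<le> 1 + sqrt 2 * BV + (1 - lam * tk k) * ee k"
      using assms l unfolding nxt_def alg_state.simps by (intro convex_step_bound XV_bound p) (auto simp: Inv_def)
    then show ?thesis using ee by simp
  qed
  have h: "norm (hv (nxt k x a s')) \<le> 2"
  proof -
    have "norm (hv (nxt k x a s')) \<le> 2 + (1 - lam * tk k) * 0"
      using assms l unfolding nxt_def alg_state.simps by (intro convex_step_bound XH_bound p) (auto simp: Inv_def)
    then show ?thesis by simp
  qed
  define b where "b = be * tk k"
  have b: "0 \<le> b" "4 * b * cJ \<le> lam * tk k" unfolding b_def
    using pos' tk_pos[of k] mult_right_mono[OF overdamped(2), of "tk k"] by (auto simp: mult_ac)
  have J: "0 \<le> Jh x" "Jh x \<le> 1" using paramsD[OF p] by (auto simp: par_simps)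
  have J': "Jh (nxt k x a s') = max 0 (min 1 (Jh x + b * gJ x))"
    by (simp add: nxt_def b_def closest_point_interval)
  have R: "XJ (par x) (st x) a s' \<le> cJ * (1 - Jh x)" "- XJ (par x) (st x) a s' \<le> cJ * Jh x"
    unfolding XJ_def par_simps using rew[OF paramsD(4)[OF p], of "st x" a] cJ
    by (auto simp: par_simps mult_le_cancel_left simp flip: mult_minus_right)
  have 1: "gJ (nxt k x a s') \<le> 2 * cJ * (1 - Jh (nxt k x a s')) + ee (Suc k)"
  proof -
    have "(1 - lam * tk k) * gJ x + lam * tk k * XJ (par x) (st x) a s' \<le> 2 * cJ * (1 - Jh (nxt k x a s')) + (1 - lam * tk k / 2) * ee k"
    proof (rule overdamped_invariant[where u = "1 - Jh x" and \<beta> = b])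
      show "gJ x \<le> 0 \<Longrightarrow> 1 - Jh x \<le> 1 - Jh (nxt k x a s')"
        unfolding J' using J b(1) mult_nonneg_nonpos[of b "gJ x"] by auto
      show "0 \<le> gJ x \<Longrightarrow> 1 - Jh x - b * gJ x \<le> 1 - Jh (nxt k x a s')"
        unfolding J' using J b(1) mult_nonneg_nonneg[of b "gJ x"] by auto
    qed (use assms J b l cJ ee R in \<open>auto simp: Inv_def\<close>)
    then show ?thesis by (simp add: nxt_def)
  qed
  have 2: "- gJ (nxt k x a s') \<le> 2 * cJ * Jh (nxt k x a s') + ee (Suc k)"
  proof -
    have "(1 - lam * tk k) * (- gJ x) + lam * tk k * (- XJ (par x) (st x) a s') \<le> 2 * cJ * Jh (nxt k x a s') + (1 - lam * tk k / 2) * ee k"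
    proof (rule overdamped_invariant[where u = "Jh x" and \<beta> = b])
      show "- gJ x \<le> 0 \<Longrightarrow> Jh x \<le> Jh (nxt k x a s')"
        unfolding J' using J b(1) mult_nonneg_nonneg[of b "gJ x"] by auto
      show "0 \<le> - gJ x \<Longrightarrow> Jh x - b * - gJ x \<le> Jh (nxt k x a s')"
        unfolding J' using J b(1) mult_nonneg_nonpos[of b "gJ x"] by auto
    qed (use assms J b l cJ ee R in \<open>auto simp: Inv_def\<close>)
    then show ?thesis by (simp add: nxt_def algebra_simps)
  qed
  show ?thesis unfolding Inv_def using f g h 1 2 par_nxt_params by blast
qed

text \<open>With step b = \<open>be * tk k\<close> the part \<open>2 * cJ * (1 - Jh x)\<close> of
  the speed covers at most half of the distance to the end, as \<open>4 * b * cJ <= 1\<close>. Only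
  the transient part \<open>ee k\<close> can therefore be clipped.\<close>

lemma clip_excess:
  assumes "Inv k x"
  shows "\<bar>Jh x + be * tk k * gJ x - Jh (nxt k x a s')\<bar> \<le> be * tk k * ee k"
proof -
  define b where "b = be * tk k"
  have "4 * b * cJ \<le> lam * tk k" unfolding b_def
    using tk_pos[of k] mult_right_mono[OF overdamped(2), of "tk k"] by (simp add: mult_ac)
  then have b: "4 * b * cJ \<le> 1" "0 \<le> b"
    using lam_tk[of k] pos' tk_pos[of k] by (linarith, simp add: b_def)
  have p: "par x \<in> params" using assms by (simp add: Inv_def)
  have J: "0 \<le> Jh x" "Jh x \<le> 1" using paramsD[OF p] by (auto simp: par_simps)
  have g: "b * gJ x \<le> b * (2 * cJ * (1 - Jh x) + ee k)" "b * (- gJ x) \<le> b * (2 * cJ * Jh x + ee k)"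
    using assms mult_left_mono[OF _ b(2), of "gJ x"] mult_left_mono[OF _ b(2), of "- gJ x"] unfolding Inv_def by blast+
  have c: "4 * b * cJ * (1 - Jh x) \<le> 1 * (1 - Jh x)" "4 * b * cJ * Jh x \<le> 1 * Jh x"
    using mult_right_mono[OF b(1), of "1 - Jh x"] mult_right_mono[OF b(1), of "Jh x"] J by auto
  have e: "0 \<le> b * ee k" using b ee_nonneg by simp
  have "b * gJ x \<le> (1 - Jh x) + b * ee k" "- (b * gJ x) \<le> Jh x + b * ee k"
    using g c J by (auto simp: algebra_simps)
  then show ?thesis unfolding b_def[symmetric] using e
    by (simp add: nxt_def b_def[symmetric] closest_point_interval max_def min_def)
qed

lemma Inv_bounds: "\<exists>M\<ge>1. \<forall>k x. Inv k x \<longrightarrow> norm (fv x) \<le> M \<and> norm (gV x) \<le> M \<and> \<bar>gJ x\<bar> \<le> M \<and> norm (hv x) \<le> M"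
proof (intro exI conjI allI impI)
  let ?M = "1 + (1 + sqrt 2 * BV) * sqrt 2 + E1 + (1 + sqrt 2 * BV + E1) + (2 * cJ + E1) + 2"
  have n: "0 \<le> sqrt 2 * BV" "0 \<le> (1 + sqrt 2 * BV) * sqrt 2" using BV by auto
  show "1 \<le> ?M" using n E1 cJ by linarith
  fix k x assume I: "Inv k x"
  have p: "par x \<in> params" using I by (simp add: Inv_def)
  have J: "0 \<le> Jh x" "Jh x \<le> 1" using paramsD[OF p] by (auto simp: par_simps)
  have c: "cJ * (1 - Jh x) \<le> cJ * 1" "cJ * Jh x \<le> cJ * 1" using J cJ by (auto intro!: mult_left_mono)
  show "norm (fv x) \<le> ?M" "norm (gV x) \<le> ?M" "\<bar>gJ x\<bar> \<le> ?M" "norm (hv x) \<le> ?M"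
    using I[unfolded Inv_def] n E1 cJ(1) c ee_le[of k] unfolding abs_le_iff mult_1_right right_diff_distrib mult.assoc
    by linarith+
qed

lemma par_step:
  assumes p: "par x \<in> params"
  shows "norm (th (nxt k x a s') - th x) = al * tk k * norm (fv x)"
    "norm (Vh (nxt k x a s') - Vh x) \<le> be * tk k * norm (gV x)"
    "\<bar>Jh (nxt k x a s') - Jh x\<bar> \<le> be * tk k * \<bar>gJ x\<bar>"
    "norm (muh (nxt k x a s') - muh x) \<le> xi * tk k * norm (hv x)"
proof -
  note n = pos pos' tk_pos[of k]
  show "norm (th (nxt k x a s') - th x) = al * tk k * norm (fv x)" using n by (simp add: nxt_def)
  have "norm (closest_point (cball 0 BV) (Vh x + (be * tk k) *\<^sub>R gV x) - Vh x) \<le> norm (Vh x + (be * tk k) *\<^sub>R gV x - Vh x)"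
    by (rule closest_point_nonexpansive) (use paramsD[OF p] in \<open>auto simp: par_simps\<close>)
  then show "norm (Vh (nxt k x a s') - Vh x) \<le> be * tk k * norm (gV x)" using n by (simp add: nxt_def)
  have "norm (closest_point {0..1} (Jh x + (be * tk k) * gJ x) - Jh x) \<le> norm (Jh x + (be * tk k) * gJ x - Jh x)"
    by (rule closest_point_nonexpansive) (use paramsD[OF p] in \<open>auto simp: par_simps\<close>)
  then show "\<bar>Jh (nxt k x a s') - Jh x\<bar> \<le> be * tk k * \<bar>gJ x\<bar>" using n by (simp add: nxt_def abs_mult)
  have "norm (closest_point prob_simplex (muh x + (xi * tk k) *\<^sub>R hv x) - muh x) \<le> norm (muh x + (xi * tk k) *\<^sub>R hv x - muh x)"
    by (rule closest_point_nonexpansive) (use paramsD[OF p] in \<open>auto simp: par_simps closed_simplex convex_simplex\<close>)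
  then show "norm (muh (nxt k x a s') - muh x) \<le> xi * tk k * norm (hv x)" using n by (simp add: nxt_def)
qed

lemma par_step_bound: "\<exists>C\<ge>0. \<forall>k x a s'. Inv k x \<longrightarrow> norm (par (nxt k x a s') - par x) \<le> C * tk k"
proof -
  obtain M where M: "M \<ge> 1" "\<And>k x. Inv k x \<Longrightarrow> norm (fv x) \<le> M \<and> norm (gV x) \<le> M \<and> \<bar>gJ x\<bar> \<le> M \<and> norm (hv x) \<le> M"
    using Inv_bounds by blast
  show ?thesis
  proof (intro exI[of _ "4 * M"] conjI allI impI)
    fix k x a s' assume I: "Inv k x"
    have p: "par x \<in> params" using I by (simp add: Inv_def)
    have le: "c * tk k * y \<le> M * tk k" if "0 \<le> c" "c \<le> 1" "y \<le> M" "0 \<le> y" for c y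
    proof -
      have "c * y \<le> 1 * M" using that by (intro mult_mono) auto
      then have "c * y * tk k \<le> M * tk k" using tk_pos[of k] by simp
      then show ?thesis by (simp add: mult_ac)
    qed
    have four: "norm (a, b, c, d) \<le> norm a + norm b + norm c + norm d"
      for a :: "real^'a^'s" and b :: "real^'s" and c :: real and d :: "real^'s"
      using norm_Pair_le[of a "(b, c, d)"] norm_Pair_le[of b "(c, d)"] norm_Pair_le[of c d] by linarith
    have "norm (par (nxt k x a s') - par x) \<le> norm (th (nxt k x a s') - th x) + norm (Vh (nxt k x a s') - Vh x)
       + \<bar>Jh (nxt k x a s') - Jh x\<bar> + norm (muh (nxt k x a s') - muh x)"
      unfolding par_def diff_Pair using four by simp
    also have "\<dots> \<le> M * tk k + M * tk k + M * tk k + M * tk k"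
      using par_step[OF p, of k a s'] le[of al "norm (fv x)"] le[of be "norm (gV x)"] le[of be "\<bar>gJ x\<bar>"] le[of xi "norm (hv x)"]
        M(2)[OF I] pos pos' by simp
    finally show "norm (par (nxt k x a s') - par x) \<le> 4 * M * tk k" by simp
  qed (use M in simp)
qed

definition fterm where
  "fterm X z k x = (norm (z x - mean X (par x)))\<^sup>2
     + 2 * (lam * tk k) * ((z x - mean X (par x)) \<bullet> poisson (softmax (th x)) (muh x) (X (par x)) (st x))"

lemma loc_avg_real_add: "loc_avg \<pi> \<mu> (\<lambda>s a s'. X s a s' + c) s = loc_avg \<pi> \<mu> X s + (c::real)"
  if "\<pi> \<in> mfg_policies"
  unfolding loc_avg_add using loc_avg_curr[OF that, where g = "\<lambda>_. c"] by simp

text \<open>The averaged form of \<open>filter_step\<close>. Constants have to be uniform in the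
  state and in k; boundedness of the samples, their means and the Poisson solutions on
  \<open>params\<close> supplies them, with a maximum over the finitely many states and
  actions.\<close>

lemma filter_drift:
  fixes X :: "(real^'a^'s) \<times> (real^'s) \<times> real \<times> (real^'s) \<Rightarrow> 's \<Rightarrow> 'a \<Rightarrow> 's \<Rightarrow> 'v::real_inner"
  assumes X: "\<And>s a s'. blip params (\<lambda>p. X p s a s')"
    and z: "\<And>k x a s'. z (nxt k x a s') = (1 - lam * tk k) *\<^sub>R z x + (lam * tk k) *\<^sub>R X (par x) (st x) a s'"
    and zb: "\<And>k x. Inv k x \<Longrightarrow> norm (z x) \<le> B"
  shows "\<exists>C. \<forall>k x a s'. Inv k x \<longrightarrow> Estep k x (fterm X z (Suc k)) \<le> fterm X z k x
     - 2 * (lam * tk k) * (norm (z x - mean X (par x)))\<^sup>2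
     + 2 * norm (z x - mean X (par x)) * norm (mean X (par (nxt k x a s')) - mean X (par x)) + C * (tk k)\<^sup>2"
proof -
  obtain CX where CX: "\<And>p s a s'. p \<in> params \<Longrightarrow> norm (X p s a s') \<le> CX"
  proof -
    have "\<forall>i::'s \<times> 'a \<times> 's. \<exists>C. \<forall>p\<in>params. norm (X p (fst i) (fst (snd i)) (snd (snd i))) \<le> C"
      using X unfolding blip_def by blast
    from choice[OF this] obtain C
      where C: "\<And>i p. p \<in> params \<Longrightarrow> norm (X p (fst i) (fst (snd i)) (snd (snd i))) \<le> C i" by blast
    show ?thesis
    proof (rule that[of "Max (range C)"])
      fix p s a s' assume "p \<in> params"
      then have "norm (X p s a s') \<le> C (s, a, s')" using C[of p "(s, a, s')"] by simp
      also have "\<dots> \<le> Max (range C)" by (rule Max_ge) auto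
      finally show "norm (X p s a s') \<le> Max (range C)" .
    qed
  qed
  obtain Cm where Cm: "Cm \<ge> 0" "\<And>p. p \<in> params \<Longrightarrow> norm (mean X p) \<le> Cm"
    "\<And>p q. p \<in> params \<Longrightarrow> q \<in> params \<Longrightarrow> norm (mean X p - mean X q) \<le> Cm * norm (p - q)"
    by (rule blipE[OF blip_avg[OF X]]) (assumption | rule that)+
  define u where "u p s = poisson (softmax (pth p)) (pmu p) (X p) s" for p s
  have blip_u: "blip params (\<lambda>p. u p s)" for s
    unfolding u_def by (rule blip_poisson[OF X])
  have "\<forall>s. \<exists>C. (\<forall>p\<in>params. norm (u p s) \<le> C) \<and> (\<forall>p\<in>params. \<forall>q\<in>params. norm (u p s - u q s) \<le> C * norm (p - q))"
    using blip_u unfolding blip_def by simp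
  from choice[OF this] obtain Cu' where Cu': "\<And>s p. p \<in> params \<Longrightarrow> norm (u p s) \<le> Cu' s"
    "\<And>s p q. p \<in> params \<Longrightarrow> q \<in> params \<Longrightarrow> norm (u p s - u q s) \<le> Cu' s * norm (p - q)"
    by blast
  define Cu where "Cu = Max (range Cu')"
  have Cu_ge: "Cu' s \<le> Cu" for s unfolding Cu_def by (rule Max_ge) auto
  have Cu: "norm (u p s) \<le> Cu" if "p \<in> params" for p s using Cu'(1)[OF that] Cu_ge order_trans by blast
  have CuL: "norm (u p s - u q s) \<le> Cu * norm (p - q)" if "p \<in> params" "q \<in> params" for p q s
    using Cu'(2)[OF that] Cu_ge by (meson mult_right_mono norm_ge_zero order_trans)
  obtain D where D: "D \<ge> 0" "\<And>k x a s'. Inv k x \<Longrightarrow> norm (par (nxt k x a s') - par x) \<le> D * tk k"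
    using par_step_bound by blast
  define M where "M = 1 + \<bar>B\<bar> + \<bar>CX\<bar> + Cm + \<bar>Cu\<bar> + Cm * D + \<bar>Cu\<bar> * D"
  have prods: "0 \<le> Cm * D" "0 \<le> \<bar>Cu\<bar> * D" using Cm D by auto
  have MB: "1 \<le> M" "B \<le> M" "CX \<le> M" "Cm \<le> M" "Cu \<le> M" "Cm * D \<le> M" "\<bar>Cu\<bar> * D \<le> M"
    unfolding M_def using prods Cm D by linarith+
  show ?thesis
  proof (intro exI[of _ "23 * M^3"] allI impI)
    fix k x a0 s0' assume I: "Inv k x"
    have p: "par x \<in> params" using I by (simp add: Inv_def)
    define \<pi> \<mu> p' where "\<pi> = softmax (th x)" and "\<mu> = muh x" and "p' = par (nxt k x a0 s0')"
    have pm: "\<pi> \<in> mfg_policies" "\<mu> \<in> prob_simplex" unfolding \<pi>_def \<mu>_def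
      using paramsD(4)[OF p] by (auto simp: softmax_policy par_simps)
    have p': "par (nxt k x a s') = p'" for a s' unfolding p'_def par_def nxt_def by simp
    have p'in: "p' \<in> params" unfolding p'_def by (rule par_nxt_params)
    have dp: "norm (p' - par x) \<le> D * tk k" unfolding p'_def by (rule D(2)[OF I])
    define \<Delta> where "\<Delta> = z x - mean X (par x)"
    have u_par: "poisson (softmax (th y)) (muh y) (X (par y)) s = u (par y) s" for y s
      unfolding u_def par_simps ..
    have step: "fterm X z (Suc k) (nxt k x a s') \<le>
      ((norm \<Delta>)\<^sup>2 - 2 * (lam * tk k) * (norm \<Delta>)\<^sup>2 + 2 * norm \<Delta> * norm (mean X p' - mean X (par x)) + 23 * M^3 * (tk k)\<^sup>2)
      + 2 * (lam * tk k) * (\<Delta> \<bullet> (X (par x) (st x) a s' - mean X (par x) + u (par x) s'))" for a s'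
    proof -
      have "norm (mean X p' - mean X (par x)) \<le> Cm * (D * tk k)"
        using Cm(3)[OF p'in p] mult_left_mono[OF dp Cm(1)] by linarith
      also have "\<dots> \<le> M * tk k" using MB(6) tk_pos[of k] by (simp add: mult.assoc[symmetric])
      finally have 1: "norm (mean X p' - mean X (par x)) \<le> M * tk k" .
      have "norm (u p' s' - u (par x) s') \<le> Cu * norm (p' - par x)" by (rule CuL[OF p'in p])
      also have "\<dots> \<le> \<bar>Cu\<bar> * (D * tk k)" using dp by (intro mult_mono) auto
      also have "\<dots> \<le> M * tk k" using MB(7) tk_pos[of k] by (simp add: mult.assoc[symmetric])
      finally have 2: "norm (u p' s' - u (par x) s') \<le> M * tk k" .
      have "\<bar>lam * tk (Suc k) - lam * tk k\<bar> \<le> 1 * (tk k)\<^sup>2"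
        unfolding right_diff_distrib[symmetric] abs_mult using pos' pos tk_diff[of k] by (intro mult_mono) auto
      then have 3: "\<bar>lam * tk (Suc k) - lam * tk k\<bar> \<le> (tk k)\<^sup>2" by simp
      have "(norm ((1 - lam * tk k) *\<^sub>R z x + (lam * tk k) *\<^sub>R X (par x) (st x) a s' - mean X p'))\<^sup>2
        + 2 * (lam * tk (Suc k)) * (((1 - lam * tk k) *\<^sub>R z x + (lam * tk k) *\<^sub>R X (par x) (st x) a s' - mean X p') \<bullet> u p' s')
        \<le> (norm \<Delta>)\<^sup>2 - 2 * (lam * tk k) * (norm \<Delta>)\<^sup>2 + 2 * norm \<Delta> * norm (mean X p' - mean X (par x))
        + 2 * (lam * tk k) * (\<Delta> \<bullet> (X (par x) (st x) a s' - mean X (par x) + u (par x) s')) + 23 * M^3 * (tk k)\<^sup>2"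
        unfolding \<Delta>_def using 1 2 3 lam_tk[of k] tk_le_one[of k] tk_pos[of k] MB zb[OF I] CX[OF p, of "st x" a s'] Cm(2)[OF p] Cm(2)[OF p'in] Cu[OF p'in, of s']
        by (intro filter_step) (auto intro: order_trans less_imp_le)
      moreover have "fterm X z (Suc k) (nxt k x a s') =
        (norm ((1 - lam * tk k) *\<^sub>R z x + (lam * tk k) *\<^sub>R X (par x) (st x) a s' - mean X p'))\<^sup>2
        + 2 * (lam * tk (Suc k)) * (((1 - lam * tk k) *\<^sub>R z x + (lam * tk k) *\<^sub>R X (par x) (st x) a s' - mean X p') \<bullet> u p' s')"
      proof -
        have st: "st (nxt k x a s') = s'" by (simp add: nxt_def)
        show ?thesis unfolding fterm_def unfolding u_par unfolding p' z st ..
      qed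
      ultimately show ?thesis by linarith
    qed
    have lin: "linear (\<lambda>v. 2 * (lam * tk k) * (\<Delta> \<bullet> v))"
      by (rule linearI) (auto simp: inner_add_right algebra_simps)
    let ?c = "(norm \<Delta>)\<^sup>2 - 2 * (lam * tk k) * (norm \<Delta>)\<^sup>2 + 2 * norm \<Delta> * norm (mean X p' - mean X (par x)) + 23 * M^3 * (tk k)\<^sup>2"
    have "Estep k x (fterm X z (Suc k)) \<le> loc_avg \<pi> \<mu> (\<lambda>s a s'. ?c
      + 2 * (lam * tk k) * (\<Delta> \<bullet> (X (par x) (st x) a s' - mean X (par x) + u (par x) s'))) (st x)"
      unfolding Estep_def \<pi>_def[symmetric] \<mu>_def[symmetric] by (rule loc_avg_mono[OF pm(1)], rule step)
    also have "\<dots> = ?c + 2 * (lam * tk k) * (\<Delta> \<bullet> loc_avg \<pi> \<mu> (\<lambda>s a s'. X (par x) (st x) a s' - mean X (par x) + u (par x) s') (st x))"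
      using loc_avg_linear[OF lin, of \<pi> \<mu> "\<lambda>s a s'. X (par x) (st x) a s' - mean X (par x) + u (par x) s'" "st x"]
        loc_avg_real_add[OF pm(1), of \<mu> "\<lambda>s a s'. 2 * (lam * tk k) * (\<Delta> \<bullet> (X (par x) (st x) a s' - mean X (par x) + u (par x) s'))" ?c "st x"]
      by (simp add: add.commute)
    \<comment> \<open>The Poisson equation: centred sample plus solution at the next state average
      to the solution at the current state, so the correction term of step k reappears
      unchanged.\<close>
    also have "loc_avg \<pi> \<mu> (\<lambda>s a s'. X (par x) (st x) a s' - mean X (par x) + u (par x) s') (st x) = u (par x) (st x)"
    proof -
      have "loc_avg \<pi> \<mu> (\<lambda>s a s'. X (par x) (st x) a s' - mean X (par x) + u (par x) s') (st x)
        = loc_avg \<pi> \<mu> (X (par x)) (st x) - mean X (par x) + loc_avg \<pi> \<mu> (\<lambda>s a s'. u (par x) s') (st x)"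
        unfolding loc_avg_add loc_avg_diff loc_avg_curr[OF pm(1), where g = "\<lambda>_. mean X (par x)"]
        using loc_avg_local[of \<pi> \<mu> "X (par x)" "st x"] by simp
      also have "loc_avg \<pi> \<mu> (\<lambda>s a s'. u (par x) s') (st x) = u (par x) (st x) - loc_avg \<pi> \<mu> (X (par x)) (st x) + avg \<pi> \<mu> (X (par x))"
        unfolding u_def par_simps \<pi>_def[symmetric] \<mu>_def[symmetric] by (rule poisson_eq[OF pm])
      finally show ?thesis unfolding par_simps \<pi>_def \<mu>_def by simp
    qed
    finally show "Estep k x (fterm X z (Suc k)) \<le> fterm X z k x
     - 2 * (lam * tk k) * (norm (z x - mean X (par x)))\<^sup>2
     + 2 * norm (z x - mean X (par x)) * norm (mean X (par (nxt k x a0 s0')) - mean X (par x)) + 23 * M^3 * (tk k)\<^sup>2"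
      unfolding fterm_def u_par \<Delta>_def p'_def by simp
  qed
qed

end

section \<open>Drift of the errors\<close>

lemma projperp_diff: "projperp (a - b) = projperp a - projperp b"
  by (simp add: projperp_def vec_eq_iff sum_subtractf diff_divide_distrib)

lemma projperp_add: "projperp (a + b) = projperp a + projperp b"
  by (simp add: projperp_def vec_eq_iff sum.distrib add_divide_distrib)

lemma projperp_scaleR: "projperp (c *\<^sub>R a) = c *\<^sub>R projperp a"
  by (simp add: projperp_def vec_eq_iff sum_distrib_left[symmetric] algebra_simps)

lemma inner_projperp: "projperp a \<bullet> projperp b = projperp a \<bullet> b"
proof -
  have "projperp a \<bullet> (b - projperp b) = (\<Sum>i\<in>UNIV. projperp a $ i) * ((\<Sum>i\<in>UNIV. b $ i) / real CARD('a))"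
    by (simp add: inner_vec_def projperp_def[of b] sum_distrib_right sum_divide_distrib)
  also have "\<dots> = 0" by (simp add: projperp_def sum_subtractf)
  finally show ?thesis by (simp add: inner_diff_right)
qed

lemma norm_projperp_decomp:
  "(norm V)\<^sup>2 = (norm (projperp V))\<^sup>2 + ((\<Sum>i\<in>UNIV. V $ i) / sqrt (real CARD('n)))\<^sup>2" for V :: "real^'n::finite"
proof -
  let ?n = "real CARD('n)" and ?S = "\<Sum>i\<in>UNIV. V $ i"
  have "(norm (projperp V))\<^sup>2 = projperp V \<bullet> V"
    by (simp add: power2_norm_eq_inner inner_projperp)
  also have "\<dots> = (norm V)\<^sup>2 - ?S * ?S / ?n"
    by (simp add: projperp_def inner_vec_def power2_norm_eq_inner left_diff_distrib sum_subtractf sum_distrib_left[symmetric] sum_divide_distrib[symmetric])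
  finally show ?thesis by (simp add: power_divide power2_eq_square)
qed

lemma norm_projperp_le: "norm (projperp V) \<le> norm V"
  using norm_projperp_decomp[of V] by - (rule power2_le_imp_le, simp_all)

lemma normalized_sum_le: "\<bar>(\<Sum>i\<in>UNIV. V $ i) / sqrt (real CARD('n))\<bar> \<le> norm V" for V :: "real^'n::finite"
  using norm_projperp_decomp[of V] by - (rule power2_le_imp_le, simp_all del: abs_divide)

lemma smooth_bound:
  fixes f :: "'v::real_inner \<Rightarrow> real"
  assumes G: "\<And>x. GDERIV f x :> G x" and lip: "\<And>x y. norm (G x - G y) \<le> c * norm (x - y)" and c: "0 \<le> c"
  shows "\<bar>f (x + h) - f x - inner h (G x)\<bar> \<le> c * (norm h)\<^sup>2"
proof -
  have der: "((\<lambda>t. f (x + t *\<^sub>R h)) has_real_derivative inner h (G (x + t *\<^sub>R h))) (at t)" for t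
  proof -
    have "((\<lambda>t. x + t *\<^sub>R h) has_derivative (\<lambda>t. t *\<^sub>R h)) (at t)"
      by (auto intro!: derivative_eq_intros)
    from has_derivative_compose[OF this G[unfolded gderiv_def]]
    have "((\<lambda>t. f (x + t *\<^sub>R h)) has_derivative (\<lambda>t'. inner (t' *\<^sub>R h) (G (x + t *\<^sub>R h)))) (at t)" .
    then show ?thesis unfolding has_field_derivative_def by (simp add: mult_commute_abs)
  qed
  have "\<exists>z>0. z < 1 \<and> f (x + 1 *\<^sub>R h) - f (x + 0 *\<^sub>R h) = (1 - 0) * inner h (G (x + z *\<^sub>R h))"
    by (rule MVT2) (auto intro: der)
  then obtain z where z: "0 < z" "z < 1" "f (x + h) - f x = inner h (G (x + z *\<^sub>R h))" by auto
  have "\<bar>inner h (G (x + z *\<^sub>R h) - G x)\<bar> \<le> norm h * norm (G (x + z *\<^sub>R h) - G x)"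
    by (rule Cauchy_Schwarz_ineq2)
  also have "\<dots> \<le> norm h * (c * norm h)"
  proof (rule mult_left_mono)
    have "norm (G (x + z *\<^sub>R h) - G x) \<le> c * (z * norm h)" using lip[of "x + z *\<^sub>R h" x] z by simp
    also have "\<dots> \<le> c * norm h" using z c by (intro mult_left_mono) (auto simp: mult_left_le_one_le)
    finally show "norm (G (x + z *\<^sub>R h) - G x) \<le> c * norm h" .
  qed simp
  finally show ?thesis using z(3) by (simp add: inner_diff_right power2_eq_square mult_ac)
qed

lemma norm_add_sq: "(norm (u + v))\<^sup>2 = (norm u)\<^sup>2 + 2 * (u \<bullet> v) + (norm v)\<^sup>2" for u v :: "'v::real_inner"
  by (simp add: power2_norm_eq_inner inner_add_left inner_add_right inner_commute)

text \<open>For an error against a moving target: \<open>y\<close> is the distance to the old target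
  after the move, \<open>a\<close> the error before it, \<open>D\<close> the displacement of the
  target, \<open>z\<close> the new error. The cross term is charged to the old error
  \<open>a\<close>, and only the second order \<open>m * D\<close> is left over;
  \<open>em_drift\<close>, \<open>ej_drift\<close> and \<open>eV_drift\<close> all end this
  way.\<close>

lemma shifted_square:
  fixes a D y m b :: real
  assumes "0 \<le> y" "y\<^sup>2 \<le> Q" "y \<le> a + m" "z \<le> y + D" "0 \<le> D" "0 \<le> z"
  shows "z\<^sup>2 \<le> Q + 2 * a * D + 2 * m * D + D\<^sup>2"
proof -
  have "z\<^sup>2 \<le> (y + D)\<^sup>2" using assms by (intro power_mono) auto
  also have "\<dots> = y\<^sup>2 + 2 * y * D + D\<^sup>2" by (simp add: power2_sum)
  also have "\<dots> \<le> Q + 2 * (a + m) * D + D\<^sup>2" using assms by (intro add_mono mult_right_mono) auto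
  finally show ?thesis by (simp add: algebra_simps)
qed

section \<open>Error quantities, and first-order drift of \<open>ell\<close>, the mean field and the
  reward estimate\<close>

context mfg_alg
begin

definition "ell x = mfg_ell K r (softmax (th x))"
definition "mst x = mustar K (softmax (th x))"
definition "gradx x = gradf (\<lambda>\<theta>. Jf K r (softmax \<theta>) (mst x)) (th x)"
definition "em x = norm (muh x - mst x)"
definition "eV x = norm (projperp (Vh x - Vf K r (softmax (th x)) (muh x)))"
definition "Jx x = Jf K r (softmax (th x)) (muh x)"
definition "ej x = \<bar>Jh x - Jx x\<bar>"
definition "nF x = norm (fv x - mean XF (par x))"
definition "nG x = norm (gV x - mean XV (par x))"
definition "nQ x = norm (gJ x - mean XJ (par x))"
definition "nH x = norm (hv x - mean XH (par x))"

lemma nonneg: "0 \<le> em x" "0 \<le> eV x" "0 \<le> ej x" "0 \<le> nF x" "0 \<le> nG x" "0 \<le> nQ x" "0 \<le> nH x"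
  by (simp_all add: em_def eV_def ej_def nF_def nG_def nQ_def nH_def)

lemma Inv_params: "Inv k x \<Longrightarrow> par x \<in> params" by (simp add: Inv_def)

lemma Inv_muh: "Inv k x \<Longrightarrow> muh x \<in> prob_simplex"
  using paramsD(4)[OF Inv_params] by (simp add: par_simps)

lemma mst_simplex: "mst x \<in> prob_simplex"
  unfolding mst_def by (rule mustar_simplex[OF softmax_policy])

lemma Jf_range:
  assumes "\<pi> \<in> mfg_policies" "\<mu> \<in> prob_simplex" shows "0 \<le> Jf K r \<pi> \<mu>" "Jf K r \<pi> \<mu> \<le> 1"
proof -
  show "0 \<le> Jf K r \<pi> \<mu>" unfolding Jf_def
    by (intro sum_nonneg mult_nonneg_nonneg simplex_nonneg stat_simplex policy_nonneg rew assms)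
  have "norm (avg \<pi> \<mu> (\<lambda>s a s'. r s a \<mu>)) \<le> 1"
    by (rule avg_norm[OF assms]) (use rew[OF assms(2)] in auto)
  then show "Jf K r \<pi> \<mu> \<le> 1" unfolding avg_rew by simp
qed

text \<open>The mean of \<open>XH\<close> vanishes at the fixed point \<open>mst x\<close>, so by
  contraction its norm is at most (1 + \<delta>) times \<open>em x\<close>. Speeds bounded by
  errors, here and in the next two lemmas, make the motion of the targets quadratic in the
  errors.\<close>

lemma hv_le: assumes "Inv k x" shows "norm (hv x) \<le> nH x + 2 * em x"
proof -
  let ?\<nu> = "\<lambda>\<mu>. stat_dist K (softmax (th x)) \<mu>"
  have "norm (mean XH (par x)) = norm ((?\<nu> (muh x) - ?\<nu> (mst x)) - (muh x - mst x))"
    unfolding mean_XH[OF Inv_params[OF assms]] unfolding par_simps mst_def mustar_fix[OF softmax_policy] by simp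
  also have "\<dots> \<le> \<delta> * em x + em x"
    using norm_triangle_ineq4[of "?\<nu> (muh x) - ?\<nu> (mst x)" "muh x - mst x"]
      stat_contraction[OF softmax_policy Inv_muh[OF assms] mst_simplex[of x], of "th x"]
    unfolding em_def by linarith
  also have "\<dots> \<le> 2 * em x" using delta nonneg(1)[of x] mult_right_mono[of \<delta> 1 "em x"] by linarith
  finally show ?thesis unfolding nH_def
    using norm_triangle_ineq[of "hv x - mean XH (par x)" "mean XH (par x)"] by simp
qed

lemma gV_le: assumes "Inv k x" shows "norm (gV x) \<le> nG x + sqrt 2 * eV x + ej x"
proof -
  have "norm (mean XV (par x)) \<le> sqrt 2 * eV x + ej x"
    using critic_mean_norm[OF softmax_policy Inv_muh[OF assms], of "th x" "Jh x" "Vh x"]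
    unfolding XV_def par_simps eV_def ej_def Jx_def by (simp add: abs_minus_commute)
  then show ?thesis unfolding nG_def
    using norm_triangle_ineq[of "gV x - mean XV (par x)" "mean XV (par x)"] by simp
qed

lemma gJ_le: assumes "Inv k x" shows "\<bar>gJ x\<bar> \<le> nQ x + cJ * ej x"
proof -
  have "\<bar>mean XJ (par x)\<bar> = cJ * ej x"
    unfolding mean_XJ[OF Inv_params[OF assms]] unfolding par_simps ej_def Jx_def using cJ by (simp add: abs_mult abs_minus_commute)
  then show ?thesis unfolding nQ_def by simp
qed

text \<open>Three sources: noise of the filter, bias from the value estimate, and evaluation of the
  gradient at the estimated instead of the induced mean field.\<close>

lemma actor_error: assumes "Inv k x" shows "norm (fv x - gradx x) \<le> nF x + 2 * eV x + LV * em x"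
proof -
  let ?g = "\<lambda>\<mu>. gradf (\<lambda>\<theta>. Jf K r (softmax \<theta>) \<mu>) (th x)"
  have "norm (mean XF (par x) - ?g (muh x)) \<le> 2 * eV x"
    using actor_bias[OF Inv_muh[OF assms], of "th x" "Vh x"] unfolding XF_def par_simps eV_def by simp
  moreover have "norm (?g (muh x) - ?g (mst x)) \<le> LV * em x"
    using Jgrad_lip[OF Inv_muh[OF assms] mst_simplex[of x], of "th x" "th x"] unfolding em_def by simp
  moreover have tri: "norm ((fv x - mean XF (par x)) + (mean XF (par x) - ?g (muh x)) + (?g (muh x) - ?g (mst x)))
     \<le> norm (fv x - mean XF (par x)) + norm (mean XF (par x) - ?g (muh x)) + norm (?g (muh x) - ?g (mst x))"
    by (rule order_trans[OF norm_triangle_ineq add_right_mono[OF norm_triangle_ineq]])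
  moreover have eq: "(fv x - mean XF (par x)) + (mean XF (par x) - ?g (muh x)) + (?g (muh x) - ?g (mst x)) = fv x - gradx x"
  proof -
    have "(a - b) + (b - c) + (c - d) = a - d" for a b c d :: "real^'a^'s" by simp
    then show ?thesis unfolding gradx_def .
  qed
  ultimately show ?thesis unfolding nF_def using tri[unfolded eq] by linarith
qed

lemma Inv_all_bounds: "\<exists>M\<ge>1. \<forall>k x. Inv k x \<longrightarrow> norm (fv x) \<le> M \<and> norm (gV x) \<le> M \<and> \<bar>gJ x\<bar> \<le> M
   \<and> norm (hv x) \<le> M \<and> norm (gradx x) \<le> M \<and> em x \<le> M \<and> eV x \<le> M \<and> ej x \<le> M \<and> nH x \<le> M \<and> nG x \<le> M \<and> nQ x \<le> M \<and> nF x \<le> M"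
proof -
  obtain M where M: "M \<ge> 1" "\<And>k x. Inv k x \<Longrightarrow> norm (fv x) \<le> M \<and> norm (gV x) \<le> M \<and> \<bar>gJ x\<bar> \<le> M \<and> norm (hv x) \<le> M"
    using Inv_bounds by blast
  define g where "g = (1 + sqrt 2 * BV) * sqrt 2"
  let ?M = "2 * M + g + 2 + 2 * BV + 1 + cJ"
  have n: "0 \<le> sqrt 2 * BV" using BV by auto
  have "(1 + sqrt 2 * BV) * 1 \<le> g" unfolding g_def by (rule mult_left_mono) (use n in auto)
  then have ng: "1 + sqrt 2 * BV \<le> g" by simp
  note n = n ng
  have "norm (fv x) \<le> ?M \<and> norm (gV x) \<le> ?M \<and> \<bar>gJ x\<bar> \<le> ?M
   \<and> norm (hv x) \<le> ?M \<and> norm (gradx x) \<le> ?M \<and> em x \<le> ?M \<and> eV x \<le> ?M \<and> ej x \<le> ?M \<and> nH x \<le> ?M \<and> nG x \<le> ?M \<and> nQ x \<le> ?M \<and> nF x \<le> ?M"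
    if I: "Inv k x" for k x
  proof -
    note p = Inv_params[OF I]
    have g: "norm (gradx x) \<le> g"
      unfolding gradx_def gradf_eq[OF policy_gradient[OF mst_simplex]]
      unfolding g_def
    proof (rule avg_norm[OF softmax_policy mst_simplex], unfold norm_scaleR, rule mult_mono[OF _ norm_score])
      fix s a s'
      let ?V = "Vf K r (softmax (th x)) (mst x)"
      have "\<bar>?V $ s' - ?V $ s\<bar> \<le> sqrt 2 * BV"
        using component_diff_bound[of ?V s' s] mult_left_mono[OF Vf_bound[OF softmax_policy mst_simplex] sqrt2_bounds(1), of "th x" x]
        by linarith
      then show "\<bar>r s a (mst x) + ?V $ s' - ?V $ s\<bar> \<le> 1 + sqrt 2 * BV"
        using rew[OF mst_simplex, of s a x] by linarith
    qed (use n in auto)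
    have m: "em x \<le> 2" unfolding em_def
      using norm_triangle_ineq4[of "muh x" "mst x"] simplex_norm[OF Inv_muh[OF I]] simplex_norm[OF mst_simplex, of x] by linarith
    have v: "eV x \<le> 2 * BV" unfolding eV_def
      using norm_projperp_le[of "Vh x - Vf K r (softmax (th x)) (muh x)"] norm_triangle_ineq4[of "Vh x" "Vf K r (softmax (th x)) (muh x)"]
        paramsD(1)[OF p] Vf_bound[OF softmax_policy Inv_muh[OF I], of "th x"] by (simp add: par_simps)
    have j: "ej x \<le> 1" unfolding ej_def Jx_def
      using paramsD(2,3)[OF p] Jf_range[OF softmax_policy Inv_muh[OF I], of "th x"] by (simp add: par_simps)
    have F: "norm (mean XF (par x)) \<le> g" unfolding g_def
      by (rule avg_norm[OF softmax_policy paramsD(4)[OF p]]) (rule XF_bound[OF p])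
    have G: "norm (mean XV (par x)) \<le> 1 + sqrt 2 * BV"
      by (rule avg_norm[OF softmax_policy paramsD(4)[OF p]]) (rule XV_bound[OF p])
    have H: "norm (mean XH (par x)) \<le> 2"
      by (rule avg_norm[OF softmax_policy paramsD(4)[OF p]]) (rule XH_bound[OF p])
    have Q: "norm (mean XJ (par x)) \<le> cJ"
    proof (rule avg_norm[OF softmax_policy paramsD(4)[OF p]])
      fix s a s'
      have "\<bar>r s a (pmu (par x)) - pJ (par x)\<bar> \<le> 1"
        using rew[OF paramsD(4)[OF p], of s a] paramsD(2,3)[OF p] by linarith
      then show "norm (XJ (par x) s a s') \<le> cJ" unfolding XJ_def using cJ by (simp add: abs_mult)
    qed
    have "nF x \<le> M + g" "nG x \<le> M + (1 + sqrt 2 * BV)" "nH x \<le> M + 2" "nQ x \<le> M + cJ"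
      unfolding nF_def nG_def nH_def nQ_def using F G H Q M(2)[OF I]
        norm_triangle_ineq4[of "fv x" "mean XF (par x)"] norm_triangle_ineq4[of "gV x" "mean XV (par x)"]
        norm_triangle_ineq4[of "hv x" "mean XH (par x)"] norm_triangle_ineq4[of "gJ x" "mean XJ (par x)"]
      unfolding real_norm_def by linarith+
    then show ?thesis using M(2)[OF I] M(1) g m v j n BV cJ by (intro conjI) linarith+
  qed
  moreover have "1 \<le> ?M" using M(1) n BV cJ by linarith
  ultimately show ?thesis by blast
qed

lemma nxt_th: "th (nxt k x a s') = th x + (al * tk k) *\<^sub>R fv x"
  by (simp add: nxt_def)

lemma mst_step: "norm (mst (nxt k x a s') - mst x) \<le> L * (al * tk k * norm (fv x))"
proof -
  have "norm (mst (nxt k x a s') - mst x) \<le> L * norm (softmax (th (nxt k x a s')) - softmax (th x))"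
    unfolding mst_def by (rule mustar_lip[OF softmax_policy softmax_policy])
  also have "\<dots> \<le> L * norm (th (nxt k x a s') - th x)" using softmax_lipschitz L by simp
  finally show ?thesis using pos tk_pos[of k] by (simp add: nxt_th)
qed

text \<open>\<open>mustar\<close> is only Lipschitz, so \<open>ell\<close> cannot be expanded
  directly. Each order of herding bounds its increment by an increment of \<open>Jf\<close> at a
  frozen mean field, which is smooth in theta. One order freezes the old mean field and the other
  the new one; their gradients differ by O(tk), which meets a step of size O(tk).\<close>

lemma ell_drift: "\<exists>C\<ge>0. \<forall>k x a s'. Inv k x \<longrightarrow>
   \<bar>ell (nxt k x a s') - ell x - \<rho> * (al * tk k) * (fv x \<bullet> gradx x)\<bar> \<le> C * (tk k)\<^sup>2"
proof -
  obtain M where M: "M \<ge> 1" "\<And>k x. Inv k x \<Longrightarrow> norm (fv x) \<le> M" using Inv_all_bounds by blast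
  let ?C = "\<rho> * (LV * (2 + L) * M\<^sup>2)"
  show ?thesis
  proof (intro exI[of _ ?C] conjI allI impI)
    fix k x a s' assume I: "Inv k x"
    define h where "h = (al * tk k) *\<^sub>R fv x"
    define y where "y = nxt k x a s'"
    have nh: "norm h \<le> M * tk k"
    proof -
      have "al * tk k * norm (fv x) \<le> 1 * tk k * M" using pos pos' tk_pos[of k] M(2)[OF I] by (intro mult_mono) auto
      then show ?thesis unfolding h_def using pos tk_pos[of k] by (simp add: mult_ac)
    qed
    have nh2: "LV * (2 + L) * (norm h)\<^sup>2 \<le> LV * (2 + L) * (M\<^sup>2 * (tk k)\<^sup>2)"
      using power_mono[OF nh, of 2] LV L by (intro mult_left_mono) (auto simp: power_mult_distrib)
    have thy: "th y = th x + h" unfolding y_def h_def nxt_th ..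
    have G: "GDERIV (\<lambda>\<theta>. Jf K r (softmax \<theta>) \<mu>) \<theta> :> gradf (\<lambda>\<theta>. Jf K r (softmax \<theta>) \<mu>) \<theta>" if "\<mu> \<in> prob_simplex" for \<mu> \<theta>
      using policy_gradient[OF that, of \<theta>] gradf_eq[OF policy_gradient[OF that, of \<theta>]] by simp
    have sm: "\<bar>Jf K r (softmax (\<theta> + h')) \<mu> - Jf K r (softmax \<theta>) \<mu> - h' \<bullet> gradf (\<lambda>\<theta>. Jf K r (softmax \<theta>) \<mu>) \<theta>\<bar> \<le> LV * (norm h')\<^sup>2"
      if "\<mu> \<in> prob_simplex" for \<mu> \<theta> h'
      using Jgrad_lip[OF that that] LV by (intro smooth_bound[OF G[OF that]]) auto
    have e: "ell z = Jf K r (softmax (th z)) (mst z)" for z unfolding ell_def mfg_ell_def mst_def ..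
    have "ell x - ell y \<le> \<rho> * (Jf K r (softmax (th x)) (mst x) - Jf K r (softmax (th y)) (mst x))"
      unfolding ell_def mst_def by (rule herding[OF softmax_policy softmax_policy])
    also have "\<dots> \<le> \<rho> * (- (h \<bullet> gradx x) + LV * (norm h)\<^sup>2)"
      using sm[OF mst_simplex[of x], of "th x" h] rho unfolding thy gradx_def by (intro mult_left_mono) auto
    also have "\<dots> \<le> \<rho> * (- (h \<bullet> gradx x) + LV * (2 + L) * (norm h)\<^sup>2)"
      using rho LV L by (intro mult_left_mono add_left_mono mult_right_mono) auto
    finally have lo: "ell x - ell y \<le> \<rho> * (- (h \<bullet> gradx x) + LV * (2 + L) * (norm h)\<^sup>2)" .
    have "ell y - ell x \<le> \<rho> * (Jf K r (softmax (th y)) (mst y) - Jf K r (softmax (th x)) (mst y))"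
      unfolding ell_def mst_def by (rule herding[OF softmax_policy softmax_policy])
    also have "\<dots> \<le> \<rho> * (h \<bullet> gradx y + LV * (norm h)\<^sup>2)"
      using sm[OF mst_simplex[of y], of "th y" "- h"] rho unfolding thy gradx_def by (intro mult_left_mono) auto
    also have "\<dots> \<le> \<rho> * (h \<bullet> gradx x + LV * (2 + L) * (norm h)\<^sup>2)"
    proof (intro mult_left_mono)
      have "norm (gradx y - gradx x) \<le> LV * (norm (th y - th x) + norm (mst y - mst x))"
        unfolding gradx_def by (rule Jgrad_lip[OF mst_simplex mst_simplex])
      also have "\<dots> \<le> LV * (norm h + L * norm h)"
        using mst_step[of k x a s'] LV pos tk_pos[of k] unfolding thy y_def[symmetric] by (intro mult_left_mono) (auto simp: h_def)
      finally have "norm h * norm (gradx y - gradx x) \<le> norm h * (LV * (norm h + L * norm h))" by (rule mult_left_mono) simp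
      moreover have "h \<bullet> (gradx y - gradx x) \<le> norm h * norm (gradx y - gradx x)" by (rule norm_cauchy_schwarz)
      ultimately have "h \<bullet> gradx y \<le> h \<bullet> gradx x + LV * (1 + L) * (norm h)\<^sup>2"
        by (simp add: inner_diff_right power2_eq_square algebra_simps)
      then show "h \<bullet> gradx y + LV * (norm h)\<^sup>2 \<le> h \<bullet> gradx x + LV * (2 + L) * (norm h)\<^sup>2" by (simp add: algebra_simps)
    qed (use rho in simp)
    finally have hi: "ell y - ell x \<le> \<rho> * (h \<bullet> gradx x + LV * (2 + L) * (norm h)\<^sup>2)" .
    have "\<bar>ell y - ell x - \<rho> * (h \<bullet> gradx x)\<bar> \<le> \<rho> * (LV * (2 + L) * (norm h)\<^sup>2)"
      using lo hi by (simp add: abs_le_iff algebra_simps)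
    also have "\<dots> \<le> \<rho> * (LV * (2 + L) * (M\<^sup>2 * (tk k)\<^sup>2))" using mult_left_mono[OF nh2, of \<rho>] rho by simp
    finally show "\<bar>ell (nxt k x a s') - ell x - \<rho> * (al * tk k) * (fv x \<bullet> gradx x)\<bar> \<le> ?C * (tk k)\<^sup>2"
      unfolding h_def y_def by (simp add: mult_ac)
  qed (use rho LV L M in simp)
qed

lemma em_drift: "\<exists>C. \<forall>k x a s'. Inv k x \<longrightarrow>
   (em (nxt k x a s'))\<^sup>2 \<le> (em x)\<^sup>2 + tk k * (- 2 * xi * (1 - \<delta>) * (em x)\<^sup>2 + 2 * xi * em x * nH x + 2 * L * al * em x * norm (fv x))
     + C * (tk k)\<^sup>2"
proof -
  obtain M where M: "M \<ge> 1" "\<And>k x. Inv k x \<Longrightarrow> norm (fv x) \<le> M \<and> norm (hv x) \<le> M" using Inv_all_bounds by blast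
  let ?C = "M\<^sup>2 + 2 * M * (L * M) + (L * M)\<^sup>2"
  show ?thesis
  proof (intro exI[of _ ?C] allI impI)
    fix k x a s' assume I: "Inv k x"
    define y where "y = nxt k x a s'"
    define t where "t = tk k"
    have t: "0 < t" "t \<le> 1" unfolding t_def by (auto simp: tk_pos tk_le_one)
    define w where "w = muh x - mst x"
    have "norm (muh y - mst x) \<le> norm (muh x + (xi * t) *\<^sub>R hv x - mst x)"
      unfolding y_def nxt_def t_def alg_state.simps
      by (rule closest_point_nonexpansive[OF closed_simplex convex_simplex mst_simplex])
    then have 1: "norm (muh y - mst x) \<le> norm (w + (xi * t) *\<^sub>R hv x)" unfolding w_def by (simp add: algebra_simps)
    have "w \<bullet> hv x = w \<bullet> (hv x - mean XH (par x)) + w \<bullet> (stat_dist K (softmax (th x)) (muh x) - stat_dist K (softmax (th x)) (mst x)) - w \<bullet> w"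
      unfolding mean_XH[OF Inv_params[OF I]] unfolding par_simps w_def mst_def mustar_fix[OF softmax_policy] by (simp add: inner_diff_right)
    also have "\<dots> \<le> em x * nH x + em x * (\<delta> * em x) - (em x)\<^sup>2"
    proof -
      have "w \<bullet> (hv x - mean XH (par x)) \<le> em x * nH x"
        unfolding em_def nH_def w_def by (rule norm_cauchy_schwarz)
      moreover have "w \<bullet> (stat_dist K (softmax (th x)) (muh x) - stat_dist K (softmax (th x)) (mst x)) \<le>
         norm w * norm (stat_dist K (softmax (th x)) (muh x) - stat_dist K (softmax (th x)) (mst x))" by (rule norm_cauchy_schwarz)
      moreover have "\<dots> \<le> norm w * (\<delta> * norm w)"
        unfolding w_def by (intro mult_left_mono stat_contraction softmax_policy Inv_muh[OF I] mst_simplex) simp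
      ultimately show ?thesis unfolding em_def w_def[symmetric] by (simp add: power2_norm_eq_inner)
    qed
    finally have wh: "w \<bullet> hv x \<le> em x * nH x - (1 - \<delta>) * (em x)\<^sup>2" by (simp add: power2_eq_square algebra_simps)
    have bg: "xi * t * norm (hv x) \<le> t * M"
    proof -
      have "xi * t * norm (hv x) \<le> 1 * t * M" using pos pos' t M(2)[OF I] by (intro mult_mono) auto
      then show ?thesis by simp
    qed
    have "(norm (muh y - mst x))\<^sup>2 \<le> (norm (w + (xi * t) *\<^sub>R hv x))\<^sup>2" using 1 by (intro power_mono) auto
    also have "\<dots> = (em x)\<^sup>2 + 2 * (xi * t) * (w \<bullet> hv x) + (xi * t * norm (hv x))\<^sup>2"
      unfolding em_def w_def[symmetric] norm_add_sq using pos' t by simp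
    also have "\<dots> \<le> (em x)\<^sup>2 + 2 * (xi * t) * (em x * nH x - (1 - \<delta>) * (em x)\<^sup>2) + (t * M)\<^sup>2"
      by (rule add_mono[OF add_left_mono[OF mult_left_mono[OF wh]] power_mono[OF bg]]) (use pos' t in auto)
    finally have Q: "(norm (muh y - mst x))\<^sup>2 \<le> (em x)\<^sup>2 + 2 * (xi * t) * (em x * nH x - (1 - \<delta>) * (em x)\<^sup>2) + (t * M)\<^sup>2" .
    define D where "D = L * (al * t * norm (fv x))"
    have D: "0 \<le> D" "D \<le> L * M * t"
    proof -
      show "0 \<le> D" unfolding D_def using L pos t by simp
      have "al * norm (fv x) \<le> 1 * M" using pos pos' M(2)[OF I] by (intro mult_mono) auto
      then show "D \<le> L * M * t" unfolding D_def using L t by (simp add: mult_ac)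
    qed
    have "norm ((xi * t) *\<^sub>R hv x) = xi * t * norm (hv x)" using pos' t by simp
    then have "norm (muh y - mst x) \<le> em x + t * M"
      using 1 bg norm_triangle_ineq[of w "(xi * t) *\<^sub>R hv x"] unfolding em_def w_def[symmetric] by linarith
    moreover have "em y \<le> norm (muh y - mst x) + D"
      using mst_step[of k x a s'] norm_triangle_ineq4[of "muh y - mst x" "mst y - mst x"] unfolding em_def D_def y_def[symmetric] t_def[symmetric] by simp
    ultimately have "(em y)\<^sup>2 \<le> ((em x)\<^sup>2 + 2 * (xi * t) * (em x * nH x - (1 - \<delta>) * (em x)\<^sup>2) + (t * M)\<^sup>2) + 2 * em x * D + 2 * (t * M) * D + D\<^sup>2"
      using D nonneg by (intro shifted_square[OF _ Q]) auto
    also have "2 * (t * M) * D \<le> 2 * (t * M) * (L * M * t)" using D t M by (intro mult_left_mono) auto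
    also have "D\<^sup>2 \<le> (L * M * t)\<^sup>2" using D by (intro power_mono) auto
    finally have "(em y)\<^sup>2 \<le> ((em x)\<^sup>2 + 2 * (xi * t) * (em x * nH x - (1 - \<delta>) * (em x)\<^sup>2) + (t * M)\<^sup>2) + 2 * em x * D + 2 * (t * M) * (L * M * t) + (L * M * t)\<^sup>2"
      by simp
    then show "(em (nxt k x a s'))\<^sup>2 \<le> (em x)\<^sup>2 + tk k * (- 2 * xi * (1 - \<delta>) * (em x)\<^sup>2 + 2 * xi * em x * nH x + 2 * L * al * em x * norm (fv x))
     + ?C * (tk k)\<^sup>2"
      unfolding y_def[symmetric] t_def[symmetric] D_def by (simp add: power2_eq_square algebra_simps)
  qed
qed

lemma Jx_step:
  assumes I: "Inv k x"
  shows "\<bar>Jx (nxt k x a s') - Jx x\<bar> \<le> LV * (tk k * (al * norm (fv x) + xi * norm (hv x)))"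
proof -
  have "\<bar>Jx (nxt k x a s') - Jx x\<bar> \<le> LV * (norm (th (nxt k x a s') - th x) + norm (muh (nxt k x a s') - muh x))"
    unfolding Jx_def using par_nxt_params[of k x a s'] Inv_muh[OF I] by (intro Jf_lip) (auto simp: params_def par_simps)
  also have "\<dots> \<le> LV * (tk k * (al * norm (fv x) + xi * norm (hv x)))"
    using par_step(1,4)[OF Inv_params[OF I], of k a s'] LV by (intro mult_left_mono) (auto simp: algebra_simps)
  finally show ?thesis .
qed

lemma ej_drift: "\<exists>C. \<forall>k x a s'. Inv k x \<longrightarrow>
   (ej (nxt k x a s'))\<^sup>2 \<le> (ej x)\<^sup>2 + tk k * (- 2 * be * cJ * (ej x)\<^sup>2 + 2 * be * ej x * nQ x
     + 2 * LV * ej x * (al * norm (fv x) + xi * norm (hv x))) + C * (tk k)\<^sup>2"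
proof -
  obtain M where M: "M \<ge> 1" "\<And>k x. Inv k x \<Longrightarrow> norm (fv x) \<le> M \<and> norm (hv x) \<le> M \<and> \<bar>gJ x\<bar> \<le> M" using Inv_all_bounds by blast
  let ?C = "M\<^sup>2 + 2 * M * (LV * (2 * M)) + (LV * (2 * M))\<^sup>2"
  show ?thesis
  proof (intro exI[of _ ?C] allI impI)
    fix k x a s' assume I: "Inv k x"
    define y where "y = nxt k x a s'"
    define t where "t = tk k"
    have t: "0 < t" "t \<le> 1" unfolding t_def by (auto simp: tk_pos tk_le_one)
    define w where "w = Jh x - Jx x"
    have Jr: "0 \<le> Jx x" "Jx x \<le> 1" unfolding Jx_def using Jf_range[OF softmax_policy Inv_muh[OF I]] by auto
    have "norm (Jh y - Jx x) \<le> norm (Jh x + (be * t) * gJ x - Jx x)"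
      unfolding y_def nxt_def t_def alg_state.simps
      by (rule closest_point_nonexpansive) (use Jr in auto)
    then have 1: "\<bar>Jh y - Jx x\<bar> \<le> \<bar>w + (be * t) * gJ x\<bar>" unfolding w_def by (simp add: algebra_simps)
    have "w * gJ x = w * (gJ x - mean XJ (par x)) - cJ * w\<^sup>2"
      unfolding mean_XJ[OF Inv_params[OF I]] unfolding par_simps w_def Jx_def by (simp add: power2_eq_square algebra_simps)
    also have "w * (gJ x - mean XJ (par x)) \<le> ej x * nQ x"
      unfolding ej_def nQ_def w_def real_norm_def abs_mult[symmetric] by (rule abs_ge_self)
    finally have wh: "w * gJ x \<le> ej x * nQ x - cJ * (ej x)\<^sup>2" unfolding ej_def w_def by simp
    have bg: "be * t * \<bar>gJ x\<bar> \<le> t * M"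
    proof -
      have "be * t * \<bar>gJ x\<bar> \<le> 1 * t * M" using pos pos' t M(2)[OF I] by (intro mult_mono) auto
      then show ?thesis by simp
    qed
    have "\<bar>Jh y - Jx x\<bar>\<^sup>2 \<le> \<bar>w + (be * t) * gJ x\<bar>\<^sup>2" using 1 by (intro power_mono) auto
    also have "\<dots> = (ej x)\<^sup>2 + 2 * (be * t) * (w * gJ x) + (be * t * \<bar>gJ x\<bar>)\<^sup>2"
      unfolding ej_def w_def[symmetric] by (simp add: power2_eq_square algebra_simps)
    also have "\<dots> \<le> (ej x)\<^sup>2 + 2 * (be * t) * (ej x * nQ x - cJ * (ej x)\<^sup>2) + (t * M)\<^sup>2"
      by (rule add_mono[OF add_left_mono[OF mult_left_mono[OF wh]] power_mono[OF bg]]) (use pos' t in auto)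
    finally have Q: "\<bar>Jh y - Jx x\<bar>\<^sup>2 \<le> (ej x)\<^sup>2 + 2 * (be * t) * (ej x * nQ x - cJ * (ej x)\<^sup>2) + (t * M)\<^sup>2" .
    define D where "D = LV * (t * (al * norm (fv x) + xi * norm (hv x)))"
    have D: "0 \<le> D" "D \<le> LV * (2 * M) * t"
    proof -
      show "0 \<le> D" unfolding D_def using LV pos pos' t by simp
      have "al * norm (fv x) \<le> 1 * M" "xi * norm (hv x) \<le> 1 * M" 
        using pos pos' M(2)[OF I] by (intro mult_mono; simp)+
      then have "al * norm (fv x) + xi * norm (hv x) \<le> 2 * M" by simp
      then have "LV * (t * (al * norm (fv x) + xi * norm (hv x))) \<le> LV * (t * (2 * M))" using LV t by (intro mult_left_mono) auto
      then show "D \<le> LV * (2 * M) * t" unfolding D_def by (simp add: mult_ac)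
    qed
    have "\<bar>be * t * gJ x\<bar> = be * t * \<bar>gJ x\<bar>" using pos' t by (simp add: abs_mult)
    then have "\<bar>Jh y - Jx x\<bar> \<le> ej x + t * M"
      using 1 bg abs_triangle_ineq[of w "be * t * gJ x"] unfolding ej_def w_def[symmetric] by linarith
    moreover have "ej y \<le> \<bar>Jh y - Jx x\<bar> + D"
      using Jx_step[OF I, of a s'] unfolding ej_def D_def y_def[symmetric] t_def[symmetric] by linarith
    ultimately have "(ej y)\<^sup>2 \<le> ((ej x)\<^sup>2 + 2 * (be * t) * (ej x * nQ x - cJ * (ej x)\<^sup>2) + (t * M)\<^sup>2) + 2 * ej x * D + 2 * (t * M) * D + D\<^sup>2"
      using D nonneg by (intro shifted_square[OF _ Q]) auto
    also have "2 * (t * M) * D \<le> 2 * (t * M) * (LV * (2 * M) * t)" using D t M by (intro mult_left_mono) auto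
    also have "D\<^sup>2 \<le> (LV * (2 * M) * t)\<^sup>2" using D by (intro power_mono) auto
    finally have "(ej y)\<^sup>2 \<le> ((ej x)\<^sup>2 + 2 * (be * t) * (ej x * nQ x - cJ * (ej x)\<^sup>2) + (t * M)\<^sup>2) + 2 * ej x * D + 2 * (t * M) * (LV * (2 * M) * t) + (LV * (2 * M) * t)\<^sup>2"
      by simp
    then show "(ej (nxt k x a s'))\<^sup>2 \<le> (ej x)\<^sup>2 + tk k * (- 2 * be * cJ * (ej x)\<^sup>2 + 2 * be * ej x * nQ x
     + 2 * LV * ej x * (al * norm (fv x) + xi * norm (hv x))) + ?C * (tk k)\<^sup>2"
      unfolding y_def[symmetric] t_def[symmetric] D_def by (simp add: power2_eq_square algebra_simps)
  qed
qed

end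

section \<open>The projected value estimate\<close>

lemma inner_lower: "2 * ((p - q) \<bullet> p) \<ge> (norm p)\<^sup>2 - (norm q)\<^sup>2" for p q :: "'v::real_inner"
proof -
  have "0 \<le> (p - q) \<bullet> (p - q)" by simp
  then show ?thesis by (simp add: power2_norm_eq_inner inner_diff_left inner_diff_right inner_commute)
qed

text \<open>The algebra behind the corrections. \<open>S\<close> and \<open>G\<close> are the sums
  of \<open>Vh\<close> and \<open>gV\<close>, \<open>q\<close> and \<open>j\<close> are
  \<open>gJ\<close> and \<open>Jh\<close> over \<open>cJ\<close>, \<open>R\<close> is reward minus
  \<open>Jh\<close>, \<open>v\<close> and \<open>v'\<close> are the values at the current and next
  state, \<open>x\<close> the clipping excess over \<open>cJ\<close>, \<open>e\<close> the loss by
  projection, \<open>z\<close> the new state term. With \<open>b = be / lam\<close> the filter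
  increments cancel \<open>be * t * G\<close> and \<open>be * t * q\<close>; the temporal difference
  \<open>v' - v\<close> telescopes with the state term.\<close>

lemma telescoping_identity:
  fixes S G q R v v' j x z e be b l t :: real
  assumes "be = b * l"
  shows "((S + be * t * G - e) + b * (((1 - l * t) * G + l * t * (R + v' - v)) - ((1 - l * t) * q + l * t * R))
     - (j + be * t * q - x) - z) - (S + b * (G - q) - j - be * t * v) + e = x + (be * t * v' - z)"
  unfolding assms by algebra

context mfg_alg
begin

text \<open>Yk is the normalized sum of the value estimate plus the corrections by gV, gJ, Jh and the current
  state that make its increment equal to - eta chat up to second order; Yl adds aa ell to remove the slow
  drift that enters through Jh.\<close>

definition "sn = sqrt (real CARD('s))"
definition "aa = 1 / (cJ * sn)"
definition "bb = be / lam"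
definition "Vhat k x = Vh x + (be * tk k) *\<^sub>R gV x"
definition "eta k x = shrink BV (Vhat k x)"
definition "chat k x = (\<Sum>i\<in>UNIV. Vhat k x $ i) / sn"
definition "Yk k x = ((\<Sum>i\<in>UNIV. Vh x $ i) + bb * ((\<Sum>i\<in>UNIV. gV x $ i) - gJ x / cJ) - Jh x / cJ
   - be * tk k * Vh x $ st x) / sn"
definition "Yl k x = Yk k x + aa * ell x"

lemma sn_ge: "1 \<le> sn" unfolding sn_def by (simp add: Suc_leI)

text \<open>The condition cJ >= 1/\<gamma> keeps the coefficient \<open>aa\<close> below
  \<open>\<gamma>\<close>, so that the couplings it creates are comparable with the decay of the
  value error.\<close>

lemma aa_bounds: "0 < aa" "aa \<le> \<gamma>" "aa * cJ \<le> 1"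
proof -
  show "0 < aa" unfolding aa_def using cJ sn_ge by simp
  have "aa \<le> 1 / cJ" unfolding aa_def using cJ sn_ge by (intro divide_left_mono) auto
  also have "\<dots> \<le> \<gamma>" using cJ by (simp add: divide_le_eq mult.commute)
  finally show "aa \<le> \<gamma>" .
  show "aa * cJ \<le> 1" unfolding aa_def using cJ sn_ge by simp
qed

lemma bb_bounds: "0 < bb" "bb * (36 * LF\<^sup>2) \<le> 1" "bb * (72 * (cJ + 3)\<^sup>2) \<le> 1" "bb \<le> 1" "bb * lam = be"
proof -
  show b: "0 < bb" "bb * lam = be" unfolding bb_def using pos' by auto
  have "36 * LF\<^sup>2 \<le> 72 * LG\<^sup>2 + 36 * LF\<^sup>2 + 8 / \<gamma>" using gam by simp
  then have "36 * LF\<^sup>2 * be \<le> lam" 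
    using S4 mult_right_mono[of "36 * LF\<^sup>2" "72 * LG\<^sup>2 + 36 * LF\<^sup>2 + 8 / \<gamma>" be] pos' by linarith
  then show "bb * (36 * LF\<^sup>2) \<le> 1" unfolding bb_def using pos' by (simp add: mult_ac)
  show "bb * (72 * (cJ + 3)\<^sup>2) \<le> 1" unfolding bb_def using overdamped(1) pos' by (simp add: mult_ac)
  show "bb \<le> 1" unfolding bb_def using pos pos' by simp
qed

lemma Vh_nxt: "Vh (nxt k x a s') = (1 - eta k x) *\<^sub>R Vhat k x"
  unfolding nxt_def eta_def Vhat_def alg_state.simps by (rule closest_point_ball[OF BV, THEN conjunct1])

text \<open>\<open>eta * norm Vhat\<close> is the length cut off by the projection, at most the
  length of the step because the previous iterate lies in the ball. Hence eta chat is O(tk) although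
  chat itself need not be small.\<close>

lemma eta_bounds: assumes I: "Inv k x"
  shows "0 \<le> eta k x" "eta k x * norm (Vhat k x) \<le> be * tk k * norm (gV x)" "eta k x = 0 \<or> BV \<le> norm (Vhat k x)"
    "eta k x * \<bar>chat k x\<bar> \<le> be * tk k * norm (gV x)"
proof -
  note c = closest_point_ball[OF BV, of "Vhat k x", folded eta_def]
  show e: "0 \<le> eta k x" "eta k x = 0 \<or> BV \<le> norm (Vhat k x)" using c by auto
  have "norm (Vhat k x) - BV \<le> norm ((be * tk k) *\<^sub>R gV x)"
    using norm_triangle_ineq[of "Vh x" "(be * tk k) *\<^sub>R gV x"] paramsD(1)[OF Inv_params[OF I]] unfolding par_simps Vhat_def by linarith
  also have "\<dots> = be * tk k * norm (gV x)" using pos' tk_pos[of k] by simp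
  finally have "norm (Vhat k x) - BV \<le> be * tk k * norm (gV x)" .
  moreover have "0 \<le> be * tk k * norm (gV x)" using pos' tk_pos[of k] by simp
  ultimately show 1: "eta k x * norm (Vhat k x) \<le> be * tk k * norm (gV x)" using c by simp
  have "eta k x * \<bar>chat k x\<bar> \<le> eta k x * norm (Vhat k x)"
    unfolding chat_def sn_def using e by (intro mult_left_mono normalized_sum_le) auto
  then show "eta k x * \<bar>chat k x\<bar> \<le> be * tk k * norm (gV x)" using 1 by simp
qed

lemma eV_drift: "\<exists>C. \<forall>k x a s'. Inv k x \<longrightarrow>
   (eV (nxt k x a s'))\<^sup>2 \<le> (eV x)\<^sup>2 + tk k * (- 2 * be * \<gamma> * (eV x)\<^sup>2 + 2 * be * eV x * ej x + 2 * be * eV x * nG x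
     + 2 * LV * eV x * (al * norm (fv x) + xi * norm (hv x))) + eta k x * (chat k x)\<^sup>2 + C * (tk k)\<^sup>2"
proof -
  obtain M where M: "M \<ge> 1" "\<And>k x. Inv k x \<Longrightarrow> norm (fv x) \<le> M \<and> norm (hv x) \<le> M \<and> norm (gV x) \<le> M" using Inv_all_bounds by blast
  let ?C = "2 * M\<^sup>2 + 2 * (2 * M) * (LV * (2 * M)) + (LV * (2 * M))\<^sup>2"
  show ?thesis
  proof (intro exI[of _ ?C] allI impI)
    fix k x a s' assume I: "Inv k x"
    define y where "y = nxt k x a s'"
    define t where "t = tk k"
    have t: "0 < t" "t \<le> 1" unfolding t_def by (auto simp: tk_pos tk_le_one)
    define \<eta> where "\<eta> = eta k x"
    define c where "c = chat k x"
    define P where "P = projperp (Vhat k x)"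
    define V0 where "V0 = Vf K r (softmax (th x)) (muh x)"
    define V1 where "V1 = Vf K r (softmax (th y)) (muh y)"
    define d where "d = projperp (Vh x - V0)"
    have d: "norm d = eV x" unfolding d_def eV_def V0_def ..
    have bg: "be * t * norm (gV x) \<le> t * M"
    proof -
      have "be * t * norm (gV x) \<le> 1 * t * M" using pos pos' t M(2)[OF I] by (intro mult_mono) auto
      then show ?thesis by simp
    qed
    have Pd: "P - projperp V0 = d + (be * t) *\<^sub>R projperp (gV x)"
      unfolding P_def d_def Vhat_def t_def projperp_add projperp_diff projperp_scaleR by simp
    have nP: "(norm P)\<^sup>2 = (norm (Vhat k x))\<^sup>2 - c\<^sup>2"
      unfolding P_def c_def chat_def sn_def using norm_projperp_decomp[of "Vhat k x"] by simp
    have \<eta>: "0 \<le> \<eta>" "\<eta> = 0 \<or> BV \<le> norm (Vhat k x)" unfolding \<eta>_def using eta_bounds[OF I] by auto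
    have \<eta>P: "\<eta> * norm P \<le> t * M"
    proof -
      have "\<eta> * norm P \<le> \<eta> * norm (Vhat k x)" unfolding P_def using \<eta>(1) by (intro mult_left_mono norm_projperp_le)
      then show ?thesis using eta_bounds(2)[OF I] bg unfolding \<eta>_def t_def by linarith
    qed
    \<comment> \<open>If the projection acts, the unprojected iterate has norm at least
      \<open>BV\<close>, while the true value has norm at most \<open>BV\<close>. By Pythagoras
      |P|^2 is the squared norm of the iterate minus \<open>c^2\<close>, so |P|^2 falls below
      |projperp V0|^2 by at most \<open>c^2\<close>; without the constant component there would be
      no excess.\<close>
    have key: "- (2 * \<eta> * ((P - projperp V0) \<bullet> P)) \<le> \<eta> * c\<^sup>2"
    proof (cases "\<eta> = 0")
      case False
      then have "BV\<^sup>2 \<le> (norm (Vhat k x))\<^sup>2" using \<eta>(2) BV by (intro power_mono) auto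
      moreover have "norm (projperp V0) \<le> BV" using norm_projperp_le[of V0] Vf_bound[OF softmax_policy Inv_muh[OF I], of "th x"] unfolding V0_def by linarith
      then have "(norm (projperp V0))\<^sup>2 \<le> BV\<^sup>2" by (intro power_mono) auto
      ultimately have "- (2 * ((P - projperp V0) \<bullet> P)) \<le> c\<^sup>2"
        using inner_lower[of P "projperp V0"] nP by linarith
      then have "\<eta> * (- (2 * ((P - projperp V0) \<bullet> P))) \<le> \<eta> * c\<^sup>2" using \<eta>(1) by (rule mult_left_mono)
      then show ?thesis by (simp add: mult_ac)
    qed simp
    have "(norm ((1 - \<eta>) *\<^sub>R P - projperp V0))\<^sup>2 = (norm ((P - projperp V0) + (- \<eta>) *\<^sub>R P))\<^sup>2"
      by (simp add: algebra_simps)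
    also have "\<dots> = (norm (P - projperp V0))\<^sup>2 - 2 * \<eta> * ((P - projperp V0) \<bullet> P) + (\<eta> * norm P)\<^sup>2"
      unfolding norm_add_sq using \<eta>(1) by (simp add: power_mult_distrib)
    also have "\<dots> \<le> (norm (P - projperp V0))\<^sup>2 + \<eta> * c\<^sup>2 + (t * M)\<^sup>2"
      using key power_mono[OF \<eta>P, of 2] \<eta>(1) by simp
    finally have A: "(norm ((1 - \<eta>) *\<^sub>R P - projperp V0))\<^sup>2 \<le> (norm (P - projperp V0))\<^sup>2 + \<eta> * c\<^sup>2 + (t * M)\<^sup>2" .
    have pg: "be * t * norm (projperp (gV x)) \<le> t * M"
    proof -
      have "be * t * norm (projperp (gV x)) \<le> be * t * norm (gV x)" using pos' t by (intro mult_left_mono norm_projperp_le) auto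
      then show ?thesis using bg by linarith
    qed
    have "(norm (P - projperp V0))\<^sup>2 = (eV x)\<^sup>2 + 2 * (be * t) * (d \<bullet> gV x) + (be * t * norm (projperp (gV x)))\<^sup>2"
      unfolding Pd norm_add_sq d using pos' t by (simp add: d_def inner_projperp)
    also have "\<dots> \<le> (eV x)\<^sup>2 + 2 * (be * t) * (eV x * nG x - \<gamma> * (eV x)\<^sup>2 + eV x * ej x) + (t * M)\<^sup>2"
    proof (rule add_mono[OF add_left_mono[OF mult_left_mono] power_mono[OF pg]])
      have "d \<bullet> (gV x - mean XV (par x)) \<le> eV x * nG x" unfolding nG_def d[symmetric] by (rule norm_cauchy_schwarz)
      moreover have "d \<bullet> mean XV (par x) \<le> - \<gamma> * (eV x)\<^sup>2 + eV x * ej x"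
        using critic_mean_descent[OF Inv_muh[OF I], of "Vh x" "th x" "Jh x"]
        unfolding XV_def par_simps d[symmetric] d_def V0_def ej_def Jx_def by (simp only: abs_minus_commute)
      ultimately show "d \<bullet> gV x \<le> eV x * nG x - \<gamma> * (eV x)\<^sup>2 + eV x * ej x" by (simp add: inner_diff_right)
    qed (use pos' t in auto)
    finally have B: "(norm (P - projperp V0))\<^sup>2 \<le> (eV x)\<^sup>2 + 2 * (be * t) * (eV x * nG x - \<gamma> * (eV x)\<^sup>2 + eV x * ej x) + (t * M)\<^sup>2" .
    define D where "D = LV * (t * (al * norm (fv x) + xi * norm (hv x)))"
    have D: "0 \<le> D" "D \<le> LV * (2 * M) * t"
    proof -
      show "0 \<le> D" unfolding D_def using LV pos pos' t by simp
      have "al * norm (fv x) \<le> 1 * M" "xi * norm (hv x) \<le> 1 * M"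
        using pos pos' M(2)[OF I] by (intro mult_mono; simp)+
      then have "al * norm (fv x) + xi * norm (hv x) \<le> 2 * M" by simp
      then have "LV * (t * (al * norm (fv x) + xi * norm (hv x))) \<le> LV * (t * (2 * M))" using LV t by (intro mult_left_mono) auto
      then show "D \<le> LV * (2 * M) * t" unfolding D_def by (simp add: mult_ac)
    qed
    have 1: "norm ((1 - \<eta>) *\<^sub>R P - projperp V0) \<le> eV x + 2 * (t * M)"
    proof -
      have "(1 - \<eta>) *\<^sub>R P - projperp V0 = (d + (be * t) *\<^sub>R projperp (gV x)) - \<eta> *\<^sub>R P"
        unfolding Pd[symmetric] by (simp add: algebra_simps)
      also have "norm \<dots> \<le> norm d + norm ((be * t) *\<^sub>R projperp (gV x)) + norm (\<eta> *\<^sub>R P)"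
        by (rule order_trans[OF norm_triangle_ineq4 add_right_mono[OF norm_triangle_ineq]])
      also have "norm ((be * t) *\<^sub>R projperp (gV x)) = be * t * norm (projperp (gV x))" using pos' t by simp
      also have "norm (\<eta> *\<^sub>R P) = \<eta> * norm P" using \<eta> by simp
      finally show ?thesis using pg \<eta>P d by linarith
    qed
    have "norm (projperp (V0 - V1)) \<le> D"
    proof -
      have "norm (projperp (V0 - V1)) \<le> LV * (norm (th x - th y) + norm (muh x - muh y))"
        unfolding V0_def V1_def using par_nxt_params[of k x a s'] Inv_muh[OF I]
        by (intro Vf_lip) (auto simp: params_def par_simps y_def)
      also have "\<dots> \<le> D" unfolding D_def
        using par_step(1,4)[OF Inv_params[OF I], of k a s'] LV unfolding y_def[symmetric] t_def[symmetric]
        by (intro mult_left_mono) (auto simp: algebra_simps norm_minus_commute)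
      finally show ?thesis .
    qed
    moreover have "projperp (Vh y - V1) = ((1 - \<eta>) *\<^sub>R P - projperp V0) + projperp (V0 - V1)"
      unfolding y_def Vh_nxt \<eta>_def[symmetric] P_def projperp_diff projperp_scaleR by simp
    ultimately have 2: "eV y \<le> norm ((1 - \<eta>) *\<^sub>R P - projperp V0) + D"
      unfolding eV_def V1_def[symmetric] using norm_triangle_ineq[of "(1 - \<eta>) *\<^sub>R P - projperp V0" "projperp (V0 - V1)"] by simp
    have "(eV y)\<^sup>2 \<le> ((eV x)\<^sup>2 + 2 * (be * t) * (eV x * nG x - \<gamma> * (eV x)\<^sup>2 + eV x * ej x) + (t * M)\<^sup>2 + \<eta> * c\<^sup>2 + (t * M)\<^sup>2)
       + 2 * eV x * D + 2 * (2 * (t * M)) * D + D\<^sup>2"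
      using A B D 1 2 nonneg by (intro shifted_square) auto
    also have "2 * (2 * (t * M)) * D \<le> 2 * (2 * (t * M)) * (LV * (2 * M) * t)" using D t M by (intro mult_left_mono) auto
    also have "D\<^sup>2 \<le> (LV * (2 * M) * t)\<^sup>2" using D by (intro power_mono) auto
    finally have "(eV y)\<^sup>2 \<le> ((eV x)\<^sup>2 + 2 * (be * t) * (eV x * nG x - \<gamma> * (eV x)\<^sup>2 + eV x * ej x) + (t * M)\<^sup>2 + \<eta> * c\<^sup>2 + (t * M)\<^sup>2)
       + 2 * eV x * D + 2 * (2 * (t * M)) * (LV * (2 * M) * t) + (LV * (2 * M) * t)\<^sup>2" by simp
    then show "(eV (nxt k x a s'))\<^sup>2 \<le> (eV x)\<^sup>2 + tk k * (- 2 * be * \<gamma> * (eV x)\<^sup>2 + 2 * be * eV x * ej x + 2 * be * eV x * nG x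
     + 2 * LV * eV x * (al * norm (fv x) + xi * norm (hv x))) + eta k x * (chat k x)\<^sup>2 + ?C * (tk k)\<^sup>2"
      unfolding y_def[symmetric] t_def[symmetric] D_def \<eta>_def[symmetric] c_def[symmetric] by (simp add: power2_eq_square algebra_simps)
  qed
qed

lemma Y_step: "\<exists>C\<ge>0. \<forall>k x a s'. Inv k x \<longrightarrow>
   \<bar>Yk (Suc k) (nxt k x a s') - Yk k x + eta k x * chat k x\<bar> \<le> C * ((tk k)\<^sup>2 + tk k * ee k)"
proof -
  obtain M where M: "M \<ge> 1" "\<And>k x. Inv k x \<Longrightarrow> norm (gV x) \<le> M" using Inv_all_bounds by blast
  let ?C = "BV + M + 1 / cJ"
  show ?thesis
  proof (intro exI[of _ ?C] conjI allI impI)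
    fix k x a s' assume I: "Inv k x"
    define y where "y = nxt k x a s'"
    define t where "t = tk k"
    have t: "0 < t" "t \<le> 1" unfolding t_def by (auto simp: tk_pos tk_le_one)
    define cx where "cx = Jh x + be * t * gJ x - Jh y"
    have chi: "\<bar>cx\<bar> \<le> be * t * ee k" unfolding cx_def t_def y_def by (rule clip_excess[OF I])
    define td where "td = r (st x) a (muh x) - Jh x + Vh x $ s' - Vh x $ st x"
    have gVy: "(\<Sum>i\<in>UNIV. gV y $ i) = (1 - lam * t) * (\<Sum>i\<in>UNIV. gV x $ i) + lam * t * td"
    proof -
      have ax: "(\<Sum>i\<in>UNIV. (axis (st x) 1 :: real^'s) $ i) = 1"
        by (rule simplex_sum[OF axis_in_simplex])
      have "gV y = (1 - lam * t) *\<^sub>R gV x + (lam * t * td) *\<^sub>R axis (st x) 1"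
        unfolding y_def nxt_def XV_def par_simps by (simp add: t_def td_def)
      then show ?thesis
        by (simp add: sum.distrib sum_distrib_left[symmetric] ax)
    qed
    have gJy: "gJ y / cJ = (1 - lam * t) * (gJ x / cJ) + lam * t * (r (st x) a (muh x) - Jh x)"
      unfolding y_def nxt_def XJ_def par_simps using cJ by (simp add: t_def add_divide_distrib)
    have Vy: "(\<Sum>i\<in>UNIV. Vh y $ i) = (\<Sum>i\<in>UNIV. Vh x $ i) + be * t * (\<Sum>i\<in>UNIV. gV x $ i) - eta k x * chat k x * sn"
    proof -
      have "(\<Sum>i\<in>UNIV. Vh y $ i) = (1 - eta k x) * (\<Sum>i\<in>UNIV. Vhat k x $ i)"
        unfolding y_def Vh_nxt by (simp add: sum_distrib_left)
      also have "\<dots> = (\<Sum>i\<in>UNIV. Vhat k x $ i) - eta k x * chat k x * sn"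
        unfolding chat_def using sn_ge by (simp add: algebra_simps)
      also have "(\<Sum>i\<in>UNIV. Vhat k x $ i) = (\<Sum>i\<in>UNIV. Vh x $ i) + be * t * (\<Sum>i\<in>UNIV. gV x $ i)"
        unfolding Vhat_def t_def by (simp add: sum.distrib sum_distrib_left)
      finally show ?thesis .
    qed
    have Jy: "Jh y / cJ = Jh x / cJ + be * t * (gJ x / cJ) - cx / cJ"
      unfolding cx_def by (simp add: diff_divide_distrib add_divide_distrib)
    have sty: "st y = s'" unfolding y_def by (simp add: nxt_def)
    \<comment> \<open>What does not cancel: the clipping excess of \<open>Jh\<close>, and the
      failure of the state term to telescope exactly, since both its weight and \<open>Vh\<close>
      change between the steps.\<close>
    define E where "E = cx / cJ + (be * t * Vh x $ s' - be * tk (Suc k) * Vh y $ s')"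
    have "(Yk (Suc k) y - Yk k x + eta k x * chat k x) * sn = E"
    proof -
      have "(Yk (Suc k) y - Yk k x + eta k x * chat k x) * sn =
        ((\<Sum>i\<in>UNIV. Vh y $ i) + bb * ((\<Sum>i\<in>UNIV. gV y $ i) - gJ y / cJ) - Jh y / cJ - be * tk (Suc k) * Vh y $ st y)
        - ((\<Sum>i\<in>UNIV. Vh x $ i) + bb * ((\<Sum>i\<in>UNIV. gV x $ i) - gJ x / cJ) - Jh x / cJ - be * tk k * Vh x $ st x)
        + eta k x * chat k x * sn"
      proof -
        have "(A / sn - B / sn + z) * sn = A - B + z * sn" for A B z using sn_ge by (simp add: field_simps)
        then show ?thesis unfolding Yk_def .
      qed
      also have "\<dots> = E" unfolding E_def gVy gJy Vy Jy sty t_def[symmetric] td_def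
        by (rule telescoping_identity[OF bb_bounds(5)[symmetric]])
      finally show ?thesis .
    qed
    then have "\<bar>Yk (Suc k) y - Yk k x + eta k x * chat k x\<bar> * sn = \<bar>E\<bar>" using sn_ge by (metis abs_mult abs_of_nonneg order_trans zero_le_one)
    then have "\<bar>Yk (Suc k) y - Yk k x + eta k x * chat k x\<bar> \<le> \<bar>E\<bar>"
      using sn_ge mult_left_mono[of 1 sn "\<bar>Yk (Suc k) y - Yk k x + eta k x * chat k x\<bar>"] by simp
    also have "\<bar>E\<bar> \<le> 1 / cJ * (t * ee k) + (BV * t\<^sup>2 + M * t\<^sup>2)"
    proof -
      have b1: "be \<le> 1" using pos by simp
      have "\<bar>cx / cJ\<bar> \<le> 1 / cJ * (t * ee k)"
      proof -
        have "be * t * ee k \<le> 1 * t * ee k" using b1 t ee_nonneg[of k] by (intro mult_right_mono) auto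
        then have "\<bar>cx\<bar> \<le> t * ee k" using chi by simp
        then show ?thesis using cJ by (simp add: divide_right_mono)
      qed
      moreover have "\<bar>be * t * Vh x $ s' - be * tk (Suc k) * Vh y $ s'\<bar> \<le> BV * t\<^sup>2 + M * t\<^sup>2"
      proof -
        have 1: "\<bar>(be * (t - tk (Suc k))) * Vh x $ s'\<bar> \<le> (1 * t\<^sup>2) * BV"
          unfolding abs_mult using tk_diff[of k] b1 pos' component_le_norm_cart[of "Vh x" s'] paramsD(1)[OF Inv_params[OF I]]
          by (intro mult_mono) (auto simp: t_def par_simps abs_minus_commute)
        have "\<bar>Vh x $ s' - Vh y $ s'\<bar> \<le> be * t * norm (gV x)"
          using component_le_norm_cart[of "Vh x - Vh y" s'] par_step(2)[OF Inv_params[OF I], of k a s']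
          unfolding y_def[symmetric] t_def[symmetric] by (simp add: norm_minus_commute)
        also have "\<dots> \<le> 1 * t * M" using b1 pos' t M(2)[OF I] by (intro mult_mono) auto
        finally have "\<bar>Vh x $ s' - Vh y $ s'\<bar> \<le> t * M" by simp
        moreover have "tk (Suc k) \<le> t" unfolding tk_def t_def by (intro divide_left_mono) auto
        ultimately have 2: "\<bar>(be * tk (Suc k)) * (Vh x $ s' - Vh y $ s')\<bar> \<le> (1 * t) * (t * M)"
          unfolding abs_mult using b1 pos' tk_pos[of "Suc k"] t by (intro mult_mono) auto
        have "be * t * Vh x $ s' - be * tk (Suc k) * Vh y $ s' = (be * (t - tk (Suc k))) * Vh x $ s' + (be * tk (Suc k)) * (Vh x $ s' - Vh y $ s')"
          by (simp add: algebra_simps)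
        then show ?thesis using 1 2 abs_triangle_ineq[of "(be * (t - tk (Suc k))) * Vh x $ s'" "(be * tk (Suc k)) * (Vh x $ s' - Vh y $ s')"]
          by (simp add: power2_eq_square mult_ac)
      qed
      ultimately show ?thesis unfolding E_def by linarith
    qed
    also have "\<dots> \<le> ?C * (t\<^sup>2 + t * ee k)"
    proof -
      have "0 \<le> 1 / cJ * t\<^sup>2" "0 \<le> BV * (t * ee k)" "0 \<le> M * (t * ee k)" using cJ BV M(1) t ee_nonneg[of k] by simp_all
      moreover have "?C * (t\<^sup>2 + t * ee k) = (1 / cJ * (t * ee k) + (BV * t\<^sup>2 + M * t\<^sup>2)) + (1 / cJ * t\<^sup>2 + BV * (t * ee k) + M * (t * ee k))"
        by (simp only: distrib_right distrib_left)
      ultimately show ?thesis by linarith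
    qed
    finally show "\<bar>Yk (Suc k) (nxt k x a s') - Yk k x + eta k x * chat k x\<bar> \<le> ?C * ((tk k)\<^sup>2 + tk k * ee k)"
      unfolding y_def t_def .
  qed (use BV M cJ in simp)
qed

lemma ell_range: "0 \<le> ell x" "ell x \<le> 1"
  unfolding ell_def mfg_ell_def using Jf_range[OF softmax_policy mustar_simplex[OF softmax_policy]] by auto

text \<open>Shows what \<open>aa * ell\<close> is for: \<open>Jh\<close> now enters only through
  \<open>Jh - ell\<close>, which is controlled by \<open>ej\<close> and \<open>em\<close>.\<close>

lemma Yl_eq: "Yl k x = (\<Sum>i\<in>UNIV. Vh x $ i) / sn - aa * (Jh x - ell x)
    + bb * ((\<Sum>i\<in>UNIV. gV x $ i) / sn - aa * gJ x) - be * tk k * Vh x $ st x / sn"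
  unfolding Yl_def Yk_def aa_def by (simp add: diff_divide_distrib add_divide_distrib right_diff_distrib mult.commute)

text \<open>The leading constant has to be explicit because \<open>Wc\<close> is compared with it.
  It is BV for the normalized sum, 1 for \<open>aa * (Jh - ell)\<close> and 1 for the filter terms,
  whose factor \<open>bb\<close> is at most 1 / (36 LF^2).\<close>

lemma Yl_bound: "\<exists>C\<ge>0. \<forall>k x. Inv k x \<longrightarrow> \<bar>Yl k x\<bar> \<le> BV + 2 + C * (tk k + ee k)"
proof (intro exI[of _ "BV + 2"] conjI allI impI)
  fix k x assume I: "Inv k x"
  have p: "norm (Vh x) \<le> BV" "0 \<le> Jh x" "Jh x \<le> 1" using paramsD[OF Inv_params[OF I]] by (auto simp: par_simps)
  have 1: "\<bar>(\<Sum>i\<in>UNIV. Vh x $ i) / sn\<bar> \<le> BV" using normalized_sum_le[of "Vh x"] p unfolding sn_def by linarith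
  have 2: "\<bar>aa * (Jh x - ell x)\<bar> \<le> 1"
    unfolding abs_mult using mult_mono[of "\<bar>aa\<bar>" 1 "\<bar>Jh x - ell x\<bar>" 1] aa_bounds gam p ell_range[of x] by simp
  have 3: "\<bar>bb * ((\<Sum>i\<in>UNIV. gV x $ i) / sn - aa * gJ x)\<bar> \<le> 1 + 2 * ee k"
  proof -
    have a: "\<bar>(\<Sum>i\<in>UNIV. gV x $ i) / sn\<bar> \<le> 1 + sqrt 2 * BV + ee k"
      using normalized_sum_le[of "gV x"] I unfolding sn_def Inv_def by linarith
    have c: "cJ * (1 - Jh x) \<le> cJ * 1" "cJ * Jh x \<le> cJ * 1" using p cJ by (auto intro!: mult_left_mono)
    then have "\<bar>gJ x\<bar> \<le> 2 * cJ + ee k" using I[unfolded Inv_def] unfolding mult.assoc by linarith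
    then have "\<bar>aa * gJ x\<bar> \<le> aa * (2 * cJ + ee k)" unfolding abs_mult using aa_bounds by (simp add: mult_left_mono)
    also have "\<dots> \<le> 2 + ee k"
      using aa_bounds gam mult_right_mono[of aa 1 "ee k"] ee_nonneg[of k] by (simp add: algebra_simps)
    finally have "\<bar>(\<Sum>i\<in>UNIV. gV x $ i) / sn - aa * gJ x\<bar> \<le> (3 + sqrt 2 * BV) + 2 * ee k" using a by linarith
    then have "bb * \<bar>(\<Sum>i\<in>UNIV. gV x $ i) / sn - aa * gJ x\<bar> \<le> bb * ((3 + sqrt 2 * BV) + 2 * ee k)"
      using bb_bounds by (intro mult_left_mono) auto
    also have "\<dots> = bb * (3 + sqrt 2 * BV) + bb * (2 * ee k)" by (rule distrib_left)
    also have "\<dots> \<le> 1 + 1 * (2 * ee k)"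
    proof (rule add_mono)
      have "3 + sqrt 2 * BV \<le> 36 * LF\<^sup>2"
      proof -
        have "sqrt 2 * BV \<le> 3/2 * BV" using sqrt2_bounds BV by (intro mult_right_mono) auto
        moreover have "LF \<le> LF\<^sup>2" using LF_ge by (simp add: power2_eq_square)
        ultimately show ?thesis using LF_ge BV by linarith
      qed
      then have "bb * (3 + sqrt 2 * BV) \<le> bb * (36 * LF\<^sup>2)" using bb_bounds by (intro mult_left_mono) auto
      then show "bb * (3 + sqrt 2 * BV) \<le> 1" using bb_bounds by linarith
      show "bb * (2 * ee k) \<le> 1 * (2 * ee k)" using bb_bounds ee_nonneg[of k] by (intro mult_right_mono) auto
    qed
    finally show ?thesis using bb_bounds by (simp add: abs_mult)
  qed
  have 4: "\<bar>be * tk k * Vh x $ st x / sn\<bar> \<le> BV * tk k"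
  proof -
    have "\<bar>be * tk k * Vh x $ st x / sn\<bar> = be * tk k * \<bar>Vh x $ st x\<bar> / sn"
      using pos' tk_pos[of k] sn_ge by (simp add: abs_mult)
    also have "\<dots> \<le> 1 * tk k * BV / 1"
      using pos pos' tk_pos[of k] sn_ge component_le_norm_cart[of "Vh x" "st x"] p by (intro frac_le mult_mono) auto
    also have "\<dots> = BV * tk k" by simp
    finally show ?thesis .
  qed
  have "\<bar>Yl k x\<bar> \<le> BV + 2 + BV * tk k + 2 * ee k" unfolding Yl_eq using 1 2 3 4 by linarith
  also have "\<dots> \<le> BV + 2 + (BV + 2) * (tk k + ee k)"
    using BV tk_pos[of k] ee_nonneg[of k] by (simp add: algebra_simps)
  finally show "\<bar>Yl k x\<bar> \<le> BV + 2 + (BV + 2) * (tk k + ee k)" .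
qed (use BV in simp)

text \<open>This makes \<open>eta * chat * (chat - Yl)\<close>, the part of the excess that the
  square of \<open>Yl\<close> leaves, a product of two small factors.\<close>

lemma chat_Yl: "\<exists>C\<ge>0. \<forall>k x. Inv k x \<longrightarrow> \<bar>chat k x - Yl k x\<bar> \<le> aa * (ej x + LV * em x) + bb * (nG x + aa * nQ x) + C * tk k"
proof -
  obtain M where M: "M \<ge> 1" "\<And>k x. Inv k x \<Longrightarrow> norm (gV x) \<le> M" using Inv_all_bounds by blast
  show ?thesis
  proof (intro exI[of _ "M + BV"] conjI allI impI)
    fix k x assume I: "Inv k x"
    note p = Inv_params[OF I]
    define t where "t = tk k"
    have t: "0 < t" unfolding t_def by (rule tk_pos)
    have ch: "chat k x = (\<Sum>i\<in>UNIV. Vh x $ i) / sn + be * t * ((\<Sum>i\<in>UNIV. gV x $ i) / sn)"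
      unfolding chat_def Vhat_def t_def by (simp add: sum.distrib sum_distrib_left add_divide_distrib)
    \<comment> \<open>The stationary parts of the two filter corrections agree, so their difference
      contains only the filter errors \<open>nG\<close> and \<open>nQ\<close>.\<close>
    have m: "(\<Sum>i\<in>UNIV. mean XV (par x) $ i) / sn = aa * mean XJ (par x)"
      unfolding mean_XJ[OF p] aa_def using critic_mean_sum[OF softmax_policy Inv_muh[OF I], of "th x" "Jh x" "Vh x"] cJ
      unfolding XV_def par_simps by simp
    have "(\<Sum>i\<in>UNIV. gV x $ i) / sn - aa * gJ x = (\<Sum>i\<in>UNIV. (gV x - mean XV (par x)) $ i) / sn - aa * (gJ x - mean XJ (par x))"
      using m by (simp add: sum_subtractf diff_divide_distrib right_diff_distrib)
    moreover have "\<bar>(\<Sum>i\<in>UNIV. (gV x - mean XV (par x)) $ i) / sn\<bar> \<le> nG x"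
      unfolding nG_def sn_def by (rule normalized_sum_le)
    moreover have "\<bar>aa * (gJ x - mean XJ (par x))\<bar> = aa * nQ x" unfolding nQ_def abs_mult using aa_bounds by simp
    ultimately have "\<bar>(\<Sum>i\<in>UNIV. gV x $ i) / sn - aa * gJ x\<bar> \<le> nG x + aa * nQ x" by linarith
    then have 1: "\<bar>bb * ((\<Sum>i\<in>UNIV. gV x $ i) / sn - aa * gJ x)\<bar> \<le> bb * (nG x + aa * nQ x)"
      unfolding abs_mult using bb_bounds by (simp add: mult_left_mono)
    have "\<bar>Jx x - ell x\<bar> \<le> LV * em x"
      using Jf_lip[OF Inv_muh[OF I] mst_simplex[of x], of "th x" "th x"] unfolding Jx_def ell_def mfg_ell_def em_def mst_def by simp
    then have "\<bar>Jh x - ell x\<bar> \<le> ej x + LV * em x" unfolding ej_def by linarith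
    then have 2: "\<bar>aa * (Jh x - ell x)\<bar> \<le> aa * (ej x + LV * em x)"
      unfolding abs_mult using aa_bounds by (simp add: mult_left_mono)
    have be1: "be \<le> 1" using pos by simp
    have 3: "\<bar>be * t * Vh x $ st x / sn\<bar> \<le> 1 * t * BV / 1"
    proof -
      have "\<bar>be * t * Vh x $ st x / sn\<bar> = be * t * \<bar>Vh x $ st x\<bar> / sn"
        using pos' t sn_ge by (simp add: abs_mult)
      also have "\<dots> \<le> 1 * t * BV / 1"
        using be1 pos' t sn_ge component_le_norm_cart[of "Vh x" "st x"] paramsD(1)[OF p] by (intro frac_le mult_mono) (auto simp: par_simps)
      finally show ?thesis .
    qed
    have 4: "\<bar>be * t * ((\<Sum>i\<in>UNIV. gV x $ i) / sn)\<bar> \<le> 1 * t * M"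
    proof -
      have "\<bar>(\<Sum>i\<in>UNIV. gV x $ i) / sn\<bar> \<le> M" using normalized_sum_le[of "gV x"] M(2)[OF I] unfolding sn_def by linarith
      then show ?thesis unfolding abs_mult[of "be * t"] using be1 pos' t by (intro mult_mono) auto
    qed
    have "\<bar>chat k x - Yl k x\<bar> \<le> aa * (ej x + LV * em x) + bb * (nG x + aa * nQ x) + (1 * t * BV / 1 + 1 * t * M)"
      unfolding ch Yl_eq t_def[symmetric] using 1 2 3 4 by linarith
    then show "\<bar>chat k x - Yl k x\<bar> \<le> aa * (ej x + LV * em x) + bb * (nG x + aa * nQ x) + (M + BV) * tk k"
      unfolding t_def by (simp add: algebra_simps)
  qed (use BV M in simp)
qed

end

section \<open>Negativity of the total drift\<close>

lemma young:
  fixes c p q x y :: real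
  assumes "c\<^sup>2 \<le> 4 * p * q" "0 \<le> p" "0 \<le> q"
  shows "c * (x * y) \<le> p * x\<^sup>2 + q * y\<^sup>2"
proof -
  have "(c * (x * y))\<^sup>2 = c\<^sup>2 * (x * y)\<^sup>2" by (simp add: power_mult_distrib)
  also have "\<dots> \<le> 4 * p * q * (x * y)\<^sup>2" using assms(1) by (rule mult_right_mono) simp
  also have "\<dots> = (p * x\<^sup>2 + q * y\<^sup>2)\<^sup>2 - (p * x\<^sup>2 - q * y\<^sup>2)\<^sup>2" by algebra
  also have "\<dots> \<le> (p * x\<^sup>2 + q * y\<^sup>2)\<^sup>2" by simp
  finally show ?thesis by (rule power2_le_imp_le) (use assms in simp)
qed

text \<open>The drift divided by \<open>be\<close>, as a form in absolute errors: \<open>nx\<close>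
  and \<open>f\<close> are the norms of the partial gradient and of \<open>fv\<close>;
  \<open>v\<close>, \<open>j\<close> the value and reward errors; \<open>F\<close>,
  \<open>G\<close>, \<open>Q\<close> filter errors; \<open>M\<close> and \<open>N\<close> the
  mean-field error and its filter error times \<open>LV\<close>; \<open>R\<close> is lam/be,
  \<open>\<omega>\<close> is 1 - \<delta>. Here \<open>\<kappa>\<close> bounds the speed of the
  targets and is not the herding constant. The filters are fast, so \<open>R\<close> and
  \<open>\<mu>\<close> put large coefficients on F, G, Q, N; every mixed product is split by Young
  so that the shares stay below the diagonal.\<close>

lemma lyapunov_form_negative:
  fixes \<gamma> cJ R \<mu> \<omega> nx f v M j F G Q N :: real
  assumes g: "0 < \<gamma>" "\<gamma> < 1" "1 \<le> cJ * \<gamma>" and cJ: "0 < cJ" and om: "0 < \<omega>" "\<omega> < 1"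
    and R: "72 * (cJ + 3)\<^sup>2 + 900 + 8 / \<gamma> \<le> R" and mu: "6912 / \<omega>\<^sup>2 \<le> \<mu>"
  defines "\<kappa> \<equiv> \<gamma> / 6912 * (f + N + 2 * M)"
    and "P \<equiv> G + 3/2 * v + j"
  shows "- \<gamma> / 50 * nx\<^sup>2 - \<gamma> / 50 * f\<^sup>2 + \<gamma> / 48 * (3 * F\<^sup>2 + 12 * v\<^sup>2 + 3 * M\<^sup>2)
    + (- 2 * \<gamma> * v\<^sup>2 + 2 * v * j + 2 * v * G + 2 * v * \<kappa>) + P * (\<gamma> * (j + M) + (G + \<gamma> * Q))
    + (- 8 * \<gamma> * M\<^sup>2 + 8 * \<gamma> / \<omega> * (M * N) + \<gamma> / 10 * (M * f))
    + (- 128 * cJ * j\<^sup>2 + 128 * j * Q + 128 * j * \<kappa>)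
    + (- 2 * \<gamma> * R * F\<^sup>2 + 6 * \<gamma> * F * \<kappa> + 4 * \<gamma> * F * P)
    + (- 2 * R * G\<^sup>2 + 2 * G * \<kappa> + 2 * G * Q + 2 * cJ * (G * j) + 3 * G\<^sup>2 + 4 * G * v + 3 * G * j)
    + (- 2 * R / cJ * Q\<^sup>2 + 2 * Q * \<kappa> + 2 * Q\<^sup>2 + 2 * cJ * (Q * j))
    + (- 8 * \<gamma> * R * \<mu> * N\<^sup>2 + \<gamma> / 5 * (N * f) + 16 * \<gamma> / \<omega> * N\<^sup>2 + 32 * \<gamma> / \<omega> * (N * M))
    \<le> - \<gamma> / 50 * nx\<^sup>2 - \<gamma> / 2 * v\<^sup>2 - \<gamma> * M\<^sup>2 - cJ * j\<^sup>2" (is "?T \<le> ?rhs")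
proof -
  define e where "e = \<gamma> / 6912"
  have e: "0 < e" "e \<le> \<gamma> / 6912" "e * \<gamma> \<le> e" unfolding e_def using g by (auto simp: mult_left_le)
  have gi: "1 / \<gamma> \<le> cJ" using g by (simp add: divide_le_eq mult.commute)
  have gi1: "1 < 1 / \<gamma>" using g by simp
  have cJ1: "1 < cJ" using gi gi1 by linarith
  have gi504: "504 / \<gamma> = 504 * (1 / \<gamma>)" "0 \<le> 8 / \<gamma>" using g by auto
  have cJsq: "(cJ + 3)\<^sup>2 = cJ * cJ + 6 * cJ + 9" by (simp add: power2_eq_square algebra_simps)
  have cc: "cJ \<le> cJ * cJ" using cJ1 by simp
  have R1: "504 / \<gamma> + 1500 \<le> R" using R gi gi504 cc unfolding cJsq by argo
  have R2: "72 * (cJ * cJ) + 432 * cJ \<le> R" using R gi504(2) unfolding cJsq by argo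
  \<comment> \<open>The weight 1/cJ of the reward filter divides its diagonal coefficient by cJ. The
    square of \<open>cJ + 3\<close> in the bound on \<open>R\<close> leaves a term linear in cJ,
    which is what the coupling of j and Q requires.\<close>
  have R3: "144 * cJ + 864 \<le> 2 * R / cJ"
  proof -
    have "(144 * cJ + 864) * cJ \<le> 2 * R" using R2 by (simp add: algebra_simps)
    then show ?thesis using cJ by (simp add: le_divide_eq)
  qed
  have R4: "2000 \<le> R" using R1 gi1 gi504 by linarith
  \<comment> \<open>The form sorted into diagonal terms and one multiple of each mixed product; each
    product gets one of the estimates below.\<close>
  have T: "?T = - \<gamma> / 50 * nx\<^sup>2 - \<gamma> / 50 * f\<^sup>2 + (\<gamma> / 16 * F\<^sup>2 + \<gamma> / 4 * v\<^sup>2 + \<gamma> / 16 * M\<^sup>2)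
    - 2 * \<gamma> * v\<^sup>2 - 8 * \<gamma> * M\<^sup>2 - 128 * cJ * j\<^sup>2 - 2 * \<gamma> * R * F\<^sup>2 - 2 * R * G\<^sup>2 - 2 * R / cJ * Q\<^sup>2 - 8 * \<gamma> * R * \<mu> * N\<^sup>2
    + (2 + 3/2 * \<gamma>) * (v * j) + (15/2) * (v * G) + 2 * e * (v * f) + 2 * e * (v * N) + (4 * e + 3/2 * \<gamma>) * (v * M) + 3/2 * \<gamma> * (v * Q)
    + 6 * \<gamma> * (F * v) + (4 * e + \<gamma>) * (G * M) + (256 * e + \<gamma>) * (j * M) + 40 * \<gamma> / \<omega> * (M * N) + \<gamma> / 10 * (M * f)
    + 12 * (e * \<gamma>) * (F * M) + 4 * e * (Q * M) + 128 * e * (j * f) + 6 * (e * \<gamma>) * (F * f) + 2 * e * (G * f) + 2 * e * (Q * f) + \<gamma> / 5 * (N * f)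
    + (2 * cJ + 4 + \<gamma>) * (j * G) + (2 * cJ + 128 + \<gamma>) * (j * Q) + 128 * e * (j * N) + 4 * \<gamma> * (F * j) + 6 * (e * \<gamma>) * (F * N) + 4 * \<gamma> * (F * G)
    + (2 + \<gamma>) * (G * Q) + 2 * e * (G * N) + 2 * e * (Q * N)
    + \<gamma> * j\<^sup>2 + 4 * G\<^sup>2 + 2 * Q\<^sup>2 + 16 * \<gamma> / \<omega> * N\<^sup>2"
    unfolding \<kappa>_def P_def e_def by (simp add: field_simps power2_eq_square)
  have sq: "c\<^sup>2 \<le> d\<^sup>2" if "0 \<le> c" "c \<le> d" for c d :: real using that by (rule power_mono[rotated])
  have yg: "c * (x * y) \<le> p * x\<^sup>2 + q * y\<^sup>2" if "0 \<le> c" "c \<le> d" "d\<^sup>2 \<le> 4 * p * q" "0 \<le> p" "0 \<le> q" for c d p q x y :: real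
    using order_trans[OF sq[OF that(1,2)] that(3)] that(4,5) by (rule young)
  \<comment> \<open>This coupling explains the weight 64 on the reward error: its share 16/\<gamma>
    is at most 16 cJ, to be paid from 128 cJ.\<close>
  have vj: "(2 + 3/2 * \<gamma>) * (v * j) \<le> \<gamma> / 4 * v\<^sup>2 + 16 / \<gamma> * j\<^sup>2"
    by (rule yg[where d = 4]) (use g in auto)
  have vG: "(15/2) * (v * G) \<le> \<gamma> / 8 * v\<^sup>2 + 128 / \<gamma> * G\<^sup>2"
    by (rule yg[where d = 8]) (use g in auto)
  \<comment> \<open>Products caused by moving targets carry the factor
    \<open>e = \<gamma> / 6912\<close> and cost only thousandths of \<gamma> on either side.\<close>
  have small: "c * e * (x * y) \<le> \<gamma> / 1000 * x\<^sup>2 + \<gamma> / 1000 * y\<^sup>2" if "0 \<le> c" "c \<le> 12" for c x y :: real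
  proof (rule yg[where d = "\<gamma> / 500"])
    have "c * e \<le> 12 * (\<gamma> / 6912)" using that e by (intro mult_mono) auto
    then show "c * e \<le> \<gamma> / 500" using g by simp
  qed (use that e g in \<open>auto simp: power2_eq_square\<close>)
  have small': "c * (e * \<gamma>) * (x * y) \<le> \<gamma> / 1000 * x\<^sup>2 + \<gamma> / 1000 * y\<^sup>2" if "0 \<le> c" "c \<le> 12" for c x y :: real
  proof (rule yg[where d = "\<gamma> / 500"])
    have "c * (e * \<gamma>) \<le> 12 * (\<gamma> / 6912)" using that e g by (intro mult_mono) auto
    then show "c * (e * \<gamma>) \<le> \<gamma> / 500" using g by simp
  qed (use that e g in \<open>auto simp: power2_eq_square\<close>)
  have vM: "(4 * e + 3/2 * \<gamma>) * (v * M) \<le> \<gamma> / 2 * v\<^sup>2 + 2 * \<gamma> * M\<^sup>2"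
    by (rule yg[where d = "2 * \<gamma>"]) (use e g in \<open>auto simp: power2_eq_square\<close>)
  have vQ: "3/2 * \<gamma> * (v * Q) \<le> \<gamma> / 100 * v\<^sup>2 + 100 * \<gamma> * Q\<^sup>2"
    by (rule yg[where d = "2 * \<gamma>"]) (use g in \<open>auto simp: power2_eq_square\<close>)
  have Fv: "6 * \<gamma> * (F * v) \<le> 180 * \<gamma> * F\<^sup>2 + \<gamma> / 20 * v\<^sup>2"
    by (rule yg[where d = "6 * \<gamma>"]) (use g in \<open>auto simp: power2_eq_square\<close>)
  have GM: "(4 * e + \<gamma>) * (G * M) \<le> 2 * \<gamma> * G\<^sup>2 + \<gamma> / 2 * M\<^sup>2"
    by (rule yg[where d = "2 * \<gamma>"]) (use e g in \<open>auto simp: power2_eq_square\<close>)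
  have jM: "(256 * e + \<gamma>) * (j * M) \<le> 2 * \<gamma> * j\<^sup>2 + \<gamma> / 2 * M\<^sup>2"
    by (rule yg[where d = "2 * \<gamma>"]) (use e g in \<open>auto simp: power2_eq_square\<close>)
  have MN: "40 * \<gamma> / \<omega> * (M * N) \<le> \<gamma> * M\<^sup>2 + 400 * \<gamma> / \<omega>\<^sup>2 * N\<^sup>2"
    by (rule yg[where d = "40 * \<gamma> / \<omega>"]) (use g om in \<open>auto simp: power2_eq_square\<close>)
  have Mf: "\<gamma> / 10 * (M * f) \<le> \<gamma> / 2 * M\<^sup>2 + \<gamma> / 200 * f\<^sup>2"
    by (rule yg[where d = "\<gamma> / 10"]) (use g in \<open>auto simp: power2_eq_square\<close>)
  have jf: "128 * e * (j * f) \<le> \<gamma> / 10 * j\<^sup>2 + \<gamma> / 1000 * f\<^sup>2"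
    by (rule yg[where d = "\<gamma> / 50"]) (use e g in \<open>auto simp: power2_eq_square\<close>)
  have jN: "128 * e * (j * N) \<le> \<gamma> / 10 * j\<^sup>2 + \<gamma> / 1000 * N\<^sup>2"
    by (rule yg[where d = "\<gamma> / 50"]) (use e g in \<open>auto simp: power2_eq_square\<close>)
  have Nf: "\<gamma> / 5 * (N * f) \<le> 10 * \<gamma> * N\<^sup>2 + \<gamma> / 1000 * f\<^sup>2"
    by (rule yg[where d = "\<gamma> / 5"]) (use g in \<open>auto simp: power2_eq_square\<close>)
  have jG: "(2 * cJ + 4 + \<gamma>) * (j * G) \<le> 4 * cJ * j\<^sup>2 + 4 * cJ * G\<^sup>2"
    by (rule yg[where d = "7 * cJ"]) (use g cJ1 in \<open>auto simp: power2_eq_square\<close>)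
  have jQ: "(2 * cJ + 128 + \<gamma>) * (j * Q) \<le> 64 * cJ * j\<^sup>2 + 68 * cJ * Q\<^sup>2"
    by (rule yg[where d = "131 * cJ"]) (use g cJ1 in \<open>auto simp: power2_eq_square\<close>)
  have Fj: "4 * \<gamma> * (F * j) \<le> 4 * \<gamma> * F\<^sup>2 + \<gamma> * j\<^sup>2"
    by (rule yg[where d = "4 * \<gamma>"]) (use g in \<open>auto simp: power2_eq_square\<close>)
  have FG: "4 * \<gamma> * (F * G) \<le> \<gamma> * F\<^sup>2 + 4 * \<gamma> * G\<^sup>2"
    by (rule yg[where d = "4 * \<gamma>"]) (use g in \<open>auto simp: power2_eq_square\<close>)
  have GQ: "(2 + \<gamma>) * (G * Q) \<le> 3 * G\<^sup>2 + 1 * Q\<^sup>2"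
    by (rule yg[where d = 3]) (use g in auto)
  define f2 v2 M2 j2 F2 G2 Q2 N2 where "f2 = f\<^sup>2" and "v2 = v\<^sup>2" and "M2 = M\<^sup>2" and "j2 = j\<^sup>2" and "F2 = F\<^sup>2" and "G2 = G\<^sup>2" and "Q2 = Q\<^sup>2" and "N2 = N\<^sup>2"
  note sqs = f2_def v2_def M2_def j2_def F2_def G2_def Q2_def N2_def
  have nn: "0 \<le> f2" "0 \<le> v2" "0 \<le> M2" "0 \<le> j2" "0 \<le> F2" "0 \<le> G2" "0 \<le> Q2" "0 \<le> N2" unfolding sqs by auto
  have jb: "16 / \<gamma> * j2 + 4 * cJ * j2 + 64 * cJ * j2 + (2 * \<gamma> + \<gamma> / 10 + \<gamma> / 10 + \<gamma> + \<gamma>) * j2 \<le> 127 * cJ * j2"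
  proof -
    have "16 / \<gamma> + 4 * cJ + 64 * cJ + (2 * \<gamma> + \<gamma> / 10 + \<gamma> / 10 + \<gamma> + \<gamma>) \<le> 127 * cJ" using gi cJ1 g by simp
    from mult_right_mono[OF this nn(4)] show ?thesis by (simp add: algebra_simps)
  qed
  have Fb: "(\<gamma> / 16 + 180 * \<gamma> + 3 * (\<gamma> / 1000) + 4 * \<gamma> + \<gamma>) * F2 \<le> 2 * \<gamma> * R * F2"
  proof -
    have "\<gamma> * 200 \<le> \<gamma> * (2 * R)" using R4 g by (intro mult_left_mono) auto
    then have "\<gamma> / 16 + 180 * \<gamma> + 3 * (\<gamma> / 1000) + 4 * \<gamma> + \<gamma> \<le> 2 * \<gamma> * R" using g by (simp add: mult_ac)
    from mult_right_mono[OF this nn(5)] show ?thesis .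
  qed
  have Gb: "(128 / \<gamma> + 2 * \<gamma> + 4 * cJ + 4 * \<gamma> + 3 + 4 + 2 * (\<gamma> / 1000)) * G2 \<le> 2 * R * G2"
  proof (rule mult_right_mono[OF _ nn(6)])
    have "128 / \<gamma> \<le> 504 / \<gamma>" using g by (simp add: divide_right_mono)
    then show "128 / \<gamma> + 2 * \<gamma> + 4 * cJ + 4 * \<gamma> + 3 + 4 + 2 * (\<gamma> / 1000) \<le> 2 * R" using R1 R2 cc g cJ by linarith
  qed
  have Qb: "(100 * \<gamma> + 68 * cJ + 1 + 2 + 3 * (\<gamma> / 1000)) * Q2 \<le> 2 * R / cJ * Q2"
    by (rule mult_right_mono[OF _ nn(7)]) (use R3 g cJ1 in linarith)
  have Nb: "(\<gamma> / 1000 + 400 * \<gamma> / \<omega>\<^sup>2 + \<gamma> / 1000 + 10 * \<gamma> + 3 * (\<gamma> / 1000) + 16 * \<gamma> / \<omega>) * N2 \<le> 8 * \<gamma> * R * \<mu> * N2"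
  proof (rule mult_right_mono[OF _ nn(8)])
    have o2: "0 < \<omega>\<^sup>2" "\<omega>\<^sup>2 \<le> \<omega>" "\<omega> \<le> 1" using om by (auto simp: power2_eq_square mult_left_le)
    have 1: "1 / \<omega> \<le> 1 / \<omega>\<^sup>2" "1 \<le> 1 / \<omega>\<^sup>2" using o2 om by (auto simp: divide_simps)
    have "\<gamma> * (1 / 1000 + 400 * (1 / \<omega>\<^sup>2) + 1 / 1000 + 10 + 3 / 1000 + 16 * (1 / \<omega>)) \<le> \<gamma> * (8 * R * \<mu>)"
    proof (rule mult_left_mono)
      have "1 / 1000 + 400 * (1 / \<omega>\<^sup>2) + 1 / 1000 + 10 + 3 / 1000 + 16 * (1 / \<omega>) \<le> 6912 * (1 / \<omega>\<^sup>2)" using 1 by linarith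
      also have "\<dots> \<le> 1 * \<mu>" using mu by simp
      also have "\<dots> \<le> (8 * R) * \<mu>"
      proof (rule mult_right_mono)
        have "0 \<le> 6912 / \<omega>\<^sup>2" by simp
        then show "0 \<le> \<mu>" using mu by linarith
      qed (use R4 in simp)
      finally show "1 / 1000 + 400 * (1 / \<omega>\<^sup>2) + 1 / 1000 + 10 + 3 / 1000 + 16 * (1 / \<omega>) \<le> 8 * R * \<mu>" .
    qed (use g in simp)
    then show "\<gamma> / 1000 + 400 * \<gamma> / \<omega>\<^sup>2 + \<gamma> / 1000 + 10 * \<gamma> + 3 * (\<gamma> / 1000) + 16 * \<gamma> / \<omega> \<le> 8 * \<gamma> * R * \<mu>"
      by (simp add: algebra_simps)
  qed
  have gp: "0 \<le> \<gamma> * f2" "0 \<le> \<gamma> * v2" "0 \<le> \<gamma> * M2" using g nn by auto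
  have "?T \<le> - \<gamma> / 50 * nx\<^sup>2 - \<gamma> / 50 * f2 + (\<gamma> / 16 * F2 + \<gamma> / 4 * v2 + \<gamma> / 16 * M2)
    - 2 * \<gamma> * v2 - 8 * \<gamma> * M2 - 128 * cJ * j2 - 2 * \<gamma> * R * F2 - 2 * R * G2 - 2 * R / cJ * Q2 - 8 * \<gamma> * R * \<mu> * N2
    + (\<gamma> / 4 * v2 + 16 / \<gamma> * j2) + (\<gamma> / 8 * v2 + 128 / \<gamma> * G2) + (\<gamma> / 1000 * v2 + \<gamma> / 1000 * f2) + (\<gamma> / 1000 * v2 + \<gamma> / 1000 * N2)
    + (\<gamma> / 2 * v2 + 2 * \<gamma> * M2) + (\<gamma> / 100 * v2 + 100 * \<gamma> * Q2) + (180 * \<gamma> * F2 + \<gamma> / 20 * v2) + (2 * \<gamma> * G2 + \<gamma> / 2 * M2)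
    + (2 * \<gamma> * j2 + \<gamma> / 2 * M2) + (\<gamma> * M2 + 400 * \<gamma> / \<omega>\<^sup>2 * N2) + (\<gamma> / 2 * M2 + \<gamma> / 200 * f2) + (\<gamma> / 1000 * F2 + \<gamma> / 1000 * M2)
    + (\<gamma> / 1000 * Q2 + \<gamma> / 1000 * M2) + (\<gamma> / 10 * j2 + \<gamma> / 1000 * f2) + (\<gamma> / 1000 * F2 + \<gamma> / 1000 * f2) + (\<gamma> / 1000 * G2 + \<gamma> / 1000 * f2)
    + (\<gamma> / 1000 * Q2 + \<gamma> / 1000 * f2) + (10 * \<gamma> * N2 + \<gamma> / 1000 * f2) + (4 * cJ * j2 + 4 * cJ * G2) + (64 * cJ * j2 + 68 * cJ * Q2)
    + (\<gamma> / 10 * j2 + \<gamma> / 1000 * N2) + (4 * \<gamma> * F2 + \<gamma> * j2) + (\<gamma> / 1000 * F2 + \<gamma> / 1000 * N2) + (\<gamma> * F2 + 4 * \<gamma> * G2)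
    + (3 * G2 + 1 * Q2) + (\<gamma> / 1000 * G2 + \<gamma> / 1000 * N2) + (\<gamma> / 1000 * Q2 + \<gamma> / 1000 * N2)
    + \<gamma> * j2 + 4 * G2 + 2 * Q2 + 16 * \<gamma> / \<omega> * N2"
    unfolding T sqs
    by (intro add_mono order.refl vj vG vM vQ Fv GM jM MN Mf jf jN Nf jG jQ Fj FG GQ small small'; simp)
  also have "\<dots> \<le> - \<gamma> / 50 * nx\<^sup>2 + (- \<gamma> / 50 * f2 + 5 * (\<gamma> / 1000) * f2 + \<gamma> / 200 * f2 + \<gamma> / 1000 * f2)
     + (- 2 * \<gamma> * v2 + \<gamma> / 4 * v2 + \<gamma> / 4 * v2 + \<gamma> / 8 * v2 + 2 * (\<gamma> / 1000) * v2 + \<gamma> / 2 * v2 + \<gamma> / 100 * v2 + \<gamma> / 20 * v2)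
     + (- 8 * \<gamma> * M2 + \<gamma> / 16 * M2 + 2 * \<gamma> * M2 + \<gamma> / 2 * M2 + \<gamma> / 2 * M2 + \<gamma> * M2 + \<gamma> / 2 * M2 + 2 * (\<gamma> / 1000) * M2) - cJ * j2"
    using jb Fb Gb Qb Nb unfolding distrib_right by argo
  also have "\<dots> \<le> - \<gamma> / 50 * nx\<^sup>2 - \<gamma> / 2 * v2 - \<gamma> * M2 - cJ * j2"
    using gp by (simp add: mult.commute)
  finally show ?thesis unfolding sqs .
qed

lemma ratio_le: "c * x \<le> d * b \<Longrightarrow> 0 < b \<Longrightarrow> c * (x / b) \<le> d" for b c d x :: real
  by (simp add: divide_le_eq)

lemma ratio_le2: "c * x \<le> d * y \<Longrightarrow> 0 < b \<Longrightarrow> c * (x / b) \<le> d * (y / b)" for b c d x y :: real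
  by (simp add: divide_right_mono)

section \<open>From the quadratic form to the drift of the potential\<close>

context mfg_alg
begin

text \<open>Actor, mean-field and filter step sizes in units of \<open>be\<close>. After division by
  \<open>be\<close> the drift depends on the step sizes only through these ratios.\<close>

definition "nA = al / be"
definition "nZ = xi / be"
definition "nR = lam / be"

text \<open>The weight of the mean-field error for which its own decay is 8 gamma (LV m)^2 in drift_form.\<close>

definition "wm = 4 * \<gamma> * LV\<^sup>2 / (nZ * (1 - \<delta>))"

lemma step_ratios:
  shows "0 < nA" "0 < nZ" "nA \<le> nZ" "be * nA = al" "be * nZ = xi" "be * nR = lam" "bb = 1 / nR"
    "LV * nZ \<le> \<gamma> / 6912" "LF * nZ \<le> \<gamma> / 6912" "LG * nZ \<le> \<gamma> / 6912" "nZ \<le> (1 - \<delta>) * \<gamma> / 6912"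
    "72 * (cJ + 3)\<^sup>2 + 900 + 8 / \<gamma> \<le> nR" "80 * (L * LV * nA) \<le> (1 - \<delta>) * nZ" "0 < wm" "LF\<^sup>2 * nZ \<le> 1 / 6912"
proof -
  show "0 < nA" "0 < nZ" "be * nA = al" "be * nZ = xi" "be * nR = lam" "bb = 1 / nR"
    unfolding nA_def nZ_def nR_def bb_def using pos(1) pos' by simp_all
  show "nA \<le> nZ" unfolding nA_def nZ_def using pos(2) pos'(2) by (simp add: divide_right_mono)
  note A = \<open>0 < nA\<close> \<open>0 < nZ\<close>
  have om: "0 < 1 - \<delta>" "1 - \<delta> \<le> 1" using delta by auto
  have Z1: "LF^4 * LV\<^sup>2 * nZ \<le> (1 - \<delta>) * \<gamma> / 6912" using ratio_le[OF S3(1) pos'(2), folded nZ_def] by simp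
  have Z2: "LF\<^sup>2 * LG\<^sup>2 * (L + 1)\<^sup>2 * LV\<^sup>2 * nZ \<le> (1 - \<delta>) * \<gamma> / 6912" using ratio_le[OF S3(2) pos'(2), folded nZ_def] by simp
  have og: "(1 - \<delta>) * \<gamma> / 6912 \<le> \<gamma> / 6912" using om gam by (simp add: divide_right_mono mult_left_le_one_le)
  have LG1: "1 \<le> LG" using LG_ge cJ by simp
  have s: "1 \<le> LF\<^sup>2" "1 \<le> LV\<^sup>2" "1 \<le> LG\<^sup>2" "1 \<le> (L + 1)\<^sup>2" "LV \<le> LV\<^sup>2" "LF \<le> LF\<^sup>2" "LG \<le> LG\<^sup>2"
    using LF_ge(1) LV LG1 L by (simp_all add: one_le_power self_le_power)
  have s4: "LF\<^sup>2 \<le> LF^4" using LF_ge by (intro power_increasing) auto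
  have p: "1 * LV \<le> LF^4 * LV\<^sup>2" "LF\<^sup>2 * 1 \<le> LF^4 * LV\<^sup>2" "1 * 1 \<le> LF^4 * LV\<^sup>2"
    using mult_mono[of 1 "LF^4" LV "LV\<^sup>2"] mult_mono[of "LF\<^sup>2" "LF^4" 1 "LV\<^sup>2"] mult_mono[of 1 "LF^4" 1 "LV\<^sup>2"] s s4 LV
    by simp_all
  have q: "1 * LG * 1 * 1 \<le> LF\<^sup>2 * LG\<^sup>2 * (L + 1)\<^sup>2 * LV\<^sup>2"
    using s LG1 by (intro mult_mono) auto
  have mono: "c * nZ \<le> (1 - \<delta>) * \<gamma> / 6912" if "c \<le> d" "d * nZ \<le> (1 - \<delta>) * \<gamma> / 6912" for c d
    using mult_right_mono[OF that(1), of nZ] A(2) that(2) by linarith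
  show "LV * nZ \<le> \<gamma> / 6912" using mono[OF _ Z1, of LV] p og by simp
  have LF2: "LF\<^sup>2 * nZ \<le> \<gamma> / 6912" using mono[OF _ Z1, of "LF\<^sup>2"] p og by simp
  then show "LF\<^sup>2 * nZ \<le> 1 / 6912" using gam by simp
  show "LF * nZ \<le> \<gamma> / 6912" using LF2 mult_right_mono[OF s(6), of nZ] A(2) by linarith
  show "LG * nZ \<le> \<gamma> / 6912" using mono[OF _ Z2, of LG] q og by simp
  show "nZ \<le> (1 - \<delta>) * \<gamma> / 6912" using mono[OF _ Z1, of 1] p by simp
  have "72 * LG\<^sup>2 + 36 * LF\<^sup>2 + 8 / \<gamma> \<le> nR" unfolding nR_def using S4 pos' by (simp add: le_divide_eq)
  moreover have "(cJ + 3)\<^sup>2 \<le> LG\<^sup>2" using LG_ge cJ by (intro power_mono) auto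
  moreover have "5\<^sup>2 \<le> LF\<^sup>2" using LF_ge by (intro power_mono) auto
  ultimately show "72 * (cJ + 3)\<^sup>2 + 900 + 8 / \<gamma> \<le> nR" by simp
  have "16 * L * LF * LV * nA \<le> (1 - \<delta>) * nZ" unfolding nA_def nZ_def by (rule ratio_le2[OF S1 pos'(2)])
  moreover have "5 * (L * LV * nA) \<le> LF * (L * LV * nA)" using LF_ge L LV A by (intro mult_right_mono) auto
  ultimately show "80 * (L * LV * nA) \<le> (1 - \<delta>) * nZ" by (simp add: mult_ac)
  show "0 < wm" unfolding wm_def using gam LV A om by simp
qed

text \<open>The inequalities \<open>t1\<close> to \<open>t9\<close> bound the summands of the actual
  drift by those of \<open>lyapunov_form_negative\<close>. Scaling the mean-field errors by
  \<open>LV\<close>, and the weight \<open>wm\<close> by its square, removes \<open>LV\<close> from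
  the couplings.\<close>

lemma drift_form:
  fixes nx f v m j F G Q H h fg w e :: real
  assumes nn: "0 \<le> f" "0 \<le> v" "0 \<le> m" "0 \<le> j" "0 \<le> F" "0 \<le> G" "0 \<le> Q" "0 \<le> H" "0 \<le> h" and h: "h \<le> H + 2 * m"
    and fg: "- fg \<le> - nx\<^sup>2 / 2 - f\<^sup>2 / 2 + e\<^sup>2 / 2" "0 \<le> e" "e \<le> F + 2 * v + LV * m"
    and w: "\<gamma> / 25 \<le> w" "w \<le> \<gamma> / 24"
  shows "- w * fg + (- 2 * \<gamma> * v\<^sup>2 + 2 * v * j + 2 * v * G + 2 * LV * v * (nA * f + nZ * h))
    + (G + sqrt 2 * v + j) * (aa * (j + LV * m) + bb * (G + aa * Q))
    + wm * (- 2 * nZ * (1 - \<delta>) * m\<^sup>2 + 2 * nZ * m * H + 2 * L * nA * m * f)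
    + 64 * (- 2 * cJ * j\<^sup>2 + 2 * j * Q + 2 * LV * j * (nA * f + nZ * h))
    + \<gamma> * (- 2 * nR * F\<^sup>2 + 2 * F * (3 * LF * (nA * f + nZ * h) + 2 * (G + sqrt 2 * v + j)))
    + (- 2 * nR * G\<^sup>2 + 2 * G * (LG * (nA * f + nZ * h) + (Q + cJ * j) + sqrt 2 * (G + sqrt 2 * v + j)))
    + 1 / cJ * (- 2 * nR * Q\<^sup>2 + 2 * Q * (cJ * (LV * (nA * f + nZ * h) + (Q + cJ * j))))
    + wm * (- 2 * nR * H\<^sup>2 + 2 * H * (2 * L * nA * f + 2 * nZ * h))
    \<le> - \<gamma> / 50 * (nx\<^sup>2 + m\<^sup>2 + v\<^sup>2 + j\<^sup>2)"
proof -
  note sr = step_ratios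
  define M where "M = LV * m"
  define N where "N = LV * H"
  define \<omega> where "\<omega> = 1 - \<delta>"
  define \<mu> where "\<mu> = 1 / (nZ * \<omega>)"
  define \<kappa> where "\<kappa> = \<gamma> / 6912 * (f + N + 2 * M)"
  define P where "P = G + 3/2 * v + j"
  define \<kappa>' where "\<kappa>' = nA * f + nZ * h"
  have om: "0 < \<omega>" "\<omega> < 1" unfolding \<omega>_def using delta by auto
  have MN: "m \<le> M" "H \<le> N" "0 \<le> M" "0 \<le> N" unfolding M_def N_def
    using mult_right_mono[OF LV nn(3)] mult_right_mono[OF LV nn(8)] LV nn by auto
  \<comment> \<open>All targets move with (th, muh). Each Lipschitz constant c with
    \<open>c * nZ <= \<gamma> / 6912\<close> therefore leads to the same bound
    \<open>\<kappa>\<close>, in which the speed of \<open>muh\<close> is already replaced by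
    errors.\<close>
  have kap: "c * \<kappa>' \<le> \<kappa>" if "0 \<le> c" "c * nZ \<le> \<gamma> / 6912" for c
  proof -
    have "nA * f \<le> nZ * f" using sr(3) nn by (intro mult_right_mono) auto
    moreover have "nZ * h \<le> nZ * (N + 2 * M)" using sr(2) h MN by (intro mult_left_mono) auto
    ultimately have "\<kappa>' \<le> nZ * (f + N + 2 * M)" unfolding \<kappa>'_def distrib_left by linarith
    then have "c * \<kappa>' \<le> c * (nZ * (f + N + 2 * M))" using that by (intro mult_left_mono) auto
    also have "\<dots> = (c * nZ) * (f + N + 2 * M)" by simp
    also have "\<dots> \<le> \<kappa>" unfolding \<kappa>_def using that nn MN by (intro mult_right_mono) auto
    finally show ?thesis .
  qed
  have kV: "LV * \<kappa>' \<le> \<kappa>" and kF: "LF * \<kappa>' \<le> \<kappa>" and kG: "LG * \<kappa>' \<le> \<kappa>"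
    using kap[OF _ sr(8)] kap[OF _ sr(9)] kap[OF _ sr(10)] LV LF_ge LG_ge cJ by auto
  have s2: "sqrt 2 * v \<le> 3/2 * v" "sqrt 2 * j \<le> 3/2 * j" "sqrt 2 * G \<le> 3/2 * G"
    by (rule mult_right_mono[OF sqrt2_bounds(2)], rule nn)+
  have P: "G + sqrt 2 * v + j \<le> P" unfolding P_def using s2 by simp
  have P0: "0 \<le> G + sqrt 2 * v + j" using nn by simp
  have t1: "- w * fg \<le> - \<gamma> / 50 * nx\<^sup>2 - \<gamma> / 50 * f\<^sup>2 + \<gamma> / 48 * (3 * F\<^sup>2 + 12 * v\<^sup>2 + 3 * M\<^sup>2)"
  proof -
    have w0: "0 \<le> w" using w gam by linarith
    have "e\<^sup>2 \<le> (F + 2 * v + M)\<^sup>2" using fg unfolding M_def by (intro power_mono) auto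
    also have "\<dots> \<le> 3 * F\<^sup>2 + 12 * v\<^sup>2 + 3 * M\<^sup>2"
    proof -
      have "0 \<le> (F - 2 * v)\<^sup>2 + (F - M)\<^sup>2 + (2 * v - M)\<^sup>2" by simp
      then show ?thesis by (simp add: power2_eq_square algebra_simps)
    qed
    finally have e: "e\<^sup>2 \<le> 3 * F\<^sup>2 + 12 * v\<^sup>2 + 3 * M\<^sup>2" .
    have "w * (- fg) \<le> w * (- nx\<^sup>2 / 2 - f\<^sup>2 / 2 + e\<^sup>2 / 2)" using fg(1) w0 by (rule mult_left_mono)
    also have "\<dots> = - (w * ((nx\<^sup>2 + f\<^sup>2) / 2)) + w * (e\<^sup>2 / 2)" by (simp add: field_simps)
    also have "\<dots> \<le> - (\<gamma> / 25 * ((nx\<^sup>2 + f\<^sup>2) / 2)) + \<gamma> / 24 * ((3 * F\<^sup>2 + 12 * v\<^sup>2 + 3 * M\<^sup>2) / 2)"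
      using w w0 e gam by (intro add_mono le_imp_neg_le mult_mono) auto
    also have "\<dots> = - \<gamma> / 50 * nx\<^sup>2 - \<gamma> / 50 * f\<^sup>2 + \<gamma> / 48 * (3 * F\<^sup>2 + 12 * v\<^sup>2 + 3 * M\<^sup>2)" by (simp add: field_simps)
    finally show ?thesis by simp
  qed
  have t2: "2 * LV * v * \<kappa>' \<le> 2 * v * \<kappa>"
    using mult_left_mono[OF kV, of "2 * v"] nn by (simp add: mult_ac)
  have t3: "(G + sqrt 2 * v + j) * (aa * (j + LV * m) + bb * (G + aa * Q)) \<le> P * (\<gamma> * (j + M) + (G + \<gamma> * Q))"
  proof (rule mult_mono[OF P])
    have jM: "0 \<le> j + M" and GQ: "0 \<le> G + aa * Q" using nn MN aa_bounds(1) by simp_all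
    have "aa * Q \<le> \<gamma> * Q" by (rule mult_right_mono[OF aa_bounds(2) nn(7)])
    then have "1 * (G + aa * Q) \<le> G + \<gamma> * Q" by simp
    with mult_right_mono[OF bb_bounds(4) GQ] have "bb * (G + aa * Q) \<le> G + \<gamma> * Q" by (rule order_trans)
    with mult_right_mono[OF aa_bounds(2) jM]
    show "aa * (j + LV * m) + bb * (G + aa * Q) \<le> \<gamma> * (j + M) + (G + \<gamma> * Q)"
      unfolding M_def[symmetric] by (rule add_mono)
    show "0 \<le> P" using P P0 by linarith
    show "0 \<le> aa * (j + LV * m) + bb * (G + aa * Q)"
      unfolding M_def[symmetric] using jM GQ aa_bounds(1) bb_bounds(1) by simp
  qed
  \<comment> \<open>The condition \<open>S1\<close> with its factor 16 and LF >= 5; it makes the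
    pull of the actor on the induced mean field small against the contraction.\<close>
  have L80: "L * LV * nA * \<mu> \<le> 1 / 80"
    unfolding \<mu>_def \<omega>_def using sr(13) sr(2) om unfolding \<omega>_def by (simp add: divide_le_eq mult_ac)
  have wmu: "wm = 4 * \<gamma> * LV\<^sup>2 * \<mu>" unfolding wm_def \<mu>_def \<omega>_def by simp
  have Zmu: "nZ * \<omega> * \<mu> = 1" "nZ * \<mu> = 1 / \<omega>" unfolding \<mu>_def using sr(2) om by (auto simp: divide_simps)
  have t4: "wm * (- 2 * nZ * (1 - \<delta>) * m\<^sup>2 + 2 * nZ * m * H + 2 * L * nA * m * f) \<le> - 8 * \<gamma> * M\<^sup>2 + 8 * \<gamma> / \<omega> * (M * N) + \<gamma> / 10 * (M * f)"
  proof -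
    have "wm * (- 2 * nZ * (1 - \<delta>) * m\<^sup>2 + 2 * nZ * m * H + 2 * L * nA * m * f) =
      - 8 * \<gamma> * (nZ * \<omega> * \<mu>) * M\<^sup>2 + 8 * \<gamma> * (nZ * \<mu>) * (M * N) + 8 * \<gamma> * (L * LV * nA * \<mu>) * (M * f)"
      unfolding wmu M_def N_def \<omega>_def by (simp add: power2_eq_square algebra_simps)
    also have "\<dots> \<le> - 8 * \<gamma> * 1 * M\<^sup>2 + 8 * \<gamma> * (1 / \<omega>) * (M * N) + 8 * \<gamma> * (1 / 80) * (M * f)"
      unfolding Zmu using L80 gam MN nn by (intro add_left_mono mult_right_mono mult_left_mono) auto
    finally show ?thesis by simp
  qed
  have t5: "64 * (- 2 * cJ * j\<^sup>2 + 2 * j * Q + 2 * LV * j * \<kappa>') \<le> - 128 * cJ * j\<^sup>2 + 128 * j * Q + 128 * j * \<kappa>"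
    using mult_left_mono[OF kV, of "128 * j"] nn by (simp add: algebra_simps)
  have t6: "\<gamma> * (- 2 * nR * F\<^sup>2 + 2 * F * (3 * LF * \<kappa>' + 2 * (G + sqrt 2 * v + j))) \<le> - 2 * \<gamma> * nR * F\<^sup>2 + 6 * \<gamma> * F * \<kappa> + 4 * \<gamma> * F * P"
  proof -
    have "6 * \<gamma> * F * (LF * \<kappa>') \<le> 6 * \<gamma> * F * \<kappa>" using kF gam nn by (intro mult_left_mono) auto
    moreover have "4 * \<gamma> * F * (G + sqrt 2 * v + j) \<le> 4 * \<gamma> * F * P" using P gam nn by (intro mult_left_mono) auto
    moreover have "\<gamma> * (- 2 * nR * F\<^sup>2 + 2 * F * (3 * LF * \<kappa>' + 2 * (G + sqrt 2 * v + j))) =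
       - 2 * \<gamma> * nR * F\<^sup>2 + 6 * \<gamma> * F * (LF * \<kappa>') + 4 * \<gamma> * F * (G + sqrt 2 * v + j)" by algebra
    ultimately show ?thesis by linarith
  qed
  have t7: "- 2 * nR * G\<^sup>2 + 2 * G * (LG * \<kappa>' + (Q + cJ * j) + sqrt 2 * (G + sqrt 2 * v + j)) \<le>
     - 2 * nR * G\<^sup>2 + 2 * G * \<kappa> + 2 * G * Q + 2 * cJ * (G * j) + 3 * G\<^sup>2 + 4 * G * v + 3 * G * j"
  proof -
    have "sqrt 2 * (G + sqrt 2 * v + j) = sqrt 2 * G + (sqrt 2 * sqrt 2) * v + sqrt 2 * j" by algebra
    also have "\<dots> \<le> 3/2 * G + 2 * v + 3/2 * j" unfolding real_sqrt_mult_self using s2 by simp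
    finally have "LG * \<kappa>' + (Q + cJ * j) + sqrt 2 * (G + sqrt 2 * v + j) \<le> \<kappa> + (Q + cJ * j) + (3/2 * G + 2 * v + 3/2 * j)" using kG by linarith
    then have "2 * G * (LG * \<kappa>' + (Q + cJ * j) + sqrt 2 * (G + sqrt 2 * v + j)) \<le> 2 * G * (\<kappa> + (Q + cJ * j) + (3/2 * G + 2 * v + 3/2 * j))"
      using nn by (intro mult_left_mono) auto
    also have "\<dots> = 2 * G * \<kappa> + 2 * G * Q + 2 * cJ * (G * j) + 3 * G\<^sup>2 + 4 * G * v + 3 * G * j" by algebra
    finally show ?thesis by simp
  qed
  have t8: "1 / cJ * (- 2 * nR * Q\<^sup>2 + 2 * Q * (cJ * (LV * \<kappa>' + (Q + cJ * j)))) \<le> - 2 * nR / cJ * Q\<^sup>2 + 2 * Q * \<kappa> + 2 * Q\<^sup>2 + 2 * cJ * (Q * j)"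
  proof -
    have "1 / cJ * (- 2 * nR * Q\<^sup>2 + 2 * Q * (cJ * (LV * \<kappa>' + (Q + cJ * j)))) = - 2 * nR / cJ * Q\<^sup>2 + 2 * Q * (LV * \<kappa>') + 2 * Q\<^sup>2 + 2 * cJ * (Q * j)"
      using cJ by (simp add: field_simps power2_eq_square)
    moreover have "2 * Q * (LV * \<kappa>') \<le> 2 * Q * \<kappa>" using kV nn by (intro mult_left_mono) auto
    ultimately show ?thesis by linarith
  qed
  have t9: "wm * (- 2 * nR * H\<^sup>2 + 2 * H * (2 * L * nA * f + 2 * nZ * h)) \<le>
    - 8 * \<gamma> * nR * \<mu> * N\<^sup>2 + \<gamma> / 5 * (N * f) + 16 * \<gamma> / \<omega> * N\<^sup>2 + 32 * \<gamma> / \<omega> * (N * M)"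
  proof -
    have "wm * (4 * nZ * H * h) \<le> wm * (4 * nZ * H * (H + 2 * m))" using h nn sr by (intro mult_left_mono) auto
    also have "\<dots> = 16 * \<gamma> * (nZ * \<mu>) * N\<^sup>2 + 32 * \<gamma> * (nZ * \<mu>) * (N * M)"
      unfolding wmu M_def N_def by algebra
    also have "\<dots> = 16 * \<gamma> / \<omega> * N\<^sup>2 + 32 * \<gamma> / \<omega> * (N * M)" unfolding Zmu by simp
    finally have h1: "wm * (4 * nZ * H * h) \<le> 16 * \<gamma> / \<omega> * N\<^sup>2 + 32 * \<gamma> / \<omega> * (N * M)" .
    have "wm * (4 * H * (L * nA * f)) = 16 * \<gamma> * (L * LV * nA * \<mu>) * (N * f)" unfolding wmu M_def N_def by algebra
    also have "\<dots> \<le> 16 * \<gamma> * (1 / 80) * (N * f)"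
      using L80 gam MN nn by (intro mult_right_mono mult_left_mono) auto
    also have "\<dots> = \<gamma> / 5 * (N * f)" by simp
    finally have h2: "wm * (4 * H * (L * nA * f)) \<le> \<gamma> / 5 * (N * f)" .
    have "wm * (- 2 * nR * H\<^sup>2 + 2 * H * (2 * L * nA * f + 2 * nZ * h)) = - 8 * \<gamma> * nR * \<mu> * N\<^sup>2 + wm * (4 * H * (L * nA * f)) + wm * (4 * nZ * H * h)"
      unfolding wmu N_def by algebra
    then show ?thesis using h1 h2 by linarith
  qed
  have mu: "6912 / \<omega>\<^sup>2 \<le> \<mu>"
  proof -
    have "nZ * \<omega> \<le> (\<omega> * \<gamma> / 6912) * \<omega>" using sr(11) om unfolding \<omega>_def[symmetric] by (intro mult_right_mono) auto
    also have "\<dots> = \<gamma> * (\<omega>\<^sup>2 / 6912)" by (simp add: power2_eq_square)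
    also have "\<dots> \<le> 1 * (\<omega>\<^sup>2 / 6912)" using gam by (intro mult_right_mono) auto
    finally have "1 / (\<omega>\<^sup>2 / 6912) \<le> 1 / (nZ * \<omega>)" using sr(2) om by (intro divide_left_mono) auto
    then show ?thesis unfolding \<mu>_def by simp
  qed
  have "1 \<le> cJ * \<gamma>" by (rule cJ(2))
  note Q1 = lyapunov_form_negative[OF gam this cJ(1) om sr(12) mu, of nx f F v M j G N Q, folded \<kappa>_def P_def]
  have fin: "- \<gamma> / 50 * nx\<^sup>2 - \<gamma> / 2 * v\<^sup>2 - \<gamma> * M\<^sup>2 - cJ * j\<^sup>2 \<le> - \<gamma> / 50 * (nx\<^sup>2 + m\<^sup>2 + v\<^sup>2 + j\<^sup>2)"
  proof -
    have "\<gamma> / 50 * v\<^sup>2 \<le> \<gamma> / 2 * v\<^sup>2" using gam by (intro mult_right_mono) auto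
    moreover have "\<gamma> / 50 * m\<^sup>2 \<le> \<gamma> * M\<^sup>2" using gam MN nn by (intro mult_mono power_mono) auto
    moreover have "\<gamma> / 50 * j\<^sup>2 \<le> cJ * j\<^sup>2"
    proof (rule mult_right_mono)
      have "1 * 1 \<le> cJ * \<gamma>" using cJ by simp
      moreover have "cJ * \<gamma> \<le> cJ * 1" using cJ gam by (intro mult_left_mono) auto
      ultimately show "\<gamma> / 50 \<le> cJ" using gam by linarith
    qed simp
    ultimately show ?thesis by (simp add: algebra_simps)
  qed
  show ?thesis unfolding \<kappa>'_def[symmetric] using t1 t2 t3 t4 t5 t6 t7 t8 t9 Q1 fin by linarith
qed

text \<open>With this weight the coefficient (Wc - aa Y) rho al / be of the gradient term stays between
  gamma/25 and gamma/24, as Y is bounded by BV + 2 up to vanishing terms.\<close>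

definition "Wc = 49 / 1200 * \<gamma> * be / (\<rho> * al)"

definition "pot k x = - Wc * ell x + (eV x)\<^sup>2 + (Yl k x)\<^sup>2 / 2"

text \<open>The excess eta chat^2 of the value error meets - eta chat Yl from half the square of
  \<open>Yl\<close>, leaving eta chat (chat - Yl). The factor \<open>w\<close> of the gradient term
  depends on the state through \<open>Yl\<close>, but lies in a fixed interval.\<close>

lemma potential_drift: "\<exists>C. \<forall>k x. Inv k x \<longrightarrow> (\<exists>w. \<gamma> / 25 \<le> w \<and> w \<le> \<gamma> / 24 \<and> (\<forall>a s'.
   pot (Suc k) (nxt k x a s') \<le> pot k x + tk k * (- be * w * (fv x \<bullet> gradx x)
     + (- 2 * be * \<gamma> * (eV x)\<^sup>2 + 2 * be * eV x * ej x + 2 * be * eV x * nG x + 2 * LV * eV x * (al * norm (fv x) + xi * norm (hv x)))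
     + be * (nG x + sqrt 2 * eV x + ej x) * (aa * (ej x + LV * em x) + bb * (nG x + aa * nQ x))) + C * ((tk k)\<^sup>2 + tk k * ee k)))"
proof -
  obtain M where M: "M \<ge> 1" "\<And>k x. Inv k x \<Longrightarrow> norm (fv x) \<le> M \<and> norm (gV x) \<le> M \<and> norm (gradx x) \<le> M" using Inv_all_bounds by blast
  obtain C1 where C1: "C1 \<ge> 0" "\<And>k x a s'. Inv k x \<Longrightarrow>
   \<bar>ell (nxt k x a s') - ell x - \<rho> * (al * tk k) * (fv x \<bullet> gradx x)\<bar> \<le> C1 * (tk k)\<^sup>2" using ell_drift by blast
  obtain C2 where C2: "C2 \<ge> 0" "\<And>k x a s'. Inv k x \<Longrightarrow>
   \<bar>Yk (Suc k) (nxt k x a s') - Yk k x + eta k x * chat k x\<bar> \<le> C2 * ((tk k)\<^sup>2 + tk k * ee k)" using Y_step by blast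
  obtain C3 where C3: "\<And>k x a s'. Inv k x \<Longrightarrow>
   (eV (nxt k x a s'))\<^sup>2 \<le> (eV x)\<^sup>2 + tk k * (- 2 * be * \<gamma> * (eV x)\<^sup>2 + 2 * be * eV x * ej x + 2 * be * eV x * nG x
     + 2 * LV * eV x * (al * norm (fv x) + xi * norm (hv x))) + eta k x * (chat k x)\<^sup>2 + C3 * (tk k)\<^sup>2" using eV_drift by blast
  obtain C4 where C4: "C4 \<ge> 0" "\<And>k x. Inv k x \<Longrightarrow> \<bar>Yl k x\<bar> \<le> BV + 2 + C4 * (tk k + ee k)" using Yl_bound by blast
  obtain C5 where C5: "C5 \<ge> 0" "\<And>k x. Inv k x \<Longrightarrow> \<bar>chat k x - Yl k x\<bar> \<le> aa * (ej x + LV * em x) + bb * (nG x + aa * nQ x) + C5 * tk k" using chat_Yl by blast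
  define D1 where "D1 = \<rho> * M\<^sup>2 + C1"
  define D2 where "D2 = M + aa * D1 + C2 * (1 + E1)"
  define D4 where "D4 = BV + 2 + C4 * (1 + E1)"
  define W1 where "W1 = Wc + aa * (BV + 2)"
  define C where "C = \<bar>C3\<bar> + D2\<^sup>2 + D4 * C2 + M * C5 + W1 * C1 + aa * C4 * D1"
  have D1: "0 \<le> D1" unfolding D1_def using rho C1 by simp
  have D4: "0 \<le> D4" unfolding D4_def using BV C4 E1 by simp
  have Wc0: "0 < Wc" unfolding Wc_def using gam pos pos' rho by simp
  have W1: "0 \<le> W1" unfolding W1_def using Wc0 aa_bounds BV by simp
  show ?thesis
  proof (rule exI[of _ C], intro allI impI)
    fix k x assume I: "Inv k x"
    define t where "t = tk k"
    define s where "s = t\<^sup>2 + t * ee k"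
    have t: "0 < t" "t \<le> 1" unfolding t_def by (auto simp: tk_pos tk_le_one)
    have e0: "0 \<le> ee k" "ee k \<le> E1" using ee_nonneg ee_le by auto
    have s: "0 \<le> s" "t\<^sup>2 \<le> s" "s \<le> (1 + E1) * t" "t * (t + ee k) = s"
    proof -
      show "0 \<le> s" "t\<^sup>2 \<le> s" unfolding s_def using t e0 by auto
      have "t * t \<le> 1 * t" "t * ee k \<le> t * E1" using t e0 by (auto intro!: mult_right_mono mult_left_mono)
      then show "s \<le> (1 + E1) * t" unfolding s_def power2_eq_square by (simp add: algebra_simps)
      show "t * (t + ee k) = s" unfolding s_def by algebra
    qed
    define g where "g = fv x \<bullet> gradx x"
    have g: "\<bar>g\<bar> \<le> M\<^sup>2"
      using Cauchy_Schwarz_ineq2[of "fv x" "gradx x"] mult_mono[of "norm (fv x)" M "norm (gradx x)" M] M(1) M(2)[OF I]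
      unfolding g_def power2_eq_square by auto
    define Y where "Y = Yl k x"
    \<comment> \<open>\<open>Yl\<close> obeys its bound BV + 2 only up to vanishing terms. Clipping
      gives a factor \<open>w\<close> that stays in its interval exactly, and the difference goes
      into the remainder \<open>s\<close>.\<close>
    define Yc where "Yc = max (- (BV + 2)) (min (BV + 2) Y)"
    have Yc: "\<bar>Yc\<bar> \<le> BV + 2" "\<bar>Y - Yc\<bar> \<le> C4 * (t + ee k)"
    proof -
      have "0 \<le> C4 * (t + ee k)" using C4 t e0 by simp
      then show "\<bar>Yc\<bar> \<le> BV + 2" "\<bar>Y - Yc\<bar> \<le> C4 * (t + ee k)"
        unfolding Yc_def Y_def t_def using C4(2)[OF I] BV by (auto simp: max_def min_def abs_le_iff)
    qed
    have Yb: "\<bar>Y\<bar> \<le> D4"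
    proof -
      have "C4 * (t + ee k) \<le> C4 * (1 + E1)" using C4 t e0 by (intro mult_left_mono) auto
      then show ?thesis unfolding Y_def D4_def using C4(2)[OF I] unfolding t_def by linarith
    qed
    define w where "w = (Wc - aa * Yc) * \<rho> * nA"
    have "be * w = (Wc - aa * Yc) * \<rho> * (be * nA)" unfolding w_def by algebra
    then have bw: "be * w = (Wc - aa * Yc) * \<rho> * al" by (simp only: step_ratios(4))
    have wr: "\<gamma> / 25 \<le> w" "w \<le> \<gamma> / 24"
    proof -
      \<comment> \<open>49/1200 is the midpoint of 1/25 = 48/1200 and 1/24 = 50/1200, so the term
        with \<open>aa * Yc\<close> may deviate by \<open>\<gamma> / 1200\<close>.\<close>
      have 1: "Wc * \<rho> * nA = 49 / 1200 * \<gamma>" unfolding Wc_def nA_def using rho pos pos' by simp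
      have "32 * \<rho> * LF\<^sup>2 * nA \<le> (1 - \<delta>) * nZ"
        unfolding nA_def nZ_def by (rule ratio_le2[OF S2 pos'(2)])
      also have "(1 - \<delta>) * nZ \<le> 1 * nZ" using delta step_ratios(2) by (intro mult_right_mono) auto
      also have "1 * nZ \<le> 1 / 6912"
      proof -
        have "1 * nZ \<le> LF\<^sup>2 * nZ" using LF_ge step_ratios(2) by (intro mult_right_mono) (auto simp: power2_eq_square intro: mult_ge1_I)
        then show ?thesis using step_ratios(15) by linarith
      qed
      finally have 2: "LF\<^sup>2 * (\<rho> * nA) \<le> 1 / 1200" by (simp add: mult_ac)
      have "BV + 2 \<le> LF * LF"
        using LF_ge BV mult_mono[of 1 LF "BV + 2" LF] by simp
      then have "(BV + 2) * (\<rho> * nA) \<le> LF\<^sup>2 * (\<rho> * nA)" unfolding power2_eq_square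
        using rho step_ratios(1) by (intro mult_right_mono) auto
      then have 3: "(BV + 2) * (\<rho> * nA) \<le> 1 / 1200" using 2 by linarith
      have "\<bar>Yc\<bar> * (\<rho> * nA) \<le> (BV + 2) * (\<rho> * nA)" using Yc rho step_ratios(1) by (intro mult_right_mono) auto
      then have "\<bar>Yc\<bar> * (\<rho> * nA) \<le> 1 / 1200" using 3 by linarith
      then have "aa * (\<bar>Yc\<bar> * (\<rho> * nA)) \<le> \<gamma> * (1 / 1200)"
        by (rule mult_mono[OF aa_bounds(2)]) (use gam rho step_ratios(1) in simp_all)
      moreover have "\<bar>aa * Yc * \<rho> * nA\<bar> = aa * (\<bar>Yc\<bar> * (\<rho> * nA))" using aa_bounds rho step_ratios(1) by (simp add: abs_mult)
      ultimately have "\<bar>aa * Yc * \<rho> * nA\<bar> \<le> \<gamma> / 1200" by simp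
      moreover have "w = Wc * \<rho> * nA - aa * Yc * \<rho> * nA" unfolding w_def by algebra
      ultimately show "\<gamma> / 25 \<le> w" "w \<le> \<gamma> / 24" unfolding 1 by linarith+
    qed
    define P where "P = aa * (ej x + LV * em x) + bb * (nG x + aa * nQ x)"
    define V where "V = - 2 * be * \<gamma> * (eV x)\<^sup>2 + 2 * be * eV x * ej x + 2 * be * eV x * nG x + 2 * LV * eV x * (al * norm (fv x) + xi * norm (hv x))"
    have P0: "0 \<le> P" unfolding P_def using nonneg[of x] aa_bounds bb_bounds LV by simp
    have "pot (Suc k) (nxt k x a s') \<le> pot k x + t * (- be * w * g + V + be * (nG x + sqrt 2 * eV x + ej x) * P) + C * s" for a s'
    proof -
      define y where "y = nxt k x a s'"
      define dl where "dl = ell y - ell x"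
      define Y' where "Y' = Yl (Suc k) y"
      define \<eta>c where "\<eta>c = eta k x * chat k x"
      have dl: "\<bar>dl - \<rho> * (al * t) * g\<bar> \<le> C1 * t\<^sup>2" unfolding dl_def y_def t_def g_def by (rule C1(2)[OF I])
      have dlb: "\<bar>dl\<bar> \<le> D1 * t"
      proof -
        have "\<bar>\<rho> * (al * t) * g\<bar> = \<rho> * (al * t) * \<bar>g\<bar>" using rho pos t by (simp add: abs_mult)
        also have "\<dots> \<le> \<rho> * (1 * t) * M\<^sup>2" using rho pos t g by (intro mult_mono) auto
        finally have "\<bar>\<rho> * (al * t) * g\<bar> \<le> \<rho> * M\<^sup>2 * t" by (simp add: mult_ac)
        moreover have "C1 * t\<^sup>2 \<le> C1 * t" using C1 t by (simp add: power2_eq_square mult_left_le mult_left_mono)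
        ultimately show ?thesis using dl unfolding D1_def distrib_right by linarith
      qed
      define e where "e = Y' - Y + \<eta>c - aa * dl"
      have e: "\<bar>e\<bar> \<le> C2 * s"
        using C2(2)[OF I, of a s'] unfolding e_def Y'_def Y_def Yl_def \<eta>c_def dl_def y_def s_def t_def by (simp add: algebra_simps)
      have ecb: "\<bar>\<eta>c\<bar> \<le> be * t * (nG x + sqrt 2 * eV x + ej x)" "\<bar>\<eta>c\<bar> \<le> M * t"
      proof -
        have eq: "\<bar>\<eta>c\<bar> = eta k x * \<bar>chat k x\<bar>" unfolding \<eta>c_def using eta_bounds(1)[OF I] by (simp add: abs_mult)
        have 1: "\<bar>\<eta>c\<bar> \<le> be * t * norm (gV x)" unfolding eq t_def by (rule eta_bounds(4)[OF I])
        also have "\<dots> \<le> be * t * (nG x + sqrt 2 * eV x + ej x)" using gV_le[OF I] pos' t by (intro mult_left_mono) auto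
        finally show "\<bar>\<eta>c\<bar> \<le> be * t * (nG x + sqrt 2 * eV x + ej x)" .
        have "be * t * norm (gV x) \<le> 1 * t * M" using pos pos' t M(2)[OF I] by (intro mult_mono) auto
        then show "\<bar>\<eta>c\<bar> \<le> M * t" using 1 by (simp add: mult_ac)
      qed
      define u where "u = Y' - Y"
      have u: "u = - \<eta>c + aa * dl + e" unfolding u_def e_def by simp
      have ub: "\<bar>u\<bar> \<le> D2 * t"
      proof -
        have "\<bar>aa * dl\<bar> \<le> aa * (D1 * t)" unfolding abs_mult using dlb aa_bounds by (simp add: mult_left_mono)
        moreover have "C2 * s \<le> C2 * ((1 + E1) * t)" using s C2 by (intro mult_left_mono) auto
        ultimately have "\<bar>u\<bar> \<le> M * t + aa * (D1 * t) + C2 * ((1 + E1) * t)" using ecb(2) e unfolding u by linarith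
        then show ?thesis unfolding D2_def by (simp add: algebra_simps)
      qed
      have u2: "u\<^sup>2 \<le> D2\<^sup>2 * s"
      proof -
        have "\<bar>u\<bar>\<^sup>2 \<le> (D2 * t)\<^sup>2" using ub by (intro power_mono) auto
        also have "\<dots> = D2\<^sup>2 * t\<^sup>2" by (simp add: power_mult_distrib)
        also have "\<dots> \<le> D2\<^sup>2 * s" using s by (intro mult_left_mono) auto
        finally show ?thesis by simp
      qed
      have Ye: "Y * e \<le> D4 * C2 * s"
      proof -
        have "\<bar>Y * e\<bar> \<le> D4 * (C2 * s)" unfolding abs_mult using Yb e D4 by (intro mult_mono) auto
        then show ?thesis by (simp add: mult.assoc)
      qed
      \<comment> \<open>One factor is the length cut off by the projection, bounded by the critic's
        speed; the other is the distance from chat to \<open>Yl\<close>. Both are linear in the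
        errors up to O(tk).\<close>
      have cY: "\<eta>c * (chat k x - Y) \<le> t * (be * (nG x + sqrt 2 * eV x + ej x) * P) + M * C5 * s"
      proof -
        have "\<eta>c * (chat k x - Y) \<le> \<bar>\<eta>c\<bar> * \<bar>chat k x - Y\<bar>" by (metis abs_ge_self abs_mult)
        also have "\<dots> \<le> \<bar>\<eta>c\<bar> * (P + C5 * t)"
          using C5(2)[OF I] unfolding Y_def P_def t_def by (intro mult_left_mono) auto
        also have "\<dots> = \<bar>\<eta>c\<bar> * P + \<bar>\<eta>c\<bar> * (C5 * t)" by (rule distrib_left)
        also have "\<dots> \<le> be * t * (nG x + sqrt 2 * eV x + ej x) * P + M * t * (C5 * t)"
          using ecb P0 C5 t by (intro add_mono mult_right_mono) auto
        also have "M * t * (C5 * t) = M * C5 * t\<^sup>2" by (simp add: power2_eq_square)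
        also have "M * C5 * t\<^sup>2 \<le> M * C5 * s" using s M C5 by (intro mult_left_mono) auto
        finally show ?thesis by (simp add: mult_ac)
      qed
      have Wd: "- (Wc - aa * Y) * dl \<le> t * (- be * w * g) + W1 * C1 * s + aa * C4 * D1 * s"
      proof -
        have eq: "- (Wc - aa * Y) * dl = - ((Wc - aa * Yc) * (\<rho> * (al * t) * g)) - (Wc - aa * Yc) * (dl - \<rho> * (al * t) * g) + aa * ((Y - Yc) * dl)"
          by algebra
        have "\<bar>Wc - aa * Yc\<bar> \<le> W1"
        proof -
          have "\<bar>aa * Yc\<bar> \<le> aa * (BV + 2)" unfolding abs_mult using Yc aa_bounds by (simp add: mult_left_mono)
          then show ?thesis unfolding W1_def using Wc0 by linarith
        qed
        then have "\<bar>(Wc - aa * Yc) * (dl - \<rho> * (al * t) * g)\<bar> \<le> W1 * (C1 * t\<^sup>2)"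
          unfolding abs_mult using dl W1 by (intro mult_mono) auto
        also have "\<dots> \<le> W1 * (C1 * s)" using s W1 C1 by (intro mult_left_mono) auto
        finally have 1: "- ((Wc - aa * Yc) * (dl - \<rho> * (al * t) * g)) \<le> W1 * C1 * s" by (simp add: mult.assoc)
        have "\<bar>(Y - Yc) * dl\<bar> \<le> (C4 * (t + ee k)) * (D1 * t)"
          unfolding abs_mult using Yc dlb C4 t e0 by (intro mult_mono) auto
        also have "\<dots> = C4 * D1 * s" unfolding s(4)[symmetric] by simp
        finally have "aa * ((Y - Yc) * dl) \<le> aa * (C4 * D1 * s)" using aa_bounds by (intro mult_left_mono) auto
        then have 2: "aa * ((Y - Yc) * dl) \<le> aa * C4 * D1 * s" by (simp add: mult.assoc)
        have 3: "- ((Wc - aa * Yc) * (\<rho> * (al * t) * g)) = t * (- be * w * g)"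
        proof -
          have "t * (- be * w * g) = - (t * ((be * w) * g))" by algebra
          then show ?thesis unfolding bw by algebra
        qed
        show ?thesis using eq 1 2 3 by linarith
      qed
      have "(Y')\<^sup>2 / 2 = Y\<^sup>2 / 2 + Y * u + u\<^sup>2 / 2" unfolding u_def by (simp add: power2_eq_square field_simps)
      also have "Y * u = - \<eta>c * Y + aa * Y * dl + Y * e" unfolding u by algebra
      finally have Ysq: "(Y')\<^sup>2 / 2 = Y\<^sup>2 / 2 + (- \<eta>c * Y + aa * Y * dl + Y * e) + u\<^sup>2 / 2" .
      have ev: "(eV y)\<^sup>2 \<le> (eV x)\<^sup>2 + t * V + \<eta>c * chat k x + C3 * t\<^sup>2"
        using C3[OF I, of a s'] unfolding y_def V_def t_def \<eta>c_def by (simp add: power2_eq_square mult.assoc)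
      have C3s: "C3 * t\<^sup>2 \<le> \<bar>C3\<bar> * s"
        using s mult_mono[of "C3" "\<bar>C3\<bar>" "t\<^sup>2" s] by auto
      have u2': "u\<^sup>2 / 2 \<le> D2\<^sup>2 * s" using u2 zero_le_power2[of u] by linarith
      have pt: "pot (Suc k) y = - Wc * ell x - Wc * dl + (eV y)\<^sup>2 + (Y')\<^sup>2 / 2" unfolding pot_def Y'_def dl_def by (simp add: algebra_simps)
      have px: "pot k x = - Wc * ell x + (eV x)\<^sup>2 + Y\<^sup>2 / 2" unfolding pot_def Y_def ..
      have "pot (Suc k) y \<le> pot k x + (- (Wc - aa * Y) * dl) + t * V + \<eta>c * (chat k x - Y) + C3 * t\<^sup>2 + Y * e + u\<^sup>2 / 2"
        unfolding pt px Ysq using ev by (simp add: algebra_simps)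
      also have "\<dots> \<le> pot k x + (t * (- be * w * g) + W1 * C1 * s + aa * C4 * D1 * s) + t * V
         + (t * (be * (nG x + sqrt 2 * eV x + ej x) * P) + M * C5 * s) + \<bar>C3\<bar> * s + D4 * C2 * s + D2\<^sup>2 * s"
        using Wd cY C3s Ye u2' by linarith
      also have "\<dots> = pot k x + t * (- be * w * g + V + be * (nG x + sqrt 2 * eV x + ej x) * P) + C * s"
        unfolding C_def by algebra
      finally show ?thesis unfolding y_def .
    qed
    then show "\<exists>w. \<gamma> / 25 \<le> w \<and> w \<le> \<gamma> / 24 \<and> (\<forall>a s'.
   pot (Suc k) (nxt k x a s') \<le> pot k x + tk k * (- be * w * (fv x \<bullet> gradx x)
     + (- 2 * be * \<gamma> * (eV x)\<^sup>2 + 2 * be * eV x * ej x + 2 * be * eV x * nG x + 2 * LV * eV x * (al * norm (fv x) + xi * norm (hv x)))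
     + be * (nG x + sqrt 2 * eV x + ej x) * (aa * (ej x + LV * em x) + bb * (nG x + aa * nQ x))) + C * ((tk k)\<^sup>2 + tk k * ee k))"
      using wr unfolding t_def[symmetric] s_def[symmetric] g_def[symmetric] V_def[symmetric] P_def[symmetric] by blast
  qed
qed

end

section \<open>Summation\<close>

lemma harmonic_le_ln: "(\<Sum>i<n. 1 / (real i + 1)) \<le> 1 + ln (real n + 1)"
proof -
  have "(\<Sum>i<Suc n. 1 / (real i + 1)) \<le> 1 + ln (real n + 1)"
  proof (induction n)
    case (Suc n)
    have "ln ((real n + 1) / (real n + 2)) \<le> (real n + 1) / (real n + 2) - 1"
      by (rule ln_le_minus_one) simp
    also have "\<dots> = - (1 / (real n + 2))" by (simp add: field_simps)
    finally have "1 / (real n + 2) \<le> ln (real n + 2) - ln (real n + 1)" by (simp add: ln_div)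
    then show ?case using Suc by (simp add: add.commute)
  qed simp
  moreover have "(\<Sum>i<n. 1 / (real i + 1)) \<le> (\<Sum>i<Suc n. 1 / (real i + 1))" by simp
  ultimately show ?thesis by linarith
qed

text \<open>The minimum is at most the average with weights \<open>tk\<close>, whose total is of
  order sqrt k. The logarithmic bound 1 + ln (k + 1) is then enlarged to the cube.\<close>

lemma min_rate:
  fixes e :: "nat \<Rightarrow> real"
  assumes e: "\<And>k. 0 \<le> e k" and D: "0 \<le> D" "\<And>n. (\<Sum>k=1..<n. tk k * e k) \<le> D * (1 + ln (real n + 1))"
  shows "\<exists>C>0. \<forall>k>0. Min (e ` {..<k}) \<le> C * ((ln (real k + 1)) ^ 3 / sqrt (real k + 1))"
proof -
  define l where "l = ln (2::real)"
  have l: "0 < l" unfolding l_def by simp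
  define A where "A = 2 * e 0 + 3 * D"
  have A: "0 \<le> A" unfolding A_def using e D by simp
  define B where "B = 1 / l ^ 3 + 1 / l\<^sup>2"
  have B: "0 < B" unfolding B_def using l by (simp add: add_pos_pos)
  have "Min (e ` {..<k}) \<le> (A * B + 1) * ((ln (real k + 1)) ^ 3 / sqrt (real k + 1))" if k: "0 < k" for k
  proof -
    define x where "x = ln (real k + 1)"
    have x: "l \<le> x" "0 < x" unfolding x_def l_def using k by (auto intro!: ln_mono simp: ln_gt_zero)
    have q: "0 < sqrt (real k + 1)" by simp
    have fin: "finite (e ` {..<k})" "e ` {..<k} \<noteq> {}" using k by auto
    have 1: "Min (e ` {..<k}) \<le> A * (1 + x) / sqrt (real k + 1)"
    \<comment> \<open>For k = 1 the sum over \<open>1..<k\<close> is empty and the minimum is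
      \<open>e 0\<close>. For k >= 2 one has k + 1 <= 3 (k - 1), which gives the factor 3
      below.\<close>
    proof (cases "k = 1")
      case True
      have "sqrt (real k + 1) \<le> 2" unfolding True by (rule real_le_lsqrt) auto
      then have "e 0 * sqrt (real k + 1) \<le> e 0 * 2" using e by (intro mult_left_mono) auto
      also have "\<dots> \<le> A * 1" unfolding A_def using D by simp
      also have "\<dots> \<le> A * (1 + x)" using A x by (intro mult_left_mono) auto
      finally have "e 0 \<le> A * (1 + x) / sqrt (real k + 1)" using q by (simp add: le_divide_eq)
      moreover have "Min (e ` {..<k}) \<le> e 0" using fin k by (intro Min_le) auto
      ultimately show ?thesis by linarith
    next
      case False
      define m where "m = Min (e ` {..<k})"
      have m: "m \<le> e i" if "i < k" for i unfolding m_def using fin that by (intro Min_le) auto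
      have m0: "0 \<le> m" unfolding m_def using fin e by (subst Min_ge_iff) auto
      have "m * (sqrt (real k + 1) / 3) \<le> m * (\<Sum>i=1..<k. tk i)"
      proof (rule mult_left_mono[OF _ m0])
        have "sqrt (real k + 1) / 3 \<le> real (k - 1) * (1 / sqrt (real k + 1))"
        proof -
          have "sqrt (real k + 1) * sqrt (real k + 1) \<le> real (k - 1) * 3" using False k by simp
          then show ?thesis using q by (simp add: field_simps)
        qed
        also have "\<dots> = (\<Sum>i=1..<k. 1 / sqrt (real k + 1))" by simp
        also have "\<dots> \<le> (\<Sum>i=1..<k. tk i)"
          unfolding tk_def by (intro sum_mono divide_left_mono) auto
        finally show "sqrt (real k + 1) / 3 \<le> (\<Sum>i=1..<k. tk i)" .
      qed
      also have "\<dots> \<le> (\<Sum>i=1..<k. tk i * e i)"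
        unfolding sum_distrib_left using m tk_pos by (intro sum_mono) (simp add: mult.commute mult_left_mono less_imp_le)
      also have "\<dots> \<le> D * (1 + x)" unfolding x_def by (rule D(2))
      finally have "m * sqrt (real k + 1) \<le> 3 * D * (1 + x)" by simp
      also have "\<dots> \<le> A * (1 + x)" unfolding A_def using e x by (intro mult_right_mono) auto
      finally show ?thesis unfolding m_def[symmetric] using q by (simp add: le_divide_eq)
    qed
    \<comment> \<open>As x >= ln 2, lower powers of x are bounded by constants times its
      cube.\<close>
    have "1 + x \<le> B * x ^ 3"
    proof -
      have "l ^ 3 \<le> x ^ 3" "l\<^sup>2 \<le> x\<^sup>2" using x l by (auto intro!: power_mono)
      then have a: "1 \<le> 1 / l ^ 3 * x ^ 3" "1 \<le> 1 / l\<^sup>2 * x\<^sup>2" using l by (auto simp: le_divide_eq)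
      have "x * 1 \<le> x * (1 / l\<^sup>2 * x\<^sup>2)" using a(2) x by (intro mult_left_mono) auto
      also have "\<dots> = 1 / l\<^sup>2 * x ^ 3" by (simp add: power2_eq_square power3_eq_cube)
      finally show ?thesis unfolding B_def distrib_right using a(1) by linarith
    qed
    then have "A * (1 + x) \<le> A * (B * x ^ 3)" using A by (rule mult_left_mono)
    also have "\<dots> \<le> (A * B + 1) * x ^ 3" using x by (simp add: algebra_simps)
    finally have "A * (1 + x) / sqrt (real k + 1) \<le> (A * B + 1) * x ^ 3 / sqrt (real k + 1)"
      using q by (intro divide_right_mono) auto
    then show ?thesis using 1 unfolding x_def by simp
  qed
  moreover have "0 < A * B + 1" using A B by (simp add: add_nonneg_pos)
  ultimately show ?thesis by blast
qed

text \<open>Telescoping begins at 1, the first time at which the bounds of the invariant are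
  available.\<close>

lemma descent_sum:
  fixes a e s :: "nat \<Rightarrow> real"
  assumes "0 < c" and step: "\<And>k. 1 \<le> k \<Longrightarrow> a (Suc k) \<le> a k - c * (tk k * e k) + C * s k"
    and B: "\<And>k. 1 \<le> k \<Longrightarrow> \<bar>a k\<bar> \<le> B" and s: "\<And>k. 0 \<le> s k" "\<And>n. (\<Sum>k<n. s k) \<le> S * (1 + ln (real n + 1))"
  shows "\<exists>D\<ge>0. \<forall>n. (\<Sum>k=1..<n. tk k * e k) \<le> D * (1 + ln (real n + 1))"
proof -
  have B0: "0 \<le> B" using B[of 1] by linarith
  have S0: "0 \<le> S" using s(2)[of 0] by simp
  define D where "D = (2 * B + \<bar>C\<bar> * S) / c"
  have main: "c * (\<Sum>k=1..<n. tk k * e k) \<le> a 1 - a n + \<bar>C\<bar> * (\<Sum>k=1..<n. s k)" if "1 \<le> n" for n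
    using that
  proof (induction n rule: dec_induct)
    case (step n)
    have "C * s n \<le> \<bar>C\<bar> * s n" using s(1) by (intro mult_right_mono) auto
    then show ?case using step assms(2)[OF step(1)] by (simp add: algebra_simps)
  qed simp
  show ?thesis
  proof (intro exI[of _ D] conjI allI)
    show "0 \<le> D" unfolding D_def using B0 S0 assms(1) by simp
    fix n
    have ln: "0 \<le> ln (real n + 1)" by simp
    show "(\<Sum>k=1..<n. tk k * e k) \<le> D * (1 + ln (real n + 1))"
    proof (cases "1 \<le> n")
      case True
      have "(\<Sum>k=1..<n. s k) \<le> (\<Sum>k<n. s k)" using s(1) by (intro sum_mono2) auto
      then have "\<bar>C\<bar> * (\<Sum>k=1..<n. s k) \<le> \<bar>C\<bar> * (S * (1 + ln (real n + 1)))"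
        using s(2)[of n] by (intro mult_left_mono) auto
      moreover have "a 1 - a n \<le> 2 * B * 1" using B[of 1] B[OF True] by linarith
      moreover have "2 * B * 1 \<le> 2 * B * (1 + ln (real n + 1))" using B0 ln by (intro mult_left_mono) auto
      ultimately have "c * (\<Sum>k=1..<n. tk k * e k) \<le> (2 * B + \<bar>C\<bar> * S) * (1 + ln (real n + 1))"
        using main[OF True] by (simp only: distrib_right mult.assoc)
      then show ?thesis unfolding D_def using assms(1) by (simp add: field_simps)
    next
      case False
      then have n: "n = 0" by simp
      show ?thesis unfolding n using \<open>0 \<le> D\<close> by simp
    qed
  qed
qed

text \<open>For j = J - rr the continuous system is j' = be g, g' = - lam (c j + g). With the
  weights c/be and 1/lam the mixed terms of the energy cancel, leaving decay in g alone; a small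
  multiple of j g transfers decay to j. No comparison of \<open>be\<close> with \<open>lam\<close>
  is needed for this.\<close>

lemma damped_oscillator:
  fixes J g :: "nat \<Rightarrow> real"
  assumes pos: "0 < be" "0 < lam" "lam \<le> 1" "0 < c" and rr: "0 \<le> rr" "rr \<le> 1"
    and J: "\<And>k. J (Suc k) = max 0 (min 1 (J k + be * tk k * g k))"
    and g: "\<And>k. g (Suc k) = (1 - lam * tk k) * g k + lam * tk k * (c * (rr - J k))" and g0: "g 0 = 0"
  shows "\<exists>D\<ge>0. \<forall>n. (\<Sum>k=1..<n. tk k * (J k - rr)\<^sup>2) \<le> D * (1 + ln (real n + 1))"
proof -
  define j where "j k = J k - rr" for k
  define M where "M = 1 + \<bar>j 0\<bar> + c * (1 + \<bar>j 0\<bar>)"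
  have M1: "1 \<le> M" "\<bar>j 0\<bar> \<le> M" "c * (1 + \<bar>j 0\<bar>) \<le> M" unfolding M_def using pos by auto
  have jb: "\<bar>j k\<bar> \<le> 1 + \<bar>j 0\<bar>" for k
    by (cases k) (use rr in \<open>auto simp: j_def J\<close>)
  have jM: "\<bar>j k\<bar> \<le> M" for k using jb[of k] M1 pos unfolding M_def by (smt (verit) mult_nonneg_nonneg)
  have l: "0 \<le> lam * tk k" "lam * tk k \<le> 1" "lam * tk k \<le> tk k" for k
    using pos tk_pos[of k] tk_le_one[of k] mult_mono[of lam 1 "tk k" 1] mult_right_mono[of lam 1 "tk k"] by auto
  have gM: "\<bar>g k\<bar> \<le> M" for k
  proof (induction k)
    case 0 then show ?case using g0 M1 by simp
  next
    case (Suc k)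
    have "\<bar>c * (rr - J k)\<bar> \<le> M"
    proof -
      have "\<bar>c * (rr - J k)\<bar> = c * \<bar>j k\<bar>" unfolding j_def abs_mult using pos by (simp add: abs_minus_commute)
      also have "\<dots> \<le> c * (1 + \<bar>j 0\<bar>)" using jb pos by (intro mult_left_mono) auto
      finally show ?thesis using M1 by linarith
    qed
    then have "\<bar>lam * tk k * (c * (rr - J k))\<bar> \<le> lam * tk k * M" unfolding abs_mult[of "lam * tk k"] using l[of k] by (simp add: mult_left_mono)
    moreover have "\<bar>(1 - lam * tk k) * g k\<bar> \<le> (1 - lam * tk k) * M" unfolding abs_mult using l[of k] Suc by (simp add: mult_left_mono)
    moreover have "(1 - lam * tk k) * M + lam * tk k * M = M" by (simp add: algebra_simps)
    ultimately show ?case unfolding g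
      using abs_triangle_ineq[of "(1 - lam * tk k) * g k" "lam * tk k * (c * (rr - J k))"] by linarith
  qed
  define b1 where "b1 = be + 1"
  define N where "N = (c + 1) * M"
  have N: "0 \<le> N" "M \<le> N" unfolding N_def using pos M1 by auto
  \<comment> \<open>The product j g creates at most \<epsilon> (lam / (2 c) + be) g^2. This choice
    makes it half of the decay 2 g^2 of the energy.\<close>
  define \<epsilon> where "\<epsilon> = 1 / (lam / (2 * c) + be)"
  have den: "0 < lam / (2 * c) + be" using pos by (simp add: add_pos_pos)
  have \<epsilon>: "0 < \<epsilon>" "\<epsilon> * (lam / (2 * c) + be) = 1" unfolding \<epsilon>_def using den by auto
  define a where "a k = c / be * (j k)\<^sup>2 + 1 / lam * (g k)\<^sup>2 + \<epsilon> * (j k * g k)" for k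
  define C where "C = c / be * (be * M)\<^sup>2 + lam * N\<^sup>2 + \<epsilon> * (be * M * N)"
  show ?thesis
  proof (unfold j_def[symmetric], rule descent_sum[where a = a and e = "\<lambda>k. (j k)\<^sup>2" and s = "\<lambda>k. 1 / (real k + 1)" and c = "\<epsilon> * (lam * c / 2)" and C = C
        and B = "c / be * M\<^sup>2 + 1 / lam * M\<^sup>2 + \<epsilon> * (M * M)" and S = 1])
    show "0 < \<epsilon> * (lam * c / 2)" using \<epsilon> pos by simp
    show "(\<Sum>k<n. 1 / (real k + 1)) \<le> 1 * (1 + ln (real n + 1))" for n using harmonic_le_ln by simp
    show "\<bar>a k\<bar> \<le> c / be * M\<^sup>2 + 1 / lam * M\<^sup>2 + \<epsilon> * (M * M)" for k
    proof -
      have sq: "(j k)\<^sup>2 \<le> M\<^sup>2" "(g k)\<^sup>2 \<le> M\<^sup>2" using jM[of k] gM[of k] M1 by (auto simp: abs_le_square_iff[symmetric])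
      have "\<bar>\<epsilon> * (j k * g k)\<bar> \<le> \<epsilon> * (M * M)" unfolding abs_mult using \<epsilon> jM[of k] gM[of k] by (auto intro!: mult_mono)
      moreover have "c / be * (j k)\<^sup>2 \<le> c / be * M\<^sup>2" "1 / lam * (g k)\<^sup>2 \<le> 1 / lam * M\<^sup>2" using sq pos by (auto intro!: mult_left_mono divide_right_mono)
      moreover have "0 \<le> c / be * (j k)\<^sup>2" "0 \<le> 1 / lam * (g k)\<^sup>2" using pos by auto
      ultimately show ?thesis unfolding a_def by linarith
    qed
    fix k :: nat assume "1 \<le> k"
    define t where "t = tk k"
    have t: "0 < t" "t \<le> 1" unfolding t_def by (auto simp: tk_pos tk_le_one)
    define x y where "x = j k" and "y = g k"
    define x' y' where "x' = j (Suc k)" and "y' = g (Suc k)"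
    have xy: "\<bar>x\<bar> \<le> M" "\<bar>y\<bar> \<le> M" "\<bar>y'\<bar> \<le> M" unfolding x_def y_def y'_def using jM gM by auto
    have y': "y' = y - lam * t * (c * x + y)" unfolding y'_def y_def x_def j_def g t_def by (simp add: algebra_simps)
    have Jk: "0 \<le> J k" "J k \<le> 1"
      using \<open>1 \<le> k\<close> J[of "k - 1"] by (auto simp: max_def min_def split: if_splits)
    \<comment> \<open>Clipping can only bring J closer to \<open>rr\<close>, which lies in the
      interval.\<close>
    have x'1: "\<bar>x'\<bar> \<le> \<bar>x + be * t * y\<bar>" unfolding x'_def x_def y_def j_def J t_def using rr by (auto simp: max_def min_def abs_if)
    have x'2: "\<bar>x' - x\<bar> \<le> be * t * \<bar>y\<bar>"
    proof -
      have "\<bar>x' - x\<bar> \<le> \<bar>be * t * y\<bar>" unfolding x'_def x_def y_def j_def J t_def using Jk by (auto simp: max_def min_def abs_if)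
      then show ?thesis using pos t by (simp add: abs_mult)
    qed
    have cxy: "\<bar>c * x + y\<bar> \<le> N"
    proof -
      have "\<bar>c * x\<bar> \<le> c * M" unfolding abs_mult using xy pos by simp
      then show ?thesis unfolding N_def distrib_right using xy by linarith
    qed
    have t1: "c / be * x'\<^sup>2 \<le> c / be * x\<^sup>2 + 2 * c * t * (x * y) + c / be * (be * M)\<^sup>2 * t\<^sup>2"
    proof -
      have "x'\<^sup>2 \<le> (x + be * t * y)\<^sup>2" using x'1 by (simp add: abs_le_square_iff)
      also have "\<dots> = x\<^sup>2 + 2 * be * t * (x * y) + be\<^sup>2 * t\<^sup>2 * y\<^sup>2" by (simp add: power2_eq_square algebra_simps)
      also have "\<dots> \<le> x\<^sup>2 + 2 * be * t * (x * y) + be\<^sup>2 * t\<^sup>2 * M\<^sup>2"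
      proof -
        have "y\<^sup>2 \<le> M\<^sup>2" using xy M1 by (simp add: abs_le_square_iff[symmetric])
        then show ?thesis by (intro add_left_mono mult_left_mono) auto
      qed
      finally have "c / be * x'\<^sup>2 \<le> c / be * (x\<^sup>2 + 2 * be * t * (x * y) + be\<^sup>2 * t\<^sup>2 * M\<^sup>2)" using pos by (intro mult_left_mono) auto
      also have "\<dots> = c / be * x\<^sup>2 + 2 * c * t * (x * y) + c / be * (be * M)\<^sup>2 * t\<^sup>2"
        using pos by (simp add: field_simps power2_eq_square)
      finally show ?thesis .
    qed
    have t2: "1 / lam * y'\<^sup>2 \<le> 1 / lam * y\<^sup>2 - 2 * t * (c * (x * y) + y\<^sup>2) + lam * N\<^sup>2 * t\<^sup>2"
    proof -
      have "y'\<^sup>2 = y\<^sup>2 - 2 * lam * t * (c * (x * y) + y\<^sup>2) + lam\<^sup>2 * t\<^sup>2 * (c * x + y)\<^sup>2" unfolding y' by (simp add: power2_eq_square algebra_simps)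
      also have "\<dots> \<le> y\<^sup>2 - 2 * lam * t * (c * (x * y) + y\<^sup>2) + lam\<^sup>2 * t\<^sup>2 * N\<^sup>2"
      proof -
        have "(c * x + y)\<^sup>2 \<le> N\<^sup>2" using cxy N by (simp add: abs_le_square_iff[symmetric])
        then show ?thesis by (intro add_left_mono mult_left_mono) auto
      qed
      finally have "1 / lam * y'\<^sup>2 \<le> 1 / lam * (y\<^sup>2 - 2 * lam * t * (c * (x * y) + y\<^sup>2) + lam\<^sup>2 * t\<^sup>2 * N\<^sup>2)" using pos by (intro mult_left_mono) auto
      also have "\<dots> = 1 / lam * y\<^sup>2 - 2 * t * (c * (x * y) + y\<^sup>2) + lam * N\<^sup>2 * t\<^sup>2"
        using pos by (simp add: field_simps power2_eq_square)
      finally show ?thesis .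
    qed
    have t3: "x' * y' \<le> x * y - lam * t * (c / 2 * x\<^sup>2) + t * ((lam / (2 * c) + be) * y\<^sup>2) + be * M * N * t\<^sup>2"
    proof -
      have "x' * y' = x * y + x * (y' - y) + (x' - x) * y + (x' - x) * (y' - y)" by algebra
      moreover have "x * (y' - y) = - (lam * t * (c * x\<^sup>2)) - lam * t * (x * y)" unfolding y' by (simp add: power2_eq_square algebra_simps)
      moreover have "- (lam * t * (x * y)) \<le> lam * t * (c / 2 * x\<^sup>2 + 1 / (2 * c) * y\<^sup>2)"
      proof -
        have "- (x * y) \<le> c / 2 * x\<^sup>2 + 1 / (2 * c) * y\<^sup>2"
        proof -
          have "0 \<le> (c * x + y)\<^sup>2 / (2 * c)" using pos by simp
          then show ?thesis using pos by (simp add: field_simps power2_eq_square)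
        qed
        then have "lam * t * (- (x * y)) \<le> lam * t * (c / 2 * x\<^sup>2 + 1 / (2 * c) * y\<^sup>2)" using pos t by (intro mult_left_mono) auto
        then show ?thesis by simp
      qed
      moreover have "(x' - x) * y \<le> t * (be * y\<^sup>2)"
      proof -
        have "(x' - x) * y \<le> \<bar>x' - x\<bar> * \<bar>y\<bar>" by (metis abs_ge_self abs_mult)
        also have "\<dots> \<le> (be * t * \<bar>y\<bar>) * \<bar>y\<bar>" using x'2 by (intro mult_right_mono) auto
        finally show ?thesis by (simp add: power2_eq_square mult_ac)
      qed
      moreover have "(x' - x) * (y' - y) \<le> be * M * N * t\<^sup>2"
      proof -
        have 1: "\<bar>x' - x\<bar> \<le> be * t * M"
        proof -
          have "be * t * \<bar>y\<bar> \<le> be * t * M" using xy pos t by (intro mult_left_mono) auto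
          then show ?thesis using x'2 by linarith
        qed
        have "\<bar>y' - y\<bar> = lam * t * \<bar>c * x + y\<bar>" unfolding y' using pos t by (simp add: abs_mult)
        also have "\<dots> \<le> 1 * t * N" using cxy pos t by (intro mult_mono) auto
        finally have "\<bar>(x' - x) * (y' - y)\<bar> \<le> (be * t * M) * (1 * t * N)" unfolding abs_mult using 1 pos t M1 by (intro mult_mono) auto
        then show ?thesis by (simp add: power2_eq_square mult_ac)
      qed
      ultimately show ?thesis by (simp add: algebra_simps)
    qed
    have t3': "\<epsilon> * (x' * y') \<le> \<epsilon> * (x * y) - \<epsilon> * (lam * c / 2) * (t * x\<^sup>2) + t * y\<^sup>2 + \<epsilon> * (be * M * N) * t\<^sup>2"
    proof -
      have "\<epsilon> * (x' * y') \<le> \<epsilon> * (x * y - lam * t * (c / 2 * x\<^sup>2) + t * ((lam / (2 * c) + be) * y\<^sup>2) + be * M * N * t\<^sup>2)"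
        using t3 \<epsilon> by (intro mult_left_mono) auto
      also have "\<dots> = \<epsilon> * (x * y) - \<epsilon> * (lam * c / 2) * (t * x\<^sup>2) + t * ((\<epsilon> * (lam / (2 * c) + be)) * y\<^sup>2) + \<epsilon> * (be * M * N) * t\<^sup>2"
      proof -
        have "e * (p - l * t * (c / 2 * x2) + t * (D * y2) + q * t2) = e * p - e * (l * c / 2) * (t * x2) + t * ((e * D) * y2) + e * q * t2"
          for e p l x2 D y2 q t2 :: real by (simp add: algebra_simps)
        then show ?thesis .
      qed
      finally show ?thesis unfolding \<epsilon>(2) by simp
    qed
    have ty: "0 \<le> t * y\<^sup>2" using t by simp
    have "a (Suc k) \<le> a k - \<epsilon> * (lam * c / 2) * (t * x\<^sup>2) + C * t\<^sup>2"
    proof -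
      have "a (Suc k) \<le> (c / be * x\<^sup>2 + 2 * c * t * (x * y) + c / be * (be * M)\<^sup>2 * t\<^sup>2) + (1 / lam * y\<^sup>2 - 2 * t * (c * (x * y) + y\<^sup>2) + lam * N\<^sup>2 * t\<^sup>2)
        + (\<epsilon> * (x * y) - \<epsilon> * (lam * c / 2) * (t * x\<^sup>2) + t * y\<^sup>2 + \<epsilon> * (be * M * N) * t\<^sup>2)"
        unfolding a_def x'_def[symmetric] y'_def[symmetric] using t1 t2 t3' by linarith
      also have "\<dots> = a k - \<epsilon> * (lam * c / 2) * (t * x\<^sup>2) + C * t\<^sup>2 - t * y\<^sup>2"
        unfolding a_def x_def[symmetric] y_def[symmetric] C_def by algebra
      finally show ?thesis using ty by linarith
    qed
    then show "a (Suc k) \<le> a k - \<epsilon> * (lam * c / 2) * (tk k * (j k)\<^sup>2) + C * (1 / (real k + 1))"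
      unfolding t_def x_def tk_sq .
  qed auto
qed

section \<open>Expected drift of the full Lyapunov function and its summation\<close>

context mfg_alg
begin

lemma Estep_add: "Estep k x (\<lambda>y. f y + g y) = Estep k x f + Estep k x g"
  unfolding Estep_def by (rule loc_avg_add)

lemma Estep_cmult: "Estep k x (\<lambda>y. c * f y) = c * Estep k x f"
  unfolding Estep_def loc_avg_def by (simp add: sum_distrib_left mult_ac)

lemma Estep_le: "(\<And>a s'. f (nxt k x a s') \<le> c) \<Longrightarrow> Estep k x f \<le> c"
proof -
  assume "\<And>a s'. f (nxt k x a s') \<le> c"
  then have "loc_avg (softmax (th x)) (muh x) (\<lambda>_ a s'. f (nxt k x a s')) (st x) \<le> loc_avg (softmax (th x)) (muh x) (\<lambda>_ _ _. c) (st x)"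
    by (intro loc_avg_mono softmax_policy)
  then show ?thesis unfolding Estep_def loc_avg_curr[OF softmax_policy, where g = "\<lambda>_. c"] .
qed

lemma fterm_bounded:
  fixes X :: "(real^'a^'s) \<times> (real^'s) \<times> real \<times> (real^'s) \<Rightarrow> 's \<Rightarrow> 'a \<Rightarrow> 's \<Rightarrow> 'v::real_inner"
  assumes X: "\<And>s a s'. blip params (\<lambda>p. X p s a s')" and zb: "\<And>k x. Inv k x \<Longrightarrow> norm (z x) \<le> B"
  shows "\<exists>C. \<forall>k x. Inv k x \<longrightarrow> \<bar>fterm X z k x\<bar> \<le> C"
proof -
  obtain Cm where Cm: "Cm \<ge> 0" "\<And>p. p \<in> params \<Longrightarrow> norm (mean X p) \<le> Cm"
    by (rule blipE[OF blip_avg[OF X]]) (assumption | rule that)+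
  have "blip params (\<lambda>p. poisson (softmax (pth p)) (pmu p) (X p) s)" for s
    by (rule blip_poisson[OF X])
  then have "\<forall>s. \<exists>C. \<forall>p\<in>params. norm (poisson (softmax (pth p)) (pmu p) (X p) s) \<le> C"
    unfolding blip_def by blast
  from choice[OF this] obtain Cu where Cu: "\<And>s p. p \<in> params \<Longrightarrow> norm (poisson (softmax (pth p)) (pmu p) (X p) s) \<le> Cu s"
    by blast
  define U where "U = Max (range Cu)"
  have "\<bar>fterm X z k x\<bar> \<le> (\<bar>B\<bar> + Cm)\<^sup>2 + 2 * ((\<bar>B\<bar> + Cm) * \<bar>U\<bar>)" if I: "Inv k x" for k x
  proof -
    have p: "par x \<in> params" using I by (simp add: Inv_def)
    define D where "D = z x - mean X (par x)"
    define u where "u = poisson (softmax (th x)) (muh x) (X (par x)) (st x)"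
    have D: "norm D \<le> \<bar>B\<bar> + Cm"
      using norm_triangle_ineq4[of "z x" "mean X (par x)"] zb[OF I] Cm(2)[OF p] unfolding D_def by linarith
    have "norm u \<le> Cu (st x)" using Cu[OF p, of "st x"] unfolding u_def par_simps .
    also have "\<dots> \<le> U" unfolding U_def by (rule Max_ge) auto
    finally have u: "norm u \<le> \<bar>U\<bar>" by simp
    have "\<bar>D \<bullet> u\<bar> \<le> norm D * norm u" by (rule Cauchy_Schwarz_ineq2)
    also have "\<dots> \<le> (\<bar>B\<bar> + Cm) * \<bar>U\<bar>" using D u Cm(1) by (intro mult_mono) auto
    finally have Du: "\<bar>D \<bullet> u\<bar> \<le> (\<bar>B\<bar> + Cm) * \<bar>U\<bar>" .
    have "\<bar>lam * tk k * (D \<bullet> u)\<bar> \<le> 1 * ((\<bar>B\<bar> + Cm) * \<bar>U\<bar>)"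
      unfolding abs_mult[of "lam * tk k"] using lam_tk[of k] Du by (intro mult_mono) auto
    moreover have "(norm D)\<^sup>2 \<le> (\<bar>B\<bar> + Cm)\<^sup>2" using D by (intro power_mono) auto
    moreover have "fterm X z k x = (norm D)\<^sup>2 + 2 * (lam * tk k * (D \<bullet> u))" unfolding fterm_def D_def u_def by simp
    moreover have "0 \<le> (norm D)\<^sup>2" by simp
    ultimately show ?thesis by linarith
  qed
  then show ?thesis by blast
qed

text \<open>The reward filter is divided by \<open>cJ\<close> because its target moves
  \<open>cJ\<close> times as fast as the quantities it averages. The mean-field error and its filter
  share the weight \<open>wm\<close>, so their coupling scales as both squares do.\<close>

definition "lyap k x = pot k x + wm * (em x)\<^sup>2 + 64 * (ej x)\<^sup>2 + \<gamma> * fterm XF fv k x + fterm XV gV k x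
  + 1 / cJ * fterm XJ gJ k x + wm * fterm XH hv k x"

definition "eps x = (norm (gradx x))\<^sup>2 + (em x)\<^sup>2 + (eV x)\<^sup>2 + (ej x)\<^sup>2"

lemma eps_eq: "eps_pi K r x + eps_mu K x + eps_V K r x + eps_J K r x = eps x"
  unfolding eps_pi_def eps_mu_def eps_V_def eps_J_def eps_def gradx_def em_def eV_def ej_def Jx_def mst_def by simp

lemma pot_bounded: "\<exists>C. \<forall>k x. Inv k x \<longrightarrow> \<bar>pot k x\<bar> \<le> C"
proof -
  obtain M where M: "M \<ge> 1" "\<And>k x. Inv k x \<Longrightarrow> eV x \<le> M" using Inv_all_bounds by blast
  obtain C4 where C4: "C4 \<ge> 0" "\<And>k x. Inv k x \<Longrightarrow> \<bar>Yl k x\<bar> \<le> BV + 2 + C4 * (tk k + ee k)" using Yl_bound by blast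
  have "\<bar>pot k x\<bar> \<le> \<bar>Wc\<bar> + M\<^sup>2 + (BV + 2 + C4 * (1 + E1))\<^sup>2" if I: "Inv k x" for k x
  proof -
    have "C4 * (tk k + ee k) \<le> C4 * (1 + E1)" using C4 tk_le_one ee_le by (intro mult_left_mono add_mono) auto
    then have "\<bar>Yl k x\<bar> \<le> BV + 2 + C4 * (1 + E1)" using C4(2)[OF I] by linarith
    then have "\<bar>Yl k x\<bar>\<^sup>2 \<le> (BV + 2 + C4 * (1 + E1))\<^sup>2" by (intro power_mono) auto
    then have 1: "(Yl k x)\<^sup>2 \<le> (BV + 2 + C4 * (1 + E1))\<^sup>2" by simp
    have 2: "(eV x)\<^sup>2 \<le> M\<^sup>2" using M(2)[OF I] nonneg[of x] by (intro power_mono) auto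
    have 3: "\<bar>- Wc * ell x\<bar> \<le> \<bar>Wc\<bar> * 1" unfolding abs_mult using ell_range[of x] by (intro mult_mono) auto
    have "0 \<le> (eV x)\<^sup>2" "0 \<le> (Yl k x)\<^sup>2" by simp_all
    with 1 2 3 show ?thesis unfolding pot_def by linarith
  qed
  then show ?thesis by blast
qed

lemma lyap_bounded: "\<exists>B. \<forall>k x. Inv k x \<longrightarrow> \<bar>lyap k x\<bar> \<le> B"
proof -
  obtain M where M: "M \<ge> 1" "\<And>k x. Inv k x \<Longrightarrow> norm (fv x) \<le> M \<and> norm (gV x) \<le> M \<and> \<bar>gJ x\<bar> \<le> M \<and> norm (hv x) \<le> M \<and> em x \<le> M \<and> ej x \<le> M"
    using Inv_all_bounds by blast
  obtain P where P: "\<And>k x. Inv k x \<Longrightarrow> \<bar>pot k x\<bar> \<le> P" using pot_bounded by blast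
  obtain F where F: "\<And>k x. Inv k x \<Longrightarrow> \<bar>fterm XF fv k x\<bar> \<le> F"
    using fterm_bounded[where X = XF and z = fv and B = M, OF blip_XF] M(2) by blast
  obtain V where V: "\<And>k x. Inv k x \<Longrightarrow> \<bar>fterm XV gV k x\<bar> \<le> V"
    using fterm_bounded[where X = XV and z = gV and B = M, OF blip_XV] M(2) by blast
  have "\<exists>J. \<forall>k x. Inv k x \<longrightarrow> \<bar>fterm XJ gJ k x\<bar> \<le> J"
    by (rule fterm_bounded[where B = M, OF blip_XJ]) (use M(2) in auto)
  then obtain J where J: "\<And>k x. Inv k x \<Longrightarrow> \<bar>fterm XJ gJ k x\<bar> \<le> J" by blast
  obtain H where H: "\<And>k x. Inv k x \<Longrightarrow> \<bar>fterm XH hv k x\<bar> \<le> H"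
    using fterm_bounded[where X = XH and z = hv and B = M, OF blip_XH] M(2) by blast
  have "\<bar>lyap k x\<bar> \<le> P + wm * M\<^sup>2 + 64 * M\<^sup>2 + \<gamma> * F + V + 1 / cJ * J + wm * H" if I: "Inv k x" for k x
  proof -
    have sc: "\<bar>c * y\<bar> \<le> c * b" if "0 \<le> c" "\<bar>y\<bar> \<le> b" for c y b :: real
      using that by (simp add: abs_mult mult_left_mono)
    have w: "0 \<le> wm" "0 \<le> \<gamma>" "0 \<le> 1 / cJ" using step_ratios(14) gam cJ by auto
    have e: "\<bar>(em x)\<^sup>2\<bar> \<le> M\<^sup>2" "\<bar>(ej x)\<^sup>2\<bar> \<le> M\<^sup>2" unfolding abs_power2 using M(2)[OF I] nonneg[of x] by (intro power_mono; simp)+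
    note b = sc[OF w(1) e(1)] sc[OF _ e(2), of 64] sc[OF w(2) F[OF I]] sc[OF w(3) J[OF I]] sc[OF w(1) H[OF I]]
    have "\<bar>p + a + d + e + v + g + h\<bar> \<le> p' + a' + d' + e' + v' + g' + h'"
      if "\<bar>p\<bar> \<le> p'" "\<bar>a\<bar> \<le> a'" "\<bar>d\<bar> \<le> d'" "\<bar>e\<bar> \<le> e'" "\<bar>v\<bar> \<le> v'" "\<bar>g\<bar> \<le> g'" "\<bar>h\<bar> \<le> h'"
      for p a d e v g h p' a' d' e' v' g' h' :: real using that by linarith
    from this[OF P[OF I] b(1,2,3) V[OF I] b(4,5)] show ?thesis unfolding lyap_def by simp
  qed
  then show ?thesis by blast
qed

lemma filter_drift_le:
  fixes X :: "(real^'a^'s) \<times> (real^'s) \<times> real \<times> (real^'s) \<Rightarrow> 's \<Rightarrow> 'a \<Rightarrow> 's \<Rightarrow> 'v::real_inner"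
  assumes X: "\<And>s a s'. blip params (\<lambda>p. X p s a s')"
    and z: "\<And>k x a s'. z (nxt k x a s') = (1 - lam * tk k) *\<^sub>R z x + (lam * tk k) *\<^sub>R X (par x) (st x) a s'"
    and zb: "\<And>k x. Inv k x \<Longrightarrow> norm (z x) \<le> B"
    and m: "\<And>k x a s'. Inv k x \<Longrightarrow> norm (mean X (par (nxt k x a s')) - mean X (par x)) \<le> be * tk k * l x"
  shows "\<exists>C. \<forall>k x. Inv k x \<longrightarrow> Estep k x (fterm X z (Suc k)) \<le> fterm X z k x
     + tk k * (be * (- 2 * nR * (norm (z x - mean X (par x)))\<^sup>2 + 2 * norm (z x - mean X (par x)) * l x)) + C * (tk k)\<^sup>2"
proof -
  obtain C where C: "\<And>k x a s'. Inv k x \<Longrightarrow> Estep k x (fterm X z (Suc k)) \<le> fterm X z k x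
     - 2 * (lam * tk k) * (norm (z x - mean X (par x)))\<^sup>2
     + 2 * norm (z x - mean X (par x)) * norm (mean X (par (nxt k x a s')) - mean X (par x)) + C * (tk k)\<^sup>2"
  proof -
    have "\<exists>C. \<forall>k x a s'. Inv k x \<longrightarrow> Estep k x (fterm X z (Suc k)) \<le> fterm X z k x
     - 2 * (lam * tk k) * (norm (z x - mean X (par x)))\<^sup>2
     + 2 * norm (z x - mean X (par x)) * norm (mean X (par (nxt k x a s')) - mean X (par x)) + C * (tk k)\<^sup>2"
      by (rule filter_drift[OF X z zb])
    then show ?thesis using that by blast
  qed
  have "Estep k x (fterm X z (Suc k)) \<le> fterm X z k x
     + tk k * (be * (- 2 * nR * (norm (z x - mean X (par x)))\<^sup>2 + 2 * norm (z x - mean X (par x)) * l x)) + C * (tk k)\<^sup>2" if I: "Inv k x" for k x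
  proof -
    define D where "D = norm (z x - mean X (par x))"
    have "2 * D * norm (mean X (par (nxt k x undefined undefined)) - mean X (par x)) \<le> 2 * D * (be * tk k * l x)"
      using m[OF I] unfolding D_def by (intro mult_left_mono) auto
    then have "Estep k x (fterm X z (Suc k)) \<le> fterm X z k x - 2 * (lam * tk k) * D\<^sup>2 + 2 * D * (be * tk k * l x) + C * (tk k)\<^sup>2"
      using C[OF I, of undefined undefined] unfolding D_def by linarith
    also have "\<dots> = fterm X z k x - 2 * ((be * nR) * tk k) * D\<^sup>2 + 2 * D * (be * tk k * l x) + C * (tk k)\<^sup>2"
      by (simp only: step_ratios(6))
    also have "\<dots> = fterm X z k x + tk k * (be * (- 2 * nR * D\<^sup>2 + 2 * D * l x)) + C * (tk k)\<^sup>2"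
      by algebra
    finally show ?thesis unfolding D_def .
  qed
  then show ?thesis by blast
qed

lemma par_step_ratios:
  assumes I: "Inv k x"
  shows "norm (th (nxt k x a s') - th x) = be * tk k * (nA * norm (fv x))"
    "norm (muh (nxt k x a s') - muh x) \<le> be * tk k * (nZ * norm (hv x))"
    "norm (Vh (nxt k x a s') - Vh x) \<le> be * tk k * (nG x + sqrt 2 * eV x + ej x)"
    "\<bar>Jh (nxt k x a s') - Jh x\<bar> \<le> be * tk k * (nQ x + cJ * ej x)"
proof -
  note p = par_step[OF Inv_params[OF I], of k a s']
  have b: "0 \<le> be * tk k" using pos' tk_pos[of k] by simp
  have "al * tk k * norm (fv x) = be * nA * tk k * norm (fv x)" by (simp only: step_ratios(4))
  also have "\<dots> = be * tk k * (nA * norm (fv x))" by algebra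
  finally show "norm (th (nxt k x a s') - th x) = be * tk k * (nA * norm (fv x))" using p(1) by linarith
  have "xi * tk k * norm (hv x) = be * nZ * tk k * norm (hv x)" by (simp only: step_ratios(5))
  also have "\<dots> = be * tk k * (nZ * norm (hv x))" by algebra
  finally show "norm (muh (nxt k x a s') - muh x) \<le> be * tk k * (nZ * norm (hv x))" using p(4) by linarith
  show "norm (Vh (nxt k x a s') - Vh x) \<le> be * tk k * (nG x + sqrt 2 * eV x + ej x)"
    using p(2) mult_left_mono[OF gV_le[OF I] b] by linarith
  show "\<bar>Jh (nxt k x a s') - Jh x\<bar> \<le> be * tk k * (nQ x + cJ * ej x)"
    using p(3) mult_left_mono[OF gJ_le[OF I] b] by linarith
qed

text \<open>In units of \<open>be * tk k\<close> these bound the joint motion of theta and mu, and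
  the motion of V.\<close>

abbreviation "speed x \<equiv> nA * norm (fv x) + nZ * norm (hv x)"
abbreviation "vspeed x \<equiv> nG x + sqrt 2 * eV x + ej x"

lemma mean_drifts:
  assumes I: "Inv k x"
  shows "norm (mean XF (par (nxt k x a s')) - mean XF (par x)) \<le> be * tk k * (3 * LF * speed x + 2 * vspeed x)"
    "norm (mean XV (par (nxt k x a s')) - mean XV (par x)) \<le> be * tk k * (LG * speed x + (nQ x + cJ * ej x) + sqrt 2 * vspeed x)"
    "norm (mean XJ (par (nxt k x a s')) - mean XJ (par x)) \<le> be * tk k * (cJ * (LV * speed x + (nQ x + cJ * ej x)))"
    "norm (mean XH (par (nxt k x a s')) - mean XH (par x)) \<le> be * tk k * (2 * L * nA * norm (fv x) + 2 * nZ * norm (hv x))"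
proof -
  note pq = par_nxt_params[of k x a s'] Inv_params[OF I]
  define y where "y = nxt k x a s'"
  define b where "b = be * tk k"
  define q where "q = sqrt 2"
  have q: "0 \<le> q" unfolding q_def by simp
  note st = par_step_ratios[OF I, of a s', folded y_def b_def q_def]
  define dT dV dJ S V Q where "dT = norm (th y - th x) + norm (muh y - muh x)" and "dV = norm (Vh y - Vh x)"
    and "dJ = \<bar>Jh y - Jh x\<bar>" and "S = speed x" and "V = nG x + q * eV x + ej x" and "Q = nQ x + cJ * ej x"
  have d: "dT \<le> b * S" "dV \<le> b * V" "dJ \<le> b * Q"
    unfolding dT_def dV_def dJ_def S_def V_def Q_def distrib_left[of b "nA * _"] using st by linarith+
  have sc: "c * u \<le> b * (c * w)" if "u \<le> b * w" "0 \<le> c" for c u w :: real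
    using mult_left_mono[OF that] by (simp add: mult_ac)
  have F: "norm (mean XF (par y) - mean XF (par x)) \<le> 3 * LF * dT + 2 * dV"
    using mean_XF_lip[OF pq] unfolding par_simps y_def dT_def dV_def .
  have G: "norm (mean XV (par y) - mean XV (par x)) \<le> LG * dT + dJ + q * dV"
    using mean_XV_lip[OF pq] unfolding par_simps y_def dT_def dV_def dJ_def q_def .
  have J: "norm (mean XJ (par y) - mean XJ (par x)) \<le> cJ * (LV * dT + dJ)"
    using mean_XJ_lip[OF pq] unfolding par_simps y_def dT_def dJ_def real_norm_def .
  have H: "norm (mean XH (par y) - mean XH (par x)) \<le> 2 * L * norm (th y - th x) + 2 * norm (muh y - muh x)"
    using mean_XH_lip[OF pq] unfolding par_simps y_def .
  have c: "0 \<le> 3 * LF" "0 \<le> LG" "0 \<le> LV" "0 \<le> 2 * L" using LF_ge LG_ge cJ LV L by auto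
  have eF: "3 * LF * dT + 2 * dV \<le> b * (3 * LF * S + 2 * V)"
    unfolding distrib_left[of b] using sc[OF d(1) c(1)] sc[OF d(2), of 2] by linarith
  have eG: "LG * dT + dJ + q * dV \<le> b * (LG * S + Q + q * V)"
    unfolding distrib_left[of b] using sc[OF d(1) c(2)] sc[OF d(2) q] d(3) by linarith
  have "LV * dT + dJ \<le> b * (LV * S + Q)" unfolding distrib_left[of b] using sc[OF d(1) c(3)] d(3) by linarith
  then have eJ: "cJ * (LV * dT + dJ) \<le> b * (cJ * (LV * S + Q))" using cJ by (intro sc) auto
  have eH: "2 * L * norm (th y - th x) + 2 * norm (muh y - muh x) \<le> b * (2 * L * nA * norm (fv x) + 2 * nZ * norm (hv x))"
    unfolding distrib_left[of b] using sc[OF eq_refl[OF st(1)] c(4)] sc[OF st(2), of 2] by (simp add: mult.assoc)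
  show "norm (mean XF (par (nxt k x a s')) - mean XF (par x)) \<le> be * tk k * (3 * LF * speed x + 2 * vspeed x)"
    using F eF unfolding y_def b_def S_def V_def q_def by (rule order_trans)
  show "norm (mean XV (par (nxt k x a s')) - mean XV (par x)) \<le> be * tk k * (LG * speed x + (nQ x + cJ * ej x) + sqrt 2 * vspeed x)"
    using G eG unfolding y_def b_def S_def V_def Q_def q_def by (rule order_trans)
  show "norm (mean XJ (par (nxt k x a s')) - mean XJ (par x)) \<le> be * tk k * (cJ * (LV * speed x + (nQ x + cJ * ej x)))"
    using J eJ unfolding y_def b_def S_def Q_def by (rule order_trans)
  show "norm (mean XH (par (nxt k x a s')) - mean XH (par x)) \<le> be * tk k * (2 * L * nA * norm (fv x) + 2 * nZ * norm (hv x))"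
    using H eH unfolding y_def b_def by (rule order_trans)
qed

lemma lyap_drift: "\<exists>C. \<forall>k x. Inv k x \<longrightarrow>
   Estep k x (lyap (Suc k)) \<le> lyap k x - be * \<gamma> / 50 * (tk k * eps x) + C * ((tk k)\<^sup>2 + tk k * ee k)"
proof -
  obtain C1 where C1: "\<And>k x. Inv k x \<Longrightarrow> \<exists>w. \<gamma> / 25 \<le> w \<and> w \<le> \<gamma> / 24 \<and> (\<forall>a s'.
   pot (Suc k) (nxt k x a s') \<le> pot k x + tk k * (- be * w * (fv x \<bullet> gradx x)
     + (- 2 * be * \<gamma> * (eV x)\<^sup>2 + 2 * be * eV x * ej x + 2 * be * eV x * nG x + 2 * LV * eV x * (al * norm (fv x) + xi * norm (hv x)))
     + be * (nG x + sqrt 2 * eV x + ej x) * (aa * (ej x + LV * em x) + bb * (nG x + aa * nQ x))) + C1 * ((tk k)\<^sup>2 + tk k * ee k))"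
    using potential_drift by blast
  obtain C2 where C2: "\<And>k x a s'. Inv k x \<Longrightarrow>
   (em (nxt k x a s'))\<^sup>2 \<le> (em x)\<^sup>2 + tk k * (- 2 * xi * (1 - \<delta>) * (em x)\<^sup>2 + 2 * xi * em x * nH x + 2 * L * al * em x * norm (fv x))
     + C2 * (tk k)\<^sup>2" using em_drift by blast
  obtain C3 where C3: "\<And>k x a s'. Inv k x \<Longrightarrow>
   (ej (nxt k x a s'))\<^sup>2 \<le> (ej x)\<^sup>2 + tk k * (- 2 * be * cJ * (ej x)\<^sup>2 + 2 * be * ej x * nQ x
     + 2 * LV * ej x * (al * norm (fv x) + xi * norm (hv x))) + C3 * (tk k)\<^sup>2" using ej_drift by blast
  obtain M where M: "M \<ge> 1" "\<And>k x. Inv k x \<Longrightarrow> norm (fv x) \<le> M \<and> norm (gV x) \<le> M \<and> \<bar>gJ x\<bar> \<le> M \<and> norm (hv x) \<le> M"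
    using Inv_bounds by blast
  have "\<exists>C. \<forall>k x. Inv k x \<longrightarrow> Estep k x (fterm XF fv (Suc k)) \<le> fterm XF fv k x
     + tk k * (be * (- 2 * nR * (norm (fv x - mean XF (par x)))\<^sup>2 + 2 * norm (fv x - mean XF (par x)) * (3 * LF * speed x + 2 * vspeed x))) + C * (tk k)\<^sup>2"
    by (rule filter_drift_le[OF blip_XF, where B = M]) (use M(2) mean_drifts(1) in \<open>auto simp: nxt_def\<close>)
  then obtain C4 where C4: "\<And>k x. Inv k x \<Longrightarrow> Estep k x (fterm XF fv (Suc k)) \<le> fterm XF fv k x
     + tk k * (be * (- 2 * nR * (nF x)\<^sup>2 + 2 * nF x * (3 * LF * speed x + 2 * vspeed x))) + C4 * (tk k)\<^sup>2"
    unfolding nF_def by blast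
  have "\<exists>C. \<forall>k x. Inv k x \<longrightarrow> Estep k x (fterm XV gV (Suc k)) \<le> fterm XV gV k x
     + tk k * (be * (- 2 * nR * (norm (gV x - mean XV (par x)))\<^sup>2 + 2 * norm (gV x - mean XV (par x)) * (LG * speed x + (nQ x + cJ * ej x) + sqrt 2 * vspeed x))) + C * (tk k)\<^sup>2"
    by (rule filter_drift_le[OF blip_XV, where B = M]) (use M(2) mean_drifts(2) in \<open>auto simp: nxt_def\<close>)
  then obtain C5 where C5: "\<And>k x. Inv k x \<Longrightarrow> Estep k x (fterm XV gV (Suc k)) \<le> fterm XV gV k x
     + tk k * (be * (- 2 * nR * (nG x)\<^sup>2 + 2 * nG x * (LG * speed x + (nQ x + cJ * ej x) + sqrt 2 * vspeed x))) + C5 * (tk k)\<^sup>2"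
    unfolding nG_def by blast
  have "\<exists>C. \<forall>k x. Inv k x \<longrightarrow> Estep k x (fterm XJ gJ (Suc k)) \<le> fterm XJ gJ k x
     + tk k * (be * (- 2 * nR * (norm (gJ x - mean XJ (par x)))\<^sup>2 + 2 * norm (gJ x - mean XJ (par x)) * (cJ * (LV * speed x + (nQ x + cJ * ej x))))) + C * (tk k)\<^sup>2"
    by (rule filter_drift_le[OF blip_XJ, where B = M]) (use M(2) mean_drifts(3) in \<open>auto simp: nxt_def\<close>)
  then obtain C6 where C6: "\<And>k x. Inv k x \<Longrightarrow> Estep k x (fterm XJ gJ (Suc k)) \<le> fterm XJ gJ k x
     + tk k * (be * (- 2 * nR * (nQ x)\<^sup>2 + 2 * nQ x * (cJ * (LV * speed x + (nQ x + cJ * ej x))))) + C6 * (tk k)\<^sup>2"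
    unfolding nQ_def by blast
  have "\<exists>C. \<forall>k x. Inv k x \<longrightarrow> Estep k x (fterm XH hv (Suc k)) \<le> fterm XH hv k x
     + tk k * (be * (- 2 * nR * (norm (hv x - mean XH (par x)))\<^sup>2 + 2 * norm (hv x - mean XH (par x)) * (2 * L * nA * norm (fv x) + 2 * nZ * norm (hv x)))) + C * (tk k)\<^sup>2"
    by (rule filter_drift_le[OF blip_XH, where B = M]) (use M(2) mean_drifts(4) in \<open>auto simp: nxt_def\<close>)
  then obtain C7 where C7: "\<And>k x. Inv k x \<Longrightarrow> Estep k x (fterm XH hv (Suc k)) \<le> fterm XH hv k x
     + tk k * (be * (- 2 * nR * (nH x)\<^sup>2 + 2 * nH x * (2 * L * nA * norm (fv x) + 2 * nZ * norm (hv x)))) + C7 * (tk k)\<^sup>2"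
    unfolding nH_def by blast
  define C where "C = \<bar>C1\<bar> + wm * \<bar>C2\<bar> + 64 * \<bar>C3\<bar> + \<gamma> * \<bar>C4\<bar> + \<bar>C5\<bar> + 1 / cJ * \<bar>C6\<bar> + wm * \<bar>C7\<bar>"
  show ?thesis
  proof (rule exI[of _ C], intro allI impI)
    fix k x assume I: "Inv k x"
    define t s where "t = tk k" and "s = t\<^sup>2 + t * ee k"
    have t: "0 < t" unfolding t_def by (rule tk_pos)
    have s: "t\<^sup>2 \<le> s" "0 \<le> s" unfolding s_def using t ee_nonneg[of k] by auto
    have Cs: "c * t\<^sup>2 \<le> \<bar>c\<bar> * s" "c * s \<le> \<bar>c\<bar> * s" for c
      using s mult_mono[of c "\<bar>c\<bar>" "t\<^sup>2" s] mult_mono[of c "\<bar>c\<bar>" s s] by auto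
    obtain w where w: "\<gamma> / 25 \<le> w" "w \<le> \<gamma> / 24" and pd: "\<And>a s'. pot (Suc k) (nxt k x a s') \<le> pot k x + tk k * (- be * w * (fv x \<bullet> gradx x)
     + (- 2 * be * \<gamma> * (eV x)\<^sup>2 + 2 * be * eV x * ej x + 2 * be * eV x * nG x + 2 * LV * eV x * (al * norm (fv x) + xi * norm (hv x)))
     + be * (nG x + sqrt 2 * eV x + ej x) * (aa * (ej x + LV * em x) + bb * (nG x + aa * nQ x))) + C1 * ((tk k)\<^sup>2 + tk k * ee k)"
      using C1[OF I] by blast
    define P q where "P = aa * (ej x + LV * em x) + bb * (nG x + aa * nQ x)" and "q = sqrt 2"
    define f h where "f = norm (fv x)" and "h = norm (hv x)"
    define D1 where "D1 = - w * (fv x \<bullet> gradx x) + (- 2 * \<gamma> * (eV x)\<^sup>2 + 2 * eV x * ej x + 2 * eV x * nG x + 2 * LV * eV x * (nA * f + nZ * h))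
      + (nG x + q * eV x + ej x) * P"
    define D2 where "D2 = - 2 * nZ * (1 - \<delta>) * (em x)\<^sup>2 + 2 * nZ * em x * nH x + 2 * L * nA * em x * f"
    define D3 where "D3 = - 2 * cJ * (ej x)\<^sup>2 + 2 * ej x * nQ x + 2 * LV * ej x * (nA * f + nZ * h)"
    define D4 where "D4 = - 2 * nR * (nF x)\<^sup>2 + 2 * nF x * (3 * LF * (nA * f + nZ * h) + 2 * (nG x + q * eV x + ej x))"
    define D5 where "D5 = - 2 * nR * (nG x)\<^sup>2 + 2 * nG x * (LG * (nA * f + nZ * h) + (nQ x + cJ * ej x) + q * (nG x + q * eV x + ej x))"
    define D6 where "D6 = - 2 * nR * (nQ x)\<^sup>2 + 2 * nQ x * (cJ * (LV * (nA * f + nZ * h) + (nQ x + cJ * ej x)))"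
    define D7 where "D7 = - 2 * nR * (nH x)\<^sup>2 + 2 * nH x * (2 * L * nA * f + 2 * nZ * h)"
    have form: "D1 + wm * D2 + 64 * D3 + \<gamma> * D4 + D5 + 1 / cJ * D6 + wm * D7 \<le> - \<gamma> / 50 * ((norm (gradx x))\<^sup>2 + (em x)\<^sup>2 + (eV x)\<^sup>2 + (ej x)\<^sup>2)"
      unfolding D1_def D2_def D3_def D4_def D5_def D6_def D7_def P_def q_def
    proof (rule drift_form[where e = "norm (fv x - gradx x)"])
      show "h \<le> nH x + 2 * em x" unfolding h_def by (rule hv_le[OF I])
      \<comment> \<open>Polarization produces both negative squares: that of the gradient is the
        metric of the theorem, and that of \<open>fv\<close> pays for the motion of the targets
        caused by the actor.\<close>
      have "(norm (fv x - gradx x))\<^sup>2 = f\<^sup>2 - 2 * (fv x \<bullet> gradx x) + (norm (gradx x))\<^sup>2"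
        unfolding f_def power2_norm_eq_inner by (simp add: inner_diff_left inner_diff_right inner_commute)
      then show "- (fv x \<bullet> gradx x) \<le> - (norm (gradx x))\<^sup>2 / 2 - f\<^sup>2 / 2 + (norm (fv x - gradx x))\<^sup>2 / 2" by linarith
      show "norm (fv x - gradx x) \<le> nF x + 2 * eV x + LV * em x" by (rule actor_error[OF I])
    qed (use w nonneg in \<open>auto simp: f_def h_def\<close>)
    have e1: "Estep k x (pot (Suc k)) \<le> pot k x + t * (be * D1) + \<bar>C1\<bar> * s"
    proof (rule Estep_le)
      fix a s'
      have "- be * w * (fv x \<bullet> gradx x)
     + (- 2 * be * \<gamma> * (eV x)\<^sup>2 + 2 * be * eV x * ej x + 2 * be * eV x * nG x + 2 * LV * eV x * ((be * nA) * f + (be * nZ) * h))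
     + be * (nG x + q * eV x + ej x) * P = be * D1" unfolding D1_def by algebra
      then have "- be * w * (fv x \<bullet> gradx x)
     + (- 2 * be * \<gamma> * (eV x)\<^sup>2 + 2 * be * eV x * ej x + 2 * be * eV x * nG x + 2 * LV * eV x * (al * f + xi * h))
     + be * (nG x + q * eV x + ej x) * P = be * D1" by (simp only: step_ratios(4,5))
      with pd[of a s'] have "pot (Suc k) (nxt k x a s') \<le> pot k x + t * (be * D1) + C1 * s"
        unfolding P_def[symmetric] q_def[symmetric] f_def[symmetric] h_def[symmetric] t_def[symmetric] s_def[symmetric] by (simp only:)
      then show "pot (Suc k) (nxt k x a s') \<le> pot k x + t * (be * D1) + \<bar>C1\<bar> * s" using Cs(2)[of C1] by linarith
    qed
    have e2: "Estep k x (\<lambda>y. (em y)\<^sup>2) \<le> (em x)\<^sup>2 + t * (be * D2) + \<bar>C2\<bar> * s"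
    proof (rule Estep_le)
      fix a s'
      have "- 2 * (be * nZ) * (1 - \<delta>) * (em x)\<^sup>2 + 2 * (be * nZ) * em x * nH x + 2 * L * (be * nA) * em x * f = be * D2"
        unfolding D2_def by algebra
      then have "- 2 * xi * (1 - \<delta>) * (em x)\<^sup>2 + 2 * xi * em x * nH x + 2 * L * al * em x * f = be * D2" by (simp only: step_ratios(4,5))
      with C2[OF I, of a s'] have "(em (nxt k x a s'))\<^sup>2 \<le> (em x)\<^sup>2 + t * (be * D2) + C2 * t\<^sup>2"
        unfolding f_def[symmetric] t_def[symmetric] by (simp only:)
      then show "(em (nxt k x a s'))\<^sup>2 \<le> (em x)\<^sup>2 + t * (be * D2) + \<bar>C2\<bar> * s" using Cs(1)[of C2] by linarith
    qed
    have e3: "Estep k x (\<lambda>y. (ej y)\<^sup>2) \<le> (ej x)\<^sup>2 + t * (be * D3) + \<bar>C3\<bar> * s"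
    proof (rule Estep_le)
      fix a s'
      have "- 2 * be * cJ * (ej x)\<^sup>2 + 2 * be * ej x * nQ x + 2 * LV * ej x * ((be * nA) * f + (be * nZ) * h) = be * D3"
        unfolding D3_def by algebra
      then have "- 2 * be * cJ * (ej x)\<^sup>2 + 2 * be * ej x * nQ x + 2 * LV * ej x * (al * f + xi * h) = be * D3" by (simp only: step_ratios(4,5))
      with C3[OF I, of a s'] have "(ej (nxt k x a s'))\<^sup>2 \<le> (ej x)\<^sup>2 + t * (be * D3) + C3 * t\<^sup>2"
        unfolding f_def[symmetric] h_def[symmetric] t_def[symmetric] by (simp only:)
      then show "(ej (nxt k x a s'))\<^sup>2 \<le> (ej x)\<^sup>2 + t * (be * D3) + \<bar>C3\<bar> * s" using Cs(1)[of C3] by linarith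
    qed
    have e4: "Estep k x (fterm XF fv (Suc k)) \<le> fterm XF fv k x + t * (be * D4) + \<bar>C4\<bar> * s"
      using C4[OF I, folded f_def h_def q_def t_def, folded D4_def] Cs(1)[of C4] by linarith
    have e5: "Estep k x (fterm XV gV (Suc k)) \<le> fterm XV gV k x + t * (be * D5) + \<bar>C5\<bar> * s"
      using C5[OF I, folded f_def h_def q_def t_def, folded D5_def] Cs(1)[of C5] by linarith
    have e6: "Estep k x (fterm XJ gJ (Suc k)) \<le> fterm XJ gJ k x + t * (be * D6) + \<bar>C6\<bar> * s"
      using C6[OF I, folded f_def h_def t_def, folded D6_def] Cs(1)[of C6] by linarith
    have e7: "Estep k x (fterm XH hv (Suc k)) \<le> fterm XH hv k x + t * (be * D7) + \<bar>C7\<bar> * s"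
      using C7[OF I, folded f_def h_def t_def, folded D7_def] Cs(1)[of C7] by linarith
    have sc: "c * E \<le> c * (p + t * (be * D) + K * s)" if "E \<le> p + t * (be * D) + K * s" "0 \<le> c" for c E p D K
      using that by (rule mult_left_mono)
    have wm0: "0 \<le> wm" using step_ratios(14) by simp
    have cJ0: "0 \<le> 1 / cJ" and g0: "0 \<le> \<gamma>" using cJ gam by auto
    have "Estep k x (lyap (Suc k)) = Estep k x (pot (Suc k)) + wm * Estep k x (\<lambda>y. (em y)\<^sup>2) + 64 * Estep k x (\<lambda>y. (ej y)\<^sup>2)
      + \<gamma> * Estep k x (fterm XF fv (Suc k)) + Estep k x (fterm XV gV (Suc k)) + 1 / cJ * Estep k x (fterm XJ gJ (Suc k)) + wm * Estep k x (fterm XH hv (Suc k))"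
      unfolding lyap_def Estep_add Estep_cmult ..
    also have "\<dots> \<le> (pot k x + t * (be * D1) + \<bar>C1\<bar> * s) + wm * ((em x)\<^sup>2 + t * (be * D2) + \<bar>C2\<bar> * s) + 64 * ((ej x)\<^sup>2 + t * (be * D3) + \<bar>C3\<bar> * s)
      + \<gamma> * (fterm XF fv k x + t * (be * D4) + \<bar>C4\<bar> * s) + (fterm XV gV k x + t * (be * D5) + \<bar>C5\<bar> * s)
      + 1 / cJ * (fterm XJ gJ k x + t * (be * D6) + \<bar>C6\<bar> * s) + wm * (fterm XH hv k x + t * (be * D7) + \<bar>C7\<bar> * s)"
      by (intro add_mono e1 e5 sc[OF e2 wm0] sc[OF e3] sc[OF e4 g0] sc[OF e6 cJ0] sc[OF e7 wm0]) simp
    also have "\<dots> = lyap k x + t * be * (D1 + wm * D2 + 64 * D3 + \<gamma> * D4 + D5 + 1 / cJ * D6 + wm * D7) + C * s"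
      unfolding lyap_def C_def by algebra
    also have "\<dots> \<le> lyap k x + t * be * (- \<gamma> / 50 * ((norm (gradx x))\<^sup>2 + (em x)\<^sup>2 + (eV x)\<^sup>2 + (ej x)\<^sup>2)) + C * s"
      using form t pos' by (intro add_right_mono add_left_mono mult_left_mono) auto
    also have "\<dots> = lyap k x - be * \<gamma> / 50 * (t * eps x) + C * s" unfolding eps_def by simp
    finally show "Estep k x (lyap (Suc k)) \<le> lyap k x - be * \<gamma> / 50 * (tk k * eps x) + C * ((tk k)\<^sup>2 + tk k * ee k)"
      unfolding s_def t_def .
  qed
qed

text \<open>All filters start at zero, so after one step they are \<open>lam\<close> times a single
  sample, which is controlled by the sizes of V0 and J0. These sizes make up
  \<open>E1\<close>.\<close>

lemma Inv_one:
  assumes x0: "fv x0 = 0" "gV x0 = 0" "gJ x0 = 0" "hv x0 = 0" "muh x0 \<in> prob_simplex"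
    and E1': "2 * (2 * (1 + 2 * norm (Vh x0)) + (1 + \<bar>Jh x0\<bar> + 2 * norm (Vh x0)) + cJ * (1 + \<bar>Jh x0\<bar>)) \<le> E1"
    and x: "x \<in> set_pmf (adist x0 1)"
  shows "Inv 1 x"
proof -
  have "x \<in> set_pmf (astep 0 x0)" using x by (simp add: bind_return_pmf)
  with set_astep[of 0 x0] obtain a s' where x: "x = nxt 0 x0 a s'" by auto
  have t0: "tk 0 = 1" by (simp add: tk_def)
  define v J rr where "v = norm (Vh x0)" and "J = Jh x0" and "rr = r (st x0) a (muh x0)"
  have r: "0 \<le> rr" "rr \<le> 1" unfolding rr_def using rew[OF x0(5)] by auto
  have V: "\<bar>Vh x0 $ i\<bar> \<le> v" for i unfolding v_def by (rule component_le_norm_cart)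
  have l: "0 \<le> lam" "lam \<le> 1" using pos pos' by auto
  have v0: "0 \<le> v" unfolding v_def by simp
  have le: "lam * y \<le> y'" if "y \<le> y'" "0 \<le> y'" for y y'
    using mult_mono[of lam 1 y' y'] mult_left_mono[OF that(1) l(1)] l that by linarith
  have f: "norm (fv x) \<le> (1 + 2 * v) * 2"
  proof -
    have "norm (XF (par x0) (st x0) a s') = \<bar>rr + Vh x0 $ s' - Vh x0 $ st x0\<bar> * norm (score (th x0) (st x0) a)"
      unfolding XF_def par_simps rr_def by simp
    also have "\<dots> \<le> (1 + 2 * v) * sqrt 2"
      using V[of s'] V[of "st x0"] r v0 by (intro mult_mono norm_score) auto
    also have "\<dots> \<le> (1 + 2 * v) * 2" using v0 by (intro mult_left_mono) (auto simp: real_le_lsqrt)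
    finally have "lam * norm (XF (par x0) (st x0) a s') \<le> (1 + 2 * v) * 2" using v0 by (intro le) auto
    then show ?thesis using l unfolding x nxt_def t0 by (simp add: x0)
  qed
  have g: "norm (gV x) \<le> 1 + \<bar>J\<bar> + 2 * v"
  proof -
    have "norm (XV (par x0) (st x0) a s') = \<bar>rr - J + Vh x0 $ s' - Vh x0 $ st x0\<bar>"
      unfolding XV_def par_simps rr_def J_def by simp
    also have "\<dots> \<le> 1 + \<bar>J\<bar> + 2 * v" using V[of s'] V[of "st x0"] r v0 by linarith
    finally have "lam * norm (XV (par x0) (st x0) a s') \<le> 1 + \<bar>J\<bar> + 2 * v" using v0 by (intro le) auto
    then show ?thesis using l unfolding x nxt_def t0 by (simp add: x0)
  qed
  have c: "0 \<le> cJ * (1 + \<bar>J\<bar>)" using cJ by simp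
  have gJ: "\<bar>gJ x\<bar> \<le> cJ * (1 + \<bar>J\<bar>)"
  proof -
    have "\<bar>XJ (par x0) (st x0) a s'\<bar> = cJ * \<bar>rr - J\<bar>" unfolding XJ_def par_simps rr_def J_def using cJ by (simp add: abs_mult)
    also have "\<dots> \<le> cJ * (1 + \<bar>J\<bar>)" using r cJ by (intro mult_left_mono) auto
    finally have "lam * \<bar>XJ (par x0) (st x0) a s'\<bar> \<le> cJ * (1 + \<bar>J\<bar>)" using c by (intro le) auto
    then show ?thesis using l unfolding x nxt_def t0 by (simp add: x0 abs_mult)
  qed
  have h: "norm (hv x) \<le> 2"
  proof -
    have "norm (XH (par x0) (st x0) a s') \<le> 2"
      unfolding XH_def par_simps
      using norm_triangle_ineq4[of "axis (st x0) 1" "muh x0"] simplex_norm[OF axis_in_simplex, of "st x0"] simplex_norm[OF x0(5)] by linarith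
    then have "lam * norm (XH (par x0) (st x0) a s') \<le> 2" by (intro le) auto
    then show ?thesis using l unfolding x nxt_def t0 by (simp add: x0)
  qed
  have "2 * (2 * (1 + 2 * v) + (1 + \<bar>J\<bar> + 2 * v) + cJ * (1 + \<bar>J\<bar>)) \<le> E1" using E1' unfolding v_def J_def .
  then have E: "2 * (2 * (1 + 2 * v)) + 2 * (1 + \<bar>J\<bar> + 2 * v) + 2 * (cJ * (1 + \<bar>J\<bar>)) \<le> E1" by (simp only: distrib_left add.assoc)
  have "lam * E1 \<le> 1 * E1" using l E1 by (intro mult_right_mono) auto
  \<comment> \<open>\<open>ee 1\<close> is already damped once, by a factor at least 1/2; the outer
    factor 2 in the bound on \<open>E1\<close> makes up for it.\<close>
  then have "E1 \<le> 2 * ee 1" unfolding One_nat_def by (simp add: t0 algebra_simps)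
  then have e1: "(1 + 2 * v) * 2 \<le> E1" "1 + \<bar>J\<bar> + 2 * v \<le> ee 1" "cJ * (1 + \<bar>J\<bar>) \<le> ee 1"
  proof -
    have "(1 + 2 * v) * 2 \<le> E' \<and> g \<le> e \<and> q \<le> e" if "E' \<le> 2 * e" "2 * (2 * (1 + 2 * v)) + 2 * g + 2 * q \<le> E'" "0 \<le> g" "0 \<le> q" for g q e E'
      using that v0 by simp
    from this[OF _ E _ c, of "ee 1"] \<open>E1 \<le> 2 * ee 1\<close> v0
    show "(1 + 2 * v) * 2 \<le> E1" "1 + \<bar>J\<bar> + 2 * v \<le> ee 1" "cJ * (1 + \<bar>J\<bar>) \<le> ee 1" by simp_all
  qed
  have p: "par x \<in> params" unfolding x by (rule par_nxt_params)
  have Jx: "0 \<le> cJ * Jh x" "0 \<le> cJ * (1 - Jh x)" using paramsD(2,3)[OF p] cJ by (auto simp: par_simps)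
  have B: "0 \<le> sqrt 2 * BV" "0 \<le> (1 + sqrt 2 * BV) * sqrt 2" using BV by auto
  show ?thesis unfolding Inv_def
  proof (intro conjI)
    show "norm (fv x) \<le> (1 + sqrt 2 * BV) * sqrt 2 + E1" using order_trans[OF f e1(1)] B(2) by linarith
    show "norm (gV x) \<le> 1 + sqrt 2 * BV + ee 1" using g e1(2) B(1) by linarith
    show "gJ x \<le> 2 * cJ * (1 - Jh x) + ee 1" "- gJ x \<le> 2 * cJ * Jh x + ee 1"
      using gJ e1(3) Jx unfolding mult.assoc by linarith+
  qed (fact p h)+
qed

lemma expectation_mono:
  assumes "finite (set_pmf p)" "\<And>x. x \<in> set_pmf p \<Longrightarrow> f x \<le> g x"
  shows "measure_pmf.expectation p f \<le> measure_pmf.expectation p (g :: _ \<Rightarrow> real)"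
  using assms by (intro integral_mono_AE integrable_measure_pmf_finite) (auto simp: AE_measure_pmf_iff)

lemma lyapunov_rate:
  assumes "fv x0 = 0" "gV x0 = 0" "gJ x0 = 0" "hv x0 = 0" "muh x0 \<in> prob_simplex"
    and "2 * (2 * (1 + 2 * norm (Vh x0)) + (1 + \<bar>Jh x0\<bar> + 2 * norm (Vh x0)) + cJ * (1 + \<bar>Jh x0\<bar>)) \<le> E1"
  shows "\<exists>C>0. \<forall>k>0. Min ((\<lambda>t. measure_pmf.expectation (adist x0 t) eps) ` {..<k}) \<le> C * ((ln (real k + 1)) ^ 3 / sqrt (real k + 1))"
proof -
  obtain C where C: "\<And>k x. Inv k x \<Longrightarrow> Estep k x (lyap (Suc k)) \<le> lyap k x - be * \<gamma> / 50 * (tk k * eps x) + C * ((tk k)\<^sup>2 + tk k * ee k)"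
    using lyap_drift by blast
  obtain B where B: "\<And>k x. Inv k x \<Longrightarrow> \<bar>lyap k x\<bar> \<le> B" using lyap_bounded by blast
  define Ex :: "nat \<Rightarrow> (('s, 'a) alg_state \<Rightarrow> real) \<Rightarrow> real" where "Ex k = measure_pmf.expectation (adist x0 k)" for k
  have I: "Inv k x" if "1 \<le> k" "x \<in> set_pmf (adist x0 k)" for k x
    by (rule adist_invariant[where P = Inv, OF Inv_one[OF assms] Inv_nxt that])
  have mono: "Ex k f \<le> Ex k g" if "\<And>x. x \<in> set_pmf (adist x0 k) \<Longrightarrow> f x \<le> g x" for k f g
    unfolding Ex_def using finite_adist that by (rule expectation_mono)
  have int: "integrable (measure_pmf (adist x0 k)) f" for k and f :: "('s, 'a) alg_state \<Rightarrow> real"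
    by (rule integrable_measure_pmf_finite[OF finite_adist])
  have Ex_c: "Ex k (\<lambda>x. c) = c" for k c unfolding Ex_def by simp
  define s where "s k = (tk k)\<^sup>2 + tk k * ee k" for k
  have s0: "0 \<le> s k" for k unfolding s_def using tk_pos[of k] ee_nonneg[of k] by auto
  \<comment> \<open>The squares give a harmonic sum. The transient part telescopes by
    \<open>ee_sum\<close>, so arbitrary initial data cost only a bounded amount.\<close>
  have ss: "(\<Sum>k<n. s k) \<le> (1 + 2 / lam * E1) * (1 + ln (real n + 1))" for n
  proof -
    have "lam / 2 * (\<Sum>i<n. tk i * ee i) \<le> E1" unfolding ee_sum using ee_nonneg[of n] by simp
    then have "(\<Sum>i<n. tk i * ee i) \<le> 2 / lam * E1" using pos' by (simp add: field_simps)
    also have "\<dots> \<le> 2 / lam * E1 * (1 + ln (real n + 1))"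
      using pos' E1 mult_left_mono[of 1 "1 + ln (real n + 1)" "2 / lam * E1"] by simp
    finally show ?thesis unfolding s_def sum.distrib tk_sq distrib_right[of 1] mult_1 by (rule add_mono[OF harmonic_le_ln])
  qed
  have "\<exists>D\<ge>0. \<forall>n. (\<Sum>k=1..<n. tk k * Ex k eps) \<le> D * (1 + ln (real n + 1))"
  proof (rule descent_sum[where a = "\<lambda>k. Ex k (lyap k)" and s = s and c = "be * \<gamma> / 50" and C = C and B = B and S = "1 + 2 / lam * E1"])
    show "0 < be * \<gamma> / 50" using pos' gam by simp
    fix k :: nat assume k: "1 \<le> k"
    have "Ex (Suc k) (lyap (Suc k)) = Ex k (\<lambda>x. Estep k x (lyap (Suc k)))" unfolding Ex_def by (rule expectation_adist_Suc)
    also have "\<dots> \<le> Ex k (\<lambda>x. lyap k x - be * \<gamma> / 50 * (tk k * eps x) + C * s k)"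
      unfolding s_def by (rule mono) (rule C[OF I[OF k]])
    also have "\<dots> = Ex k (lyap k) - be * \<gamma> / 50 * (tk k * Ex k eps) + C * s k"
      unfolding Ex_def by (subst Bochner_Integration.integral_add[OF int int], subst Bochner_Integration.integral_diff[OF int int]) simp
    finally show "Ex (Suc k) (lyap (Suc k)) \<le> Ex k (lyap k) - be * \<gamma> / 50 * (tk k * Ex k eps) + C * s k" .
    have "Ex k (lyap k) \<le> Ex k (\<lambda>x. B)" "Ex k (\<lambda>x. - B) \<le> Ex k (lyap k)"
      by (rule mono, use B[OF I[OF k]] in \<open>force simp: abs_le_iff\<close>)+
    then show "\<bar>Ex k (lyap k)\<bar> \<le> B" unfolding Ex_c by simp
  qed (rule s0 ss)+
  moreover have "0 \<le> Ex k eps" for k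
    using mono[of k "\<lambda>_. 0" eps] unfolding Ex_c by (simp add: eps_def)
  ultimately show ?thesis using min_rate[of "\<lambda>k. Ex k eps"] unfolding Ex_def by blast
qed

end

section \<open>The convergence theorem\<close>

lemma (in mfg) convergence_rate:
  assumes "0 < al" "al \<le> xi" "xi \<le> be" "be \<le> lam" "lam \<le> 1/4"
    "16 * L * LF * LV * al \<le> (1 - \<delta>) * xi" "32 * \<rho> * LF\<^sup>2 * al \<le> (1 - \<delta>) * xi"
    "6912 * (LF^4 * LV\<^sup>2) * xi \<le> (1 - \<delta>) * \<gamma> * be"
    "6912 * (LF\<^sup>2 * LG\<^sup>2 * (L + 1)\<^sup>2 * LV\<^sup>2) * xi \<le> (1 - \<delta>) * \<gamma> * be"
    "(72 * LG\<^sup>2 + 36 * LF\<^sup>2 + 8 / \<gamma>) * be \<le> lam"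
    and x0: "fv x0 = 0" "gV x0 = 0" "gJ x0 = 0" "hv x0 = 0" "muh x0 \<in> prob_simplex"
  shows "\<exists>C>0. \<forall>k>0. Min ((\<lambda>t. measure_pmf.expectation (alg_dist K r cJ BV (\<lambda>k. al / sqrt (real k + 1)) (\<lambda>k. be / sqrt (real k + 1))
      (\<lambda>k. xi / sqrt (real k + 1)) (\<lambda>k. lam / sqrt (real k + 1)) x0 t)
      (\<lambda>x. eps_pi K r x + eps_mu K x + eps_V K r x + eps_J K r x)) ` {..<k}) \<le> C * ((ln (real k + 1)) ^ 3 / sqrt (real k + 1))"
proof -
  define E1 where "E1 = 2 * (2 * (1 + 2 * norm (Vh x0)) + (1 + \<bar>Jh x0\<bar> + 2 * norm (Vh x0)) + cJ * (1 + \<bar>Jh x0\<bar>))"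
  interpret mfg_alg K C0 C1 r \<delta> L BV LV LTV \<gamma> \<rho> cJ al be xi lam E1
    by unfold_locales (use assms(1-10) cJ in \<open>auto simp: E1_def\<close>)
  show ?thesis unfolding eps_eq by (rule lyapunov_rate[OF x0]) (simp add: E1_def)
qed

lemma gradf_const: "gradf (\<lambda>_. c) x = 0"
  by (rule gradf_eq) (simp add: gderiv_def)

lemma simplex_singleton:
  assumes "\<And>i j :: 'n::finite. i = j" "p \<in> prob_simplex" shows "p = (\<chi> i::'n. 1)"
proof -
  have "p $ i = 1" for i
  proof -
    have U: "(UNIV :: 'n set) = {i}" using assms(1) by auto
    have "(\<Sum>j\<in>UNIV. p $ j) = p $ i" unfolding U by simp
    then show ?thesis using assms(2) unfolding prob_simplex_def by simp
  qed
  then show ?thesis by (simp add: vec_eq_iff)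
qed

lemma projperp_singleton:
  assumes "\<And>i j :: 'n::finite. i = j" shows "projperp (V :: real^'n) = 0"
proof -
  have "projperp V $ i = 0" for i
  proof -
    have U: "(UNIV :: 'n set) = {i}" using assms by auto
    have "(\<Sum>j\<in>UNIV. V $ j) = V $ i" unfolding U by simp
    moreover have "CARD('n) = 1" unfolding U by simp
    ultimately show ?thesis unfolding projperp_def by simp
  qed
  then show ?thesis by (simp add: vec_eq_iff)
qed

text \<open>With one state and one action the simplexes are points: the policy, mean-field and value
  metrics vanish, the reward is a constant \<open>rr\<close>, and no randomness reaches
  \<open>Jh\<close> and \<open>gJ\<close>. They follow the recursion \<open>jg\<close>, which is a
  damped oscillator.\<close>

lemma singleton_rate:
  fixes K :: "real^'s::finite \<Rightarrow> 's \<Rightarrow> 'a::finite \<Rightarrow> 's pmf"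
  assumes one: "\<And>i j :: 's. i = j" "\<And>i j :: 'a. i = j"
    and rew: "\<And>s a \<mu>. \<mu> \<in> prob_simplex \<Longrightarrow> 0 \<le> r s a \<mu> \<and> r s a \<mu> \<le> 1"
    and mustar_unique: "\<And>\<pi>. \<pi> \<in> mfg_policies \<Longrightarrow> \<exists>!\<mu>. \<mu> \<in> prob_simplex \<and> \<mu> = stat_dist K \<pi> \<mu>"
    and pos: "0 < be" "0 < lam" "lam \<le> 1" "0 < cJ" and init: "gJ x0 = 0" "muh x0 \<in> prob_simplex"
  shows "\<exists>C>0. \<forall>k>0. Min ((\<lambda>t. measure_pmf.expectation (alg_dist K r cJ BV \<alpha> (\<lambda>k. be / sqrt (real k + 1))
      \<xi> (\<lambda>k. lam / sqrt (real k + 1)) x0 t)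
      (\<lambda>x. eps_pi K r x + eps_mu K x + eps_V K r x + eps_J K r x)) ` {..<k}) \<le> C * ((ln (real k + 1)) ^ 3 / sqrt (real k + 1))"
proof -
  define dist where "dist = alg_dist K r cJ BV \<alpha> (\<lambda>k. be / sqrt (real k + 1)) \<xi> (\<lambda>k. lam / sqrt (real k + 1)) x0"
  note simplex1 = simplex_singleton[OF one(1)] and policy1 = simplex_singleton[OF one(2)]
  define m :: "real^'s" where "m = (\<chi> i. 1)"
  define s0 a0 where "s0 = st x0" and "a0 = (undefined :: 'a)"
  define rr where "rr = r s0 a0 m"
  have mS: "m \<in> prob_simplex" using init(2) simplex1[of "muh x0"] unfolding m_def by simp
  have r_eq: "r s a \<mu> = rr" if "\<mu> \<in> prob_simplex" for s a \<mu>
    using that simplex1[of \<mu>] one(1)[of s s0] one(2)[of a a0] unfolding rr_def m_def by simp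
  have rr: "0 \<le> rr" "rr \<le> 1" unfolding rr_def using rew[OF mS] by auto
  define jg where "jg = rec_nat (Jh x0, 0) (\<lambda>k p. (max 0 (min 1 (fst p + be * tk k * snd p)),
    (1 - lam * tk k) * snd p + lam * tk k * (cJ * (rr - fst p))))"
  have inv: "x \<in> set_pmf (dist k) \<Longrightarrow> Jh x = fst (jg k) \<and> gJ x = snd (jg k) \<and> muh x \<in> prob_simplex" for x k
  proof (induction k arbitrary: x)
    case 0 then show ?case using init by (simp add: dist_def jg_def)
  next
    case (Suc k)
    then obtain y where y: "y \<in> set_pmf (dist k)" and
      x: "x \<in> set_pmf (alg_step K r cJ BV \<alpha> (\<lambda>k. be / sqrt (real k + 1)) \<xi> (\<lambda>k. lam / sqrt (real k + 1)) k y)"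
      unfolding dist_def by (auto simp: set_bind_pmf)
    note IH = Suc.IH[OF y]
    have "Jh x = closest_point {0..1} (Jh y + be * tk k * gJ y)"
      "gJ x = (1 - lam * tk k) * gJ y + lam * tk k * cJ * (rr - Jh y)"
      "muh x = closest_point prob_simplex (muh y + \<xi> k *\<^sub>R hv y)"
      using x r_eq[of "muh y"] IH unfolding alg_step_def Let_def tk_def by (auto simp: set_bind_pmf)
    moreover have "closest_point prob_simplex v \<in> (prob_simplex :: (real^'s) set)" for v
      by (rule closest_point_in_set) (auto simp: closed_simplex simplex_nonempty)
    ultimately show ?case using IH by (simp add: jg_def closest_point_interval)
  qed
  have eps: "eps_pi K r x + eps_mu K x + eps_V K r x + eps_J K r x = (fst (jg k) - rr)\<^sup>2" if "x \<in> set_pmf (dist k)" for x k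
  proof -
    note x = inv[OF that]
    have pol: "\<pi> = \<pi>'" if "\<pi> \<in> mfg_policies" "\<pi>' \<in> mfg_policies" for \<pi> \<pi>' :: "real^'a^'s"
      using that policy1 unfolding mfg_policies_def vec_eq_iff by (metis mem_Collect_eq)
    define \<pi> where "\<pi> = softmax (th x)"
    have \<pi>: "\<pi> \<in> mfg_policies" unfolding \<pi>_def by (rule softmax_policy)
    have sm: "softmax \<theta> = \<pi>" for \<theta> using pol[OF softmax_policy \<pi>] .
    have ms: "mustar K \<pi> \<in> prob_simplex" "mustar K \<pi> = stat_dist K \<pi> (mustar K \<pi>)"
      using theI'[OF mustar_unique[OF \<pi>]] unfolding mustar_def by auto
    have mu: "muh x = m" "mustar K \<pi> = m" using simplex1[of "muh x"] simplex1[OF ms(1)] x unfolding m_def by auto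
    have sd: "stat_dist K \<pi> m = m" using ms(2) unfolding mu by simp
    have "\<pi> $ s0 $ a0 = 1" using \<pi> policy1[of "\<pi> $ s0"] unfolding mfg_policies_def by simp
    moreover have US: "(UNIV :: 's set) = {s0}" and UA: "(UNIV :: 'a set) = {a0}" using one by auto
    moreover have "Jf K r \<pi> m = \<pi> $ s0 $ a0 * rr" unfolding Jf_def sd r_eq[OF mS] US UA by (simp add: m_def)
    ultimately have "Jf K r \<pi> m = rr" by simp
    then show ?thesis
      unfolding eps_pi_def eps_mu_def eps_V_def eps_J_def sm mu gradf_const projperp_singleton[OF one(1)] using x by simp
  qed
  have "measure_pmf.expectation (dist k) (\<lambda>x. eps_pi K r x + eps_mu K x + eps_V K r x + eps_J K r x) = (fst (jg k) - rr)\<^sup>2" for k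
  proof -
    have "measure_pmf.expectation (dist k) (\<lambda>x. eps_pi K r x + eps_mu K x + eps_V K r x + eps_J K r x)
      = measure_pmf.expectation (dist k) (\<lambda>x. (fst (jg k) - rr)\<^sup>2)"
      by (rule Bochner_Integration.integral_cong_AE) (auto simp: AE_measure_pmf_iff eps)
    then show ?thesis by simp
  qed
  moreover have "\<exists>D\<ge>0. \<forall>n. (\<Sum>k=1..<n. tk k * (fst (jg k) - rr)\<^sup>2) \<le> D * (1 + ln (real n + 1))"
    by (rule damped_oscillator[OF pos rr, where g = "\<lambda>k. snd (jg k)"]) (simp_all add: jg_def)
  ultimately show ?thesis unfolding dist_def[symmetric] using min_rate[of "\<lambda>k. (fst (jg k) - rr)\<^sup>2"] by auto
qed

theorem theorem1:
  fixes K :: "real^'s::finite \<Rightarrow> 's \<Rightarrow> 'a::finite \<Rightarrow> 's pmf"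
    and r :: "'s \<Rightarrow> 'a \<Rightarrow> real^'s \<Rightarrow> real"
    and C0 C1 \<delta> L BV \<rho> \<kappa> LV LTV \<gamma> cJ lam0 al0 be0 xi0 :: real
    and \<theta>0 :: "real^'a^'s" and V0 :: "real^'s" and J0 :: real and \<mu>0 :: "real^'s" and s0 :: 's
  defines "card_S \<equiv> real CARD('s)"
  defines "BF \<equiv> BV + 1"
  defines "BG \<equiv> 2 * (BV + cJ + 2)"
  defines "BH \<equiv> (2::real)"
  defines "LF \<equiv> 10 * BV + L + 2 * BF * LTV + 5"
  defines "LG \<equiv> 2 * BG * LTV + (L + 1) * (cJ + 1) + 2"
  defines "LH \<equiv> L + 1"
  defines "C_xi \<equiv> min (min ((1 - \<delta>) / (32 * \<rho> * LF\<^sup>2)) ((1 - \<delta>) / (4 * \<rho>)))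
                      (min (LH / (2 * LF * LV)) ((1 - \<delta>) / (16 * L * LF * LV)))"
  defines "C_beta \<equiv> min (min (\<gamma> / 4) (\<rho> * \<gamma> / (512 * (LF\<^sup>2 + LG\<^sup>2 + LH\<^sup>2 + LV\<^sup>2 + L\<^sup>2 / (1 - \<delta>)))))
                      (min (sqrt (\<gamma> / (3456 * card_S * (LF^4 * LG^4 + LF\<^sup>2 * LH\<^sup>2 + \<rho> * LF\<^sup>2
                                   + LV\<^sup>2 / \<gamma> + L\<^sup>2 * LF\<^sup>2 * (1 - \<delta>)))))
                           (\<gamma> / (2 * \<rho>)))"
  defines "lm \<equiv> (\<lambda>k::nat. lam0 / sqrt (real k + 1))"
  defines "\<alpha> \<equiv> (\<lambda>k::nat. al0 / sqrt (real k + 1))"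
  defines "\<beta> \<equiv> (\<lambda>k::nat. be0 / sqrt (real k + 1))"
  defines "\<xi> \<equiv> (\<lambda>k::nat. xi0 / sqrt (real k + 1))"
  defines "x0 \<equiv> \<lparr> th = \<theta>0, Vh = V0, Jh = J0, muh = \<mu>0, fv = 0, gV = 0, gJ = 0, hv = 0, st = s0 \<rparr>"
  defines "E \<equiv> (\<lambda>t. measure_pmf.expectation (alg_dist K r cJ BV \<alpha> \<beta> \<xi> lm x0 t)
                  (\<lambda>x. eps_pi K r x + eps_mu K x + eps_V K r x + eps_J K r x))"
  \<comment> \<open>reward in [0,1]\<close>
  assumes rew: "\<forall>s a. \<forall>\<mu>\<in>prob_simplex. 0 \<le> r s a \<mu> \<and> r s a \<mu> \<le> 1"
  \<comment> \<open>Assumption 1\<close>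
  assumes A1: "C0 \<ge> 1" "0 < C1" "C1 < 1"
    "\<forall>\<pi>\<in>mfg_policies. \<forall>\<mu>\<in>prob_simplex. irreducible_aperiodic K \<pi> \<mu> \<and>
        (\<forall>s k. dTV (\<lambda>x. kstep K \<pi> \<mu> k s $ x) (\<lambda>x. stat_dist K \<pi> \<mu> $ x) \<le> C0 * C1 ^ k)"
  \<comment> \<open>Assumption 2\<close>
  assumes A2: "0 < \<delta>" "\<delta> < 1"
    "\<forall>\<pi>\<in>mfg_policies. \<forall>\<mu>1\<in>prob_simplex. \<forall>\<mu>2\<in>prob_simplex.
        norm (stat_dist K \<pi> \<mu>1 - stat_dist K \<pi> \<mu>2) \<le> \<delta> * norm (\<mu>1 - \<mu>2)"
  \<comment> \<open>Assumption 3\<close>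
  assumes A3: "L > 0"
    "\<forall>s a. \<forall>\<mu>1\<in>prob_simplex. \<forall>\<mu>2\<in>prob_simplex. \<bar>r s a \<mu>1 - r s a \<mu>2\<bar> \<le> L * norm (\<mu>1 - \<mu>2)"
    "\<forall>d1\<in>prob_simplex. \<forall>d2\<in>prob_simplex. \<forall>\<pi>1\<in>mfg_policies. \<forall>\<pi>2\<in>mfg_policies. \<forall>\<mu>1\<in>prob_simplex. \<forall>\<mu>2\<in>prob_simplex.
        dTV (\<lambda>s'. \<Sum>s\<in>UNIV. d1 $ s * Pmat K \<pi>1 \<mu>1 s s') (\<lambda>s'. \<Sum>s\<in>UNIV. d2 $ s * Pmat K \<pi>2 \<mu>2 s s')
          \<le> dTV (\<lambda>s. d1 $ s) (\<lambda>s. d2 $ s) + L * (norm (\<pi>1 - \<pi>2) + norm (\<mu>1 - \<mu>2))"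
    "\<forall>\<pi>1\<in>mfg_policies. \<forall>\<pi>2\<in>mfg_policies. \<forall>\<mu>1\<in>prob_simplex. \<forall>\<mu>2\<in>prob_simplex.
        dTV (\<lambda>x. stat_dist K \<pi>1 \<mu>1 $ x) (\<lambda>x. stat_dist K \<pi>2 \<mu>2 $ x) \<le> L * (norm (\<pi>1 - \<pi>2) + norm (\<mu>1 - \<mu>2))"
    "\<forall>\<pi>1\<in>mfg_policies. \<forall>\<pi>2\<in>mfg_policies. norm (mustar K \<pi>1 - mustar K \<pi>2) \<le> L * norm (\<pi>1 - \<pi>2)"
    "BV > 0" "\<forall>\<pi>\<in>mfg_policies. \<forall>\<mu>\<in>prob_simplex. norm (Vf K r \<pi> \<mu>) \<le> BV"
  \<comment> \<open>the mean field mu*(pi) is (assumed) unique\<close>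
  assumes mustar_unique: "\<forall>\<pi>\<in>mfg_policies. \<exists>!\<mu>. \<mu> \<in> prob_simplex \<and> \<mu> = stat_dist K \<pi> \<mu>"
  \<comment> \<open>kappa-herding with constant rho\<close>
  assumes herd: "\<kappa> \<ge> 0" "0 < \<rho>"
    "\<forall>\<pi>\<in>mfg_policies. \<forall>\<pi>'\<in>mfg_policies. mfg_ell K r \<pi> - mfg_ell K r \<pi>'
        \<le> \<rho> * (Jf K r \<pi> (mustar K \<pi>) - Jf K r \<pi>' (mustar K \<pi>)) + \<kappa> * norm (\<pi> - \<pi>')"
  \<comment> \<open>constant L_V (the gradients exist)\<close>
  assumes LV: "LV \<ge> 1"
    "\<forall>\<theta>. \<forall>\<mu>\<in>prob_simplex. (\<exists>g. GDERIV (\<lambda>\<theta>'. Jf K r (softmax \<theta>') \<mu>) \<theta> :> g)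
                   \<and> (\<exists>g. GDERIV (\<lambda>\<mu>'. Jf K r (softmax \<theta>) \<mu>') \<mu> :> g)"
    "\<forall>\<theta>1 \<theta>2. \<forall>\<mu>1\<in>prob_simplex. \<forall>\<mu>2\<in>prob_simplex.
        norm (projperp (Vf K r (softmax \<theta>1) \<mu>1 - Vf K r (softmax \<theta>2) \<mu>2))
          \<le> LV * (norm (\<theta>1 - \<theta>2) + norm (\<mu>1 - \<mu>2)) \<and>
        \<bar>Jf K r (softmax \<theta>1) \<mu>1 - Jf K r (softmax \<theta>2) \<mu>2\<bar>
          \<le> LV * (norm (\<theta>1 - \<theta>2) + norm (\<mu>1 - \<mu>2)) \<and>
        norm (gradf (\<lambda>\<theta>. Jf K r (softmax \<theta>) \<mu>1) \<theta>1 - gradf (\<lambda>\<theta>. Jf K r (softmax \<theta>) \<mu>2) \<theta>2)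
          \<le> LV * (norm (\<theta>1 - \<theta>2) + norm (\<mu>1 - \<mu>2)) \<and>
        norm (gradf (\<lambda>\<mu>. Jf K r (softmax \<theta>1) \<mu>) \<mu>1 - gradf (\<lambda>\<mu>. Jf K r (softmax \<theta>2) \<mu>) \<mu>2)
          \<le> LV * (norm (\<theta>1 - \<theta>2) + norm (\<mu>1 - \<mu>2))"
  \<comment> \<open>constant L_TV\<close>
  assumes LTV: "\<forall>\<pi>1\<in>mfg_policies. \<forall>\<pi>2\<in>mfg_policies. \<forall>\<mu>1\<in>prob_simplex. \<forall>\<mu>2\<in>prob_simplex.
        dTV (mfg_joint K \<pi>1 \<mu>1) (mfg_joint K \<pi>2 \<mu>2) \<le> LTV * (norm (\<pi>1 - \<pi>2) + norm (\<mu>1 - \<mu>2))"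
  \<comment> \<open>constant gamma\<close>
  assumes gam: "0 < \<gamma>" "\<gamma> < 1"
    "\<forall>\<theta>. \<forall>\<mu>\<in>prob_simplex. \<forall>V::real^'s. (\<Sum>s\<in>UNIV. V $ s) = 0 \<longrightarrow>
        (\<Sum>s\<in>UNIV. \<Sum>a\<in>UNIV. \<Sum>s'\<in>UNIV. stat_dist K (softmax \<theta>) \<mu> $ s * softmax \<theta> $ s $ a
            * pmf (K \<mu> s a) s' * (V $ s * (V $ s' - V $ s))) \<le> - \<gamma> * (norm V)\<^sup>2"
  \<comment> \<open>step-size conditions\<close>
  assumes step: "cJ > 0" "cJ \<ge> 1 / \<gamma>"
    "0 < al0" "al0 \<le> xi0" "xi0 \<le> be0" "be0 \<le> lam0" "lam0 \<le> 1/4"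
    "al0 \<le> lam0 / (192 * (LF\<^sup>2 + LG\<^sup>2 + LH\<^sup>2 + LV\<^sup>2 + L\<^sup>2 / (1 - \<delta>) + \<rho>))"
    "al0 \<le> C_beta * be0" "al0 \<le> C_xi * xi0"
    "xi0 \<le> lam0 / (64 * (LH\<^sup>2 * LF\<^sup>2 + LG\<^sup>2 + LV\<^sup>2 / \<gamma> + 1 / (1 - \<delta>)))"
    "xi0 \<le> (1 - \<delta>) * \<gamma> * be0 / (6912 * (LF^4 * LV\<^sup>2 + LF\<^sup>2 * LG\<^sup>2 * LH\<^sup>2 * LV\<^sup>2
                                          + LF\<^sup>2 * LH^4 * LV\<^sup>2 + LV\<^sup>2))"
    "be0 \<le> lam0 / (72 * card_S * LG\<^sup>2 + 36 * LF\<^sup>2 + 8 / \<gamma>)"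
    "be0 \<le> \<gamma> / (4 * LG\<^sup>2)" "be0 \<le> (1 - \<delta>) / (2 * LH\<^sup>2)"
  \<comment> \<open>initialization\<close>
  assumes init: "\<mu>0 \<in> prob_simplex"
  shows "\<exists>C>0. \<forall>k::nat. 0 < k \<and> (\<forall>\<pi>\<in>mfg_policies. \<forall>\<mu>\<in>prob_simplex. mix_time K \<pi> \<mu> (\<alpha> k) \<le> k) \<longrightarrow>
           Min (E ` {..<k}) \<le> C * ((ln (real k + 1)) ^ 3 / sqrt (real k + 1) + \<kappa>)"
proof -
  have rate0: "0 \<le> (ln (real k + 1)) ^ 3 / sqrt (real k + 1)" for k by simp
  have finish: ?thesis
    if "\<exists>C>0. \<forall>k>0. Min (E ` {..<k}) \<le> C * ((ln (real k + 1)) ^ 3 / sqrt (real k + 1))"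
  proof -
    from that obtain C where C: "C > 0" "\<And>k. k > 0 \<Longrightarrow> Min (E ` {..<k}) \<le> C * ((ln (real k + 1)) ^ 3 / sqrt (real k + 1))"
      by blast
    have "Min (E ` {..<k}) \<le> C * ((ln (real k + 1)) ^ 3 / sqrt (real k + 1) + \<kappa>)" if "k > 0" for k
    proof -
      have "C * ((ln (real k + 1)) ^ 3 / sqrt (real k + 1)) \<le> C * ((ln (real k + 1)) ^ 3 / sqrt (real k + 1) + \<kappa>)"
        using C(1) herd(1) by (intro mult_left_mono) auto
      with C(2)[OF that] show ?thesis by (rule order_trans)
    qed
    then show ?thesis using C(1) by (intro exI[where x = C]) simp
  qed
  have init': "gJ x0 = 0" "muh x0 \<in> prob_simplex" "fv x0 = 0" "gV x0 = 0" "hv x0 = 0"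
    unfolding x0_def using init by simp_all
  have pos: "0 < be0" "0 < lam0" "0 < xi0" using step by linarith+
  consider "\<kappa> > 0" | "LTV < 0" | "\<kappa> = 0" "0 \<le> LTV" using herd(1) by linarith
  then show ?thesis
  proof cases
    case 1
    define C where "C = (\<bar>E 0\<bar> + 1) / \<kappa>"
    have C: "0 < C" "C * \<kappa> = \<bar>E 0\<bar> + 1" unfolding C_def using 1 by auto
    have "Min (E ` {..<k}) \<le> C * ((ln (real k + 1)) ^ 3 / sqrt (real k + 1) + \<kappa>)" if "k > 0" for k
    proof -
      have "Min (E ` {..<k}) \<le> E 0" using that by (intro Min_le) auto
      also have "\<dots> \<le> C * \<kappa>" unfolding C(2) by simp
      also have "\<dots> \<le> C * ((ln (real k + 1)) ^ 3 / sqrt (real k + 1) + \<kappa>)"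
        using C(1) rate0 by (intro mult_left_mono) auto
      finally show ?thesis .
    qed
    then show ?thesis using C(1) by (intro exI[where x = C]) simp
  next
    case 2
    \<comment> \<open>A total variation distance is nonnegative, so a negative \<open>LTV\<close>
      forces any two policies and any two mean fields to coincide. Point masses then show that there
      is one state and one action.\<close>
    have eq: "\<pi>1 = \<pi>2 \<and> \<mu>1 = \<mu>2" if "\<pi>1 \<in> mfg_policies" "\<pi>2 \<in> mfg_policies" "\<mu>1 \<in> prob_simplex" "\<mu>2 \<in> prob_simplex"
      for \<pi>1 \<pi>2 :: "real^'a^'s" and \<mu>1 \<mu>2 :: "real^'s"
    proof -
      have "0 \<le> LTV * (norm (\<pi>1 - \<pi>2) + norm (\<mu>1 - \<mu>2))"
        using LTV that dTV_nonneg[of "mfg_joint K \<pi>1 \<mu>1" "mfg_joint K \<pi>2 \<mu>2"] by (meson order_trans)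
      then have "norm (\<pi>1 - \<pi>2) + norm (\<mu>1 - \<mu>2) \<le> 0" using 2 by (simp add: zero_le_mult_iff)
      then have "norm (\<pi>1 - \<pi>2) = 0" "norm (\<mu>1 - \<mu>2) = 0"
        using norm_ge_zero[of "\<pi>1 - \<pi>2"] norm_ge_zero[of "\<mu>1 - \<mu>2"] by linarith+
      then show ?thesis by simp
    qed
    have ax: "(\<chi> s. axis a 1) \<in> (mfg_policies :: (real^'a^'s) set)" for a
      by (simp add: mfg_policies_def axis_in_simplex)
    have one1: "i = j" for i j :: 's
    proof -
      have "axis i (1::real) = axis j 1" using eq[OF ax ax axis_in_simplex axis_in_simplex] by blast
      then show ?thesis by (simp add: axis_eq_axis)
    qed
    have one2: "i = j" for i j :: 'a
    proof -
      have "((\<chi> s. axis i 1) :: real^'a^'s) = (\<chi> s. axis j 1)" using eq[OF ax ax axis_in_simplex axis_in_simplex] by blast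
      then have "axis i (1::real) = axis j 1" by (simp add: vec_eq_iff)
      then show ?thesis by (simp add: axis_eq_axis)
    qed
    show ?thesis
      unfolding E_def \<beta>_def lm_def
      by (rule finish[unfolded E_def \<beta>_def lm_def], rule singleton_rate[OF one1 one2])
        (use rew mustar_unique step init' pos in auto)
  next
    case 3
    have cJ: "0 < cJ" "1 \<le> cJ * \<gamma>" using step(1,2) gam(1) by (auto simp: divide_le_eq)
    have M: "mfg K C0 C1 r \<delta> L BV LV LTV \<gamma> \<rho> cJ"
    proof (unfold_locales)
      show "dTV (\<lambda>s'. \<Sum>s\<in>UNIV. d $ s * Pmat K \<pi>1 \<mu>1 s s') (\<lambda>s'. \<Sum>s\<in>UNIV. d $ s * Pmat K \<pi>2 \<mu>2 s s')
        \<le> L * (norm (\<pi>1 - \<pi>2) + norm (\<mu>1 - \<mu>2))"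
        if "d \<in> prob_simplex" "\<pi>1 \<in> mfg_policies" "\<pi>2 \<in> mfg_policies" "\<mu>1 \<in> prob_simplex" "\<mu>2 \<in> prob_simplex" for d \<pi>1 \<pi>2 \<mu>1 \<mu>2
      proof -
        have "dTV (\<lambda>s. d $ s) (\<lambda>s. d $ s) = 0" by (simp add: dTV_eq)
        moreover have "dTV (\<lambda>s'. \<Sum>s\<in>UNIV. d $ s * Pmat K \<pi>1 \<mu>1 s s') (\<lambda>s'. \<Sum>s\<in>UNIV. d $ s * Pmat K \<pi>2 \<mu>2 s s')
          \<le> dTV (\<lambda>s. d $ s) (\<lambda>s. d $ s) + L * (norm (\<pi>1 - \<pi>2) + norm (\<mu>1 - \<mu>2))"
          using A3(3) that by blast
        ultimately show ?thesis by linarith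
      qed
      show "mfg_ell K r \<pi> - mfg_ell K r \<pi>' \<le> \<rho> * (Jf K r \<pi> (mustar K \<pi>) - Jf K r \<pi>' (mustar K \<pi>))"
        if "\<pi> \<in> mfg_policies" "\<pi>' \<in> mfg_policies" for \<pi> \<pi>'
        using bspec[OF bspec[OF herd(3) that(1)] that(2)] 3(1) by simp
      show "0 \<le> r s a \<mu>" "r s a \<mu> \<le> 1" if "\<mu> \<in> prob_simplex" for s a \<mu> using rew that by blast+
      show "dTV (\<lambda>x. kstep K \<pi> \<mu> k s $ x) (\<lambda>x. stat_dist K \<pi> \<mu> $ x) \<le> C0 * C1 ^ k"
        if "\<pi> \<in> mfg_policies" "\<mu> \<in> prob_simplex" for \<pi> \<mu> s k using A1(4) that by blast
      show "norm (stat_dist K \<pi> \<mu>1 - stat_dist K \<pi> \<mu>2) \<le> \<delta> * norm (\<mu>1 - \<mu>2)"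
        if "\<pi> \<in> mfg_policies" "\<mu>1 \<in> prob_simplex" "\<mu>2 \<in> prob_simplex" for \<pi> \<mu>1 \<mu>2
        by (rule A2(3)[rule_format, OF that])
      show "\<bar>r s a \<mu>1 - r s a \<mu>2\<bar> \<le> L * norm (\<mu>1 - \<mu>2)" if "\<mu>1 \<in> prob_simplex" "\<mu>2 \<in> prob_simplex" for s a \<mu>1 \<mu>2
        by (rule A3(2)[rule_format, OF that])
      show "dTV (\<lambda>x. stat_dist K \<pi>1 \<mu>1 $ x) (\<lambda>x. stat_dist K \<pi>2 \<mu>2 $ x) \<le> L * (norm (\<pi>1 - \<pi>2) + norm (\<mu>1 - \<mu>2))"
        if "\<pi>1 \<in> mfg_policies" "\<pi>2 \<in> mfg_policies" "\<mu>1 \<in> prob_simplex" "\<mu>2 \<in> prob_simplex" for \<pi>1 \<pi>2 \<mu>1 \<mu>2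
        by (rule A3(4)[rule_format, OF that])
      show "norm (mustar K \<pi>1 - mustar K \<pi>2) \<le> L * norm (\<pi>1 - \<pi>2)" if "\<pi>1 \<in> mfg_policies" "\<pi>2 \<in> mfg_policies" for \<pi>1 \<pi>2
        by (rule A3(5)[rule_format, OF that])
      show "norm (Vf K r \<pi> \<mu>) \<le> BV" if "\<pi> \<in> mfg_policies" "\<mu> \<in> prob_simplex" for \<pi> \<mu>
        by (rule A3(7)[rule_format, OF that])
      show "\<exists>!\<mu>. \<mu> \<in> prob_simplex \<and> \<mu> = stat_dist K \<pi> \<mu>" if "\<pi> \<in> mfg_policies" for \<pi>
        by (rule mustar_unique[rule_format, OF that])
      show "dTV (mfg_joint K \<pi>1 \<mu>1) (mfg_joint K \<pi>2 \<mu>2) \<le> LTV * (norm (\<pi>1 - \<pi>2) + norm (\<mu>1 - \<mu>2))"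
        if "\<pi>1 \<in> mfg_policies" "\<pi>2 \<in> mfg_policies" "\<mu>1 \<in> prob_simplex" "\<mu>2 \<in> prob_simplex" for \<pi>1 \<pi>2 \<mu>1 \<mu>2
        by (rule LTV[rule_format, OF that])
      show "norm (projperp (Vf K r (softmax \<theta>1) \<mu>1 - Vf K r (softmax \<theta>2) \<mu>2)) \<le> LV * (norm (\<theta>1 - \<theta>2) + norm (\<mu>1 - \<mu>2))"
        "\<bar>Jf K r (softmax \<theta>1) \<mu>1 - Jf K r (softmax \<theta>2) \<mu>2\<bar> \<le> LV * (norm (\<theta>1 - \<theta>2) + norm (\<mu>1 - \<mu>2))"
        "norm (gradf (\<lambda>\<theta>. Jf K r (softmax \<theta>) \<mu>1) \<theta>1 - gradf (\<lambda>\<theta>. Jf K r (softmax \<theta>) \<mu>2) \<theta>2)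
          \<le> LV * (norm (\<theta>1 - \<theta>2) + norm (\<mu>1 - \<mu>2))"
        if "\<mu>1 \<in> prob_simplex" "\<mu>2 \<in> prob_simplex" for \<theta>1 \<theta>2 \<mu>1 \<mu>2
        using LV(3)[rule_format, OF that, of \<theta>1 \<theta>2] by simp_all
      show "(\<Sum>s\<in>UNIV. \<Sum>a\<in>UNIV. \<Sum>s'\<in>UNIV. stat_dist K (softmax \<theta>) \<mu> $ s * softmax \<theta> $ s $ a
            * pmf (K \<mu> s a) s' * (V $ s * (V $ s' - V $ s))) \<le> - \<gamma> * (norm V)\<^sup>2"
        if "\<mu> \<in> prob_simplex" "(\<Sum>s\<in>UNIV. V $ s) = 0" for \<theta> \<mu> V
        by (rule gam(3)[rule_format, OF that])
    qed (fact A1 A2 A3 gam LV cJ \<open>0 < \<rho>\<close> \<open>0 \<le> LTV\<close>)+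
    have F: "mfg.LF L BV LTV = LF" unfolding LF_def BF_def by (rule mfg.LF_def[OF M])
    have G: "mfg.LG L BV LTV cJ = LG" unfolding LG_def BG_def by (rule mfg.LG_def[OF M])
    note Mrate = mfg.convergence_rate[OF M, unfolded F G]
    have om: "0 < 1 - \<delta>" using A2 by simp
    have L0: "0 < L" and LV1: "1 \<le> LV" and rho: "0 < \<rho>" and g: "0 < \<gamma>" using A3 LV herd gam by auto
    have "0 \<le> 2 * BF * LTV" "0 \<le> 2 * BG * LTV" unfolding BF_def BG_def using A3(6) cJ 3 by auto
    moreover have "0 < (L + 1) * (cJ + 1)" using L0 cJ by simp
    ultimately have LFG: "0 < LF" "0 < LG" unfolding LF_def LG_def using A3(6) L0 by linarith+
    have C_le: "al0 \<le> c * xi0" if "C_xi \<le> c" for c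
      using step(10) mult_right_mono[OF that, of xi0] pos by linarith
    have div: "d * al0 \<le> n * xi0" if "al0 \<le> n / d * xi0" "0 < d" for d n
      using mult_left_mono[OF that(1), of d] that(2) by simp
    have S1: "16 * L * LF * LV * al0 \<le> (1 - \<delta>) * xi0"
      by (rule div, rule C_le) (use L0 LFG LV1 in \<open>auto simp: C_xi_def\<close>)
    have S2: "32 * \<rho> * LF\<^sup>2 * al0 \<le> (1 - \<delta>) * xi0"
      by (rule div, rule C_le) (use rho LFG in \<open>auto simp: C_xi_def\<close>)
    \<comment> \<open>Only nonnegativity of the summands matters: each is at most \<open>Q\<close>,
      so the single bound on \<open>xi0\<close> yields one inequality for each of them.\<close>
    define Q where "Q = LF^4 * LV\<^sup>2 + LF\<^sup>2 * LG\<^sup>2 * LH\<^sup>2 * LV\<^sup>2 + LF\<^sup>2 * LH^4 * LV\<^sup>2 + LV\<^sup>2"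
    have Qge: "LF^4 * LV\<^sup>2 \<le> Q" "LF\<^sup>2 * LG\<^sup>2 * LH\<^sup>2 * LV\<^sup>2 \<le> Q" "0 < Q"
    proof -
      have n: "0 \<le> LF^4 * LV\<^sup>2" "0 \<le> LF\<^sup>2 * LG\<^sup>2 * LH\<^sup>2 * LV\<^sup>2" "0 \<le> LF\<^sup>2 * LH^4 * LV\<^sup>2" "0 < LV\<^sup>2" using LV1 by simp_all
      then show "LF^4 * LV\<^sup>2 \<le> Q" "LF\<^sup>2 * LG\<^sup>2 * LH\<^sup>2 * LV\<^sup>2 \<le> Q" "0 < Q" unfolding Q_def by linarith+
    qed
    have S3: "6912 * Q * xi0 \<le> (1 - \<delta>) * \<gamma> * be0"
      using step(12) Qge(3) unfolding Q_def[symmetric] by (simp add: le_divide_eq mult.commute)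
    have S3': "6912 * q * xi0 \<le> (1 - \<delta>) * \<gamma> * be0" if "q \<le> Q" for q
    proof -
      have "6912 * q * xi0 \<le> 6912 * Q * xi0" using that pos(3) by (intro mult_right_mono) auto
      then show ?thesis using S3 by (rule order_trans)
    qed
    define R where "R = 72 * LG\<^sup>2 + 36 * LF\<^sup>2 + 8 / \<gamma>"
    have S4: "R * be0 \<le> lam0"
    proof -
      have "1 \<le> card_S" unfolding card_S_def by (simp add: Suc_leI)
      then have "72 * LG\<^sup>2 * 1 \<le> 72 * LG\<^sup>2 * card_S" by (intro mult_left_mono) auto
      then have R': "R \<le> 72 * card_S * LG\<^sup>2 + 36 * LF\<^sup>2 + 8 / \<gamma>" unfolding R_def by (simp add: mult_ac)
      have "0 < R" unfolding R_def using LFG g by (simp add: add_pos_pos)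
      with R' have "(72 * card_S * LG\<^sup>2 + 36 * LF\<^sup>2 + 8 / \<gamma>) * be0 \<le> lam0"
        using step(13) by (simp add: le_divide_eq mult.commute)
      moreover have "R * be0 \<le> (72 * card_S * LG\<^sup>2 + 36 * LF\<^sup>2 + 8 / \<gamma>) * be0" using R' pos by (intro mult_right_mono) auto
      ultimately show ?thesis by linarith
    qed
    show ?thesis
      by (rule finish, unfold E_def \<alpha>_def \<beta>_def \<xi>_def lm_def,
        rule Mrate[OF step(3-7) S1 S2 S3'[OF Qge(1)] S3'[OF Qge(2), unfolded LH_def] S4[unfolded R_def] init'(3,4,1,5,2)])
  qed
qed

end
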